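(* Let $A$ be the preprojective algebra, over a field $\mathbb{F}$, of a connected finite graph $\Delta$ distinct from $\mathrm{A}_1$ and $\mathrm{A}_2$. Let $M$ be an $A$-bimodule. Define $\omega_0=\sum_ie_i\otimes\sigma_i\in A\otimes_{k^e}W_2$, where the sum runs over the vertices $i$ of $\Delta$, $e_i$ is the idempotent and $\sigma_i$ the quadratic relation of $A$ associated with $i$. For each Koszul $p$-cochain $f\in\mathrm{Hom}_{k^e}(W_p,M)$ define the Koszul $(2-p)$-chain $\theta_M(f)=\omega_0\frown f\in M\otimes_{k^e}W_{2-p}$. Then $\theta_M$ is an isomorphism of complexes from the complex $C_1=(\mathrm{Hom}_{k^e}(W_\bullet,M),b_K)$ of Koszul cochains with coefficients in $M$ to the complex $C_2=(M\otimes_{k^e}W_{2-\bullet},b^K)$ of Koszul chains with coefficients in $M$. Moreover, the equalities $$\theta_{M\otimes_AN}(f\smile g)=\theta_M(f)\frown g=f\frown\theta_N(g)$$ hold for any Koszul cochains $f$ and $g$ with coefficients in $A$-bimodules $M$ and $N$ respectively.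
   Context: Preprojective algebra. $\Delta$ is a connected graph with finite vertex and edge sets (loops and multiple edges allowed, no labels). $\mathrm{A}_1$ is one vertex without edge; $\mathrm{A}_2$ is two vertices joined by one edge. Let $Q$ be a quiver with underlying graph $\Delta$; $\mathfrak{s},\mathfrak{t}$ denote source and target. For each $a\in Q_1$ add an arrow $a^*$ with $\mathfrak{s}(a^* )=\mathfrak{t}(a)$, $\mathfrak{t}(a^* )=\mathfrak{s}(a)$, giving the double quiver $\overline{Q}$ with $\overline{Q}_0=Q_0$, $\overline{Q}_1=Q_1\sqcup Q_1^*$; $(-)^*$ is regarded as an involution of $\overline{Q}_1$. Put $\varepsilon(a)=1$ if $a\in Q_1$ and $\varepsilon(a)=-1$ if $a\in Q_1^*$. Paths are written from right to left. Let $k=\mathbb{F}Q_0$ with orthogonal idempotents $e_i$ ($i\in Q_0$), $V=\mathbb{F}\overline{Q}_1$ (a $k$-bimodule with $e_jae_i=a$ if $i=\mathfrak{s}(a)$, $j=\mathfrak{t}(a)$, and $0$ otherwise), so that $T_k(V)\cong\mathbb{F}\overline{Q}$. Let $R\subseteq V\otimes_kV$ be spanned by $\sigma_i=\sum_{a\in\overline{Q}_1,\ \mathfrak{t}(a)=i}\varepsilon(a)aa^*$, $i\in Q_0$. Then $A=T_k(V)/(R)$. Koszul chains and cochains. $\otimes=\otimes_{\mathbb{F}}$, $k^e=k\otimes k$; $A$-bimodules are $\mathbb{F}$-symmetric. Put $W_0=k$, $W_1=V$, $W_p=\bigcap_{i+2+j=p}V^{\otimes_k i}\otimes_kR\otimes_kV^{\otimes_k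 j}$ for $p\geq2$ (so $W_2=R$); an element of $W_p$ is written $x_1\ldots x_p$ (a sum of such products is understood). The Koszul $p$-cochains with coefficients in $M$ are the elements of $\mathrm{Hom}_{k^e}(W_p,M)$ and the Koszul $p$-chains are the elements of $M\otimes_{k^e}W_p$. The differentials are $b^K(m\otimes x_1\ldots x_p)=mx_1\otimes x_2\ldots x_p+(-1)^px_pm\otimes x_1\ldots x_{p-1}$ and, for $f:W_p\to M$, $b_K(f)(x_1\ldots x_{p+1})=f(x_1\ldots x_p)x_{p+1}-(-1)^px_1f(x_2\ldots x_{p+1})$. For $x\in e_jMe_i$ and $w\in e_iWe_j$ one identifies $x\otimes_{k^e}w=x\otimes w$. Products. For $f:W_p\to P$, $g:W_q\to N$ and $z=m\otimes x_1\ldots x_q\in M\otimes_{k^e}W_q$ ($P,N,M$ $A$-bimodules): $(f\smile g)(x_1\ldots x_{p+q})=(-1)^{pq}f(x_1\ldots x_p)\otimes_Ag(x_{p+1}\ldots x_{p+q})$, $f\frown z=(-1)^{(q-p)p}(f(x_{q-p+1}\ldots x_q)\otimes_Am)\otimes x_1\ldots x_{q-p}$, $z\frown f=(-1)^{pq}(m\otimes_Af(x_1\ldots x_p))\otimes x_{p+1}\ldots x_q$ (zero if $p>q$). $A\otimes_AM$ and $M\otimes_AA$ are identified with $M$. *)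

theory Defs
  imports
    "HOL-Algebra.Free_Abelian_Groups"
    "HOL-Algebra.QuotRing"
    "HOL-Algebra.Module"
    "HOL-Algebra.Algebraic_Closure_Type"
    "Graph_Theory.Digraph_Component"
    "Graph_Theory.Arc_Walk"
begin

section \<open>Quivers and path algebras\<close>

text \<open>
  A quiver is a \<^typ>\<open>('v, 'e) pre_digraph\<close>: its arrows have a source \<^const>\<open>tail\<close> and a
  target \<^const>\<open>head\<close>; loops and multiple arrows are allowed. The underlying graph forgets
  the direction of the arrows.
\<close>

definition underlying_A1 :: "('v, 'e) pre_digraph \<Rightarrow> bool" where
  "underlying_A1 Q \<longleftrightarrow> (\<exists>v. verts Q = {v}) \<and> arcs Q = {}"

definition underlying_A2 :: "('v, 'e) pre_digraph \<Rightarrow> bool" where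
  "underlying_A2 Q \<longleftrightarrow>
     (\<exists>u v a. u \<noteq> v \<and> verts Q = {u, v} \<and> arcs Q = {a} \<and> {tail Q a, head Q a} = {u, v})"

text \<open>\<open>Inl a\<close> is the arrow \<open>a\<close> of \<open>Q\<close>, \<open>Inr a\<close> is the added arrow \<open>a\<^sup>*\<close>.\<close>

definition double_quiver :: "('v, 'e) pre_digraph \<Rightarrow> ('v, 'e + 'e) pre_digraph" where
  "double_quiver Q =
     \<lparr>verts = verts Q, arcs = arcs Q <+> arcs Q,
      tail = case_sum (tail Q) (head Q), head = case_sum (head Q) (tail Q)\<rparr>"

definition star :: "'e + 'e \<Rightarrow> 'e + 'e" where
  "star = case_sum Inr Inl"

definition eps :: "'e + 'e \<Rightarrow> 'f::field" where
  "eps = case_sum (\<lambda>_. 1) (\<lambda>_. - 1)"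

text \<open>
  Paths are written from right to left: \<open>(i, [x\<^sub>1, \<dots>, x\<^sub>n], j)\<close> is the path
  \<open>x\<^sub>1 \<dots> x\<^sub>n\<close> with target \<open>i\<close> and source \<open>j\<close>, so that the source of \<open>x\<^sub>l\<close> is the target
  of the next arrow. The trivial path \<open>e\<^sub>i\<close> is \<open>(i, [], i)\<close>.
\<close>

type_synonym ('v, 'a) qpath = "'v \<times> 'a list \<times> 'v"
type_synonym ('v, 'a, 'f) pelem = "('v, 'a) qpath \<Rightarrow>\<^sub>0 'f"

definition paths :: "('v, 'a) pre_digraph \<Rightarrow> ('v, 'a) qpath set" where
  "paths G = {(i, xs, j). pre_digraph.awalk G j (rev xs) i}"

definition trivial_path :: "'v \<Rightarrow> ('v, 'a, 'f::field) pelem" where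
  "trivial_path i = Poly_Mapping.single (i, [], i) 1"

definition arrow :: "('v, 'a) pre_digraph \<Rightarrow> 'a \<Rightarrow> ('v, 'a, 'f::field) pelem" where
  "arrow G x = Poly_Mapping.single (head G x, [x], tail G x) 1"

definition pscale :: "'f \<Rightarrow> ('v, 'a, 'f::field) pelem \<Rightarrow> ('v, 'a, 'f) pelem" where
  "pscale c x = Poly_Mapping.map ((*) c) x"

lemma lookup_pscale [simp]:
  "Poly_Mapping.lookup (pscale c x) p = c * Poly_Mapping.lookup x p"
  by (simp add: pscale_def Poly_Mapping.map.rep_eq when_def)

global_interpretation pelem: vector_space pscale
  by unfold_locales (auto intro!: poly_mapping_eqI simp: lookup_add algebra_simps)

definition path_mult ::
  "('v, 'a, 'f::field) pelem \<Rightarrow> ('v, 'a, 'f) pelem \<Rightarrow> ('v, 'a, 'f) pelem" (infixl \<open>\<star>\<close> 75) where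
  "x \<star> y =
     (\<Sum>(i, xs, j)\<in>Poly_Mapping.keys x. \<Sum>(j', ys, l)\<in>Poly_Mapping.keys y.
        if j = j'
        then Poly_Mapping.single (i, xs @ ys, l)
               (Poly_Mapping.lookup x (i, xs, j) * Poly_Mapping.lookup y (j', ys, l))
        else 0)"

definition path_algebra :: "('v, 'a) pre_digraph \<Rightarrow> ('v, 'a, 'f::field) pelem ring" where
  "path_algebra G =
     \<lparr>carrier = {x. Poly_Mapping.keys x \<subseteq> paths G},
      monoid.mult = (\<star>), one = (\<Sum>i\<in>verts G. trivial_path i), zero = 0, add = (+)\<rparr>"

text \<open>
  The span of the paths of length \<open>n\<close>. Under the identification of the tensor algebra \<open>T\<^sub>k(V)\<close>
  with the path algebra this is \<open>V\<^bsup>\<otimes>n\<^esup>\<close> (tensor power over \<open>k\<close>); in particular \<open>k\<close> is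
  \<open>path_deg G 0\<close> and \<open>V\<close> is \<open>path_deg G 1\<close>.
\<close>

definition path_deg :: "('v, 'a) pre_digraph \<Rightarrow> nat \<Rightarrow> ('v, 'a, 'f::field) pelem set" where
  "path_deg G n = {x. Poly_Mapping.keys x \<subseteq> {(i, xs, j) \<in> paths G. length xs = n}}"


section \<open>The preprojective algebra\<close>

definition sigma :: "('v, 'e) pre_digraph \<Rightarrow> 'v \<Rightarrow> ('v, 'e + 'e, 'f::field) pelem" where
  "sigma Q i =
     (\<Sum>a\<in>{a \<in> arcs (double_quiver Q). head (double_quiver Q) a = i}.
        pscale (eps a) (arrow (double_quiver Q) a \<star> arrow (double_quiver Q) (star a)))"

definition relations :: "('v, 'e) pre_digraph \<Rightarrow> ('v, 'e + 'e, 'f::field) pelem set" where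
  "relations Q = pelem.span (sigma Q ` verts Q)"

abbreviation tensor_algebra ::
  "('v, 'e) pre_digraph \<Rightarrow> ('v, 'e + 'e, 'f::field) pelem ring" where
  "tensor_algebra Q \<equiv> path_algebra (double_quiver Q)"

definition preproj :: "('v, 'e) pre_digraph \<Rightarrow> ('v, 'e + 'e, 'f::field) pelem set ring" where
  "preproj Q = tensor_algebra Q Quot genideal (tensor_algebra Q) (relations Q)"

definition cls ::
  "('v, 'e) pre_digraph \<Rightarrow> ('v, 'e + 'e, 'f::field) pelem \<Rightarrow> ('v, 'e + 'e, 'f) pelem set" where
  "cls Q x = genideal (tensor_algebra Q) (relations Q) +>\<^bsub>tensor_algebra Q\<^esub> x"

definition scalar ::
  "('v, 'e) pre_digraph \<Rightarrow> 'f \<Rightarrow> ('v, 'e + 'e, 'f::field) pelem set" where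
  "scalar Q c = cls Q (pscale c \<one>\<^bsub>tensor_algebra Q\<^esub>)"

definition koszul_W ::
  "('v, 'e) pre_digraph \<Rightarrow> int \<Rightarrow> ('v, 'e + 'e, 'f::field) pelem set" where
  "koszul_W Q p =
     (if p < 0 then {0}
      else if p = 0 then path_deg (double_quiver Q) 0
      else if p = 1 then path_deg (double_quiver Q) 1
      else \<Inter> {pelem.span {u \<star> r \<star> v |u r v.
                 u \<in> path_deg (double_quiver Q) i \<and> r \<in> relations Q \<and>
                 v \<in> path_deg (double_quiver Q) j} |i j. int i + 2 + int j = p})"


section \<open>Bimodules\<close>

text \<open>
  The left action is \<^const>\<open>module.smult\<close>. As for \<^locale>\<open>module\<close>, the fields \<^const>\<open>monoid.mult\<close> and
  \<^const>\<open>one\<close> of the underlying record play no role.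
\<close>

record ('a, 'b) bimodule = "('a, 'b) module" +
  rsmult :: "'b \<Rightarrow> 'a \<Rightarrow> 'b" (infixl \<open>\<oslash>\<index>\<close> 70)

locale bimodule = R?: ring R + M?: abelian_group M
  for R :: "('a, 'x) ring_scheme" (structure) and M :: "('a, 'b, 'y) bimodule_scheme" (structure) +
  assumes lact_closed: "\<lbrakk>a \<in> carrier R; x \<in> carrier M\<rbrakk> \<Longrightarrow> a \<odot>\<^bsub>M\<^esub> x \<in> carrier M"
    and lact_l_distr: "\<lbrakk>a \<in> carrier R; b \<in> carrier R; x \<in> carrier M\<rbrakk> \<Longrightarrow>
      (a \<oplus> b) \<odot>\<^bsub>M\<^esub> x = a \<odot>\<^bsub>M\<^esub> x \<oplus>\<^bsub>M\<^esub> b \<odot>\<^bsub>M\<^esub> x"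
    and lact_r_distr: "\<lbrakk>a \<in> carrier R; x \<in> carrier M; y \<in> carrier M\<rbrakk> \<Longrightarrow>
      a \<odot>\<^bsub>M\<^esub> (x \<oplus>\<^bsub>M\<^esub> y) = a \<odot>\<^bsub>M\<^esub> x \<oplus>\<^bsub>M\<^esub> a \<odot>\<^bsub>M\<^esub> y"
    and lact_assoc: "\<lbrakk>a \<in> carrier R; b \<in> carrier R; x \<in> carrier M\<rbrakk> \<Longrightarrow>
      (a \<otimes> b) \<odot>\<^bsub>M\<^esub> x = a \<odot>\<^bsub>M\<^esub> (b \<odot>\<^bsub>M\<^esub> x)"
    and lact_one: "x \<in> carrier M \<Longrightarrow> \<one> \<odot>\<^bsub>M\<^esub> x = x"
    and ract_closed: "\<lbrakk>a \<in> carrier R; x \<in> carrier M\<rbrakk> \<Longrightarrow> x \<oslash>\<^bsub>M\<^esub> a \<in> carrier M"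
    and ract_r_distr: "\<lbrakk>a \<in> carrier R; b \<in> carrier R; x \<in> carrier M\<rbrakk> \<Longrightarrow>
      x \<oslash>\<^bsub>M\<^esub> (a \<oplus> b) = x \<oslash>\<^bsub>M\<^esub> a \<oplus>\<^bsub>M\<^esub> x \<oslash>\<^bsub>M\<^esub> b"
    and ract_l_distr: "\<lbrakk>a \<in> carrier R; x \<in> carrier M; y \<in> carrier M\<rbrakk> \<Longrightarrow>
      (x \<oplus>\<^bsub>M\<^esub> y) \<oslash>\<^bsub>M\<^esub> a = x \<oslash>\<^bsub>M\<^esub> a \<oplus>\<^bsub>M\<^esub> y \<oslash>\<^bsub>M\<^esub> a"
    and ract_assoc: "\<lbrakk>a \<in> carrier R; b \<in> carrier R; x \<in> carrier M\<rbrakk> \<Longrightarrow>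
      x \<oslash>\<^bsub>M\<^esub> (a \<otimes> b) = (x \<oslash>\<^bsub>M\<^esub> a) \<oslash>\<^bsub>M\<^esub> b"
    and ract_one: "x \<in> carrier M \<Longrightarrow> x \<oslash>\<^bsub>M\<^esub> \<one> = x"
    and lact_ract: "\<lbrakk>a \<in> carrier R; b \<in> carrier R; x \<in> carrier M\<rbrakk> \<Longrightarrow>
      (a \<odot>\<^bsub>M\<^esub> x) \<oslash>\<^bsub>M\<^esub> b = a \<odot>\<^bsub>M\<^esub> (x \<oslash>\<^bsub>M\<^esub> b)"

text \<open>
  Bimodules over the preprojective algebra are symmetric over the ground field, whose action on
  them is the one through \<^const>\<open>scalar\<close>.
\<close>

definition preproj_bimodule ::
  "('v, 'e) pre_digraph \<Rightarrow> (('v, 'e + 'e, 'f::field) pelem set, 'm) bimodule \<Rightarrow> bool" where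
  "preproj_bimodule Q M \<longleftrightarrow>
     bimodule (preproj Q) M \<and>
     (\<forall>c. \<forall>m\<in>carrier M. scalar Q c \<odot>\<^bsub>M\<^esub> m = m \<oslash>\<^bsub>M\<^esub> scalar Q c)"

definition regular_bimodule :: "'a ring \<Rightarrow> ('a, 'a) bimodule" where
  "regular_bimodule R =
     \<lparr>carrier = carrier R, monoid.mult = monoid.mult R, one = one R, zero = zero R, add = add R,
      module.smult = monoid.mult R, rsmult = monoid.mult R\<rparr>"


section \<open>Tensor products\<close>

text \<open>
  \<open>M \<otimes>\<^sub>S N\<close> is the free abelian group on \<^term>\<open>carrier M \<times> carrier N\<close> modulo the subgroup
  generated by the biadditivity and balancing relations; \<open>ract\<close> and \<open>lact\<close> are the right action
  of \<open>S\<close> on \<open>M\<close> and its left action on \<open>N\<close>, and it suffices that \<open>S\<close> generates the ring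
  additively.
\<close>

definition balancing_relators ::
  "('m, 'x) ring_scheme \<Rightarrow> ('n, 'y) ring_scheme \<Rightarrow> 's set \<Rightarrow>
   ('m \<Rightarrow> 's \<Rightarrow> 'm) \<Rightarrow> ('s \<Rightarrow> 'n \<Rightarrow> 'n) \<Rightarrow> ('m \<times> 'n \<Rightarrow>\<^sub>0 int) set" where
  "balancing_relators M N S ract lact =
     {frag_of (m \<oplus>\<^bsub>M\<^esub> m', n) - frag_of (m, n) - frag_of (m', n) |m m' n.
        m \<in> carrier M \<and> m' \<in> carrier M \<and> n \<in> carrier N} \<union>
     {frag_of (m, n \<oplus>\<^bsub>N\<^esub> n') - frag_of (m, n) - frag_of (m, n') |m n n'.
        m \<in> carrier M \<and> n \<in> carrier N \<and> n' \<in> carrier N} \<union>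
     {frag_of (ract m s, n) - frag_of (m, lact s n) |m s n.
        m \<in> carrier M \<and> s \<in> S \<and> n \<in> carrier N}"

definition tensor_null ::
  "('m, 'x) ring_scheme \<Rightarrow> ('n, 'y) ring_scheme \<Rightarrow> 's set \<Rightarrow>
   ('m \<Rightarrow> 's \<Rightarrow> 'm) \<Rightarrow> ('s \<Rightarrow> 'n \<Rightarrow> 'n) \<Rightarrow> ('m \<times> 'n \<Rightarrow>\<^sub>0 int) set" where
  "tensor_null M N S ract lact =
     generate (free_Abelian_group (carrier M \<times> carrier N)) (balancing_relators M N S ract lact)"

text \<open>
  The map induced on cosets modulo \<open>K\<close> by the additive extension of a function \<open>h\<close> on generators
  (meaningful whenever this extension respects the relations).
\<close>

definition frag_coset :: "('b \<Rightarrow>\<^sub>0 int) set \<Rightarrow> ('b \<Rightarrow>\<^sub>0 int) \<Rightarrow> ('b \<Rightarrow>\<^sub>0 int) set" where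
  "frag_coset K r = K #>\<^bsub>free_Abelian_group UNIV\<^esub> r"

definition induced ::
  "('b \<Rightarrow>\<^sub>0 int) set \<Rightarrow> ('a \<Rightarrow> 'b \<Rightarrow>\<^sub>0 int) \<Rightarrow> ('a \<Rightarrow>\<^sub>0 int) set \<Rightarrow> ('b \<Rightarrow>\<^sub>0 int) set" where
  "induced K h Z = (\<Union>r\<in>Z. frag_coset K (frag_extend h r))"

definition null_ring ::
  "('a, 'z) ring_scheme \<Rightarrow> ('a, 'm) bimodule \<Rightarrow> ('a, 'n) bimodule \<Rightarrow> ('m \<times> 'n \<Rightarrow>\<^sub>0 int) set"
  where
  "null_ring R M N = tensor_null M N (carrier R) (rsmult M) (module.smult N)"

definition bimodule_tensor ::
  "('a, 'z) ring_scheme \<Rightarrow> ('a, 'm) bimodule \<Rightarrow> ('a, 'n) bimodule \<Rightarrow>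
   ('a, ('m \<times> 'n \<Rightarrow>\<^sub>0 int) set) bimodule" where
  "bimodule_tensor R M N =
     (let K = null_ring R M N; G = free_Abelian_group (carrier M \<times> carrier N) Mod K in
      \<lparr>carrier = carrier G, monoid.mult = undefined, one = undefined,
       zero = \<one>\<^bsub>G\<^esub>, add = monoid.mult G,
       module.smult = (\<lambda>a. induced K (\<lambda>(m, n). frag_of (a \<odot>\<^bsub>M\<^esub> m, n))),
       rsmult = (\<lambda>Z a. induced K (\<lambda>(m, n). frag_of (m, n \<oslash>\<^bsub>N\<^esub> a)) Z)\<rparr>)"

definition pure_tensor ::
  "('a, 'z) ring_scheme \<Rightarrow> ('a, 'm) bimodule \<Rightarrow> ('a, 'n) bimodule \<Rightarrow> 'm \<Rightarrow> 'n \<Rightarrow>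
   ('m \<times> 'n \<Rightarrow>\<^sub>0 int) set" where
  "pure_tensor R M N m n = frag_coset (null_ring R M N) (frag_of (m, n))"

text \<open>The identification of \<open>R \<otimes>\<^sub>R M\<close> with \<open>M\<close>.\<close>

definition left_unitor ::
  "('a, 'm) bimodule \<Rightarrow> ('a \<times> 'm \<Rightarrow>\<^sub>0 int) set \<Rightarrow> 'm" where
  "left_unitor M Z =
     the_elem ((\<lambda>r. \<Oplus>\<^bsub>M\<^esub>y\<in>Poly_Mapping.keys r.
                  [Poly_Mapping.lookup r y] \<cdot>\<^bsub>M\<^esub> (fst y \<odot>\<^bsub>M\<^esub> snd y)) ` Z)"


section \<open>Koszul chains and cochains\<close>

abbreviation base_k :: "('v, 'e) pre_digraph \<Rightarrow> ('v, 'e + 'e, 'f::field) pelem set" where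
  "base_k Q \<equiv> path_deg (double_quiver Q) 0"

definition koszul_cochains ::
  "('v, 'e) pre_digraph \<Rightarrow> (('v, 'e + 'e, 'f::field) pelem set, 'm) bimodule \<Rightarrow> int \<Rightarrow>
   ('f, ('v, 'e + 'e, 'f) pelem \<Rightarrow> 'm) module" where
  "koszul_cochains Q M p =
     \<lparr>carrier = {f \<in> koszul_W Q p \<rightarrow>\<^sub>E carrier M.
        (\<forall>u\<in>koszul_W Q p. \<forall>v\<in>koszul_W Q p. f (u + v) = f u \<oplus>\<^bsub>M\<^esub> f v) \<and>
        (\<forall>c\<in>base_k Q. \<forall>d\<in>base_k Q. \<forall>w\<in>koszul_W Q p.
           f (c \<star> w \<star> d) = (cls Q c \<odot>\<^bsub>M\<^esub> f w) \<oslash>\<^bsub>M\<^esub> cls Q d)},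
      monoid.mult = undefined, one = undefined,
      zero = (\<lambda>w\<in>koszul_W Q p. \<zero>\<^bsub>M\<^esub>),
      add = (\<lambda>f g. \<lambda>w\<in>koszul_W Q p. f w \<oplus>\<^bsub>M\<^esub> g w),
      module.smult = (\<lambda>c f. \<lambda>w\<in>koszul_W Q p. scalar Q c \<odot>\<^bsub>M\<^esub> f w)\<rparr>"

text \<open>
  \<open>M \<otimes> W\<^sub>p\<close> over \<open>k\<^sup>e = k \<otimes> k\<close>. The pair \<open>(c, d)\<close> stands for \<open>c \<otimes> d\<close>, which acts by
  \<open>(c \<otimes> d) w = c w d\<close> on \<open>W\<^sub>p\<close> and by \<open>m (c \<otimes> d) = d m c\<close> on \<open>M\<close>.
\<close>

definition null_ke ::
  "('v, 'e) pre_digraph \<Rightarrow> (('v, 'e + 'e, 'f::field) pelem set, 'm) bimodule \<Rightarrow> int \<Rightarrow>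
   ('m \<times> ('v, 'e + 'e, 'f) pelem \<Rightarrow>\<^sub>0 int) set" where
  "null_ke Q M p =
     tensor_null M (tensor_algebra Q\<lparr>carrier := koszul_W Q p\<rparr>) (base_k Q \<times> base_k Q)
       (\<lambda>m (c, d). (cls Q d \<odot>\<^bsub>M\<^esub> m) \<oslash>\<^bsub>M\<^esub> cls Q c) (\<lambda>(c, d) w. c \<star> w \<star> d)"

definition koszul_chains ::
  "('v, 'e) pre_digraph \<Rightarrow> (('v, 'e + 'e, 'f::field) pelem set, 'm) bimodule \<Rightarrow> int \<Rightarrow>
   ('f, ('m \<times> ('v, 'e + 'e, 'f) pelem \<Rightarrow>\<^sub>0 int) set) module" where
  "koszul_chains Q M p =
     (let K = null_ke Q M p; G = free_Abelian_group (carrier M \<times> koszul_W Q p) Mod K in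
      \<lparr>carrier = carrier G, monoid.mult = undefined, one = undefined,
       zero = \<one>\<^bsub>G\<^esub>, add = monoid.mult G,
       module.smult = (\<lambda>c. induced K (\<lambda>(m, w). frag_of (scalar Q c \<odot>\<^bsub>M\<^esub> m, w)))\<rparr>)"

text \<open>
  The notation \<open>x\<^sub>1 \<dots> x\<^bsub>p+q\<^esub>\<close> for \<open>w\<close> in \<open>W\<^bsub>p+q\<^esub>\<close>, with its first \<open>p\<close> and last \<open>q\<close> factors
  separated, means a choice of a decomposition of \<open>w\<close> in \<open>W\<^sub>p \<otimes>\<^sub>k W\<^sub>q\<close> (sum understood); the
  formulas below do not depend on this choice. The degrees \<open>p\<close> and \<open>q\<close> are nonnegative here.
\<close>

definition split ::
  "('v, 'e) pre_digraph \<Rightarrow> int \<Rightarrow> int \<Rightarrow> ('v, 'e + 'e, 'f::field) pelem \<Rightarrow>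
   (('v, 'e + 'e, 'f) pelem \<times> ('v, 'e + 'e, 'f) pelem) list" where
  "split Q p q w =
     (SOME ps. set ps \<subseteq> koszul_W Q p \<times> koszul_W Q q \<and> (\<Sum>(u, v)\<leftarrow>ps. u \<star> v) = w)"

definition list_msum :: "('m, 'z) ring_scheme \<Rightarrow> ('a \<Rightarrow> 'm) \<Rightarrow> 'a list \<Rightarrow> 'm" where
  "list_msum M g xs = foldr (\<lambda>x s. g x \<oplus>\<^bsub>M\<^esub> s) xs \<zero>\<^bsub>M\<^esub>"

definition sgn_pow :: "int \<Rightarrow> int" where
  "sgn_pow n = (if even n then 1 else - 1)"

text \<open>
  Degrees are integers. As \<open>W\<^sub>p = 0\<close> for \<open>p < 0\<close>, the maps out of or into negative degrees are
  zero, which has to be said explicitly since \<^const>\<open>split\<close> does not apply.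
\<close>

definition cochain_d ::
  "('v, 'e) pre_digraph \<Rightarrow> (('v, 'e + 'e, 'f::field) pelem set, 'm) bimodule \<Rightarrow> int \<Rightarrow>
   (('v, 'e + 'e, 'f) pelem \<Rightarrow> 'm) \<Rightarrow> ('v, 'e + 'e, 'f) pelem \<Rightarrow> 'm" where
  "cochain_d Q M p f = (\<lambda>w\<in>koszul_W Q (p + 1).
     if p < 0 then \<zero>\<^bsub>M\<^esub>
     else list_msum M (\<lambda>(u, x). f u \<oslash>\<^bsub>M\<^esub> cls Q x) (split Q p 1 w) \<ominus>\<^bsub>M\<^esub>
          [sgn_pow p] \<cdot>\<^bsub>M\<^esub> list_msum M (\<lambda>(x, u). cls Q x \<odot>\<^bsub>M\<^esub> f u) (split Q 1 p w))"

definition chain_d ::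
  "('v, 'e) pre_digraph \<Rightarrow> (('v, 'e + 'e, 'f::field) pelem set, 'm) bimodule \<Rightarrow> int \<Rightarrow>
   ('m \<times> ('v, 'e + 'e, 'f) pelem \<Rightarrow>\<^sub>0 int) set \<Rightarrow>
   ('m \<times> ('v, 'e + 'e, 'f) pelem \<Rightarrow>\<^sub>0 int) set" where
  "chain_d Q M p z =
     (if p \<le> 0 then \<zero>\<^bsub>koszul_chains Q M (p - 1)\<^esub>
      else induced (null_ke Q M (p - 1))
        (\<lambda>(m, w). (\<Sum>(x, v)\<leftarrow>split Q 1 (p - 1) w. frag_of (m \<oslash>\<^bsub>M\<^esub> cls Q x, v)) +
           frag_cmul (sgn_pow p)
             (\<Sum>(u, x)\<leftarrow>split Q (p - 1) 1 w. frag_of (cls Q x \<odot>\<^bsub>M\<^esub> m, u))) z)"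


section \<open>Cup and cap products\<close>

definition cup ::
  "('v, 'e) pre_digraph \<Rightarrow> (('v, 'e + 'e, 'f::field) pelem set, 'm) bimodule \<Rightarrow>
   (('v, 'e + 'e, 'f) pelem set, 'n) bimodule \<Rightarrow> int \<Rightarrow> int \<Rightarrow>
   (('v, 'e + 'e, 'f) pelem \<Rightarrow> 'm) \<Rightarrow> (('v, 'e + 'e, 'f) pelem \<Rightarrow> 'n) \<Rightarrow>
   ('v, 'e + 'e, 'f) pelem \<Rightarrow> ('m \<times> 'n \<Rightarrow>\<^sub>0 int) set" where
  "cup Q M N p q f g =
     (let MN = bimodule_tensor (preproj Q) M N in
      (\<lambda>w\<in>koszul_W Q (p + q).
        if p < 0 \<or> q < 0 then \<zero>\<^bsub>MN\<^esub>
        else [sgn_pow (p * q)] \<cdot>\<^bsub>MN\<^esub>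
               list_msum MN (\<lambda>(u, v). pure_tensor (preproj Q) M N (f u) (g v)) (split Q p q w)))"

text \<open>\<open>f \<frown> z\<close> for a \<open>p\<close>-cochain \<open>f\<close> with values in \<open>P\<close> and a \<open>q\<close>-chain \<open>z\<close> with values in \<open>M\<close>.\<close>

definition cap_left ::
  "('v, 'e) pre_digraph \<Rightarrow> (('v, 'e + 'e, 'f::field) pelem set, 'p) bimodule \<Rightarrow>
   (('v, 'e + 'e, 'f) pelem set, 'm) bimodule \<Rightarrow> int \<Rightarrow> int \<Rightarrow>
   (('v, 'e + 'e, 'f) pelem \<Rightarrow> 'p) \<Rightarrow>
   ('m \<times> ('v, 'e + 'e, 'f) pelem \<Rightarrow>\<^sub>0 int) set \<Rightarrow>
   (('p \<times> 'm \<Rightarrow>\<^sub>0 int) set \<times> ('v, 'e + 'e, 'f) pelem \<Rightarrow>\<^sub>0 int) set" where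
  "cap_left Q P M p q f z =
     (let PM = bimodule_tensor (preproj Q) P M in
      if p < 0 \<or> q < p then \<zero>\<^bsub>koszul_chains Q PM (q - p)\<^esub>
      else induced (null_ke Q PM (q - p))
        (\<lambda>(m, w). frag_cmul (sgn_pow ((q - p) * p))
           (\<Sum>(u, v)\<leftarrow>split Q (q - p) p w. frag_of (pure_tensor (preproj Q) P M (f v) m, u))) z)"

text \<open>\<open>z \<frown> f\<close> for a \<open>q\<close>-chain \<open>z\<close> with values in \<open>M\<close> and a \<open>p\<close>-cochain \<open>f\<close> with values in \<open>P\<close>.\<close>

definition cap_right ::
  "('v, 'e) pre_digraph \<Rightarrow> (('v, 'e + 'e, 'f::field) pelem set, 'm) bimodule \<Rightarrow>
   (('v, 'e + 'e, 'f) pelem set, 'p) bimodule \<Rightarrow> int \<Rightarrow> int \<Rightarrow>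
   ('m \<times> ('v, 'e + 'e, 'f) pelem \<Rightarrow>\<^sub>0 int) set \<Rightarrow>
   (('v, 'e + 'e, 'f) pelem \<Rightarrow> 'p) \<Rightarrow>
   (('m \<times> 'p \<Rightarrow>\<^sub>0 int) set \<times> ('v, 'e + 'e, 'f) pelem \<Rightarrow>\<^sub>0 int) set" where
  "cap_right Q M P q p z f =
     (let MP = bimodule_tensor (preproj Q) M P in
      if p < 0 \<or> q < p then \<zero>\<^bsub>koszul_chains Q MP (q - p)\<^esub>
      else induced (null_ke Q MP (q - p))
        (\<lambda>(m, w). frag_cmul (sgn_pow (p * q))
           (\<Sum>(u, v)\<leftarrow>split Q p (q - p) w. frag_of (pure_tensor (preproj Q) M P m (f u), v))) z)"


section \<open>The fundamental chain and the duality map\<close>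

definition omega0 ::
  "('v, 'e) pre_digraph \<Rightarrow>
   (('v, 'e + 'e, 'f::field) pelem set \<times> ('v, 'e + 'e, 'f) pelem \<Rightarrow>\<^sub>0 int) set" where
  "omega0 Q =
     frag_coset (null_ke Q (regular_bimodule (preproj Q)) 2)
       (\<Sum>i\<in>verts Q. frag_of (cls Q (trivial_path i), sigma Q i))"

text \<open>
  For a \<open>p\<close>-cochain \<open>f\<close>, the chain \<open>\<omega>\<^sub>0 \<frown> f\<close> has coefficients in \<open>A \<otimes>\<^sub>A M\<close>, which is identified
  with \<open>M\<close>.
\<close>

definition theta ::
  "('v, 'e) pre_digraph \<Rightarrow> (('v, 'e + 'e, 'f::field) pelem set, 'm) bimodule \<Rightarrow> int \<Rightarrow>
   (('v, 'e + 'e, 'f) pelem \<Rightarrow> 'm) \<Rightarrow> ('m \<times> ('v, 'e + 'e, 'f) pelem \<Rightarrow>\<^sub>0 int) set" where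
  "theta Q M p f =
     induced (null_ke Q M (2 - p)) (\<lambda>(t, w). frag_of (left_unitor M t, w))
       (cap_right Q (regular_bimodule (preproj Q)) M 2 p (omega0 Q) f)"


section \<open>Complexes of vector spaces\<close>

definition linear_maps ::
  "('f, 'a, 'x) module_scheme \<Rightarrow> ('f, 'b, 'y) module_scheme \<Rightarrow> ('a \<Rightarrow> 'b) set" where
  "linear_maps C D =
     {h \<in> carrier C \<rightarrow> carrier D.
        (\<forall>x\<in>carrier C. \<forall>y\<in>carrier C. h (x \<oplus>\<^bsub>C\<^esub> y) = h x \<oplus>\<^bsub>D\<^esub> h y) \<and>
        (\<forall>c. \<forall>x\<in>carrier C. h (c \<odot>\<^bsub>C\<^esub> x) = c \<odot>\<^bsub>D\<^esub> h x)}"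

definition cochain_complex ::
  "(int \<Rightarrow> ('f::field, 'a) module) \<Rightarrow> (int \<Rightarrow> 'a \<Rightarrow> 'a) \<Rightarrow> bool" where
  "cochain_complex C d \<longleftrightarrow>
     (\<forall>n. module (ring_of_type_algebra :: 'f ring) (C n) \<and>
          d n \<in> linear_maps (C n) (C (n + 1)) \<and>
          (\<forall>x\<in>carrier (C n). d (n + 1) (d n x) = \<zero>\<^bsub>C (n + 1 + 1)\<^esub>))"

definition complex_isomorphism ::
  "(int \<Rightarrow> ('f::field, 'a) module) \<Rightarrow> (int \<Rightarrow> 'a \<Rightarrow> 'a) \<Rightarrow>
   (int \<Rightarrow> ('f, 'b) module) \<Rightarrow> (int \<Rightarrow> 'b \<Rightarrow> 'b) \<Rightarrow> (int \<Rightarrow> 'a \<Rightarrow> 'b) \<Rightarrow> bool" where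
  "complex_isomorphism C d D e h \<longleftrightarrow>
     cochain_complex C d \<and> cochain_complex D e \<and>
     (\<forall>n. h n \<in> linear_maps (C n) (D n) \<and> bij_betw (h n) (carrier (C n)) (carrier (D n)) \<and>
          (\<forall>x\<in>carrier (C n). h (n + 1) (d n x) = e n (h n x)))"

end

(*
  The fundamental chain omega_0 is a Casimir element: for 0 <= p <= 2, splitting the sigma_i into factors
  of degrees p and 2 - p yields the sum of b b' over a basis of W_p, where the b' form a basis of W_{2-p}.
  Hence theta_M sends f to the sum of the f(b) tensor b', and is bijective as W_p = 0 for p > 2. The
  exclusion of A_1 makes every sigma_i nonzero, that of A_2 makes W_3 vanish: an element of W_3 is a
  combination of words a a* a, and comparing its expressions in R V and V R shows that the edge of a
  would be isolated. Compatibility with the differentials and with the products is one statement about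
  trilinear maps T: the sums of T over the ways of cutting omega_0 into factors of degrees p, q and r
  agree up to a cyclic permutation and a sign. As p + q + r = 2, one of these degrees is 0, and the
  statement reduces to the Casimir property and its behaviour under exchanging p and 2 - p.
*)
theory Submission
  imports Defs
begin

text \<open>\<open>split\<close> is a Hilbert choice, so a formula containing it has a meaning only
  once independence of the decomposition is known. This comes from coordinates that are coefficients
  at single paths: as the degree of the left factor is known, a path of \<open>u \<star> v\<close>
  can be cut in one place only, and its coefficient is a product of two coefficients
  (\<open>lookup_path_mult\<close>). For sigma_i the path is a a* with an arbitrary arrow a into i.
  Values occur in bimodules as well as in quotients of formal sums. A bimodule M is treated as the
  quotient of the formal sums of its elements by \<open>eval_ker M\<close>, so that congruence of
  formal sums modulo a subgroup is the one notion used for both. Vertices matter for bijectivity: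
  f(b) lies in a corner e_h M e_t, and a functional on chains that reads it off has to cut out this
  corner in order to be balanced over k^e. For chains, neither the linearity of the differential nor
  b^K b^K = 0 is computed; both are carried over from the cochains along theta.\<close>

section \<open>Path algebras\<close>

text \<open>The coefficient sits inside the term instead of in front of it: additivity in it and the
  value 0 at 0 allow the double sum of \<open>path_mult\<close> to range over any finite sets that
  contain the supports.\<close>

definition path_cat ::
  "('v, 'a) qpath \<Rightarrow> ('v, 'a) qpath \<Rightarrow> 'f \<Rightarrow> ('v, 'a, 'f::field) pelem" where
  "path_cat p q c =
     (if snd (snd p) = fst q
      then Poly_Mapping.single (fst p, fst (snd p) @ fst (snd q), snd (snd q)) c else 0)"

lemma path_cat_simps [simp]:
  "path_cat (i, xs, j) (j', ys, l) c = (if j = j' then Poly_Mapping.single (i, xs @ ys, l) c else 0)"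
  "path_cat p q 0 = 0"
  "path_cat p q (c + d) = path_cat p q c + path_cat p q d"
  by (auto simp: path_cat_def single_add)

lemma pscale_single [simp]: "pscale c (Poly_Mapping.single p d) = Poly_Mapping.single p (c * d)"
  by (rule poly_mapping_eqI) (simp add: lookup_single when_def)

lemma pscale_path_cat: "pscale c (path_cat p q d) = path_cat p q (c * d)"
  by (auto simp: path_cat_def)

text \<open>Through cancellation the support of a sum can be smaller than the union of the supports.
  With summation sets that merely contain the supports, the products for \<open>x\<close>,
  \<open>y\<close> and \<open>x + y\<close> are sums over the same sets.\<close>

lemma path_mult_eq_sum:
  assumes "finite A" "Poly_Mapping.keys x \<subseteq> A" "finite B" "Poly_Mapping.keys y \<subseteq> B"
  shows "x \<star> y =
    (\<Sum>p\<in>A. \<Sum>q\<in>B. path_cat p q (Poly_Mapping.lookup x p * Poly_Mapping.lookup y q))"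
proof -
  have "x \<star> y = (\<Sum>p\<in>Poly_Mapping.keys x. \<Sum>q\<in>Poly_Mapping.keys y.
      path_cat p q (Poly_Mapping.lookup x p * Poly_Mapping.lookup y q))"
    unfolding path_mult_def by (auto simp: path_cat_def split_def intro!: sum.cong)
  also have "\<dots> = (\<Sum>p\<in>Poly_Mapping.keys x. \<Sum>q\<in>B.
      path_cat p q (Poly_Mapping.lookup x p * Poly_Mapping.lookup y q))"
    by (intro sum.cong refl sum.mono_neutral_left assms) (auto simp: in_keys_iff)
  also have "\<dots> = (\<Sum>p\<in>A. \<Sum>q\<in>B.
      path_cat p q (Poly_Mapping.lookup x p * Poly_Mapping.lookup y q))"
    by (intro sum.mono_neutral_left assms) (auto simp: in_keys_iff)
  finally show ?thesis .
qed

lemma path_mult_add_left: "(x + y) \<star> z = x \<star> z + y \<star> z"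
proof -
  let ?A = "Poly_Mapping.keys x \<union> Poly_Mapping.keys y" and ?B = "Poly_Mapping.keys z"
  have *: "finite ?A" "Poly_Mapping.keys (x + y) \<subseteq> ?A" "Poly_Mapping.keys x \<subseteq> ?A"
    "Poly_Mapping.keys y \<subseteq> ?A"
    using keys_add[of x y] by auto
  show ?thesis
    unfolding path_mult_eq_sum[OF *(1,2) finite_keys subset_refl]
      path_mult_eq_sum[OF *(1,3) finite_keys subset_refl]
      path_mult_eq_sum[OF *(1,4) finite_keys subset_refl]
    by (simp add: lookup_add distrib_right sum.distrib)
qed

lemma path_mult_add_right: "z \<star> (x + y) = z \<star> x + z \<star> y"
proof -
  let ?A = "Poly_Mapping.keys x \<union> Poly_Mapping.keys y" and ?B = "Poly_Mapping.keys z"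
  have *: "finite ?A" "Poly_Mapping.keys (x + y) \<subseteq> ?A" "Poly_Mapping.keys x \<subseteq> ?A"
    "Poly_Mapping.keys y \<subseteq> ?A"
    using keys_add[of x y] by auto
  show ?thesis
    unfolding path_mult_eq_sum[OF finite_keys subset_refl *(1,2)]
      path_mult_eq_sum[OF finite_keys subset_refl *(1,3)]
      path_mult_eq_sum[OF finite_keys subset_refl *(1,4)]
    by (simp add: lookup_add distrib_left sum.distrib)
qed

lemma path_mult_0 [simp]: "0 \<star> z = 0" "z \<star> 0 = 0"
  by (simp_all add: path_mult_def)

lemma keys_pscale: "Poly_Mapping.keys (pscale c x) \<subseteq> Poly_Mapping.keys x"
  by (auto simp: in_keys_iff)

lemma path_mult_pscale_left: "pscale c x \<star> y = pscale c (x \<star> y)"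
  unfolding path_mult_eq_sum[OF finite_keys keys_pscale finite_keys subset_refl, where y = y]
    path_mult_eq_sum[where x = x and y = y, OF finite_keys subset_refl finite_keys subset_refl]
  by (simp add: pelem.scale_sum_right pscale_path_cat mult.assoc)

lemma path_mult_pscale_right: "x \<star> pscale c y = pscale c (x \<star> y)"
  unfolding path_mult_eq_sum[where x = x and y = "pscale c y", OF finite_keys subset_refl finite_keys keys_pscale]
    path_mult_eq_sum[where x = x and y = y, OF finite_keys subset_refl finite_keys subset_refl]
  by (simp add: pelem.scale_sum_right pscale_path_cat ac_simps)

lemma path_mult_sum_left: "(\<Sum>i\<in>I. f i) \<star> z = (\<Sum>i\<in>I. f i \<star> z)"
  by (induction I rule: infinite_finite_induct) (simp_all add: path_mult_add_left)

lemma path_mult_sum_right: "z \<star> (\<Sum>i\<in>I. f i) = (\<Sum>i\<in>I. z \<star> f i)"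
  by (induction I rule: infinite_finite_induct) (simp_all add: path_mult_add_right)

lemma path_mult_single [simp]:
  "Poly_Mapping.single p c \<star> Poly_Mapping.single q d = path_cat p q (c * d)"
  using path_mult_eq_sum[of "{p}" "Poly_Mapping.single p c" "{q}" "Poly_Mapping.single q d"]
  by (auto simp: lookup_single split: if_splits)

lemma pelem_eq_sum_single:
  "(x :: 'k \<Rightarrow>\<^sub>0 'f::comm_monoid_add) =
     (\<Sum>p\<in>Poly_Mapping.keys x. Poly_Mapping.single p (Poly_Mapping.lookup x p))"
  by (rule poly_mapping_eqI)
    (auto simp: lookup_sum lookup_single when_def in_keys_iff sum.delta' cong: if_cong)

lemma pelem_induct [case_names zero add]:
  fixes x :: "'k \<Rightarrow>\<^sub>0 'f::comm_monoid_add"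
  assumes "P 0" "\<And>p c y. P y \<Longrightarrow> P (Poly_Mapping.single p c + y)"
  shows "P x"
proof -
  have "P (\<Sum>p\<in>A. Poly_Mapping.single p (Poly_Mapping.lookup x p))" if "finite A" for A
    using that by induction (simp_all add: assms)
  from this[OF finite_keys[of x]] show ?thesis
    using pelem_eq_sum_single[of x] by simp
qed

lemma path_mult_assoc: "(x \<star> y) \<star> z = x \<star> (y \<star> z)"
proof (induction x rule: pelem_induct)
  case (add p c x)
  have "(Poly_Mapping.single p c \<star> y) \<star> z = Poly_Mapping.single p c \<star> (y \<star> z)"
  proof (induction y rule: pelem_induct)
    case (add q d y)
    have "(Poly_Mapping.single p c \<star> Poly_Mapping.single q d) \<star> z =
        Poly_Mapping.single p c \<star> (Poly_Mapping.single q d \<star> z)"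
    proof (induction z rule: pelem_induct)
      case (add r e z)
      then show ?case
        by (auto simp: path_mult_add_right path_cat_def mult.assoc)
    qed auto
    with add show ?case
      by (simp add: path_mult_add_left path_mult_add_right)
  qed auto
  with add show ?case
    by (simp add: path_mult_add_left)
qed auto

lemma keys_path_mult:
  "Poly_Mapping.keys (x \<star> y) \<subseteq>
     {(i, xs @ ys, l) |i xs j ys l. (i, xs, j) \<in> Poly_Mapping.keys x \<and> (j, ys, l) \<in> Poly_Mapping.keys y}"
    (is "_ \<subseteq> ?R")
proof -
  have "Poly_Mapping.keys (x \<star> y) \<subseteq>
      (\<Union>p\<in>Poly_Mapping.keys x. \<Union>q\<in>Poly_Mapping.keys y. Poly_Mapping.keys
          (path_cat p q (Poly_Mapping.lookup x p * Poly_Mapping.lookup y q)))"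
    unfolding path_mult_eq_sum[OF finite_keys subset_refl finite_keys subset_refl]
    by (intro order.trans[OF keys_sum] UN_mono order_refl)
  also have "\<dots> \<subseteq> ?R"
    by (fastforce simp: path_cat_def split: if_splits)
  finally show ?thesis .
qed

lemma path_algebra_simps [simp]:
  "x \<in> carrier (path_algebra G) \<longleftrightarrow> Poly_Mapping.keys x \<subseteq> paths G"
  "x \<otimes>\<^bsub>path_algebra G\<^esub> y = x \<star> y" "x \<oplus>\<^bsub>path_algebra G\<^esub> y = x + y" "\<zero>\<^bsub>path_algebra G\<^esub> = 0"
  by (simp_all add: path_algebra_def)

section \<open>Paths of a finite quiver and the grading by length\<close>

context fin_digraph
begin

lemma paths_append:
  assumes "(i, xs, j) \<in> paths G" "(j, ys, l) \<in> paths G"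
  shows "(i, xs @ ys, l) \<in> paths G"
  using assms by (auto simp: paths_def dest: awalk_appendI)

text \<open>The source is the tail of the last arrow of the list, or \<open>i\<close> if the list is
  empty. Hence cutting a path after a given number of arrows determines the middle vertex.\<close>

lemma paths_unique: "(i, xs, j) \<in> paths G \<Longrightarrow> (i, xs, j') \<in> paths G \<Longrightarrow> j = j'"
  unfolding paths_def awalk_def using cas_ends[of j "rev xs" i j' i] by auto

lemma paths_Nil [simp]: "(i, [], j) \<in> paths G \<longleftrightarrow> i = j \<and> i \<in> verts G"
  by (auto simp: paths_def awalk_Nil_iff)

text \<open>Lists are read from right to left while walks run from source to target, so the first
  arrow of the list is the last step of the walk.\<close>

lemma paths_Cons:
  "(i, a # xs, j) \<in> paths G \<longleftrightarrow> a \<in> arcs G \<and> i = head G a \<and> (tail G a, xs, j) \<in> paths G"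
proof -
  have "awalk j (rev xs @ [a]) i \<longleftrightarrow> a \<in> arcs G \<and> i = head G a \<and> awalk j (rev xs) (tail G a)"
    by (auto simp: awalk_Cons_iff awalk_Nil_iff dest: awlast_if_cas intro: head_in_verts)
  then show ?thesis
    by (simp add: paths_def)
qed

lemma path_mult_closed:
  assumes "Poly_Mapping.keys x \<subseteq> paths G" "Poly_Mapping.keys y \<subseteq> paths G"
  shows "Poly_Mapping.keys (x \<star> y) \<subseteq> paths G"
  using keys_path_mult[of x y] assms by (fastforce intro: paths_append)

lemma trivial_path_closed [simp]:
  "i \<in> verts G \<Longrightarrow> Poly_Mapping.keys (trivial_path i :: ('a, 'b, 'f::field) pelem) \<subseteq> paths G"
  by (simp add: trivial_path_def)

lemma one_closed: "Poly_Mapping.keys (\<one>\<^bsub>path_algebra G\<^esub> :: ('a, 'b, 'f::field) pelem) \<subseteq> paths G"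
  unfolding path_algebra_def
  by (auto intro!: order.trans[OF keys_sum] UN_least trivial_path_closed simp del: subset_iff)

lemma path_mult_one:
  fixes x :: "('a, 'b, 'f::field) pelem"
  assumes "Poly_Mapping.keys x \<subseteq> paths G"
  shows "\<one>\<^bsub>path_algebra G\<^esub> \<star> x = x" "x \<star> \<one>\<^bsub>path_algebra G\<^esub> = x"
proof -
  let ?f = "\<lambda>p. Poly_Mapping.single p (Poly_Mapping.lookup x p)"
  have verts: "i \<in> verts G \<and> j \<in> verts G" if "(i, xs, j) \<in> paths G" for i xs j
    using that by (auto simp: paths_def)
  have "\<one>\<^bsub>path_algebra G\<^esub> \<star> ?f p = ?f p \<and> ?f p \<star> \<one>\<^bsub>path_algebra G\<^esub> = ?f p"
    if "p \<in> Poly_Mapping.keys x" for p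
  proof -
    obtain i xs j where p: "p = (i, xs, j)" by (cases p)
    with that assms verts have "i \<in> verts G" "j \<in> verts G" by blast+
    then show ?thesis
      by (simp add: path_algebra_def path_mult_sum_left path_mult_sum_right trivial_path_def p
          eq_commute[of j] cong: if_cong)
  qed
  then have "(\<Sum>p\<in>Poly_Mapping.keys x. \<one>\<^bsub>path_algebra G\<^esub> \<star> ?f p) = (\<Sum>p\<in>Poly_Mapping.keys x. ?f p)"
    and "(\<Sum>p\<in>Poly_Mapping.keys x. ?f p \<star> \<one>\<^bsub>path_algebra G\<^esub>) = (\<Sum>p\<in>Poly_Mapping.keys x. ?f p)"
    by simp_all
  then show "\<one>\<^bsub>path_algebra G\<^esub> \<star> x = x" "x \<star> \<one>\<^bsub>path_algebra G\<^esub> = x"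
    by (simp_all flip: path_mult_sum_left path_mult_sum_right pelem_eq_sum_single)
qed

lemma ring_path_algebra: "ring (path_algebra G :: ('a, 'b, 'f::field) pelem ring)"
proof (intro ringI abelian_groupI monoidI)
  fix x :: "('a, 'b, 'f::field) pelem"
  assume "x \<in> carrier (path_algebra G)"
  then show "\<exists>y\<in>carrier (path_algebra G). y \<oplus>\<^bsub>path_algebra G\<^esub> x = \<zero>\<^bsub>path_algebra G\<^esub>"
    by (intro bexI[of _ "- x"]) auto
qed (auto simp: path_mult_add_left path_mult_add_right path_mult_assoc path_mult_one add_ac
    intro: subsetD[OF path_mult_closed] subsetD[OF one_closed] dest!: subsetD[OF keys_add])

lemma path_degD: "x \<in> path_deg G n \<Longrightarrow> Poly_Mapping.keys x \<subseteq> paths G"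
  by (auto simp: path_deg_def)

text \<open>All paths of \<open>x\<close> have length \<open>n\<close>, so the path
  \<open>xs @ ys\<close> can only arise by cutting it after \<open>xs\<close>, and
  \<open>paths_unique\<close> fixes the middle vertex. Thus a single pair of paths contributes and
  nothing cancels. All later computations of coordinates of products rest on this.\<close>

lemma lookup_path_mult:
  fixes x y :: "('a, 'b, 'f::field) pelem"
  assumes x: "x \<in> path_deg G n" and xs: "length xs = n" and p: "(i, xs, j) \<in> paths G"
  shows "Poly_Mapping.lookup (x \<star> y) (i, xs @ ys, l) =
    Poly_Mapping.lookup x (i, xs, j) * Poly_Mapping.lookup y (j, ys, l)"
proof -
  let ?A = "insert (i, xs, j) (Poly_Mapping.keys x)" and ?B = "insert (j, ys, l) (Poly_Mapping.keys y)"
  have *: "Poly_Mapping.lookup (path_cat p q (Poly_Mapping.lookup x p * Poly_Mapping.lookup y q)) (i, xs @ ys, l) =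
      (if q = (j, ys, l) then (if p = (i, xs, j) then Poly_Mapping.lookup x p * Poly_Mapping.lookup y q else 0) else 0)"
    if "p \<in> ?A" "q \<in> ?B" for p q
  proof -
    have "fst p = i \<and> fst (snd p) = xs \<and> snd (snd p) = j \<and> fst (snd q) = ys"
      if "fst p = i" "fst (snd p) @ fst (snd q) = xs @ ys"
    proof -
      have "p \<in> paths G" "length (fst (snd p)) = n"
        using \<open>p \<in> ?A\<close> x xs p by (auto simp: path_deg_def split_def)
      then show ?thesis
        using that xs p by (cases p) (auto dest: paths_unique)
    qed
    then show ?thesis
      by (cases p; cases q) (fastforce simp: lookup_single when_def)
  qed
  have "Poly_Mapping.lookup (x \<star> y) (i, xs @ ys, l) =
      (\<Sum>p\<in>?A. \<Sum>q\<in>?B. Poly_Mapping.lookup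
         (path_cat p q (Poly_Mapping.lookup x p * Poly_Mapping.lookup y q)) (i, xs @ ys, l))"
    by (subst path_mult_eq_sum[of ?A x ?B y]) (auto simp: lookup_sum)
  also have "\<dots> = (\<Sum>p\<in>?A. \<Sum>q\<in>?B.
      (if q = (j, ys, l) then (if p = (i, xs, j) then Poly_Mapping.lookup x p * Poly_Mapping.lookup y q else 0) else 0))"
    by (intro sum.cong refl *)
  also have "\<dots> = Poly_Mapping.lookup x (i, xs, j) * Poly_Mapping.lookup y (j, ys, l)"
    by (subst sum.delta, simp, simp only: insertI1 if_True, subst sum.delta, simp_all)
  finally show ?thesis .
qed

lemma path_deg_add: "x \<in> path_deg G n \<Longrightarrow> y \<in> path_deg G n \<Longrightarrow> x + y \<in> path_deg G n"
  using keys_add[of x y] by (auto simp: path_deg_def)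

lemma path_deg_0 [simp]: "0 \<in> path_deg G n"
  by (simp add: path_deg_def)

lemma path_deg_pscale: "x \<in> path_deg G n \<Longrightarrow> pscale c x \<in> path_deg G n"
  using keys_pscale[of c x] by (auto simp: path_deg_def)

lemma path_deg_sum: "(\<And>i. i \<in> I \<Longrightarrow> f i \<in> path_deg G n) \<Longrightarrow> (\<Sum>i\<in>I. f i) \<in> path_deg G n"
  by (induction I rule: infinite_finite_induct) (auto intro: path_deg_add)

lemma path_deg_mult:
  "x \<in> path_deg G m \<Longrightarrow> y \<in> path_deg G n \<Longrightarrow> x \<star> y \<in> path_deg G (m + n)"
  using keys_path_mult[of x y] unfolding path_deg_def
  by (fastforce intro: paths_append)

lemma subspace_path_deg: "pelem.subspace (path_deg G n)"
  by (auto simp: pelem.subspace_def intro: path_deg_add path_deg_pscale)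

lemma trivial_path_deg: "i \<in> verts G \<Longrightarrow> trivial_path i \<in> path_deg G 0"
  by (simp add: path_deg_def trivial_path_def)

lemma arrow_deg: "a \<in> arcs G \<Longrightarrow> arrow G a \<in> path_deg G 1"
  by (simp add: path_deg_def arrow_def paths_Cons)

lemma one_deg: "\<one>\<^bsub>path_algebra G\<^esub> \<in> path_deg G 0"
  unfolding path_algebra_def by (auto intro!: path_deg_sum trivial_path_deg)

lemma base_expand:
  fixes c :: "('a, 'b, 'f::field) pelem"
  assumes "c \<in> path_deg G 0"
  shows "c = (\<Sum>i\<in>verts G. pscale (Poly_Mapping.lookup c (i, [], i)) (trivial_path i))"
proof (rule poly_mapping_eqI)
  fix p
  have "p \<in> {(i, xs, j) \<in> paths G. length xs = 0}" if "Poly_Mapping.lookup c p \<noteq> 0"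
    using that assms by (auto simp: path_deg_def in_keys_iff)
  then have "Poly_Mapping.lookup c p = 0" if "\<not> (\<exists>i\<in>verts G. p = (i, [], i))"
    using that by (cases p) fastforce
  then show "Poly_Mapping.lookup c p = Poly_Mapping.lookup
      (\<Sum>i\<in>verts G. pscale (Poly_Mapping.lookup c (i, [], i)) (trivial_path i)) p"
    by (cases "\<exists>i\<in>verts G. p = (i, [], i)")
      (auto simp: lookup_sum trivial_path_def lookup_single when_def intro!: sum.neutral[symmetric] cong: if_cong)
qed

lemma trivial_path_mult:
  "trivial_path i \<star> trivial_path j = (if i = j then trivial_path i else (0 :: ('a, 'b, 'f::field) pelem))"
  by (simp add: trivial_path_def)

lemma base_mult_trivial:
  fixes c :: "('a, 'b, 'f::field) pelem"
  assumes "c \<in> path_deg G 0" "i \<in> verts G"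
  shows "c \<star> trivial_path i = pscale (Poly_Mapping.lookup c (i, [], i)) (trivial_path i)"
    and "trivial_path i \<star> c = pscale (Poly_Mapping.lookup c (i, [], i)) (trivial_path i)"
proof -
  note * = base_expand[OF assms(1)]
  have "c \<star> trivial_path i =
      (\<Sum>j\<in>verts G. pscale (Poly_Mapping.lookup c (j, [], j)) (trivial_path j \<star> trivial_path i))"
    by (subst *) (simp add: path_mult_sum_left path_mult_pscale_left)
  then show "c \<star> trivial_path i = pscale (Poly_Mapping.lookup c (i, [], i)) (trivial_path i)"
    using assms(2) by (simp add: trivial_path_mult if_distrib[of "pscale _"] cong: if_cong)
  have "trivial_path i \<star> c =
      (\<Sum>j\<in>verts G. pscale (Poly_Mapping.lookup c (j, [], j)) (trivial_path i \<star> trivial_path j))"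
    by (subst *) (simp add: path_mult_sum_right path_mult_pscale_right)
  then show "trivial_path i \<star> c = pscale (Poly_Mapping.lookup c (i, [], i)) (trivial_path i)"
    using assms(2) by (simp add: trivial_path_mult if_distrib[of "pscale _"] cong: if_cong)
qed

end

text \<open>
  A finite basis \<open>b\<close> of a \<open>k\<close>-subbimodule of \<open>V\<^bsup>\<otimes>n\<^esup>\<close> with \<open>b i \<in> e\<^bsub>h i\<^esub> W e\<^bsub>t i\<^esub>\<close>, whose
  coordinate functions are, up to the factors \<open>\<kappa> i\<close>, the coefficients at the single paths \<open>\<pi> i\<close>.
\<close>

locale path_basis = fin_digraph G
  for G :: "('v, 'a) pre_digraph" +
  fixes W :: "('v, 'a, 'f::field) pelem set" and n :: nat and I :: "'i set"
    and b :: "'i \<Rightarrow> ('v, 'a, 'f) pelem" and h t :: "'i \<Rightarrow> 'v"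
    and \<kappa> :: "'i \<Rightarrow> 'f" and \<pi> :: "'i \<Rightarrow> 'a list"
  assumes fin_I: "finite I"
    and W_deg: "W \<subseteq> path_deg G n"
    and b_in: "i \<in> I \<Longrightarrow> b i \<in> W"
    and path_pi: "i \<in> I \<Longrightarrow> (h i, \<pi> i, t i) \<in> paths G"
    and length_pi: "i \<in> I \<Longrightarrow> length (\<pi> i) = n"
    and b_head: "i \<in> I \<Longrightarrow> trivial_path (h i) \<star> b i = b i"
    and b_tail: "i \<in> I \<Longrightarrow> b i \<star> trivial_path (t i) = b i"
    and W_subspace: "pelem.subspace W"
    and expand: "w \<in> W \<Longrightarrow>
      w = (\<Sum>i\<in>I. pscale (\<kappa> i * Poly_Mapping.lookup w (h i, \<pi> i, t i)) (b i))"
    and dual: "\<lbrakk>i \<in> I; j \<in> I\<rbrakk> \<Longrightarrow>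
      \<kappa> i * Poly_Mapping.lookup (b j) (h i, \<pi> i, t i) = (if i = j then 1 else 0)"
begin

definition co :: "'i \<Rightarrow> ('v, 'a, 'f) pelem \<Rightarrow> 'f" where
  "co i w = \<kappa> i * Poly_Mapping.lookup w (h i, \<pi> i, t i)"

lemma h_in: "i \<in> I \<Longrightarrow> h i \<in> verts G" and t_in: "i \<in> I \<Longrightarrow> t i \<in> verts G"
  using path_pi[of i] by (auto simp: paths_def)

lemma co_expand: "w \<in> W \<Longrightarrow> w = (\<Sum>i\<in>I. pscale (co i w) (b i))"
  unfolding co_def by (rule expand)

lemma co_b: "\<lbrakk>i \<in> I; j \<in> I\<rbrakk> \<Longrightarrow> co i (b j) = (if i = j then 1 else 0)"
  unfolding co_def by (rule dual)

lemma co_add: "co i (v + w) = co i v + co i w"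
  by (simp add: co_def lookup_add distrib_left)

lemma W_add: "v \<in> W \<Longrightarrow> w \<in> W \<Longrightarrow> v + w \<in> W"
  and W_0: "0 \<in> W"
  and W_pscale: "w \<in> W \<Longrightarrow> pscale c w \<in> W"
  using W_subspace by (auto simp: pelem.subspace_def)

lemma W_sum: "(\<And>j. j \<in> J \<Longrightarrow> f j \<in> W) \<Longrightarrow> (\<Sum>j\<in>J. f j) \<in> W"
  by (induction J rule: infinite_finite_induct) (auto intro: W_add W_0)

lemma base_mult_b:
  assumes "c \<in> path_deg G 0" "i \<in> I"
  shows "c \<star> b i = pscale (Poly_Mapping.lookup c (h i, [], h i)) (b i)"
    and "b i \<star> c = pscale (Poly_Mapping.lookup c (t i, [], t i)) (b i)"
proof -
  have "c \<star> b i = (c \<star> trivial_path (h i)) \<star> b i"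
    using b_head[OF assms(2)] by (simp add: path_mult_assoc)
  then show "c \<star> b i = pscale (Poly_Mapping.lookup c (h i, [], h i)) (b i)"
    using b_head assms h_in by (simp add: base_mult_trivial path_mult_pscale_left)
  have "b i \<star> c = b i \<star> (trivial_path (t i) \<star> c)"
    using b_tail[OF assms(2)] by (simp flip: path_mult_assoc)
  then show "b i \<star> c = pscale (Poly_Mapping.lookup c (t i, [], t i)) (b i)"
    using b_tail assms t_in by (simp add: base_mult_trivial path_mult_pscale_right)
qed

text \<open>The locale only asks for a subspace. Stability under k follows because each basis
  element has one target and one source, so that an element of k multiplies it by a scalar.\<close>

lemma W_lmult: assumes "c \<in> path_deg G 0" "w \<in> W" shows "c \<star> w \<in> W"
proof -
  have "c \<star> w = (\<Sum>i\<in>I. pscale (co i w) (c \<star> b i))"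
    by (subst co_expand[OF assms(2)]) (simp add: path_mult_sum_right path_mult_pscale_right)
  also have "\<dots> \<in> W"
    using assms by (auto simp: base_mult_b intro!: W_sum W_pscale b_in)
  finally show ?thesis .
qed

lemma W_rmult: assumes "c \<in> path_deg G 0" "w \<in> W" shows "w \<star> c \<in> W"
proof -
  have "w \<star> c = (\<Sum>i\<in>I. pscale (co i w) (b i \<star> c))"
    by (subst co_expand[OF assms(2)]) (simp add: path_mult_sum_left path_mult_pscale_left)
  also have "\<dots> \<in> W"
    using assms by (auto simp: base_mult_b intro!: W_sum W_pscale b_in)
  finally show ?thesis .
qed

lemma co_lmult:
  assumes "c \<in> path_deg G 0" "i \<in> I"
  shows "co i (c \<star> w) = Poly_Mapping.lookup c (h i, [], h i) * co i w"
  using lookup_path_mult[OF assms(1), of "[]" "h i" "h i" w "\<pi> i" "t i"] h_in[OF assms(2)]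
  by (simp add: co_def)

text \<open>In contrast to \<open>co_lmult\<close>, membership of \<open>w\<close> is needed: a path
  of the product is cut after the left factor, whose degree must be known, and here the left factor
  is \<open>w\<close>.\<close>

lemma co_rmult:
  assumes "i \<in> I" "w \<in> W"
  shows "co i (w \<star> c) = co i w * Poly_Mapping.lookup c (t i, [], t i)"
  using lookup_path_mult[of w n "\<pi> i" "h i" "t i" c "[]" "t i"] path_pi length_pi assms W_deg
  by (auto simp: co_def)

end

section \<open>The double quiver and bases of \<open>W\<^sub>p\<close>\<close>

lemma verts_double_quiver [simp]: "verts (double_quiver Q) = verts Q"
  and double_quiver_arrows: "arcs (double_quiver Q) = arcs Q <+> arcs Q"
  "tail (double_quiver Q) (Inl x) = tail Q x" "tail (double_quiver Q) (Inr x) = head Q x"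
  "head (double_quiver Q) (Inl x) = head Q x" "head (double_quiver Q) (Inr x) = tail Q x"
  by (simp_all add: double_quiver_def)

lemma star_simps [simp]: "star (Inl x) = Inr x" "star (Inr x) = Inl x"
  by (simp_all add: star_def)

lemma star_star [simp]: "star (star a) = a"
  by (cases a) simp_all

lemma star_inject [simp]: "star a = star b \<longleftrightarrow> a = b"
  by (metis star_star)

lemma star_neq [simp]: "star a \<noteq> a" "a \<noteq> star a"
  by (cases a; simp)+

lemma star_arcs [simp]: "star a \<in> arcs (double_quiver Q) \<longleftrightarrow> a \<in> arcs (double_quiver Q)"
  by (cases a) (auto simp: double_quiver_arrows)

lemma head_star [simp]: "head (double_quiver Q) (star a) = tail (double_quiver Q) a"
  and tail_star [simp]: "tail (double_quiver Q) (star a) = head (double_quiver Q) a"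
  by (cases a; simp add: double_quiver_arrows)+

lemma eps_star [simp]: "eps (star a) = - (eps a :: 'f::field)"
  by (cases a) (simp_all add: eps_def)

lemma eps_sqr [simp]: "eps a * eps a = (1 :: 'f::field)" "eps a * (eps a * x) = (x :: 'f)"
  by (cases a; simp add: eps_def)+

lemma eps_neq_0 [simp]: "eps a \<noteq> (0 :: 'f::field)"
  by (cases a) (simp_all add: eps_def)

lemma bij_star: "bij_betw star (arcs (double_quiver Q)) (arcs (double_quiver Q))"
  by (rule bij_betwI[of _ _ _ star]) auto

section \<open>Connectedness and the exclusion of the two small graphs\<close>

locale connected_quiver = fin_digraph Q for Q :: "('v, 'e) pre_digraph" +
  assumes connected: "Digraph_Component.connected Q"
    and not_A1: "\<not> underlying_A1 Q" and not_A2: "\<not> underlying_A2 Q"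
begin

sublocale dq: fin_digraph "double_quiver Q"
proof
  fix a assume "a \<in> arcs (double_quiver Q)"
  then show "tail (double_quiver Q) a \<in> verts (double_quiver Q)"
    "head (double_quiver Q) a \<in> verts (double_quiver Q)"
    by (auto simp: double_quiver_arrows)
qed (auto simp: double_quiver_arrows)

text \<open>The form in which connectedness enters: a set that no edge leaves or enters is closed
  under reachability in the symmetrized graph. It is applied to one vertex and to the two ends of
  one edge.\<close>

lemma closed_vertex_set:
  assumes "S \<subseteq> verts Q" "S \<noteq> {}" and "\<And>a. a \<in> arcs Q \<Longrightarrow> tail Q a \<in> S \<longleftrightarrow> head Q a \<in> S"
  shows "S = verts Q"
proof -
  interpret sym: pair_wf_digraph "mk_symmetric Q" ..
  obtain u where u: "u \<in> S" using assms by auto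
  have "v \<in> S" if "v \<in> verts Q" for v
  proof -
    have "u \<rightarrow>\<^sup>*\<^bsub>with_proj (mk_symmetric Q)\<^esub> v"
      using connected that u assms(1) by (auto simp: Digraph_Component.connected_def strongly_connected_def)
    then show "v \<in> S"
    proof (induction rule: sym.reachable_induct)
      case (step x y)
      from step(2) have "(x, y) \<in> parcs (mk_symmetric Q)" by simp
      with step(3) assms(3) show ?case by (auto simp: parcs_mk_symmetric)
    qed (rule u)
  qed
  with assms show ?thesis by auto
qed

text \<open>Every edge appears in the double quiver with both orientations, so a vertex without
  incoming arrow touches no edge at all. Such a vertex alone is a closed vertex set.\<close>

lemma incoming_arrow:
  assumes "i \<in> verts Q" shows "\<exists>a\<in>arcs (double_quiver Q). head (double_quiver Q) a = i"
proof (rule ccontr)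
  assume none: "\<not> (\<exists>a\<in>arcs (double_quiver Q). head (double_quiver Q) a = i)"
  have no: "head Q a \<noteq> i \<and> tail Q a \<noteq> i" if "a \<in> arcs Q" for a
  proof -
    have "Inl a \<in> arcs (double_quiver Q)" "Inr a \<in> arcs (double_quiver Q)"
      using that by (auto simp: double_quiver_arrows)
    with none show ?thesis
      by (metis double_quiver_arrows(4,5))
  qed
  have "{i} = verts Q"
    using assms no by (intro closed_vertex_set) auto
  then have "underlying_A1 Q"
    using no tail_in_verts unfolding underlying_A1_def by blast
  with not_A1 show False by simp
qed

abbreviation (input) "D \<equiv> double_quiver Q"

text \<open>The hypotheses say that no arrow ends at either end of \<open>a\<close> except
  \<open>a\<close> and \<open>star a\<close>. Hence the edge underlying \<open>a\<close> is the only
  one touching its ends, these form a closed vertex set, and the graph would be A_2.\<close>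

lemma not_isolated_edge:
  assumes a: "a \<in> arcs (double_quiver Q)"
    and "\<And>x. \<lbrakk>x \<in> arcs (double_quiver Q); head (double_quiver Q) x = head (double_quiver Q) a\<rbrakk> \<Longrightarrow> x = a"
    and "\<And>x. \<lbrakk>x \<in> arcs (double_quiver Q); head (double_quiver Q) x = tail (double_quiver Q) a\<rbrakk> \<Longrightarrow> x = star a"
  shows False
proof -
  obtain x where x: "x \<in> arcs Q" "a = Inl x \<or> a = Inr x"
    using a by (auto simp: double_quiver_arrows)
  let ?S = "{head Q x, tail Q x}"
  have ends: "{head D a, tail D a} = ?S"
    using x by (auto simp: double_quiver_arrows)
  have only: "y = x" if y: "y \<in> arcs Q" "head Q y \<in> ?S \<or> tail Q y \<in> ?S" for y
  proof -
    obtain z where z: "z = Inl y \<or> z = Inr y" "head D z \<in> {head D a, tail D a}"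
      using y(2) ends by (metis double_quiver_arrows(4,5))
    with y(1) have "z \<in> arcs D"
      by (auto simp: double_quiver_arrows)
    with z(2) assms(2,3) have "z = a \<or> z = star a"
      by blast
    with z(1) x(2) show ?thesis
      by auto
  qed
  have S: "?S = verts Q"
  proof (rule closed_vertex_set)
    show "tail Q y \<in> ?S \<longleftrightarrow> head Q y \<in> ?S" if "y \<in> arcs Q" for y
      using only[OF that] by blast
  qed (use x in auto)
  have "y = x" if "y \<in> arcs Q" for y
    using only[OF that] head_in_verts[OF that] S by simp
  with x(1) have "arcs Q = {x}"
    by blast
  \<comment> \<open>If \<open>a\<close> were a loop, \<open>star a\<close> would be a second arrow
    with the same head as \<open>a\<close>.\<close>
  moreover have "head Q x \<noteq> tail Q x"
    using assms(2)[of "star a"] a x(2) by (auto simp: double_quiver_arrows(2-))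
  ultimately have "underlying_A2 Q"
    using S unfolding underlying_A2_def by (intro exI[of _ "head Q x"] exI[of _ "tail Q x"] exI[of _ x]) auto
  with not_A2 show False by simp
qed

section \<open>Coefficients of the relations and bases in degrees 0, 1 and 2\<close>

lemma sigma_eq:
  "sigma Q i = (\<Sum>a\<in>{a \<in> arcs D. head D a = i}.
     Poly_Mapping.single (i, [a, star a], i) (eps a :: 'f::field))"
  unfolding sigma_def by (intro sum.cong) (auto simp: arrow_def)

lemma lookup_sigma:
  "a \<in> arcs D \<Longrightarrow> Poly_Mapping.lookup (sigma Q i) (j, [a, star a], l) =
     (if head D a = i \<and> j = i \<and> l = i then eps a else (0 :: 'f::field))"
proof -
  assume a: "a \<in> arcs D"
  have "Poly_Mapping.lookup (sigma Q i) (j, [a, star a], l) =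
      (\<Sum>x\<in>{x \<in> arcs D. head D x = i}. if x = a then if j = i \<and> l = i then eps a else (0 :: 'f) else 0)"
    unfolding sigma_eq lookup_sum by (intro sum.cong) (auto simp: lookup_single when_def)
  also have "\<dots> = (if head D a = i \<and> j = i \<and> l = i then eps a else 0)"
    using a by (simp add: sum.delta)
  finally show ?thesis .
qed

lemma keys_sigma:
  assumes "p \<in> Poly_Mapping.keys (sigma Q i :: ('v, 'e + 'e, 'f::field) pelem)"
  obtains a where "a \<in> arcs D" "head D a = i" "p = (i, [a, star a], i)"
proof -
  have "p \<in> (\<Union>a\<in>{a \<in> arcs D. head D a = i}. Poly_Mapping.keys
      (Poly_Mapping.single (i, [a, star a], i) (eps a :: 'f)))"
    using subsetD[OF keys_sum] assms unfolding sigma_eq .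
  then show ?thesis using that by (auto split: if_splits)
qed

lemma path2: "a \<in> arcs D \<Longrightarrow> (head D a, [a, star a], head D a) \<in> paths D"
  using dq.head_in_verts by (auto simp: dq.paths_Cons)

lemma sigma_deg: "sigma Q i \<in> path_deg D 2"
proof -
  have "p \<in> {(i, xs, j) \<in> paths D. length xs = 2}" if "p \<in> Poly_Mapping.keys (sigma Q i)" for p
    using keys_sigma[OF that] path2 by (metis (mono_tags, lifting) CollectI case_prod_conv length_Cons list.size(3) numeral_2_eq_2)
  then show ?thesis
    by (auto simp: path_deg_def)
qed

lemma sigma_head: "trivial_path i \<star> sigma Q i = (sigma Q i :: ('v, 'e + 'e, 'f::field) pelem)"
  and sigma_tail: "sigma Q i \<star> trivial_path i = (sigma Q i :: ('v, 'e + 'e, 'f::field) pelem)"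
  unfolding sigma_eq path_mult_sum_left path_mult_sum_right trivial_path_def
  by simp_all

text \<open>An arbitrary choice. With a = \<open>arrow_to i\<close>, the coefficient of sigma_i at
  the path a a* is \<open>eps a\<close>, and this path occurs in no other sigma_j; so one
  coefficient reads off the coordinate of sigma_i.\<close>

definition arrow_to :: "'v \<Rightarrow> 'e + 'e" where
  "arrow_to i = (SOME a. a \<in> arcs D \<and> head D a = i)"

lemma arrow_to: "i \<in> verts Q \<Longrightarrow> arrow_to i \<in> arcs D \<and> head D (arrow_to i) = i"
  unfolding arrow_to_def
  using incoming_arrow[of i] someI_ex[of "\<lambda>a. a \<in> arcs D \<and> head D a = i"] by blast

text \<open>
  The index of the basis of \<open>W\<^sub>p\<close> consisting of the \<open>e\<^sub>i\<close> (\<open>p = 0\<close>), the arrows (\<open>p = 1\<close>) and the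
  \<open>\<sigma>\<^sub>i\<close> (\<open>p = 2\<close>); \<open>dua p\<close> is the basis of \<open>W\<^bsub>2-p\<^esub>\<close> for which
  \<open>\<sigma>\<^sub>i\<close> is the sum of the products \<open>bas p b \<star> dua p b\<close> with \<open>hh b = i\<close>.
\<close>

definition idx :: "int \<Rightarrow> ('v + ('e + 'e)) set" where
  "idx p = (if p = 0 \<or> p = 2 then Inl ` verts Q else if p = 1 then Inr ` arcs D else {})"

definition bas :: "int \<Rightarrow> 'v + ('e + 'e) \<Rightarrow> ('v, 'e + 'e, 'f::field) pelem" where
  "bas p = case_sum (\<lambda>i. if p = 0 then trivial_path i else sigma Q i) (arrow D)"

definition dua :: "int \<Rightarrow> 'v + ('e + 'e) \<Rightarrow> ('v, 'e + 'e, 'f::field) pelem" where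
  "dua p = case_sum (\<lambda>i. if p = 0 then sigma Q i else trivial_path i)
     (\<lambda>a. pscale (eps a) (arrow D (star a)))"

text \<open>For \<open>b\<close> in \<open>idx p\<close>, these are the target and the source of
  \<open>bas p b\<close>. For \<open>dua p b\<close> the two are exchanged, so that the product of
  both is a closed path combination at \<open>hh b\<close>.\<close>

definition hh :: "'v + ('e + 'e) \<Rightarrow> 'v" where "hh = case_sum (\<lambda>i. i) (head D)"
definition tt :: "'v + ('e + 'e) \<Rightarrow> 'v" where "tt = case_sum (\<lambda>i. i) (tail D)"

text \<open>The functions are left arbitrary on the right summand, which the index set does not
  meet. This way the statement can be instantiated both for \<open>bas 0\<close> and for
  \<open>dua 2\<close>, which differ there.\<close>

lemma trivial_path_basis:
  "path_basis D (path_deg D 0) 0 (Inl ` verts Q :: ('v + ('e + 'e)) set) (case_sum trivial_path (f :: _ \<Rightarrow> ('v, 'e + 'e, 'f::field) pelem))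
     (case_sum (\<lambda>i. i) g) (case_sum (\<lambda>i. i) g') (case_sum (\<lambda>_. 1) f') (case_sum (\<lambda>_. []) f'')"
proof unfold_locales
  fix w :: "('v, 'e + 'e, 'f) pelem" assume "w \<in> path_deg D 0"
  from dq.base_expand[OF this]
  show "w = (\<Sum>i\<in>Inl ` verts Q. pscale (case_sum (\<lambda>_. 1) f' i * Poly_Mapping.lookup w (case_sum (\<lambda>i. i) g i, case_sum (\<lambda>_. []) f'' i, case_sum (\<lambda>i. i) g' i))
            (case_sum trivial_path f i))"
    by (simp add: sum.reindex)
next
  fix i :: "'v + ('e + 'e)" assume "i \<in> Inl ` verts Q"
  then obtain v where v: "v \<in> verts Q" "i = Inl v" by auto
  show "length (case_sum (\<lambda>_. []) f'' i) = 0"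
    using v by simp
  show "(case_sum (\<lambda>i. i) g i, case_sum (\<lambda>_. []) f'' i, case_sum (\<lambda>i. i) g' i) \<in> paths D"
    using v by simp
  show "case_sum trivial_path f i \<in> path_deg D 0"
    using v by (simp add: dq.trivial_path_deg)
  show "trivial_path (case_sum (\<lambda>i. i) g i) \<star> case_sum trivial_path f i = case_sum trivial_path f i"
    and "case_sum trivial_path f i \<star> trivial_path (case_sum (\<lambda>i. i) g' i) = case_sum trivial_path f i"
    using v by (simp_all add: dq.trivial_path_mult)
  fix j :: "'v + ('e + 'e)" assume "j \<in> Inl ` verts Q"
  then show "case_sum (\<lambda>_. 1) f' i * Poly_Mapping.lookup (case_sum trivial_path f j) (case_sum (\<lambda>i. i) g i, case_sum (\<lambda>_. []) f'' i, case_sum (\<lambda>i. i) g' i) =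
      (if i = j then 1 else 0)"
    using v by (auto simp: trivial_path_def lookup_single when_def split: if_splits)
qed (simp_all add: dq.subspace_path_deg)

text \<open>Two bases of V are needed: the arrows, with \<open>s\<close> the identity and
  \<open>c\<close> constantly 1, and the dual one consisting of the eps(a) a*, with \<open>s\<close>
  = \<open>star\<close> and \<open>c\<close> = \<open>eps\<close>. As \<open>c a\<close> is its own
  inverse, it is also the factor in the coordinate function.\<close>

lemma arrow_basis:
  fixes c :: "'e + 'e \<Rightarrow> 'f::field"
  assumes s: "bij_betw s (arcs D) (arcs D)" and c: "\<And>a. c a * c a = 1"
  shows "path_basis D (path_deg D 1) 1 (Inr ` arcs D :: ('v + ('e + 'e)) set)
     (case_sum f (\<lambda>a. pscale (c a) (arrow D (s a))))
     (case_sum g (\<lambda>a. head D (s a))) (case_sum g' (\<lambda>a. tail D (s a))) (case_sum f' c) (case_sum f'' (\<lambda>a. [s a]))"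
proof unfold_locales
  have sa: "s a \<in> arcs D" if "a \<in> arcs D" for a
    using s that by (auto simp: bij_betw_def)
  have [simp]: "c a * x * c a = x" for a x
    by (metis c mult.assoc mult.commute mult_1)
  fix w :: "('v, 'e + 'e, 'f) pelem" assume w: "w \<in> path_deg D 1"
  have "w = (\<Sum>a\<in>arcs D. Poly_Mapping.single (head D a, [a], tail D a)
      (Poly_Mapping.lookup w (head D a, [a], tail D a)))"
  proof (rule poly_mapping_eqI)
    fix p
    have "\<exists>a\<in>arcs D. p = (head D a, [a], tail D a)" if "Poly_Mapping.lookup w p \<noteq> 0"
    proof -
      have "p \<in> {(i, xs, j) \<in> paths D. length xs = 1}"
        using that w by (auto simp: path_deg_def in_keys_iff)
      then show ?thesis
        by (cases p) (auto simp: length_Suc_conv dq.paths_Cons)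
    qed
    moreover have "Poly_Mapping.lookup w p = (\<Sum>a\<in>arcs D. if (head D a, [a], tail D a) = p
        then Poly_Mapping.lookup w (head D a, [a], tail D a) else 0)" if "x \<in> arcs D" "p = (head D x, [x], tail D x)" for x
    proof -
      have "(\<Sum>a\<in>arcs D. if (head D a, [a], tail D a) = p
          then Poly_Mapping.lookup w (head D a, [a], tail D a) else 0) =
        (\<Sum>a\<in>arcs D. if a = x then Poly_Mapping.lookup w p else 0)"
        using that by (intro sum.cong) auto
      with that show ?thesis by simp
    qed
    moreover have "0 = (\<Sum>a\<in>arcs D. if (head D a, [a], tail D a) = p
        then Poly_Mapping.lookup w (head D a, [a], tail D a) else 0)" if "Poly_Mapping.lookup w p = 0"
      using that by (intro sum.neutral[symmetric]) auto
    ultimately have "Poly_Mapping.lookup w p = (\<Sum>a\<in>arcs D. if (head D a, [a], tail D a) = p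
        then Poly_Mapping.lookup w (head D a, [a], tail D a) else 0)"
      by (metis (no_types, lifting))
    then show "Poly_Mapping.lookup w p = Poly_Mapping.lookup (\<Sum>a\<in>arcs D. Poly_Mapping.single (head D a, [a], tail D a)
      (Poly_Mapping.lookup w (head D a, [a], tail D a))) p"
      by (simp only: lookup_sum lookup_single when_def)
  qed
  also have "\<dots> = (\<Sum>a\<in>arcs D. Poly_Mapping.single (head D (s a), [s a], tail D (s a))
      (Poly_Mapping.lookup w (head D (s a), [s a], tail D (s a))))"
    using s by (rule sum.reindex_bij_betw[symmetric])
  finally show "w = (\<Sum>i\<in>Inr ` arcs D. pscale (case_sum f' c i * Poly_Mapping.lookup w (case_sum g (\<lambda>a. head D (s a)) i, case_sum f'' (\<lambda>a. [s a]) i, case_sum g' (\<lambda>a. tail D (s a)) i))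
            (case_sum f (\<lambda>a. pscale (c a) (arrow D (s a))) i))"
    by (simp add: sum.reindex arrow_def)
next
  fix i :: "'v + ('e + 'e)" assume "i \<in> Inr ` arcs D"
  then show "case_sum f (\<lambda>a. pscale (c a) (arrow D (s a))) i \<in> path_deg D 1"
    using s by (auto simp: bij_betw_def simp del: One_nat_def intro!: dq.path_deg_pscale dq.arrow_deg)
next
  fix i :: "'v + ('e + 'e)" assume "i \<in> Inr ` arcs D"
  then show "(case_sum g (\<lambda>a. head D (s a)) i, case_sum f'' (\<lambda>a. [s a]) i, case_sum g' (\<lambda>a. tail D (s a)) i) \<in> paths D"
    using bij_betw_apply[OF s] dq.tail_in_verts by (auto simp: dq.paths_Cons)
next
  fix i j :: "'v + ('e + 'e)" assume "i \<in> Inr ` arcs D" "j \<in> Inr ` arcs D"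
  moreover have "s x = s y \<longleftrightarrow> x = y" if "x \<in> arcs D" "y \<in> arcs D" for x y
    using that s by (auto simp: bij_betw_def inj_on_def)
  ultimately show "case_sum f' c i * Poly_Mapping.lookup (case_sum f (\<lambda>a. pscale (c a) (arrow D (s a))) j)
       (case_sum g (\<lambda>a. head D (s a)) i, case_sum f'' (\<lambda>a. [s a]) i, case_sum g' (\<lambda>a. tail D (s a)) i) =
       (if i = j then 1 else 0)"
    by (auto simp: arrow_def lookup_single when_def c)
next
  fix i :: "'v + ('e + 'e)" assume "i \<in> Inr ` arcs D"
  then obtain a where a: "i = Inr a" by auto
  show "trivial_path (case_sum g (\<lambda>a. head D (s a)) i) \<star> case_sum f (\<lambda>a. pscale (c a) (arrow D (s a))) i =
      case_sum f (\<lambda>a. pscale (c a) (arrow D (s a))) i"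
    "case_sum f (\<lambda>a. pscale (c a) (arrow D (s a))) i \<star> trivial_path (case_sum g' (\<lambda>a. tail D (s a)) i) =
      case_sum f (\<lambda>a. pscale (c a) (arrow D (s a))) i"
    "length (case_sum f'' (\<lambda>a. [s a]) i) = 1"
    by (simp_all add: a arrow_def trivial_path_def)
qed (simp_all add: dq.subspace_path_deg)

lemma sigma_basis:
  "path_basis D (relations Q) 2 (Inl ` verts Q :: ('v + ('e + 'e)) set) (case_sum (sigma Q) (f :: _ \<Rightarrow> ('v, 'e + 'e, 'f::field) pelem))
     (case_sum (\<lambda>i. i) g) (case_sum (\<lambda>i. i) g') (case_sum (\<lambda>i. eps (arrow_to i)) f')
     (case_sum (\<lambda>i. [arrow_to i, star (arrow_to i)]) f'')"
proof unfold_locales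
  fix w :: "('v, 'e + 'e, 'f) pelem" assume "w \<in> relations Q"
  let ?c = "\<lambda>w i. eps (arrow_to i) * Poly_Mapping.lookup w (i, [arrow_to i, star (arrow_to i)], i)"
  \<comment> \<open>The expansion formula is a linear condition on \<open>w\<close>, so it extends
    from the sigma_j to their span. On sigma_j the coordinate at \<open>j\<close> is a square of
    \<open>eps\<close>, hence 1.\<close>
  have "relations Q \<subseteq> {w :: ('v, 'e + 'e, 'f) pelem. w = (\<Sum>i\<in>verts Q. pscale (?c w i) (sigma Q i))}"
    unfolding relations_def
  proof (rule pelem.span_minimal)
    show "pelem.subspace {w :: ('v, 'e + 'e, 'f) pelem. w = (\<Sum>i\<in>verts Q. pscale (?c w i) (sigma Q i))}"
      unfolding pelem.subspace_def
    proof (intro conjI ballI allI; clarsimp)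
      fix x y :: "('v, 'e + 'e, 'f) pelem"
      assume "x = (\<Sum>i\<in>verts Q. pscale (?c x i) (sigma Q i))" "y = (\<Sum>i\<in>verts Q. pscale (?c y i) (sigma Q i))"
      then show "x + y = (\<Sum>i\<in>verts Q. pscale (eps (arrow_to i) * Poly_Mapping.lookup (x + y) (i, [arrow_to i, star (arrow_to i)], i)) (sigma Q i))"
        by (simp only: lookup_add distrib_left pelem.scale_left_distrib sum.distrib)
    next
      fix c and x :: "('v, 'e + 'e, 'f) pelem"
      assume "x = (\<Sum>i\<in>verts Q. pscale (?c x i) (sigma Q i))"
      then have "pscale c x = (\<Sum>i\<in>verts Q. pscale (c * ?c x i) (sigma Q i))"
        by (metis (no_types, lifting) pelem.scale_sum_right pelem.scale_scale sum.cong)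
      then show "pscale c x = (\<Sum>i\<in>verts Q. pscale (eps (arrow_to i) * (c * Poly_Mapping.lookup x (i, [arrow_to i, star (arrow_to i)], i))) (sigma Q i))"
        by (simp only: mult.left_commute)
    qed
    have "(\<Sum>i\<in>verts Q. pscale (?c (sigma Q j) i) (sigma Q i)) =
        (\<Sum>i\<in>verts Q. if i = j then sigma Q i else (0 :: ('v, 'e + 'e, 'f) pelem))" for j
      using arrow_to by (intro sum.cong) (auto simp: lookup_sigma)
    then show "sigma Q ` verts Q \<subseteq> {w :: ('v, 'e + 'e, 'f) pelem. w = (\<Sum>i\<in>verts Q. pscale (?c w i) (sigma Q i))}"
      by auto
  qed
  with \<open>w \<in> relations Q\<close> have "w = (\<Sum>i\<in>verts Q. pscale (?c w i) (sigma Q i))"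
    by blast
  then show "w = (\<Sum>i\<in>Inl ` verts Q. pscale (case_sum (\<lambda>i. eps (arrow_to i)) f' i * Poly_Mapping.lookup w
      (case_sum (\<lambda>i. i) g i, case_sum (\<lambda>i. [arrow_to i, star (arrow_to i)]) f'' i, case_sum (\<lambda>i. i) g' i))
            (case_sum (sigma Q) f i))"
    by (simp add: sum.reindex)
next
  show "relations Q \<subseteq> (path_deg D 2 :: ('v, 'e + 'e, 'f) pelem set)"
    unfolding relations_def by (rule pelem.span_minimal) (auto simp: sigma_deg dq.subspace_path_deg)
next
  fix i :: "'v + ('e + 'e)" assume "i \<in> Inl ` verts Q"
  then obtain v where v: "v \<in> verts Q" "i = Inl v" by auto
  show "(case_sum (\<lambda>i. i) g i, case_sum (\<lambda>i. [arrow_to i, star (arrow_to i)]) f'' i, case_sum (\<lambda>i. i) g' i) \<in> paths D"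
    using v path2[of "arrow_to v"] arrow_to[of v] by simp
  show "case_sum (sigma Q) f i \<in> relations Q"
    using v by (auto simp: relations_def intro: pelem.span_base)
  show "trivial_path (case_sum (\<lambda>i. i) g i) \<star> case_sum (sigma Q) f i = case_sum (sigma Q) f i"
    and "case_sum (sigma Q) f i \<star> trivial_path (case_sum (\<lambda>i. i) g' i) = case_sum (sigma Q) f i"
    using v by (simp_all add: sigma_head sigma_tail)
  show "length (case_sum (\<lambda>i. [arrow_to i, star (arrow_to i)]) f'' i) = 2"
    using v by simp
  fix j :: "'v + ('e + 'e)" assume "j \<in> Inl ` verts Q"
  then show "case_sum (\<lambda>i. eps (arrow_to i)) f' i * Poly_Mapping.lookup (case_sum (sigma Q) f j)
      (case_sum (\<lambda>i. i) g i, case_sum (\<lambda>i. [arrow_to i, star (arrow_to i)]) f'' i, case_sum (\<lambda>i. i) g' i) =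
      (if i = j then 1 else 0)"
    using v arrow_to[of v] by (elim imageE) (simp add: lookup_sigma)
qed (simp_all add: relations_def pelem.subspace_span)

end

lemma mult_cong_scale: "e * x = e' * y \<Longrightarrow> e * (c * x) = e' * (c * y)" for e :: "'f::field"
  by (metis mult.left_commute)

section \<open>The space W_2 and the vanishing of W_p for p at least 3\<close>

context connected_quiver
begin

text \<open>The intersection has the single member with \<open>i = j = 0\<close>, the span of the
  products k R k. This is R, since R is a sub-bimodule over k and k contains the unit.\<close>

lemma koszul_W_2: "koszul_W Q 2 = (relations Q :: ('v, 'e + 'e, 'f::field) pelem set)"
proof -
  interpret s: path_basis D "relations Q :: ('v, 'e + 'e, 'f) pelem set" 2
    "Inl ` verts Q :: ('v + ('e + 'e)) set" "case_sum (sigma Q) (\<lambda>_. 0)" "case_sum (\<lambda>i. i) undefined" "case_sum (\<lambda>i. i) undefined"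
    "case_sum (\<lambda>i. eps (arrow_to i)) (\<lambda>_. 0)" "case_sum (\<lambda>i. [arrow_to i, star (arrow_to i)]) (\<lambda>_. [])"
    by (rule sigma_basis)
  let ?X = "{u \<star> r \<star> v |u r v. u \<in> path_deg D 0 \<and> r \<in> relations Q \<and> v \<in> path_deg D 0}
    :: ('v, 'e + 'e, 'f) pelem set"
  have "{pelem.span {u \<star> r \<star> v |u r v. u \<in> path_deg D i \<and> r \<in> relations Q \<and> v \<in> path_deg D j} |i j.
      int i + 2 + int j = 2} = {pelem.span ?X}"
  proof -
    have "int i + 2 + int j = 2 \<longleftrightarrow> i = 0 \<and> j = 0" for i j
      by linarith
    then show ?thesis by simp
  qed
  then have "koszul_W Q 2 = pelem.span ?X"
    by (simp add: koszul_W_def)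
  also have "?X = relations Q"
  proof
    show "?X \<subseteq> relations Q"
      using s.W_lmult s.W_rmult by blast
    show "relations Q \<subseteq> ?X"
    proof
      fix r :: "('v, 'e + 'e, 'f) pelem" assume r: "r \<in> relations Q"
      then have "r = \<one>\<^bsub>tensor_algebra Q\<^esub> \<star> r \<star> \<one>\<^bsub>tensor_algebra Q\<^esub>"
        using s.W_deg by (auto simp: dq.path_mult_one dest!: dq.path_degD)
      then show "r \<in> ?X"
        using r dq.one_deg by blast
    qed
  qed
  also have "pelem.span (relations Q :: ('v, 'e + 'e, 'f) pelem set) = relations Q"
    using s.W_subspace by (simp add: pelem.span_eq_iff)
  finally show ?thesis .
qed

text \<open>Both properties are linear in \<open>r\<close>, so it suffices to look at a sigma_v.
  There the coefficient of a a* is \<open>eps a\<close> when \<open>a\<close> ends at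
  \<open>v\<close>, and multiplying by \<open>eps a\<close> gives 1 whichever arrow is
  taken.\<close>

lemma lookup_relations:
  fixes r :: "('v, 'e + 'e, 'f::field) pelem"
  assumes r: "r \<in> relations Q" and a: "a \<in> arcs D" and b: "b \<in> arcs D"
  shows "Poly_Mapping.lookup r (i, [a, b], j) \<noteq> 0 \<Longrightarrow> b = star a"
    and "head D a = i \<Longrightarrow> head D b = i \<Longrightarrow>
      eps a * Poly_Mapping.lookup r (i, [a, star a], j) = eps b * Poly_Mapping.lookup r (i, [b, star b], j)"
proof -
  let ?P = "\<lambda>r :: ('v, 'e + 'e, 'f) pelem. (b \<noteq> star a \<longrightarrow> Poly_Mapping.lookup r (i, [a, b], j) = 0) \<and>
    (head D a = i \<and> head D b = i \<longrightarrow>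
      eps a * Poly_Mapping.lookup r (i, [a, star a], j) = eps b * Poly_Mapping.lookup r (i, [b, star b], j))"
  have "relations Q \<subseteq> Collect ?P"
    unfolding relations_def
  proof (rule pelem.span_minimal)
    show "sigma Q ` verts Q \<subseteq> Collect ?P"
    proof clarify
      fix v assume "v \<in> verts Q"
      have "Poly_Mapping.lookup (sigma Q v :: ('v, 'e + 'e, 'f) pelem) (i, [a, b], j) = 0" if "b \<noteq> star a"
        using that by (metis in_keys_iff keys_sigma list.inject prod.inject)
      then show "?P (sigma Q v)"
        by (simp add: lookup_sigma[OF a] lookup_sigma[OF b])
    qed
    show "pelem.subspace (Collect ?P)"
      unfolding pelem.subspace_def by (auto simp: lookup_add distrib_left intro!: mult_cong_scale)
  qed
  with r show "Poly_Mapping.lookup r (i, [a, b], j) \<noteq> 0 \<Longrightarrow> b = star a"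
    and "head D a = i \<Longrightarrow> head D b = i \<Longrightarrow>
      eps a * Poly_Mapping.lookup r (i, [a, star a], j) = eps b * Poly_Mapping.lookup r (i, [b, star b], j)"
    by blast+
qed

text \<open>
  A word \<open>a b c \<dots>\<close> occurring in an element of \<open>W\<^sub>p\<close>, \<open>p \<ge> 3\<close>, has \<open>b = a\<^sup>*\<close> and \<open>c = b\<^sup>*\<close>. Exchanging
  \<open>a a\<^sup>*\<close>, respectively \<open>b b\<^sup>*\<close>, for another summand of the same \<open>\<sigma>\<^sub>i\<close> gives a word that occurs as well,
  whence \<open>a\<close> is the only arrow into its target and \<open>a\<^sup>*\<close> the only one into its source.
\<close>

lemma koszul_W_ge_3:
  assumes p: "p \<ge> 3"
  shows "koszul_W Q p = {0 :: ('v, 'e + 'e, 'f::field) pelem}"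
proof -
  interpret s: path_basis D "relations Q :: ('v, 'e + 'e, 'f) pelem set" 2
    "Inl ` verts Q :: ('v + ('e + 'e)) set" "case_sum (sigma Q) (\<lambda>_. 0)" "case_sum (\<lambda>i. i) undefined" "case_sum (\<lambda>i. i) undefined"
    "case_sum (\<lambda>i. eps (arrow_to i)) (\<lambda>_. 0)" "case_sum (\<lambda>i. [arrow_to i, star (arrow_to i)]) (\<lambda>_. [])"
    by (rule sigma_basis)
  define S where "S i j = pelem.span {u \<star> r \<star> v |u r v.
    u \<in> path_deg D i \<and> r \<in> relations Q \<and> (v :: ('v, 'e + 'e, 'f) pelem) \<in> path_deg D j}" for i j
  define m where "m = nat (p - 3)"
  have W: "koszul_W Q p = \<Inter> {S i j |i j. int i + 2 + int j = p}"
    using p by (simp add: koszul_W_def S_def)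
  \<comment> \<open>Of all the members of the intersection, two are enough: R V...V and V R V...V,
    with the relation at letters 1, 2 and at letters 2, 3.\<close>
  have "int 0 + 2 + int (m + 1) = p" "int 1 + 2 + int m = p"
    using p by (simp_all add: m_def)
  then have "S 0 (m + 1) \<in> {S i j |i j. int i + 2 + int j = p}" "S 1 m \<in> {S i j |i j. int i + 2 + int j = p}"
    by blast+
  then have WS: "koszul_W Q p \<subseteq> S 0 (m + 1) \<inter> S 1 m"
    unfolding W by blast
  \<comment> \<open>\<open>R\<close> transfers the conditions of \<open>lookup_relations\<close> to
    the first two letters of a longer word, and \<open>R'\<close> below to the second and third.
    Both define subspaces, so they pass from products to spans.\<close>
  define R where "R a b i xs l x \<longleftrightarrow> (b \<noteq> star a \<longrightarrow> Poly_Mapping.lookup x (i, a # b # xs, l) = 0) \<and>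
      (head D a = i \<and> head D b = i \<longrightarrow>
        eps a * Poly_Mapping.lookup x (i, a # star a # xs, l) = eps b * Poly_Mapping.lookup x (i, b # star b # xs, l))"
    for a b i xs l and x :: "('v, 'e + 'e, 'f) pelem"
  have R_sub: "pelem.subspace (Collect (R a b i xs l))" for a b i xs l
    unfolding pelem.subspace_def R_def mem_Collect_eq
    by (auto simp: lookup_add distrib_left intro!: mult_cong_scale)
  have RV: "R a b i xs l (r \<star> v)"
    if r: "r \<in> relations Q" and ab: "a \<in> arcs D" "b \<in> arcs D" for a b i xs l r v
  proof -
    have r2: "r \<in> path_deg D 2" using r s.W_deg by blast
    have lk: "Poly_Mapping.lookup (r \<star> v) (i, x # y # xs, l) = Poly_Mapping.lookup r (i, [x, y], tail D y) * Poly_Mapping.lookup v (tail D y, xs, l)"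
      if "(i, [x, y], tail D y) \<in> paths D" for x y
      using dq.lookup_path_mult[OF r2 _ that, of v xs l] by simp
    have 1: "Poly_Mapping.lookup (r \<star> v) (i, a # b # xs, l) = 0" if "b \<noteq> star a"
    proof (rule ccontr)
      assume "Poly_Mapping.lookup (r \<star> v) (i, a # b # xs, l) \<noteq> 0"
      then have "(i, a # b # xs, l) \<in> Poly_Mapping.keys (r \<star> v)" by (simp add: in_keys_iff)
      then obtain xs1 j ys where k: "a # b # xs = xs1 @ ys" "(i, xs1, j) \<in> Poly_Mapping.keys r"
        using keys_path_mult[of r v] by blast
      then have "(i, xs1, j) \<in> paths D" "length xs1 = 2"
        using r2 by (auto simp: path_deg_def)
      with k have "xs1 = [a, b]"
        by (auto simp: length_Suc_conv numeral_2_eq_2)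
      with k(2) lookup_relations(1)[OF r ab] that show False
        by (auto simp: in_keys_iff)
    qed
    have 2: "eps a * Poly_Mapping.lookup (r \<star> v) (i, a # star a # xs, l) =
        eps b * Poly_Mapping.lookup (r \<star> v) (i, b # star b # xs, l)" if h: "head D a = i \<and> head D b = i"
    proof -
      have "(i, [a, star a], tail D (star a)) \<in> paths D" "(i, [b, star b], tail D (star b)) \<in> paths D"
        using path2[OF ab(1)] path2[OF ab(2)] h by auto
      from this[THEN lk] lookup_relations(2)[OF r ab, of i i] h
      show ?thesis
        by (simp flip: mult.assoc)
    qed
    from 1 2 show ?thesis by (simp add: R_def)
  qed
  have S0: "R a b i xs l x" if "x \<in> S 0 (m + 1)" "a \<in> arcs D" "b \<in> arcs D" for a b i xs l x
  proof -
    have "S 0 (m + 1) \<subseteq> Collect (R a b i xs l)"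
      unfolding S_def using RV[OF s.W_lmult that(2,3)] by (intro pelem.span_minimal R_sub) blast
    with that show ?thesis by blast
  qed
  define R' where "R' c a b i xs l x \<longleftrightarrow> (b \<noteq> star a \<longrightarrow> Poly_Mapping.lookup x (i, c # a # b # xs, l) = 0) \<and>
      (head D c = i \<and> head D a = tail D c \<and> head D b = tail D c \<longrightarrow>
        eps a * Poly_Mapping.lookup x (i, c # a # star a # xs, l) = eps b * Poly_Mapping.lookup x (i, c # b # star b # xs, l))"
    for c a b i xs l and x :: "('v, 'e + 'e, 'f) pelem"
  have R'_sub: "pelem.subspace (Collect (R' c a b i xs l))" for c a b i xs l
    unfolding pelem.subspace_def R'_def mem_Collect_eq
    by (auto simp: lookup_add distrib_left intro!: mult_cong_scale)
  have VRV: "R' c a b i xs l (u \<star> x)"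
    if u: "u \<in> path_deg D 1" and c: "c \<in> arcs D" and x: "R a b (tail D c) xs l x" for a b c i xs l u x
  proof (cases "head D c = i")
    case True
    then have "(i, [c], tail D c) \<in> paths D"
      using c dq.tail_in_verts[OF c] by (simp add: dq.paths_Cons)
    from dq.lookup_path_mult[OF u _ this, of x]
    have "Poly_Mapping.lookup (u \<star> x) (i, c # ys, l) = Poly_Mapping.lookup u (i, [c], tail D c) * Poly_Mapping.lookup x (tail D c, ys, l)" for ys
      by simp
    with x show ?thesis
      by (auto simp: R_def R'_def intro: mult_cong_scale)
  next
    case False
    have "Poly_Mapping.lookup (u \<star> x) (i, c # ys, l) = 0" for ys
    proof (rule ccontr)
      assume "Poly_Mapping.lookup (u \<star> x) (i, c # ys, l) \<noteq> 0"
      then have "(i, c # ys, l) \<in> Poly_Mapping.keys (u \<star> x)" by (simp add: in_keys_iff)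
      then obtain xs1 j zs where k: "c # ys = xs1 @ zs" "(i, xs1, j) \<in> Poly_Mapping.keys u"
        using keys_path_mult[of u x] by blast
      then have "(i, xs1, j) \<in> paths D" "length xs1 = 1"
        using u by (auto simp: path_deg_def)
      with k False show False
        by (auto simp: length_Suc_conv dq.paths_Cons)
    qed
    with False show ?thesis by (simp add: R'_def)
  qed
  have S1: "R' c a b i xs l x" if "x \<in> S 1 m" "a \<in> arcs D" "b \<in> arcs D" "c \<in> arcs D" for a b c i xs l x
  proof -
    have "S 1 m \<subseteq> Collect (R' c a b i xs l)"
      unfolding S_def using VRV[OF _ that(4) RV[OF _ that(2,3)]]
      by (intro pelem.span_minimal R'_sub) (auto simp: path_mult_assoc)
    with that show ?thesis by blast
  qed
  have S1_deg: "S 1 m \<subseteq> path_deg D (m + 3)"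
    unfolding S_def
  proof (rule pelem.span_minimal)
    show "{u \<star> r \<star> v |u r v. u \<in> path_deg D 1 \<and> r \<in> relations Q \<and> v \<in> path_deg D m} \<subseteq>
      (path_deg D (m + 3) :: ('v, 'e + 'e, 'f) pelem set)"
    proof clarify
      fix u r v :: "('v, 'e + 'e, 'f) pelem"
      assume "u \<in> path_deg D 1" "r \<in> relations Q" "v \<in> path_deg D m"
      then have "u \<star> r \<star> v \<in> path_deg D (1 + 2 + m)"
        using s.W_deg by (intro dq.path_deg_mult) auto
      then show "u \<star> r \<star> v \<in> path_deg D (m + 3)"
        by (simp add: numeral_3_eq_3)
    qed
  qed (rule dq.subspace_path_deg)
  have "w = 0" if "w \<in> koszul_W Q p" for w :: "('v, 'e + 'e, 'f) pelem"
  proof (rule ccontr)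
    assume "w \<noteq> 0"
    have w: "w \<in> S 0 (m + 1)" "w \<in> S 1 m" and deg: "w \<in> path_deg D (m + 3)"
      using that WS S1_deg by auto
    obtain i xs l where k: "(i, xs, l) \<in> Poly_Mapping.keys w"
      using \<open>w \<noteq> 0\<close> by (metis all_not_in_conv keys_eq_empty prod_cases3)
    then have path: "(i, xs, l) \<in> paths D" "length xs = m + 3"
      using deg by (auto simp: path_deg_def)
    then obtain a b c ys where xs: "xs = a # b # c # ys"
      by (auto simp: length_Suc_conv numeral_3_eq_3)
    have abc: "a \<in> arcs D" "b \<in> arcs D" "c \<in> arcs D" "head D a = i"
      using path(1) by (auto simp: xs dq.paths_Cons)
    have nz: "Poly_Mapping.lookup w (i, a # b # c # ys, l) \<noteq> 0"
      using k by (simp add: xs in_keys_iff)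
    with S0[OF w(1) abc(1,2)] have b: "b = star a" by (auto simp: R_def)
    from nz S1[OF w(2) abc(2,3,1)] have c: "c = star b" by (auto simp: R'_def)
    show False
    proof (rule not_isolated_edge[OF abc(1)])
      fix x assume x: "x \<in> arcs D" "head D x = head D a"
      with S0[OF w(1) abc(1) x(1), of i "c # ys" l] abc nz b
      have "Poly_Mapping.lookup w (i, x # star x # c # ys, l) \<noteq> 0"
        by (auto simp: R_def)
      with S1[OF w(2) _ abc(3) x(1), of "star x" i ys l] x(1) have "c = star (star x)"
        by (auto simp: R'_def)
      with b c show "x = a" by simp
    next
      fix x assume x: "x \<in> arcs D" "head D x = tail D a"
      with S1[OF w(2) abc(2) x(1) abc(1), of i ys l] abc nz b c
      have "Poly_Mapping.lookup w (i, a # x # star x # ys, l) \<noteq> 0"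
        by (auto simp: R'_def)
      with S0[OF w(1) abc(1) x(1), of i "star x # ys" l] show "x = star a"
        by (auto simp: R_def)
    qed
  qed
  moreover have "(0 :: ('v, 'e + 'e, 'f) pelem) \<in> koszul_W Q p"
    unfolding W S_def by (auto intro: pelem.span_zero)
  ultimately show ?thesis by blast
qed

lemma koszul_W_simps:
  "koszul_W Q 0 = path_deg D 0" "koszul_W Q 1 = path_deg D 1" "p < 0 \<Longrightarrow> koszul_W Q p = {0}"
  by (simp_all add: koszul_W_def)

lemma empty_basis: "path_basis D {0 :: ('v, 'e + 'e, 'f::field) pelem} n {} b h t \<kappa> \<pi>"
  by unfold_locales auto

text \<open>Valid for every integer \<open>p\<close>: outside 0, 1, 2 both the space and the index
  set are trivial. This spares later arguments the distinction of degrees.\<close>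

lemma bas_basis:
  "path_basis D (koszul_W Q p) (nat p) (idx p) (bas p :: _ \<Rightarrow> ('v, 'e + 'e, 'f::field) pelem) hh tt
     (case_sum (\<lambda>i. if p = 2 then eps (arrow_to i) else 1) (\<lambda>_. 1))
     (case_sum (\<lambda>i. if p = 2 then [arrow_to i, star (arrow_to i)] else []) (\<lambda>a. [a]))"
proof -
  consider "p = 0" | "p = 1" | "p = 2" | "p < 0" | "p \<ge> 3" by linarith
  then show ?thesis
  proof cases
    case 1
    show ?thesis
      using trivial_path_basis[of "arrow D" "head D" "tail D" "\<lambda>_. 1" "\<lambda>a. [a]"]
      by (simp add: 1 idx_def bas_def hh_def tt_def koszul_W_simps)
  next
    case 2
    show ?thesis
      using arrow_basis[of "\<lambda>a. a" "\<lambda>_. 1" "sigma Q" "\<lambda>i. i" "\<lambda>i. i" "\<lambda>_. 1" "\<lambda>_. []", OF bij_betw_id[unfolded id_def]]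
      by (simp add: 2 idx_def bas_def hh_def tt_def koszul_W_simps)
  next
    case 3
    show ?thesis
      using sigma_basis[of "arrow D" "head D" "tail D" "\<lambda>_. 1" "\<lambda>a. [a]"]
      by (simp add: 3 idx_def bas_def hh_def tt_def koszul_W_2)
  qed (auto simp: idx_def koszul_W_simps koszul_W_ge_3 empty_basis)
qed

text \<open>The point is that W_{2-p} is indexed by the same set as W_p. An element of the chain
  group is then determined by one element of M per index, just as a cochain is by its values on
  \<open>bas p\<close>.\<close>

lemma dua_basis:
  "path_basis D (koszul_W Q (2 - p)) (nat (2 - p)) (idx p) (dua p :: _ \<Rightarrow> ('v, 'e + 'e, 'f::field) pelem) tt hh
     (case_sum (\<lambda>i. if p = 0 then eps (arrow_to i) else 1) eps)
     (case_sum (\<lambda>i. if p = 0 then [arrow_to i, star (arrow_to i)] else []) (\<lambda>a. [star a]))"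
proof -
  consider "p = 0" | "p = 1" | "p = 2" | "p < 0" | "p \<ge> 3" by linarith
  then show ?thesis
  proof cases
    case 1
    show ?thesis
      using sigma_basis[of "\<lambda>a. pscale (eps a) (arrow D (star a))" "tail D" "head D" eps "\<lambda>a. [star a]"]
      by (simp add: 1 idx_def dua_def hh_def tt_def koszul_W_2)
  next
    case 2
    show ?thesis
      using arrow_basis[of star eps "trivial_path" "\<lambda>i. i" "\<lambda>i. i" "\<lambda>_. 1" "\<lambda>_. []", OF bij_star]
      by (simp add: 2 idx_def dua_def hh_def tt_def koszul_W_simps)
  next
    case 3
    show ?thesis
      using trivial_path_basis[of "\<lambda>a. pscale (eps a) (arrow D (star a))" "tail D" "head D" eps "\<lambda>a. [star a]"]
      by (simp add: 3 idx_def dua_def hh_def tt_def koszul_W_simps)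
  qed (auto simp: idx_def koszul_W_simps koszul_W_ge_3 empty_basis)
qed

end

section \<open>Quotients of free abelian groups\<close>

text \<open>
  Congruence of \<open>a\<close> and \<open>b\<close> modulo \<open>K\<close> is expressed as \<^term>\<open>frag_coset K a = frag_coset K b\<close>.
\<close>

definition add_subgroup :: "('b \<Rightarrow>\<^sub>0 int) set \<Rightarrow> bool" where
  "add_subgroup K \<longleftrightarrow> 0 \<in> K \<and> (\<forall>a\<in>K. \<forall>b\<in>K. a - b \<in> K)"

lemma frag_coset_eq: "frag_coset K r = (\<lambda>k. k + r) ` K"
  by (auto simp: frag_coset_def r_coset_def)

lemma add_subgroupD:
  assumes "add_subgroup K"
  shows "0 \<in> K" "a \<in> K \<Longrightarrow> b \<in> K \<Longrightarrow> a - b \<in> K" "a \<in> K \<Longrightarrow> - a \<in> K" "a \<in> K \<Longrightarrow> b \<in> K \<Longrightarrow> a + b \<in> K"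
proof -
  show 0: "0 \<in> K" and d: "\<And>a b. a \<in> K \<Longrightarrow> b \<in> K \<Longrightarrow> a - b \<in> K"
    using assms by (auto simp: add_subgroup_def)
  show m: "- a \<in> K" if "a \<in> K" for a
    using d[OF 0 that] by simp
  show "a + b \<in> K" if "a \<in> K" "b \<in> K"
    using d[OF that(1) m[OF that(2)]] by simp
qed

lemma frag_coset_eq_iff:
  assumes "add_subgroup K"
  shows "frag_coset K a = frag_coset K b \<longleftrightarrow> a - b \<in> K"
proof
  assume "frag_coset K a = frag_coset K b"
  moreover have "a \<in> frag_coset K a"
    using add_subgroupD(1)[OF assms] by (force simp: frag_coset_eq)
  ultimately show "a - b \<in> K"
    by (auto simp: frag_coset_eq)
next
  assume d: "a - b \<in> K"
  show "frag_coset K a = frag_coset K b"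
  proof (intro equalityI subsetI)
    fix x assume "x \<in> frag_coset K a"
    then obtain k where "k \<in> K" "x = k + a" by (auto simp: frag_coset_eq)
    then show "x \<in> frag_coset K b"
      using add_subgroupD(4)[OF assms, of k "a - b"] d by (auto simp: frag_coset_eq intro!: image_eqI[of _ _ "k + (a - b)"])
  next
    fix x assume "x \<in> frag_coset K b"
    then obtain k where "k \<in> K" "x = k + b" by (auto simp: frag_coset_eq)
    then show "x \<in> frag_coset K a"
      using add_subgroupD(2)[OF assms, of k "a - b"] d by (auto simp: frag_coset_eq intro!: image_eqI[of _ _ "k - (a - b)"])
  qed
qed

lemma frag_coset_0: "K = frag_coset K 0"
  by (simp add: frag_coset_eq)

lemma frag_cmul_diff_right: "frag_cmul n (a - b) = frag_cmul n a - frag_cmul n b"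
  by (rule poly_mapping_eqI) (simp add: lookup_minus right_diff_distrib)

context
  fixes K :: "('b \<Rightarrow>\<^sub>0 int) set"
  assumes K: "add_subgroup K"
begin

lemma frag_coset_add:
  "frag_coset K a = frag_coset K a' \<Longrightarrow> frag_coset K b = frag_coset K b' \<Longrightarrow>
   frag_coset K (a + b) = frag_coset K (a' + b')"
  unfolding frag_coset_eq_iff[OF K] using add_subgroupD(4)[OF K, of "a - a'" "b - b'"]
  by (simp add: algebra_simps)

lemma frag_coset_diff:
  "frag_coset K a = frag_coset K a' \<Longrightarrow> frag_coset K b = frag_coset K b' \<Longrightarrow>
   frag_coset K (a - b) = frag_coset K (a' - b')"
  unfolding frag_coset_eq_iff[OF K] using add_subgroupD(2)[OF K, of "a - a'" "b - b'"]
  by (simp add: algebra_simps)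

lemma frag_coset_cmul:
  assumes "frag_coset K a = frag_coset K a'"
  shows "frag_coset K (frag_cmul n a) = frag_coset K (frag_cmul n a')"
proof -
  have d: "a - a' \<in> K" using assms by (simp add: frag_coset_eq_iff[OF K])
  have "frag_cmul n (a - a') \<in> K"
  proof (induction n)
    case (nonneg m)
    then show ?case
      by (induction m) (auto simp: frag_cmul_distrib add_subgroupD[OF K] d)
  next
    case (neg m)
    have "frag_cmul (int k) (a - a') \<in> K" for k
      by (induction k) (auto simp: frag_cmul_distrib add_subgroupD[OF K] d)
    from add_subgroupD(3)[OF K this[of "Suc m"]] show ?case
      by simp
  qed
  then show ?thesis
    by (simp only: frag_coset_eq_iff[OF K] frag_cmul_diff_right)
qed

lemma frag_coset_sum:
  "(\<And>i. i \<in> I \<Longrightarrow> frag_coset K (f i) = frag_coset K (g i)) \<Longrightarrow>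
   frag_coset K (\<Sum>i\<in>I. f i) = frag_coset K (\<Sum>i\<in>I. g i)"
  by (induction I rule: infinite_finite_induct) (auto intro!: frag_coset_add)

lemma frag_coset_sum_list:
  "(\<And>x. x \<in> set xs \<Longrightarrow> frag_coset K (f x) = frag_coset K (g x)) \<Longrightarrow>
   frag_coset K (\<Sum>x\<leftarrow>xs. f x) = frag_coset K (\<Sum>x\<leftarrow>xs. g x)"
  by (induction xs) (auto intro!: frag_coset_add)

lemma frag_coset_extend:
  "(\<And>y. y \<in> Poly_Mapping.keys r \<Longrightarrow> frag_coset K (f y) = frag_coset K (g y)) \<Longrightarrow>
   frag_coset K (frag_extend f r) = frag_coset K (frag_extend g r)"
  unfolding frag_extend_def by (intro frag_coset_sum frag_coset_cmul)

end

lemma frag_extend_fun_add: "frag_extend (\<lambda>y. f y + g y) r = frag_extend f r + frag_extend g r"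
  by (simp add: frag_extend_def frag_cmul_distrib2 sum.distrib)

lemma frag_extend_sum_list: "frag_extend f (\<Sum>x\<leftarrow>xs. g x) = (\<Sum>x\<leftarrow>xs. frag_extend f (g x))"
  by (induction xs) (simp_all add: frag_extend_add)

lemma frag_extend_frag_extend: "frag_extend f (frag_extend g r) = frag_extend (\<lambda>y. frag_extend f (g y)) r"
  unfolding frag_extend_def[of g] frag_extend_def[of "\<lambda>y. frag_extend f (g y)"]
  by (simp add: frag_extend_sum frag_extend_cmul comp_def)

lemma carrier_frag_quotient:
  "carrier (free_Abelian_group Y Mod K) = {frag_coset K r |r. Poly_Mapping.keys r \<subseteq> Y}"
proof -
  have "K #>\<^bsub>free_Abelian_group Y\<^esub> r = frag_coset K r" for r
    by (simp add: frag_coset_def r_coset_def)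
  then show ?thesis
    by (auto simp: FactGroup_def RCOSETS_def)
qed

lemma frag_quotient_ops:
  assumes "add_subgroup K"
  shows "frag_coset K r \<otimes>\<^bsub>free_Abelian_group Y Mod K\<^esub> frag_coset K s = frag_coset K (r + s)"
    and "\<one>\<^bsub>free_Abelian_group Y Mod K\<^esub> = frag_coset K 0"
proof -
  have "frag_coset K r <#>\<^bsub>free_Abelian_group Y\<^esub> frag_coset K s = frag_coset K (r + s)"
  proof (intro equalityI subsetI)
    fix x assume "x \<in> frag_coset K r <#>\<^bsub>free_Abelian_group Y\<^esub> frag_coset K s"
    then obtain k l where "k \<in> K" "l \<in> K" "x = (k + r) + (l + s)"
      by (auto simp: set_mult_def frag_coset_eq)
    then show "x \<in> frag_coset K (r + s)"
      using add_subgroupD(4)[OF assms, of k l]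
      by (auto simp: frag_coset_eq algebra_simps intro!: image_eqI[of _ _ "k + l"])
  next
    fix x assume "x \<in> frag_coset K (r + s)"
    then obtain k where "k \<in> K" "x = (k + r) + (0 + s)"
      by (auto simp: frag_coset_eq algebra_simps)
    then show "x \<in> frag_coset K r <#>\<^bsub>free_Abelian_group Y\<^esub> frag_coset K s"
      using add_subgroupD(1)[OF assms] by (force simp: set_mult_def frag_coset_eq)
  qed
  then show "frag_coset K r \<otimes>\<^bsub>free_Abelian_group Y Mod K\<^esub> frag_coset K s = frag_coset K (r + s)"
    by (simp add: FactGroup_def)
  show "\<one>\<^bsub>free_Abelian_group Y Mod K\<^esub> = frag_coset K 0"
    by (simp add: FactGroup_def flip: frag_coset_0)
qed

text \<open>Stated for any record with these components, because both \<open>koszul_chains\<close>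
  and \<open>bimodule_tensor\<close> repackage a quotient group as a module record.\<close>

lemma abelian_group_frag_quotient:
  fixes R :: "(('b \<Rightarrow>\<^sub>0 int) set, 'z) ring_scheme"
  assumes K: "add_subgroup K"
    and c: "carrier R = {frag_coset K r |r. Poly_Mapping.keys r \<subseteq> Y}"
    and z: "\<zero>\<^bsub>R\<^esub> = frag_coset K 0"
    and a: "\<And>r s. frag_coset K r \<oplus>\<^bsub>R\<^esub> frag_coset K s = frag_coset K (r + s)"
  shows "abelian_group R"
proof (rule abelian_groupI)
  show "\<zero>\<^bsub>R\<^esub> \<in> carrier R"
    unfolding c z by (auto intro!: exI[of _ 0])
  fix x y assume "x \<in> carrier R" "y \<in> carrier R"
  then obtain r s where rs: "x = frag_coset K r" "Poly_Mapping.keys r \<subseteq> Y" "y = frag_coset K s" "Poly_Mapping.keys s \<subseteq> Y"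
    unfolding c by auto
  show "x \<oplus>\<^bsub>R\<^esub> y \<in> carrier R"
    using rs keys_add[of r s] unfolding c by (auto simp: a intro!: exI[of _ "r + s"])
  show "x \<oplus>\<^bsub>R\<^esub> y = y \<oplus>\<^bsub>R\<^esub> x"
    by (simp add: rs a add.commute)
  show "\<exists>y\<in>carrier R. y \<oplus>\<^bsub>R\<^esub> x = \<zero>\<^bsub>R\<^esub>"
    using rs unfolding c z by (auto simp: a intro!: exI[of _ "frag_coset K (- r)"] exI[of _ "- r"])
  show "\<zero>\<^bsub>R\<^esub> \<oplus>\<^bsub>R\<^esub> x = x"
    by (simp add: rs a z)
  fix w assume "w \<in> carrier R"
  then obtain t where "w = frag_coset K t" unfolding c by auto
  then show "x \<oplus>\<^bsub>R\<^esub> y \<oplus>\<^bsub>R\<^esub> w = x \<oplus>\<^bsub>R\<^esub> (y \<oplus>\<^bsub>R\<^esub> w)"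
    by (simp add: rs a add.assoc)
qed

section \<open>Tensor relations\<close>

definition tensor_closed ::
  "('m, 'x) ring_scheme \<Rightarrow> ('n, 'y) ring_scheme \<Rightarrow> 's set \<Rightarrow> ('m \<Rightarrow> 's \<Rightarrow> 'm) \<Rightarrow> ('s \<Rightarrow> 'n \<Rightarrow> 'n) \<Rightarrow> bool" where
  "tensor_closed M N S ract lact \<longleftrightarrow>
     (\<forall>m\<in>carrier M. \<forall>m'\<in>carrier M. m \<oplus>\<^bsub>M\<^esub> m' \<in> carrier M) \<and>
     (\<forall>n\<in>carrier N. \<forall>n'\<in>carrier N. n \<oplus>\<^bsub>N\<^esub> n' \<in> carrier N) \<and>
     (\<forall>m\<in>carrier M. \<forall>s\<in>S. ract m s \<in> carrier M) \<and>
     (\<forall>n\<in>carrier N. \<forall>s\<in>S. lact s n \<in> carrier N)"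

text \<open>\<open>h\<close> is biadditive and balanced modulo \<open>K\<close>. Values are formal
  sums and not cosets, since this is the form in which \<open>induced\<close> receives the
  maps.\<close>

definition respects_tensor ::
  "('c \<Rightarrow>\<^sub>0 int) set \<Rightarrow> ('m, 'x) ring_scheme \<Rightarrow> ('n, 'y) ring_scheme \<Rightarrow> 's set \<Rightarrow>
   ('m \<Rightarrow> 's \<Rightarrow> 'm) \<Rightarrow> ('s \<Rightarrow> 'n \<Rightarrow> 'n) \<Rightarrow> ('m \<times> 'n \<Rightarrow> 'c \<Rightarrow>\<^sub>0 int) \<Rightarrow> bool" where
  "respects_tensor K M N S ract lact h \<longleftrightarrow>
     (\<forall>m\<in>carrier M. \<forall>m'\<in>carrier M. \<forall>n\<in>carrier N.
        frag_coset K (h (m \<oplus>\<^bsub>M\<^esub> m', n)) = frag_coset K (h (m, n) + h (m', n))) \<and>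
     (\<forall>m\<in>carrier M. \<forall>n\<in>carrier N. \<forall>n'\<in>carrier N.
        frag_coset K (h (m, n \<oplus>\<^bsub>N\<^esub> n')) = frag_coset K (h (m, n) + h (m, n'))) \<and>
     (\<forall>m\<in>carrier M. \<forall>s\<in>S. \<forall>n\<in>carrier N.
        frag_coset K (h (ract m s, n)) = frag_coset K (h (m, lact s n)))"

lemma relators_keys:
  assumes "tensor_closed M N S ract lact" "x \<in> balancing_relators M N S ract lact"
  shows "Poly_Mapping.keys x \<subseteq> carrier M \<times> carrier N"
  using assms unfolding balancing_relators_def tensor_closed_def
  by (auto dest!: subsetD[OF keys_diff] simp: keys_frag_of split: if_splits)

lemma add_subgroup_tensor_null:
  assumes "tensor_closed M N S ract lact"
  shows "add_subgroup (tensor_null M N S ract lact)"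
proof -
  let ?F = "free_Abelian_group (carrier M \<times> carrier N)" and ?R = "balancing_relators M N S ract lact"
  interpret F: group ?F by simp
  have sub: "?R \<subseteq> carrier ?F"
    using relators_keys[OF assms] by auto
  interpret S: subgroup "generate ?F ?R" ?F
    using sub by (rule F.generate_is_subgroup)
  show ?thesis
    unfolding add_subgroup_def tensor_null_def
  proof (intro conjI ballI)
    show "0 \<in> generate ?F ?R"
      using S.one_closed by simp
    fix a b assume ab: "a \<in> generate ?F ?R" "b \<in> generate ?F ?R"
    then have "Poly_Mapping.keys b \<subseteq> carrier M \<times> carrier N"
      using S.mem_carrier by auto
    then show "a - b \<in> generate ?F ?R"
      using S.m_closed[OF ab(1) S.m_inv_closed[OF ab(2)]] by simp
  qed
qed

lemma respects_tensor_refl: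
  assumes "tensor_closed M N S ract lact"
  shows "respects_tensor (tensor_null M N S ract lact) M N S ract lact frag_of"
  unfolding respects_tensor_def frag_coset_eq_iff[OF add_subgroup_tensor_null[OF assms]] diff_diff_eq[symmetric]
  by (intro conjI ballI; unfold tensor_null_def; rule generate.incl) (auto simp: balancing_relators_def)

lemma respects_tensor_null:
  assumes ok: "tensor_closed M N S ract lact" and K: "add_subgroup K"
    and h: "respects_tensor K M N S ract lact h"
    and r: "r \<in> tensor_null M N S ract lact"
  shows "frag_extend h r \<in> K"
proof -
  have rel: "frag_extend h x \<in> K" if "x \<in> balancing_relators M N S ract lact" for x
    using that h unfolding balancing_relators_def respects_tensor_def frag_coset_eq_iff[OF K]
    by (auto simp: frag_extend_diff frag_extend_add diff_diff_eq)
  show ?thesis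
    using r unfolding tensor_null_def
  proof (induction rule: generate.induct)
    case (inv x)
    then show ?case
      using rel relators_keys[OF ok] by (simp add: frag_extend_minus add_subgroupD[OF K])
  qed (auto simp: add_subgroupD[OF K] rel frag_extend_add)
qed

text \<open>The universal property of the tensor product: the extension of \<open>h\<close> sends
  the relations into \<open>K\<close>, so the cosets united in \<open>induced\<close> all
  coincide.\<close>

lemma induced_coset:
  assumes ok: "tensor_closed M N S ract lact" and K: "add_subgroup K"
    and h: "respects_tensor K M N S ract lact h"
  shows "induced K h (frag_coset (tensor_null M N S ract lact) r) = frag_coset K (frag_extend h r)"
proof -
  let ?N = "tensor_null M N S ract lact"
  have "frag_coset K (frag_extend h (k + r)) = frag_coset K (frag_extend h r)" if "k \<in> ?N" for k
    using respects_tensor_null[OF ok K h that] by (simp add: frag_coset_eq_iff[OF K] frag_extend_add)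
  moreover have "0 \<in> ?N"
    by (rule add_subgroupD[OF add_subgroup_tensor_null[OF ok]])
  ultimately show ?thesis
    unfolding induced_def frag_coset_eq[of ?N] by auto
qed

lemma respects_tensor_add:
  assumes K: "add_subgroup K" "respects_tensor K M N S ract lact f" "respects_tensor K M N S ract lact g"
  shows "respects_tensor K M N S ract lact (\<lambda>x. f x + g x)"
  unfolding respects_tensor_def
proof (intro conjI ballI)
  fix m m' n assume "m \<in> carrier M" "m' \<in> carrier M" "n \<in> carrier N"
  then have "frag_coset K (f (m \<oplus>\<^bsub>M\<^esub> m', n) + g (m \<oplus>\<^bsub>M\<^esub> m', n)) =
      frag_coset K ((f (m, n) + f (m', n)) + (g (m, n) + g (m', n)))"
    using assms by (intro frag_coset_add) (auto simp: respects_tensor_def)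
  then show "frag_coset K (f (m \<oplus>\<^bsub>M\<^esub> m', n) + g (m \<oplus>\<^bsub>M\<^esub> m', n)) =
      frag_coset K (f (m, n) + g (m, n) + (f (m', n) + g (m', n)))"
    by (simp only: add.assoc add.left_commute)
next
  fix m n n' assume "m \<in> carrier M" "n \<in> carrier N" "n' \<in> carrier N"
  then have "frag_coset K (f (m, n \<oplus>\<^bsub>N\<^esub> n') + g (m, n \<oplus>\<^bsub>N\<^esub> n')) =
      frag_coset K ((f (m, n) + f (m, n')) + (g (m, n) + g (m, n')))"
    using assms by (intro frag_coset_add) (auto simp: respects_tensor_def)
  then show "frag_coset K (f (m, n \<oplus>\<^bsub>N\<^esub> n') + g (m, n \<oplus>\<^bsub>N\<^esub> n')) =
      frag_coset K (f (m, n) + g (m, n) + (f (m, n') + g (m, n')))"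
    by (simp only: add.assoc add.left_commute)
next
  fix m s n assume "m \<in> carrier M" "s \<in> S" "n \<in> carrier N"
  then show "frag_coset K (f (ract m s, n) + g (ract m s, n)) = frag_coset K (f (m, lact s n) + g (m, lact s n))"
    using assms by (intro frag_coset_add) (auto simp: respects_tensor_def)
qed

lemma respects_tensor_cmul:
  assumes K: "add_subgroup K" and f: "respects_tensor K M N S ract lact f"
  shows "respects_tensor K M N S ract lact (\<lambda>x. frag_cmul n (f x))"
  using f unfolding respects_tensor_def frag_cmul_distrib2[symmetric]
  by (intro conjI ballI frag_coset_cmul[OF K]) blast+

section \<open>Evaluation of formal sums in an abelian group\<close>

definition frag_eval :: "('m, 'z) ring_scheme \<Rightarrow> ('b \<Rightarrow> 'm) \<Rightarrow> ('b \<Rightarrow>\<^sub>0 int) \<Rightarrow> 'm" where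
  "frag_eval M g r = (\<Oplus>\<^bsub>M\<^esub>y\<in>Poly_Mapping.keys r. [Poly_Mapping.lookup r y] \<cdot>\<^bsub>M\<^esub> g y)"

text \<open>The formal sums of elements of M modulo this kernel form M again. An equation in M thus
  becomes a congruence of formal sums, and by \<open>frag_of_eval_ker\<close> it can be recovered
  from it; results about arbitrary subgroups \<open>K\<close> then also cover maps with values in
  M.\<close>

definition eval_ker :: "('m, 'z) ring_scheme \<Rightarrow> ('m \<Rightarrow>\<^sub>0 int) set" where
  "eval_ker M = {r. Poly_Mapping.keys r \<subseteq> carrier M \<and> frag_eval M (\<lambda>x. x) r = \<zero>\<^bsub>M\<^esub>}"

context abelian_group
begin

lemma frag_eval_superset:
  assumes "finite A" "Poly_Mapping.keys r \<subseteq> A" "\<And>y. y \<in> A \<Longrightarrow> g y \<in> carrier G"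
  shows "frag_eval G g r = (\<Oplus>y\<in>A. [Poly_Mapping.lookup r y] \<cdot> g y)"
proof -
  have "[(0 :: int)] \<cdot> x = \<zero>" for x
    by (simp add: add_pow_def int_pow_def nat_pow_def)
  with assms show ?thesis
    unfolding frag_eval_def by (intro add.finprod_mono_neutral_cong_left) (auto simp: in_keys_iff)
qed

lemma frag_eval_closed:
  "(\<And>y. y \<in> Poly_Mapping.keys r \<Longrightarrow> g y \<in> carrier G) \<Longrightarrow> frag_eval G g r \<in> carrier G"
  unfolding frag_eval_def by (intro finsum_closed) auto

lemma frag_eval_add:
  assumes "\<And>y. y \<in> Poly_Mapping.keys r \<union> Poly_Mapping.keys s \<Longrightarrow> g y \<in> carrier G"
  shows "frag_eval G g (r + s) = frag_eval G g r \<oplus> frag_eval G g s"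
proof -
  let ?A = "Poly_Mapping.keys r \<union> Poly_Mapping.keys s"
  have "frag_eval G g (r + s) = (\<Oplus>y\<in>?A. [Poly_Mapping.lookup (r + s) y] \<cdot> g y)"
    using assms keys_add[of r s] by (intro frag_eval_superset) auto
  also have "\<dots> = (\<Oplus>y\<in>?A. [Poly_Mapping.lookup r y] \<cdot> g y \<oplus> [Poly_Mapping.lookup s y] \<cdot> g y)"
    using assms by (intro finsum_cong') (auto simp: lookup_add add.int_pow_mult)
  also have "\<dots> = (\<Oplus>y\<in>?A. [Poly_Mapping.lookup r y] \<cdot> g y) \<oplus> (\<Oplus>y\<in>?A. [Poly_Mapping.lookup s y] \<cdot> g y)"
    using assms by (intro finsum_addf) auto
  also have "(\<Oplus>y\<in>?A. [Poly_Mapping.lookup r y] \<cdot> g y) = frag_eval G g r"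
    using assms by (intro frag_eval_superset[symmetric]) auto
  also have "(\<Oplus>y\<in>?A. [Poly_Mapping.lookup s y] \<cdot> g y) = frag_eval G g s"
    using assms by (intro frag_eval_superset[symmetric]) auto
  finally show ?thesis .
qed

lemma frag_eval_0 [simp]: "frag_eval G g 0 = \<zero>"
  by (simp add: frag_eval_def)

lemma frag_eval_frag_of [simp]: "g y \<in> carrier G \<Longrightarrow> frag_eval G g (frag_of y) = g y"
  by (subst frag_eval_superset[of "{y}"]) (auto simp: add.int_pow_1)

lemma frag_eval_minus:
  assumes "\<And>y. y \<in> Poly_Mapping.keys r \<Longrightarrow> g y \<in> carrier G"
  shows "frag_eval G g (- r) = \<ominus> frag_eval G g r"
proof -
  have "frag_eval G g (- r) \<oplus> frag_eval G g r = frag_eval G g (- r + r)"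
    by (rule frag_eval_add[symmetric]) (use assms in auto)
  then show ?thesis
    using frag_eval_closed[of r g] frag_eval_closed[of "- r" g] assms by (simp add: minus_equality)
qed

lemma add_subgroup_eval_ker: "add_subgroup (eval_ker G)"
  unfolding add_subgroup_def eval_ker_def
proof (intro conjI ballI CollectI)
  fix a b assume a: "a \<in> {r. Poly_Mapping.keys r \<subseteq> carrier G \<and> frag_eval G (\<lambda>x. x) r = \<zero>}"
    and b: "b \<in> {r. Poly_Mapping.keys r \<subseteq> carrier G \<and> frag_eval G (\<lambda>x. x) r = \<zero>}"
  then show "Poly_Mapping.keys (a - b) \<subseteq> carrier G"
    using keys_diff[of a b] by auto
  have "frag_eval G (\<lambda>x. x) (- b) = \<ominus> frag_eval G (\<lambda>x. x) b"
    using b by (intro frag_eval_minus) auto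
  then have "frag_eval G (\<lambda>x. x) (a + - b) = \<zero>"
    by (subst frag_eval_add) (use a b in auto)
  then show "frag_eval G (\<lambda>x. x) (a - b) = \<zero>" by simp
qed auto

lemma frag_of_eval_ker:
  assumes "x \<in> carrier G" "y \<in> carrier G"
  shows "frag_coset (eval_ker G) (frag_of x) = frag_coset (eval_ker G) (frag_of y) \<longleftrightarrow> x = y"
proof
  assume "frag_coset (eval_ker G) (frag_of x) = frag_coset (eval_ker G) (frag_of y)"
  then have "frag_eval G (\<lambda>x. x) (frag_of x + - frag_of y) = \<zero>"
    unfolding frag_coset_eq_iff[OF add_subgroup_eval_ker] by (simp add: eval_ker_def)
  moreover have "frag_eval G (\<lambda>x. x) (- frag_of y) = \<ominus> y"
    using assms by (subst frag_eval_minus) (auto simp: keys_frag_of)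
  ultimately have "x \<oplus> \<ominus> y = \<zero>"
    by (subst (asm) frag_eval_add) (use assms in \<open>auto simp: keys_frag_of\<close>)
  then show "x = y"
    using assms by (metis add.inv_closed add.m_comm minus_equality minus_minus)
qed simp

text \<open>Serves to trade a sum computed in the group for the formal sum of its terms. The support
  of the latter is tracked in the induction because membership in \<open>eval_ker\<close> asks for
  it.\<close>

lemma eval_ker_frag_of_eval:
  assumes "\<And>y. y \<in> Poly_Mapping.keys r \<Longrightarrow> g y \<in> carrier G"
  shows "frag_coset (eval_ker G) (frag_of (frag_eval G g r)) = frag_coset (eval_ker G) (frag_extend (\<lambda>y. frag_of (g y)) r)"
proof -
  let ?e = "frag_extend (\<lambda>y. frag_of (g y))"
  have "frag_eval G g r = frag_eval G (\<lambda>x. x) (frag_extend (\<lambda>y. frag_of (g y)) r) \<and>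
      Poly_Mapping.keys (frag_extend (\<lambda>y. frag_of (g y)) r) \<subseteq> carrier G"
    using subset_refl[of "Poly_Mapping.keys r"]
  proof (rule free_Abelian_group_induct)
    fix x y
    assume "Poly_Mapping.keys x \<subseteq> Poly_Mapping.keys r" "Poly_Mapping.keys y \<subseteq> Poly_Mapping.keys r"
      and x: "frag_eval G g x = frag_eval G (\<lambda>x. x) (?e x) \<and> Poly_Mapping.keys (?e x) \<subseteq> carrier G"
      and y: "frag_eval G g y = frag_eval G (\<lambda>x. x) (?e y) \<and> Poly_Mapping.keys (?e y) \<subseteq> carrier G"
    with assms have xy: "\<And>z. z \<in> Poly_Mapping.keys x \<union> Poly_Mapping.keys y \<Longrightarrow> g z \<in> carrier G"
      by auto
    have "frag_eval G g (x + - y) = frag_eval G g x \<oplus> \<ominus> frag_eval G g y"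
      using xy by (subst frag_eval_add) (auto simp: frag_eval_minus)
    moreover have "frag_eval G (\<lambda>x. x) (?e x + - ?e y) = frag_eval G (\<lambda>x. x) (?e x) \<oplus> \<ominus> frag_eval G (\<lambda>x. x) (?e y)"
      using x y by (subst frag_eval_add) (auto intro!: arg_cong2[where f = "(\<oplus>)"] frag_eval_minus)
    ultimately show "frag_eval G g (x - y) = frag_eval G (\<lambda>x. x) (?e (x - y)) \<and> Poly_Mapping.keys (?e (x - y)) \<subseteq> carrier G"
      using x y keys_diff[of "?e x" "?e y"] by (simp add: frag_extend_diff) blast
  qed (auto simp: assms keys_frag_of)
  note * = this
  have c: "frag_eval G g r \<in> carrier G"
    by (rule frag_eval_closed) (rule assms)
  have "frag_eval G (\<lambda>x. x) (- ?e r) = \<ominus> frag_eval G (\<lambda>x. x) (?e r)"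
    using * by (intro frag_eval_minus) auto
  then have "frag_eval G (\<lambda>x. x) (frag_of (frag_eval G g r) + - ?e r) = \<zero>"
    using * c by (subst frag_eval_add) (auto simp: keys_frag_of r_neg)
  moreover have "Poly_Mapping.keys (frag_of (frag_eval G g r) - frag_extend (\<lambda>y. frag_of (g y)) r) \<subseteq> carrier G"
    using * c keys_diff[of "frag_of (frag_eval G g r)" "frag_extend (\<lambda>y. frag_of (g y)) r"] by (auto simp: keys_frag_of)
  ultimately show ?thesis
    unfolding frag_coset_eq_iff[OF add_subgroup_eval_ker] by (simp add: eval_ker_def)
qed

lemma eval_ker_add:
  assumes "x \<in> carrier G" "y \<in> carrier G"
  shows "frag_coset (eval_ker G) (frag_of (x \<oplus> y)) = frag_coset (eval_ker G) (frag_of x + frag_of y)"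
proof -
  have "frag_eval G (\<lambda>x. x) (frag_of x + frag_of y) = x \<oplus> y"
    using assms by (subst frag_eval_add) (auto simp: keys_frag_of)
  then show ?thesis
    using eval_ker_frag_of_eval[of "frag_of x + frag_of y" "\<lambda>x. x"] assms keys_add[of "frag_of x" "frag_of y"]
    by (auto simp: keys_frag_of frag_extend_add)
qed

lemma eval_ker_zero: "frag_coset (eval_ker G) (frag_of \<zero>) = frag_coset (eval_ker G) 0"
  using eval_ker_frag_of_eval[of 0 "\<lambda>x. x"] by simp

lemma eval_ker_minus:
  assumes "x \<in> carrier G"
  shows "frag_coset (eval_ker G) (frag_of (\<ominus> x)) = frag_coset (eval_ker G) (- frag_of x)"
proof -
  have "frag_eval G (\<lambda>x. x) (- frag_of x) = \<ominus> x"
    using assms by (subst frag_eval_minus) (auto simp: keys_frag_of)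
  then show ?thesis
    using eval_ker_frag_of_eval[of "- frag_of x" "\<lambda>x. x"] assms
    by (simp add: keys_frag_of frag_extend_minus)
qed

lemma eval_ker_diff:
  assumes "x \<in> carrier G" "y \<in> carrier G"
  shows "frag_coset (eval_ker G) (frag_of (x \<ominus> y)) = frag_coset (eval_ker G) (frag_of x - frag_of y)"
proof -
  have "frag_coset (eval_ker G) (frag_of (x \<ominus> y)) = frag_coset (eval_ker G) (frag_of x + frag_of (\<ominus> y))"
    unfolding a_minus_def using assms by (intro eval_ker_add) auto
  also have "\<dots> = frag_coset (eval_ker G) (frag_of x + - frag_of y)"
    using assms by (intro frag_coset_add[OF add_subgroup_eval_ker] eval_ker_minus refl)
  finally show ?thesis by simp
qed

lemma add_pow_sgn:
  assumes "x \<in> carrier G"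
  shows "[sgn_pow n] \<cdot> x = (if even n then x else \<ominus> x)"
  using assms by (auto simp: sgn_pow_def add.int_pow_1 add.int_pow_neg)

lemma eval_ker_sgn_pow:
  assumes "x \<in> carrier G"
  shows "frag_coset (eval_ker G) (frag_of ([sgn_pow n] \<cdot> x)) = frag_coset (eval_ker G) (frag_cmul (sgn_pow n) (frag_of x))"
  using assms by (auto simp: add_pow_sgn eval_ker_minus) (auto simp: sgn_pow_def)

lemma list_msum_closed:
  "(\<And>x. x \<in> set xs \<Longrightarrow> g x \<in> carrier G) \<Longrightarrow> list_msum G g xs \<in> carrier G"
  by (induction xs) (auto simp: list_msum_def)

lemma eval_ker_list_msum:
  "(\<And>x. x \<in> set xs \<Longrightarrow> g x \<in> carrier G) \<Longrightarrow>
   frag_coset (eval_ker G) (frag_of (list_msum G g xs)) = frag_coset (eval_ker G) (\<Sum>x\<leftarrow>xs. frag_of (g x))"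
proof (induction xs)
  case Nil
  then show ?case by (simp add: list_msum_def eval_ker_zero)
next
  case (Cons x xs)
  have "frag_coset (eval_ker G) (frag_of (list_msum G g (x # xs))) = frag_coset (eval_ker G) (frag_of (g x) + frag_of (list_msum G g xs))"
    using Cons.prems list_msum_closed[of xs g] unfolding list_msum_def by (simp add: eval_ker_add)
  also have "\<dots> = frag_coset (eval_ker G) (frag_of (g x) + (\<Sum>x\<leftarrow>xs. frag_of (g x)))"
    using Cons by (intro frag_coset_add[OF add_subgroup_eval_ker]) auto
  finally show ?case by simp
qed

end

section \<open>Independence of the choice of decompositions\<close>

context connected_quiver
begin

text \<open>The condition on \<Psi> that makes it a map on the tensor product of W_p and W_q over k,
  modulo \<open>K\<close>. It is exactly the situation in which summing over a chosen decomposition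
  makes sense.\<close>

definition balanced ::
  "('c \<Rightarrow>\<^sub>0 int) set \<Rightarrow> int \<Rightarrow> int \<Rightarrow>
   (('v, 'e + 'e, 'f::field) pelem \<Rightarrow> ('v, 'e + 'e, 'f) pelem \<Rightarrow> 'c \<Rightarrow>\<^sub>0 int) \<Rightarrow> bool" where
  "balanced K p q \<Psi> \<longleftrightarrow>
     (\<forall>u\<in>koszul_W Q p. \<forall>u'\<in>koszul_W Q p. \<forall>v\<in>koszul_W Q q.
        frag_coset K (\<Psi> (u + u') v) = frag_coset K (\<Psi> u v + \<Psi> u' v)) \<and>
     (\<forall>u\<in>koszul_W Q p. \<forall>v\<in>koszul_W Q q. \<forall>v'\<in>koszul_W Q q.
        frag_coset K (\<Psi> u (v + v')) = frag_coset K (\<Psi> u v + \<Psi> u v')) \<and>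
     (\<forall>u\<in>koszul_W Q p. \<forall>c\<in>base_k Q. \<forall>v\<in>koszul_W Q q.
        frag_coset K (\<Psi> (u \<star> c) v) = frag_coset K (\<Psi> u (c \<star> v)))"

lemma koszul_W_closed:
  fixes v w c :: "('v, 'e + 'e, 'f::field) pelem"
  shows "v \<in> koszul_W Q p \<Longrightarrow> w \<in> koszul_W Q p \<Longrightarrow> v + w \<in> koszul_W Q p"
    and "(0 :: ('v, 'e + 'e, 'f) pelem) \<in> koszul_W Q p"
    and "w \<in> koszul_W Q p \<Longrightarrow> pscale a w \<in> koszul_W Q p"
    and "c \<in> base_k Q \<Longrightarrow> w \<in> koszul_W Q p \<Longrightarrow> c \<star> w \<in> koszul_W Q p"
    and "c \<in> base_k Q \<Longrightarrow> w \<in> koszul_W Q p \<Longrightarrow> w \<star> c \<in> koszul_W Q p"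
    and "w \<in> koszul_W Q p \<Longrightarrow> Poly_Mapping.keys w \<subseteq> paths D"
proof -
  interpret A: path_basis D "koszul_W Q p :: ('v, 'e + 'e, 'f) pelem set" "nat p" "idx p" "bas p" hh tt
     "case_sum (\<lambda>i. if p = 2 then eps (arrow_to i) else 1) (\<lambda>_. 1)"
     "case_sum (\<lambda>i. if p = 2 then [arrow_to i, star (arrow_to i)] else []) (\<lambda>a. [a])"
    by (rule bas_basis)
  show "(0 :: ('v, 'e + 'e, 'f) pelem) \<in> koszul_W Q p" by (rule A.W_0)
  show "v \<in> koszul_W Q p \<Longrightarrow> w \<in> koszul_W Q p \<Longrightarrow> v + w \<in> koszul_W Q p" by (rule A.W_add)
  show "w \<in> koszul_W Q p \<Longrightarrow> pscale a w \<in> koszul_W Q p" by (rule A.W_pscale)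
  show "c \<in> base_k Q \<Longrightarrow> w \<in> koszul_W Q p \<Longrightarrow> c \<star> w \<in> koszul_W Q p" by (rule A.W_lmult)
  show "c \<in> base_k Q \<Longrightarrow> w \<in> koszul_W Q p \<Longrightarrow> w \<star> c \<in> koszul_W Q p" by (rule A.W_rmult)
  show "w \<in> koszul_W Q p \<Longrightarrow> Poly_Mapping.keys w \<subseteq> paths D" using A.W_deg dq.path_degD by blast
qed

lemma koszul_W_sum: "(\<And>i. i \<in> I \<Longrightarrow> f i \<in> koszul_W Q p) \<Longrightarrow> (\<Sum>i\<in>I. f i) \<in> koszul_W Q p"
  by (induction I rule: infinite_finite_induct) (auto intro: koszul_W_closed)

lemma base_scalar: "pscale a \<one>\<^bsub>tensor_algebra Q\<^esub> \<in> base_k Q"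
  by (intro dq.path_deg_pscale dq.one_deg)

text \<open>Scalars act through multiples of the unit, which lie in k. Therefore linearity over the
  field never has to be assumed separately from balancing over k.\<close>

lemma pscale_eq_mult:
  fixes w :: "('v, 'e + 'e, 'f::field) pelem"
  assumes "Poly_Mapping.keys w \<subseteq> paths D"
  shows "pscale a w = pscale a \<one>\<^bsub>tensor_algebra Q\<^esub> \<star> w" "pscale a w = w \<star> pscale a \<one>\<^bsub>tensor_algebra Q\<^esub>"
  using assms by (simp_all add: path_mult_pscale_left path_mult_pscale_right dq.path_mult_one)

context
  fixes K :: "('c \<Rightarrow>\<^sub>0 int) set" and p q :: int
    and \<Psi> :: "('v, 'e + 'e, 'f::field) pelem \<Rightarrow> ('v, 'e + 'e, 'f) pelem \<Rightarrow> 'c \<Rightarrow>\<^sub>0 int"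
  assumes K: "add_subgroup K" and bal: "balanced K p q \<Psi>"
begin

lemma balancedD:
  shows "u \<in> koszul_W Q p \<Longrightarrow> u' \<in> koszul_W Q p \<Longrightarrow> v \<in> koszul_W Q q \<Longrightarrow>
      frag_coset K (\<Psi> (u + u') v) = frag_coset K (\<Psi> u v + \<Psi> u' v)"
    and "u \<in> koszul_W Q p \<Longrightarrow> v \<in> koszul_W Q q \<Longrightarrow> v' \<in> koszul_W Q q \<Longrightarrow>
      frag_coset K (\<Psi> u (v + v')) = frag_coset K (\<Psi> u v + \<Psi> u v')"
    and "u \<in> koszul_W Q p \<Longrightarrow> c \<in> base_k Q \<Longrightarrow> v \<in> koszul_W Q q \<Longrightarrow>
      frag_coset K (\<Psi> (u \<star> c) v) = frag_coset K (\<Psi> u (c \<star> v))"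
  using bal unfolding balanced_def by blast+

lemma balanced_0_left: "v \<in> koszul_W Q q \<Longrightarrow> frag_coset K (\<Psi> 0 v) = frag_coset K 0"
proof -
  assume v: "v \<in> koszul_W Q q"
  have "(0 :: ('v, 'e + 'e, 'f) pelem) \<in> koszul_W Q p" by (rule koszul_W_closed)
  from balancedD(1)[OF this this v] show ?thesis
    using add_subgroupD(3)[OF K, of "- \<Psi> 0 v"] by (simp add: frag_coset_eq_iff[OF K])
qed

lemma balanced_0_right: "u \<in> koszul_W Q p \<Longrightarrow> frag_coset K (\<Psi> u 0) = frag_coset K 0"
proof -
  assume u: "u \<in> koszul_W Q p"
  have "(0 :: ('v, 'e + 'e, 'f) pelem) \<in> koszul_W Q q" by (rule koszul_W_closed)
  from balancedD(2)[OF u this this] show ?thesis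
    using add_subgroupD(3)[OF K, of "- \<Psi> u 0"] by (simp add: frag_coset_eq_iff[OF K])
qed

lemma balanced_sum_left:
  "(\<And>i. i \<in> I \<Longrightarrow> f i \<in> koszul_W Q p) \<Longrightarrow> v \<in> koszul_W Q q \<Longrightarrow>
   frag_coset K (\<Psi> (\<Sum>i\<in>I. f i) v) = frag_coset K (\<Sum>i\<in>I. \<Psi> (f i) v)"
proof (induction I rule: infinite_finite_induct)
  case (insert i I)
  then have "frag_coset K (\<Psi> (f i + (\<Sum>i\<in>I. f i)) v) = frag_coset K (\<Psi> (f i) v + \<Psi> (\<Sum>i\<in>I. f i) v)"
    by (intro balancedD koszul_W_sum) auto
  also have "\<dots> = frag_coset K (\<Psi> (f i) v + (\<Sum>i\<in>I. \<Psi> (f i) v))"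
    using insert by (intro frag_coset_add[OF K] refl) auto
  finally show ?case using insert by simp
qed (auto simp: balanced_0_left)

lemma balanced_sum_right:
  "(\<And>i. i \<in> I \<Longrightarrow> f i \<in> koszul_W Q q) \<Longrightarrow> u \<in> koszul_W Q p \<Longrightarrow>
   frag_coset K (\<Psi> u (\<Sum>i\<in>I. f i)) = frag_coset K (\<Sum>i\<in>I. \<Psi> u (f i))"
proof (induction I rule: infinite_finite_induct)
  case (insert i I)
  then have "frag_coset K (\<Psi> u (f i + (\<Sum>i\<in>I. f i))) = frag_coset K (\<Psi> u (f i) + \<Psi> u (\<Sum>i\<in>I. f i))"
    by (intro balancedD koszul_W_sum) auto
  also have "\<dots> = frag_coset K (\<Psi> u (f i) + (\<Sum>i\<in>I. \<Psi> u (f i)))"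
    using insert by (intro frag_coset_add[OF K] refl) auto
  finally show ?case using insert by simp
qed (auto simp: balanced_0_right)

lemma balanced_pscale:
  assumes "u \<in> koszul_W Q p" "v \<in> koszul_W Q q"
  shows "frag_coset K (\<Psi> u (pscale a v)) = frag_coset K (\<Psi> (pscale a u) v)"
proof -
  have "pscale a u = u \<star> pscale a \<one>\<^bsub>tensor_algebra Q\<^esub>" "pscale a v = pscale a \<one>\<^bsub>tensor_algebra Q\<^esub> \<star> v"
    using assms koszul_W_closed(6) by (auto intro: pscale_eq_mult)
  then show ?thesis
    using assms by (simp only: balancedD(3) base_scalar)
qed

text \<open>
  The sum of \<open>\<Psi> u v\<close> over a decomposition of \<open>w\<close> is computed by expanding both factors in the bases
  of \<open>W\<^sub>p\<close> and \<open>W\<^sub>q\<close>: the resulting coefficients only depend on \<open>w\<close>, as they are, up to a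
  constant, coefficients of \<open>w\<close> at concatenations of the paths defining the coordinates.
\<close>

lemma sum_decomposition:
  obtains \<Phi> where "\<And>ps. set ps \<subseteq> koszul_W Q p \<times> koszul_W Q q \<Longrightarrow>
    frag_coset K (\<Sum>(u, v)\<leftarrow>ps. \<Psi> u v) = frag_coset K (\<Phi> (\<Sum>(u, v)\<leftarrow>ps. u \<star> v))"
proof -
  define \<kappa> :: "int \<Rightarrow> 'v + ('e + 'e) \<Rightarrow> 'f" where
    "\<kappa> p = case_sum (\<lambda>i. if p = 2 then eps (arrow_to i) else 1) (\<lambda>_. 1)" for p
  define \<pi> where
    "\<pi> p = case_sum (\<lambda>i. if p = 2 then [arrow_to i, star (arrow_to i)] else []) (\<lambda>a. [a])" for p :: int
  interpret A: path_basis D "koszul_W Q p :: ('v, 'e + 'e, 'f) pelem set" "nat p" "idx p" "bas p" hh tt "\<kappa> p" "\<pi> p"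
    unfolding \<kappa>_def \<pi>_def by (rule bas_basis)
  interpret B: path_basis D "koszul_W Q q :: ('v, 'e + 'e, 'f) pelem set" "nat q" "idx q" "bas q" hh tt "\<kappa> q" "\<pi> q"
    unfolding \<kappa>_def \<pi>_def by (rule bas_basis)
  \<comment> \<open>On a product \<open>u \<star> v\<close> this coefficient is the product of the
    coordinates of \<open>u\<close> and \<open>v\<close>, provided that the paths can be joined;
    hence the condition \<open>tt i = hh j\<close> in \<Phi>.\<close>
  define \<nu> where "\<nu> i j w = \<kappa> p i * \<kappa> q j * Poly_Mapping.lookup w (hh i, \<pi> p i @ \<pi> q j, tt j)" for i j w
  define \<Phi> where "\<Phi> w = (\<Sum>i\<in>idx p. \<Sum>j\<in>idx q. if tt i = hh j then \<Psi> (pscale (\<nu> i j w) (bas p i)) (bas q j) else 0)" for w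
  have \<nu>_mult: "\<nu> i j (u \<star> v) = A.co i u * B.co j v"
    if "u \<in> koszul_W Q p" "i \<in> idx p" "tt i = hh j" for u v i j
    using dq.lookup_path_mult[OF subsetD[OF A.W_deg that(1)] A.length_pi A.path_pi, OF that(2) that(2), of v "\<pi> q j" "tt j"] that(3)
    unfolding \<nu>_def A.co_def B.co_def by simp
  have \<Phi>_0: "frag_coset K (\<Phi> 0) = frag_coset K 0"
  proof -
    have "frag_coset K (\<Phi> 0) = frag_coset K (\<Sum>i\<in>idx p. \<Sum>j\<in>idx q. 0)"
      unfolding \<Phi>_def using B.b_in by (intro frag_coset_sum[OF K]) (auto simp: \<nu>_def balanced_0_left)
    then show ?thesis by simp
  qed
  have \<Phi>_add: "frag_coset K (\<Phi> (w + w')) = frag_coset K (\<Phi> w + \<Phi> w')" for w w'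
  proof -
    have "frag_coset K (\<Phi> (w + w')) = frag_coset K (\<Sum>i\<in>idx p. \<Sum>j\<in>idx q.
        (if tt i = hh j then \<Psi> (pscale (\<nu> i j w) (bas p i)) (bas q j) else 0) +
        (if tt i = hh j then \<Psi> (pscale (\<nu> i j w') (bas p i)) (bas q j) else 0))"
      unfolding \<Phi>_def
    proof (intro frag_coset_sum[OF K])
      fix i j assume "i \<in> idx p" "j \<in> idx q"
      then show "frag_coset K (if tt i = hh j then \<Psi> (pscale (\<nu> i j (w + w')) (bas p i)) (bas q j) else 0) =
        frag_coset K ((if tt i = hh j then \<Psi> (pscale (\<nu> i j w) (bas p i)) (bas q j) else 0) +
        (if tt i = hh j then \<Psi> (pscale (\<nu> i j w') (bas p i)) (bas q j) else 0))"
        using balancedD(1)[of "pscale (\<nu> i j w) (bas p i)" "pscale (\<nu> i j w') (bas p i)" "bas q j"]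
        by (auto simp: \<nu>_def lookup_add distrib_left pelem.scale_left_distrib A.b_in B.b_in A.W_pscale)
    qed
    then show ?thesis
      by (simp add: \<Phi>_def sum.distrib)
  qed
  have \<Phi>_mult: "frag_coset K (\<Psi> u v) = frag_coset K (\<Phi> (u \<star> v))"
    if uv: "u \<in> koszul_W Q p" "v \<in> koszul_W Q q" for u v
  proof -
    have "frag_coset K (\<Psi> u v) = frag_coset K (\<Psi> (\<Sum>i\<in>idx p. pscale (A.co i u) (bas p i)) v)"
      using A.co_expand[OF uv(1)] by simp
    also have "\<dots> = frag_coset K (\<Sum>i\<in>idx p. \<Psi> (pscale (A.co i u) (bas p i)) v)"
      using uv by (intro balanced_sum_left) (auto intro: A.W_pscale A.b_in)
    also have "\<dots> = frag_coset K (\<Sum>i\<in>idx p. \<Psi> (pscale (A.co i u) (bas p i)) (\<Sum>j\<in>idx q. pscale (B.co j v) (bas q j)))"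
      using B.co_expand[OF uv(2)] by simp
    also have "\<dots> = frag_coset K (\<Sum>i\<in>idx p. \<Sum>j\<in>idx q. \<Psi> (pscale (A.co i u) (bas p i)) (pscale (B.co j v) (bas q j)))"
      by (intro frag_coset_sum[OF K] balanced_sum_right) (auto intro: A.W_pscale A.b_in B.W_pscale B.b_in)
    also have "\<dots> = frag_coset K (\<Phi> (u \<star> v))"
      unfolding \<Phi>_def
    proof (intro frag_coset_sum[OF K])
      fix i j assume ij: "i \<in> idx p" "j \<in> idx q"
      let ?x = "pscale (A.co i u) (bas p i)" and ?y = "pscale (B.co j v) (bas q j)"
      have x: "?x \<in> koszul_W Q p" and y: "?y \<in> koszul_W Q q"
        using ij by (auto intro: A.W_pscale A.b_in B.W_pscale B.b_in)
      \<comment> \<open>If the middle vertices differ, the idempotent at \<open>hh j\<close>, which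
        is absorbed by the right factor, can be moved over to the left one and kills it. So the
        pairs omitted in \<Phi> contribute nothing.\<close>
      have xt: "?x \<star> trivial_path (hh j) = (if tt i = hh j then ?x else 0)"
      proof -
        have "?x \<star> trivial_path (hh j) = pscale (A.co i u) (bas p i \<star> (trivial_path (tt i) \<star> trivial_path (hh j)))"
          using A.b_tail[OF ij(1)] by (simp add: path_mult_pscale_left flip: path_mult_assoc)
        then show ?thesis
          using A.b_tail[OF ij(1)] by (cases "tt i = hh j") (simp_all add: dq.trivial_path_mult path_mult_pscale_left)
      qed
      have hy: "trivial_path (hh j) \<star> ?y = ?y"
        using B.b_head[OF ij(2)] by (simp add: path_mult_pscale_right)
      show "frag_coset K (\<Psi> ?x ?y) = frag_coset K (if tt i = hh j then \<Psi> (pscale (\<nu> i j (u \<star> v)) (bas p i)) (bas q j) else 0)"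
      proof (cases "tt i = hh j")
        case True
        have "frag_coset K (\<Psi> ?x ?y) = frag_coset K (\<Psi> (pscale (B.co j v) ?x) (bas q j))"
          by (rule balanced_pscale[OF x B.b_in[OF ij(2)]])
        then show ?thesis
          using True \<nu>_mult[OF uv(1) ij(1) True] by (simp add: mult.commute)
      next
        case False
        have "frag_coset K (\<Psi> ?x (trivial_path (hh j) \<star> ?y)) = frag_coset K (\<Psi> (?x \<star> trivial_path (hh j)) ?y)"
          using x y B.h_in[OF ij(2)] by (intro balancedD(3)[symmetric]) (auto intro: dq.trivial_path_deg)
        with False xt hy balanced_0_left[OF y] show ?thesis by simp
      qed
    qed
    finally show ?thesis .
  qed
  show thesis
  proof (rule that[of \<Phi>])
    fix ps :: "(('v, 'e + 'e, 'f) pelem \<times> ('v, 'e + 'e, 'f) pelem) list"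
    assume "set ps \<subseteq> koszul_W Q p \<times> koszul_W Q q"
    then show "frag_coset K (\<Sum>(u, v)\<leftarrow>ps. \<Psi> u v) = frag_coset K (\<Phi> (\<Sum>(u, v)\<leftarrow>ps. u \<star> v))"
    proof (induction ps)
      case (Cons x ps)
      obtain u v where x: "x = (u, v)" by (cases x)
      with Cons have "frag_coset K (\<Psi> u v + (\<Sum>(u, v)\<leftarrow>ps. \<Psi> u v)) =
          frag_coset K (\<Phi> (u \<star> v) + \<Phi> (\<Sum>(u, v)\<leftarrow>ps. u \<star> v))"
        by (intro frag_coset_add[OF K] \<Phi>_mult) auto
      then show ?case
        by (simp add: x \<Phi>_add)
    qed (simp add: \<Phi>_0)
  qed
qed

lemma decomposition_cong:
  assumes "set ps \<subseteq> koszul_W Q p \<times> koszul_W Q q" "set ps' \<subseteq> koszul_W Q p \<times> koszul_W Q q"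
    and "(\<Sum>(u, v)\<leftarrow>ps. u \<star> v) = (\<Sum>(u, v)\<leftarrow>ps'. u \<star> v)"
  shows "frag_coset K (\<Sum>(u, v)\<leftarrow>ps. \<Psi> u v) = frag_coset K (\<Sum>(u, v)\<leftarrow>ps'. \<Psi> u v)"
  using assms by (metis sum_decomposition)

end

text \<open>Since W_n = 0 for n at least 3, few cases remain: a factor of degree 0 can be taken to
  be the unit, and for p = q = 1 each sigma_i is by definition a combination of products of two
  arrows.\<close>

lemma decomposition_exists:
  fixes w :: "('v, 'e + 'e, 'f::field) pelem"
  assumes pq: "p \<ge> 0" "q \<ge> 0" and w: "w \<in> koszul_W Q (p + q)"
  shows "\<exists>ps. set ps \<subseteq> koszul_W Q p \<times> koszul_W Q q \<and> (\<Sum>(u, v)\<leftarrow>ps. u \<star> v) = w"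
proof -
  have one: "\<one>\<^bsub>tensor_algebra Q\<^esub> \<in> koszul_W Q 0"
    by (simp add: koszul_W_simps dq.one_deg)
  consider "p + q \<ge> 3" | "p = 0" | "q = 0" | "p = 1" "q = 1"
    using pq by linarith
  then show ?thesis
  proof cases
    case 1
    with w have "w = 0" by (simp add: koszul_W_ge_3)
    then show ?thesis by (intro exI[of _ "[]"]) simp
  next
    case 2
    with w one show ?thesis
      using koszul_W_closed(6)[OF w] by (intro exI[of _ "[(\<one>\<^bsub>tensor_algebra Q\<^esub>, w)]"]) (simp add: dq.path_mult_one)
  next
    case 3
    with w one show ?thesis
      using koszul_W_closed(6)[OF w] by (intro exI[of _ "[(w, \<one>\<^bsub>tensor_algebra Q\<^esub>)]"]) (simp add: dq.path_mult_one)
  next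
    case 4
    let ?E = "{w :: ('v, 'e + 'e, 'f) pelem. \<exists>ps. set ps \<subseteq> koszul_W Q p \<times> koszul_W Q q \<and> (\<Sum>(u, v)\<leftarrow>ps. u \<star> v) = w}"
    have sub: "pelem.subspace ?E"
      unfolding pelem.subspace_def
    proof (intro conjI ballI allI)
      show "0 \<in> ?E" by (auto intro!: exI[of _ "[]"])
    next
      fix x y assume "x \<in> ?E" "y \<in> ?E"
      then obtain ps ps' where "set ps \<subseteq> koszul_W Q p \<times> koszul_W Q q" "(\<Sum>(u, v)\<leftarrow>ps. u \<star> v) = x"
        "set ps' \<subseteq> koszul_W Q p \<times> koszul_W Q q" "(\<Sum>(u, v)\<leftarrow>ps'. u \<star> v) = y" by auto
      then show "x + y \<in> ?E" by (auto intro!: exI[of _ "ps @ ps'"])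
    next
      fix a x assume "x \<in> ?E"
      then obtain ps where ps: "set ps \<subseteq> koszul_W Q p \<times> koszul_W Q q" "(\<Sum>(u, v)\<leftarrow>ps. u \<star> v) = x" by auto
      have "(\<Sum>(u, v)\<leftarrow>ps. pscale a u \<star> v) = pscale a (\<Sum>(u, v)\<leftarrow>ps. u \<star> v)"
        by (induction ps) (auto simp: path_mult_pscale_left pelem.scale_right_distrib)
      moreover have "set (map (\<lambda>(u, v). (pscale a u, v)) ps) \<subseteq> koszul_W Q p \<times> koszul_W Q q"
        using ps(1) koszul_W_closed(3) by fastforce
      ultimately show "pscale a x \<in> ?E"
        using ps(2) by (intro CollectI exI[of _ "map (\<lambda>(u, v). (pscale a u, v)) ps"]) (simp add: comp_def case_prod_unfold)
    qed
    have "arrow D a \<star> arrow D (star a) \<in> ?E" if "a \<in> arcs D" for a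
      using that 4 dq.arrow_deg[of a] dq.arrow_deg[of "star a"]
      by (auto simp: koszul_W_simps intro!: exI[of _ "[(arrow D a, arrow D (star a))]"])
    then have "sigma Q i \<in> ?E" for i
      unfolding sigma_def by (intro pelem.subspace_sum[OF sub] pelem.subspace_scale[OF sub]) auto
    then have "pelem.span (sigma Q ` verts Q) \<subseteq> ?E"
      by (intro pelem.span_minimal sub) auto
    moreover have "w \<in> pelem.span (sigma Q ` verts Q)"
      using w 4 by (simp add: koszul_W_2 relations_def)
    ultimately show ?thesis by blast
  qed
qed

text \<open>These two facts are all that is used about the choice made in
  \<open>split\<close>.\<close>

lemma split_decomposition:
  assumes "p \<ge> 0" "q \<ge> 0" "w \<in> koszul_W Q (p + q)"
  shows "set (split Q p q w) \<subseteq> koszul_W Q p \<times> koszul_W Q q" "(\<Sum>(u, v)\<leftarrow>split Q p q w. u \<star> v) = w"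
  using someI_ex[OF decomposition_exists[OF assms]] unfolding split_def by auto

context
  fixes K :: "('c \<Rightarrow>\<^sub>0 int) set" and p q :: int
    and \<Psi> :: "('v, 'e + 'e, 'f::field) pelem \<Rightarrow> ('v, 'e + 'e, 'f) pelem \<Rightarrow> 'c \<Rightarrow>\<^sub>0 int"
  assumes K: "add_subgroup K" and bal: "balanced K p q \<Psi>" and pq: "p \<ge> 0" "q \<ge> 0"
begin

text \<open>Permits replacing the unknown decomposition by a convenient one, such as 1 w, w 1 or the
  defining sum of a sigma_i.\<close>

lemma split_eq_list:
  assumes "set ps \<subseteq> koszul_W Q p \<times> koszul_W Q q" "(\<Sum>(u, v)\<leftarrow>ps. u \<star> v) = w" "w \<in> koszul_W Q (p + q)"
  shows "frag_coset K (\<Sum>(u, v)\<leftarrow>split Q p q w. \<Psi> u v) = frag_coset K (\<Sum>(u, v)\<leftarrow>ps. \<Psi> u v)"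
  using assms pq by (intro decomposition_cong[OF K bal]) (simp_all add: split_decomposition)

lemma split_eq_sum:
  assumes fin: "finite J" and uv: "\<And>j. j \<in> J \<Longrightarrow> u j \<in> koszul_W Q p \<and> v j \<in> koszul_W Q q"
    and w: "(\<Sum>j\<in>J. u j \<star> v j) = w" "w \<in> koszul_W Q (p + q)"
  shows "frag_coset K (\<Sum>(u, v)\<leftarrow>split Q p q w. \<Psi> u v) = frag_coset K (\<Sum>j\<in>J. \<Psi> (u j) (v j))"
proof -
  obtain js where js: "set js = J" "distinct js"
    using finite_distinct_list[OF fin] by auto
  have "frag_coset K (\<Sum>(u, v)\<leftarrow>split Q p q w. \<Psi> u v) = frag_coset K (\<Sum>(u, v)\<leftarrow>map (\<lambda>j. (u j, v j)) js. \<Psi> u v)"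
    using w uv js by (intro split_eq_list) (auto simp: comp_def sum_list_distinct_conv_sum_set)
  then show ?thesis
    using js by (simp add: comp_def sum_list_distinct_conv_sum_set)
qed

lemma split_add:
  assumes "w \<in> koszul_W Q (p + q)" "w' \<in> koszul_W Q (p + q)"
  shows "frag_coset K (\<Sum>(u, v)\<leftarrow>split Q p q (w + w'). \<Psi> u v) =
    frag_coset K ((\<Sum>(u, v)\<leftarrow>split Q p q w. \<Psi> u v) + (\<Sum>(u, v)\<leftarrow>split Q p q w'. \<Psi> u v))"
  using split_eq_list[of "split Q p q w @ split Q p q w'" "w + w'"] pq assms
  by (simp add: split_decomposition koszul_W_closed)

lemma split_bimod:
  assumes "w \<in> koszul_W Q (p + q)" "c \<in> base_k Q" "d \<in> base_k Q"
  shows "frag_coset K (\<Sum>(u, v)\<leftarrow>split Q p q (c \<star> w \<star> d). \<Psi> u v) =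
    frag_coset K (\<Sum>(u, v)\<leftarrow>split Q p q w. \<Psi> (c \<star> u) (v \<star> d))"
proof -
  have "(\<Sum>(u, v)\<leftarrow>ps. c \<star> u \<star> (v \<star> d)) = c \<star> (\<Sum>(u, v)\<leftarrow>ps. u \<star> v) \<star> d" for ps
    by (induction ps) (auto simp: path_mult_add_left path_mult_add_right path_mult_assoc)
  then have "frag_coset K (\<Sum>(u, v)\<leftarrow>split Q p q (c \<star> w \<star> d). \<Psi> u v) =
      frag_coset K (\<Sum>(u, v)\<leftarrow>map (\<lambda>(u, v). (c \<star> u, v \<star> d)) (split Q p q w). \<Psi> u v)"
    using split_decomposition[OF pq assms(1)] assms koszul_W_closed(4,5)
    by (intro split_eq_list) (fastforce simp: comp_def case_prod_unfold)+
  then show ?thesis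
    by (simp add: comp_def case_prod_unfold)
qed

end

end

text \<open>A map \<phi> that is additive modulo \<open>K\<close> factors through the evaluation of
  formal sums. With \<phi> sending m to m \<otimes> w, identities in M are carried into the chain
  groups.\<close>

lemma (in abelian_group) eval_ker_map:
  assumes K: "add_subgroup K"
    and \<phi>: "\<And>x y. x \<in> carrier G \<Longrightarrow> y \<in> carrier G \<Longrightarrow> frag_coset K (\<phi> (x \<oplus> y)) = frag_coset K (\<phi> x + \<phi> y)"
    and ab: "frag_coset (eval_ker G) a = frag_coset (eval_ker G) b"
  shows "frag_coset K (frag_extend \<phi> a) = frag_coset K (frag_extend \<phi> b)"
proof -
  have \<phi>0: "frag_coset K (\<phi> \<zero>) = frag_coset K 0"
    using \<phi>[of \<zero> \<zero>] add_subgroupD(3)[OF K, of "- \<phi> \<zero>"] by (simp add: frag_coset_eq_iff[OF K])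
  have ev: "frag_eval G (\<lambda>x. x) r \<in> carrier G \<and> frag_coset K (frag_extend \<phi> r) = frag_coset K (\<phi> (frag_eval G (\<lambda>x. x) r))"
    if "Poly_Mapping.keys r \<subseteq> carrier G" for r
    using that
  proof (rule free_Abelian_group_induct)
    fix x y :: "'a \<Rightarrow>\<^sub>0 int"
    assume kx: "Poly_Mapping.keys x \<subseteq> carrier G" and ky: "Poly_Mapping.keys y \<subseteq> carrier G"
      and x: "frag_eval G (\<lambda>x. x) x \<in> carrier G \<and> frag_coset K (frag_extend \<phi> x) = frag_coset K (\<phi> (frag_eval G (\<lambda>x. x) x))"
      and y: "frag_eval G (\<lambda>x. x) y \<in> carrier G \<and> frag_coset K (frag_extend \<phi> y) = frag_coset K (\<phi> (frag_eval G (\<lambda>x. x) y))"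
    let ?x = "frag_eval G (\<lambda>x. x) x" and ?y = "frag_eval G (\<lambda>x. x) y"
    have "frag_eval G (\<lambda>x. x) (- y) = \<ominus> ?y"
      using ky by (intro frag_eval_minus) auto
    then have e: "frag_eval G (\<lambda>x. x) (x - y) = ?x \<ominus> ?y"
      using kx ky frag_eval_add[of x "- y" "\<lambda>x. x"] by (auto simp: a_minus_def)
    have "frag_coset K (\<phi> ((?x \<ominus> ?y) \<oplus> ?y)) = frag_coset K (\<phi> (?x \<ominus> ?y) + \<phi> ?y)"
      using x y by (intro \<phi>) auto
    moreover have "(?x \<ominus> ?y) \<oplus> ?y = ?x"
      using x y by (simp add: a_minus_def a_assoc l_neg)
    ultimately have "frag_coset K (\<phi> ?x - \<phi> ?y) = frag_coset K (\<phi> (?x \<ominus> ?y) + \<phi> ?y - \<phi> ?y)"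
      by (intro frag_coset_diff[OF K]) auto
    moreover have "frag_coset K (frag_extend \<phi> x - frag_extend \<phi> y) = frag_coset K (\<phi> ?x - \<phi> ?y)"
      using x y by (intro frag_coset_diff[OF K]) auto
    ultimately show "frag_eval G (\<lambda>x. x) (x - y) \<in> carrier G \<and>
        frag_coset K (frag_extend \<phi> (x - y)) = frag_coset K (\<phi> (frag_eval G (\<lambda>x. x) (x - y)))"
      using x y by (simp add: e frag_extend_diff)
  qed (auto simp: \<phi>0)
  have "a - b \<in> eval_ker G"
    using ab by (simp add: frag_coset_eq_iff[OF add_subgroup_eval_ker])
  then have "frag_coset K (frag_extend \<phi> (a - b)) = frag_coset K 0"
    using ev[of "a - b"] \<phi>0 by (simp add: eval_ker_def)
  then show ?thesis
    by (simp add: frag_coset_eq_iff[OF K] frag_extend_diff)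
qed

lemma (in abelian_group) eval_ker_eqI:
  assumes "x \<in> carrier G" "y \<in> carrier G" "frag_coset (eval_ker G) (frag_of x) = frag_coset (eval_ker G) (frag_of y)"
  shows "x = y"
  using assms frag_of_eval_ker by simp

context connected_quiver
begin

section \<open>Bimodules over the preprojective algebra\<close>

lemma ring_tensor_algebra: "ring (tensor_algebra Q :: ('v, 'e + 'e, 'f::field) pelem ring)"
  by (rule dq.ring_path_algebra)

lemma relations_closed: "relations Q \<subseteq> (carrier (tensor_algebra Q) :: ('v, 'e + 'e, 'f::field) pelem set)"
proof
  fix x :: "('v, 'e + 'e, 'f) pelem" assume "x \<in> relations Q"
  then have "x \<in> koszul_W Q 2" by (simp add: koszul_W_2)
  then show "x \<in> carrier (tensor_algebra Q)" by (simp add: koszul_W_closed)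
qed

lemma cls_hom: "cls Q \<in> ring_hom (tensor_algebra Q :: ('v, 'e + 'e, 'f::field) pelem ring) (preproj Q)"
proof -
  interpret T: ring "tensor_algebra Q :: ('v, 'e + 'e, 'f) pelem ring" by (rule ring_tensor_algebra)
  interpret J: ideal "genideal (tensor_algebra Q) (relations Q) :: ('v, 'e + 'e, 'f) pelem set"
    "tensor_algebra Q :: ('v, 'e + 'e, 'f) pelem ring"
    using relations_closed by (rule T.genideal_ideal)
  show ?thesis
    using J.rcos_ring_hom unfolding preproj_def cls_def[abs_def] by simp
qed

lemma cls_simps:
  fixes x y :: "('v, 'e + 'e, 'f::field) pelem"
  shows "Poly_Mapping.keys x \<subseteq> paths D \<Longrightarrow> cls Q x \<in> carrier (preproj Q)"
    and "Poly_Mapping.keys x \<subseteq> paths D \<Longrightarrow> Poly_Mapping.keys y \<subseteq> paths D \<Longrightarrow> cls Q (x + y) = cls Q x \<oplus>\<^bsub>preproj Q\<^esub> cls Q y"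
    and "Poly_Mapping.keys x \<subseteq> paths D \<Longrightarrow> Poly_Mapping.keys y \<subseteq> paths D \<Longrightarrow> cls Q (x \<star> y) = cls Q x \<otimes>\<^bsub>preproj Q\<^esub> cls Q y"
    and "cls Q (\<one>\<^bsub>tensor_algebra Q\<^esub> :: ('v, 'e + 'e, 'f) pelem) = \<one>\<^bsub>preproj Q\<^esub>"
  using cls_hom[unfolded ring_hom_def, where 'f = 'f] by auto

lemma cls_surj:
  assumes "a \<in> carrier (preproj Q)"
  obtains x :: "('v, 'e + 'e, 'f::field) pelem" where "Poly_Mapping.keys x \<subseteq> paths D" "a = cls Q x"
  using assms by (auto simp: preproj_def FactRing_def A_RCOSETS_def' cls_def)

lemma cls_relation: "r \<in> relations Q \<Longrightarrow> cls Q r = \<zero>\<^bsub>preproj Q\<^esub>"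
  for r :: "('v, 'e + 'e, 'f::field) pelem"
proof -
  assume r: "r \<in> relations Q"
  interpret T: ring "tensor_algebra Q :: ('v, 'e + 'e, 'f) pelem ring" by (rule ring_tensor_algebra)
  interpret J: ideal "genideal (tensor_algebra Q) (relations Q) :: ('v, 'e + 'e, 'f) pelem set"
    "tensor_algebra Q :: ('v, 'e + 'e, 'f) pelem ring"
    using relations_closed by (rule T.genideal_ideal)
  have "r \<in> genideal (tensor_algebra Q) (relations Q)"
    using T.genideal_self[OF relations_closed] r by blast
  then show ?thesis
    by (simp add: cls_def preproj_def FactRing_def J.a_rcos_const)
qed

lemma scalar_keys: "Poly_Mapping.keys (pscale c \<one>\<^bsub>tensor_algebra Q\<^esub> :: ('v, 'e + 'e, 'f::field) pelem) \<subseteq> paths D"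
  using base_scalar[of c] dq.path_degD by blast

lemma base_keys: "c \<in> base_k Q \<Longrightarrow> Poly_Mapping.keys c \<subseteq> paths D"
  by (rule dq.path_degD)

lemma scalar_comm:
  fixes x :: "('v, 'e + 'e, 'f::field) pelem"
  assumes "Poly_Mapping.keys x \<subseteq> paths D"
  shows "scalar Q c \<otimes>\<^bsub>preproj Q\<^esub> cls Q x = cls Q (pscale c x)" "cls Q x \<otimes>\<^bsub>preproj Q\<^esub> scalar Q c = cls Q (pscale c x)"
  by (simp_all only: scalar_def pscale_eq_mult(1)[OF assms] cls_simps(3)[OF scalar_keys assms])
    (simp only: cls_simps(3)[OF assms scalar_keys, symmetric] pscale_eq_mult[OF assms, symmetric]
      cls_simps(3)[OF scalar_keys assms, symmetric])

context
  fixes M :: "(('v, 'e + 'e, 'f::field) pelem set, 'm) bimodule"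
  assumes M: "preproj_bimodule Q M"
begin

lemma bimodule_M: "bimodule (preproj Q) M"
  using M by (simp add: preproj_bimodule_def)

lemma abelian_M: "abelian_group M"
  using bimodule_M by (simp add: bimodule_def)

interpretation Mg: abelian_group M by (rule abelian_M)

interpretation bm: bimodule "preproj Q" M by (rule bimodule_M)

lemma act_simps:
  fixes x y :: "('v, 'e + 'e, 'f) pelem"
  shows "Poly_Mapping.keys x \<subseteq> paths D \<Longrightarrow> m \<in> carrier M \<Longrightarrow> cls Q x \<odot>\<^bsub>M\<^esub> m \<in> carrier M"
    and "Poly_Mapping.keys x \<subseteq> paths D \<Longrightarrow> m \<in> carrier M \<Longrightarrow> m \<oslash>\<^bsub>M\<^esub> cls Q x \<in> carrier M"
    and "Poly_Mapping.keys x \<subseteq> paths D \<Longrightarrow> m \<in> carrier M \<Longrightarrow> m' \<in> carrier M \<Longrightarrow>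
      cls Q x \<odot>\<^bsub>M\<^esub> (m \<oplus>\<^bsub>M\<^esub> m') = (cls Q x \<odot>\<^bsub>M\<^esub> m) \<oplus>\<^bsub>M\<^esub> (cls Q x \<odot>\<^bsub>M\<^esub> m')"
    and "Poly_Mapping.keys x \<subseteq> paths D \<Longrightarrow> m \<in> carrier M \<Longrightarrow> m' \<in> carrier M \<Longrightarrow>
      (m \<oplus>\<^bsub>M\<^esub> m') \<oslash>\<^bsub>M\<^esub> cls Q x = (m \<oslash>\<^bsub>M\<^esub> cls Q x) \<oplus>\<^bsub>M\<^esub> (m' \<oslash>\<^bsub>M\<^esub> cls Q x)"
    and "Poly_Mapping.keys x \<subseteq> paths D \<Longrightarrow> Poly_Mapping.keys y \<subseteq> paths D \<Longrightarrow> m \<in> carrier M \<Longrightarrow>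
      cls Q (x + y) \<odot>\<^bsub>M\<^esub> m = (cls Q x \<odot>\<^bsub>M\<^esub> m) \<oplus>\<^bsub>M\<^esub> (cls Q y \<odot>\<^bsub>M\<^esub> m)"
    and "Poly_Mapping.keys x \<subseteq> paths D \<Longrightarrow> Poly_Mapping.keys y \<subseteq> paths D \<Longrightarrow> m \<in> carrier M \<Longrightarrow>
      m \<oslash>\<^bsub>M\<^esub> cls Q (x + y) = (m \<oslash>\<^bsub>M\<^esub> cls Q x) \<oplus>\<^bsub>M\<^esub> (m \<oslash>\<^bsub>M\<^esub> cls Q y)"
    and "Poly_Mapping.keys x \<subseteq> paths D \<Longrightarrow> Poly_Mapping.keys y \<subseteq> paths D \<Longrightarrow> m \<in> carrier M \<Longrightarrow>
      cls Q (x \<star> y) \<odot>\<^bsub>M\<^esub> m = cls Q x \<odot>\<^bsub>M\<^esub> (cls Q y \<odot>\<^bsub>M\<^esub> m)"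
    and "Poly_Mapping.keys x \<subseteq> paths D \<Longrightarrow> Poly_Mapping.keys y \<subseteq> paths D \<Longrightarrow> m \<in> carrier M \<Longrightarrow>
      m \<oslash>\<^bsub>M\<^esub> cls Q (x \<star> y) = (m \<oslash>\<^bsub>M\<^esub> cls Q x) \<oslash>\<^bsub>M\<^esub> cls Q y"
    and "Poly_Mapping.keys x \<subseteq> paths D \<Longrightarrow> Poly_Mapping.keys y \<subseteq> paths D \<Longrightarrow> m \<in> carrier M \<Longrightarrow>
      (cls Q x \<odot>\<^bsub>M\<^esub> m) \<oslash>\<^bsub>M\<^esub> cls Q y = cls Q x \<odot>\<^bsub>M\<^esub> (m \<oslash>\<^bsub>M\<^esub> cls Q y)"
    and "m \<in> carrier M \<Longrightarrow> cls Q \<one>\<^bsub>tensor_algebra Q\<^esub> \<odot>\<^bsub>M\<^esub> m = m"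
    and "m \<in> carrier M \<Longrightarrow> m \<oslash>\<^bsub>M\<^esub> cls Q \<one>\<^bsub>tensor_algebra Q\<^esub> = m"
  by (simp_all add: cls_simps bm.lact_closed bm.ract_closed bm.lact_r_distr bm.ract_l_distr
      bm.lact_l_distr bm.ract_r_distr bm.lact_assoc bm.ract_assoc bm.lact_ract bm.lact_one bm.ract_one)

lemma scalar_act:
  "m \<in> carrier M \<Longrightarrow> scalar Q c \<odot>\<^bsub>M\<^esub> m \<in> carrier M"
  "m \<in> carrier M \<Longrightarrow> m \<oslash>\<^bsub>M\<^esub> scalar Q c = scalar Q c \<odot>\<^bsub>M\<^esub> m"
  using M scalar_keys[of c] act_simps(1,2) by (auto simp: preproj_bimodule_def scalar_def)

lemma act_zero:
  fixes x :: "('v, 'e + 'e, 'f) pelem"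
  assumes "Poly_Mapping.keys x \<subseteq> paths D"
  shows "cls Q x \<odot>\<^bsub>M\<^esub> \<zero>\<^bsub>M\<^esub> = \<zero>\<^bsub>M\<^esub>" "\<zero>\<^bsub>M\<^esub> \<oslash>\<^bsub>M\<^esub> cls Q x = \<zero>\<^bsub>M\<^esub>"
proof -
  have "(cls Q x \<odot>\<^bsub>M\<^esub> \<zero>\<^bsub>M\<^esub>) \<oplus>\<^bsub>M\<^esub> (cls Q x \<odot>\<^bsub>M\<^esub> \<zero>\<^bsub>M\<^esub>) = cls Q x \<odot>\<^bsub>M\<^esub> \<zero>\<^bsub>M\<^esub>"
    using act_simps(3)[OF assms Mg.zero_closed Mg.zero_closed] by simp
  then show "cls Q x \<odot>\<^bsub>M\<^esub> \<zero>\<^bsub>M\<^esub> = \<zero>\<^bsub>M\<^esub>"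
    using act_simps(1)[OF assms Mg.zero_closed] by (metis Mg.add.r_cancel_one')
  have "(\<zero>\<^bsub>M\<^esub> \<oslash>\<^bsub>M\<^esub> cls Q x) \<oplus>\<^bsub>M\<^esub> (\<zero>\<^bsub>M\<^esub> \<oslash>\<^bsub>M\<^esub> cls Q x) = \<zero>\<^bsub>M\<^esub> \<oslash>\<^bsub>M\<^esub> cls Q x"
    using act_simps(4)[OF assms Mg.zero_closed Mg.zero_closed] by simp
  then show "\<zero>\<^bsub>M\<^esub> \<oslash>\<^bsub>M\<^esub> cls Q x = \<zero>\<^bsub>M\<^esub>"
    using act_simps(2)[OF assms Mg.zero_closed] by (metis Mg.add.r_cancel_one')
qed

lemma act_minus:
  fixes x :: "('v, 'e + 'e, 'f) pelem"
  assumes "Poly_Mapping.keys x \<subseteq> paths D" "m \<in> carrier M"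
  shows "cls Q x \<odot>\<^bsub>M\<^esub> (\<ominus>\<^bsub>M\<^esub> m) = \<ominus>\<^bsub>M\<^esub> (cls Q x \<odot>\<^bsub>M\<^esub> m)" "(\<ominus>\<^bsub>M\<^esub> m) \<oslash>\<^bsub>M\<^esub> cls Q x = \<ominus>\<^bsub>M\<^esub> (m \<oslash>\<^bsub>M\<^esub> cls Q x)"
proof -
  have "(cls Q x \<odot>\<^bsub>M\<^esub> (\<ominus>\<^bsub>M\<^esub> m)) \<oplus>\<^bsub>M\<^esub> (cls Q x \<odot>\<^bsub>M\<^esub> m) = \<zero>\<^bsub>M\<^esub>"
    using assms by (simp add: Mg.l_neg act_zero flip: act_simps(3))
  then show "cls Q x \<odot>\<^bsub>M\<^esub> (\<ominus>\<^bsub>M\<^esub> m) = \<ominus>\<^bsub>M\<^esub> (cls Q x \<odot>\<^bsub>M\<^esub> m)"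
    using assms by (simp add: Mg.minus_equality act_simps(1))
  have "((\<ominus>\<^bsub>M\<^esub> m) \<oslash>\<^bsub>M\<^esub> cls Q x) \<oplus>\<^bsub>M\<^esub> (m \<oslash>\<^bsub>M\<^esub> cls Q x) = \<zero>\<^bsub>M\<^esub>"
    using assms by (simp add: Mg.l_neg act_zero flip: act_simps(4))
  then show "(\<ominus>\<^bsub>M\<^esub> m) \<oslash>\<^bsub>M\<^esub> cls Q x = \<ominus>\<^bsub>M\<^esub> (m \<oslash>\<^bsub>M\<^esub> cls Q x)"
    using assms by (simp add: Mg.minus_equality act_simps(2))
qed

lemma zero_act: "m \<in> carrier M \<Longrightarrow> \<zero>\<^bsub>preproj Q\<^esub> \<odot>\<^bsub>M\<^esub> m = \<zero>\<^bsub>M\<^esub>" "m \<in> carrier M \<Longrightarrow> m \<oslash>\<^bsub>M\<^esub> \<zero>\<^bsub>preproj Q\<^esub> = \<zero>\<^bsub>M\<^esub>"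
proof -
  assume m: "m \<in> carrier M"
  show "\<zero>\<^bsub>preproj Q\<^esub> \<odot>\<^bsub>M\<^esub> m = \<zero>\<^bsub>M\<^esub>"
    using bm.lact_l_distr[of "\<zero>\<^bsub>preproj Q\<^esub>" "\<zero>\<^bsub>preproj Q\<^esub>" m] bm.lact_closed[of "\<zero>\<^bsub>preproj Q\<^esub>" m] m
    by (metis Mg.add.r_cancel_one' bm.R.r_zero bm.R.zero_closed)
  show "m \<oslash>\<^bsub>M\<^esub> \<zero>\<^bsub>preproj Q\<^esub> = \<zero>\<^bsub>M\<^esub>"
    using bm.ract_r_distr[of "\<zero>\<^bsub>preproj Q\<^esub>" "\<zero>\<^bsub>preproj Q\<^esub>" m] bm.ract_closed[of "\<zero>\<^bsub>preproj Q\<^esub>" m] m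
    by (metis Mg.add.r_cancel_one' bm.R.r_zero bm.R.zero_closed)
qed

lemma scalar_cls_comm:
  fixes x :: "('v, 'e + 'e, 'f) pelem"
  assumes "Poly_Mapping.keys x \<subseteq> paths D" "m \<in> carrier M"
  shows "scalar Q c \<odot>\<^bsub>M\<^esub> (cls Q x \<odot>\<^bsub>M\<^esub> m) = cls Q x \<odot>\<^bsub>M\<^esub> (scalar Q c \<odot>\<^bsub>M\<^esub> m)"
    and "scalar Q c \<odot>\<^bsub>M\<^esub> (m \<oslash>\<^bsub>M\<^esub> cls Q x) = (scalar Q c \<odot>\<^bsub>M\<^esub> m) \<oslash>\<^bsub>M\<^esub> cls Q x"
    and "scalar Q c \<odot>\<^bsub>M\<^esub> (cls Q x \<odot>\<^bsub>M\<^esub> m) = cls Q (pscale c x) \<odot>\<^bsub>M\<^esub> m"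
  using assms scalar_keys[of c] scalar_comm[OF assms(1), of c]
  by (simp_all add: scalar_def act_simps bm.lact_assoc[symmetric] cls_simps)

lemma scalar_distrib:
  assumes "m \<in> carrier M"
  shows "m' \<in> carrier M \<Longrightarrow> scalar Q c \<odot>\<^bsub>M\<^esub> (m \<oplus>\<^bsub>M\<^esub> m') = (scalar Q c \<odot>\<^bsub>M\<^esub> m) \<oplus>\<^bsub>M\<^esub> (scalar Q c \<odot>\<^bsub>M\<^esub> m')"
    and "scalar Q (c + d) \<odot>\<^bsub>M\<^esub> m = (scalar Q c \<odot>\<^bsub>M\<^esub> m) \<oplus>\<^bsub>M\<^esub> (scalar Q d \<odot>\<^bsub>M\<^esub> m)"
    and "scalar Q (c * d) \<odot>\<^bsub>M\<^esub> m = scalar Q c \<odot>\<^bsub>M\<^esub> (scalar Q d \<odot>\<^bsub>M\<^esub> m)"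
    and "scalar Q 1 \<odot>\<^bsub>M\<^esub> m = m"
    and "scalar Q 0 \<odot>\<^bsub>M\<^esub> m = \<zero>\<^bsub>M\<^esub>"
    and "scalar Q c \<odot>\<^bsub>M\<^esub> \<zero>\<^bsub>M\<^esub> = \<zero>\<^bsub>M\<^esub>"
    and "scalar Q c \<odot>\<^bsub>M\<^esub> (\<ominus>\<^bsub>M\<^esub> m) = \<ominus>\<^bsub>M\<^esub> (scalar Q c \<odot>\<^bsub>M\<^esub> m)"
proof -
  note k = scalar_keys[where 'f = 'f]
  show "m' \<in> carrier M \<Longrightarrow> scalar Q c \<odot>\<^bsub>M\<^esub> (m \<oplus>\<^bsub>M\<^esub> m') = (scalar Q c \<odot>\<^bsub>M\<^esub> m) \<oplus>\<^bsub>M\<^esub> (scalar Q c \<odot>\<^bsub>M\<^esub> m')"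
    using assms k by (simp add: scalar_def act_simps)
  show "scalar Q (c + d) \<odot>\<^bsub>M\<^esub> m = (scalar Q c \<odot>\<^bsub>M\<^esub> m) \<oplus>\<^bsub>M\<^esub> (scalar Q d \<odot>\<^bsub>M\<^esub> m)"
    using assms k by (simp add: scalar_def pelem.scale_left_distrib act_simps)
  show "scalar Q (c * d) \<odot>\<^bsub>M\<^esub> m = scalar Q c \<odot>\<^bsub>M\<^esub> (scalar Q d \<odot>\<^bsub>M\<^esub> m)"
    using assms k scalar_cls_comm(3)[OF k assms, of c d] by (simp add: scalar_def)
  show "scalar Q 1 \<odot>\<^bsub>M\<^esub> m = m"
    using assms by (simp add: scalar_def act_simps)
  have "cls Q (0 :: ('v, 'e + 'e, 'f) pelem) = \<zero>\<^bsub>preproj Q\<^esub>"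
    by (rule cls_relation) (simp add: relations_def pelem.span_zero)
  then show "scalar Q 0 \<odot>\<^bsub>M\<^esub> m = \<zero>\<^bsub>M\<^esub>"
    using assms by (simp add: scalar_def zero_act)
  show "scalar Q c \<odot>\<^bsub>M\<^esub> \<zero>\<^bsub>M\<^esub> = \<zero>\<^bsub>M\<^esub>" "scalar Q c \<odot>\<^bsub>M\<^esub> (\<ominus>\<^bsub>M\<^esub> m) = \<ominus>\<^bsub>M\<^esub> (scalar Q c \<odot>\<^bsub>M\<^esub> m)"
    using assms k by (simp_all add: scalar_def act_zero act_minus)
qed

section \<open>Sums over decompositions in a bimodule\<close>

lemma list_msum_simps:
  "list_msum M g [] = \<zero>\<^bsub>M\<^esub>" "list_msum M g (x # xs) = g x \<oplus>\<^bsub>M\<^esub> list_msum M g xs"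
  by (simp_all add: list_msum_def)

lemma list_msum_add:
  assumes "\<And>x. x \<in> set xs \<Longrightarrow> g x \<in> carrier M \<and> h x \<in> carrier M"
  shows "list_msum M (\<lambda>x. g x \<oplus>\<^bsub>M\<^esub> h x) xs = list_msum M g xs \<oplus>\<^bsub>M\<^esub> list_msum M h xs"
  using assms Mg.list_msum_closed[of _ g] Mg.list_msum_closed[of _ h]
  by (induction xs) (auto simp: list_msum_simps Mg.a_ac)

lemma list_msum_act:
  fixes x :: "('v, 'e + 'e, 'f) pelem"
  assumes "Poly_Mapping.keys x \<subseteq> paths D" "\<And>y. y \<in> set xs \<Longrightarrow> g y \<in> carrier M"
  shows "cls Q x \<odot>\<^bsub>M\<^esub> list_msum M g xs = list_msum M (\<lambda>y. cls Q x \<odot>\<^bsub>M\<^esub> g y) xs"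
    and "list_msum M g xs \<oslash>\<^bsub>M\<^esub> cls Q x = list_msum M (\<lambda>y. g y \<oslash>\<^bsub>M\<^esub> cls Q x) xs"
  using assms(2) Mg.list_msum_closed[of _ g]
  by (induction xs) (auto simp: list_msum_simps act_zero act_simps assms(1))

lemma list_msum_cong: "(\<And>x. x \<in> set xs \<Longrightarrow> g x = h x) \<Longrightarrow> list_msum M g xs = list_msum M h xs"
  by (induction xs) (auto simp: list_msum_simps)

text \<open>The version of \<open>balanced\<close> with values in M itself;
  \<open>mbalanced_balanced\<close> reduces it to the case of formal sums modulo
  \<open>eval_ker M\<close>.\<close>

definition mbalanced ::
  "int \<Rightarrow> int \<Rightarrow> (('v, 'e + 'e, 'f) pelem \<Rightarrow> ('v, 'e + 'e, 'f) pelem \<Rightarrow> 'm) \<Rightarrow> bool" where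
  "mbalanced p q \<Psi> \<longleftrightarrow>
     (\<forall>u\<in>koszul_W Q p. \<forall>v\<in>koszul_W Q q. \<Psi> u v \<in> carrier M) \<and>
     (\<forall>u\<in>koszul_W Q p. \<forall>u'\<in>koszul_W Q p. \<forall>v\<in>koszul_W Q q. \<Psi> (u + u') v = \<Psi> u v \<oplus>\<^bsub>M\<^esub> \<Psi> u' v) \<and>
     (\<forall>u\<in>koszul_W Q p. \<forall>v\<in>koszul_W Q q. \<forall>v'\<in>koszul_W Q q. \<Psi> u (v + v') = \<Psi> u v \<oplus>\<^bsub>M\<^esub> \<Psi> u v') \<and>
     (\<forall>u\<in>koszul_W Q p. \<forall>c\<in>base_k Q. \<forall>v\<in>koszul_W Q q. \<Psi> (u \<star> c) v = \<Psi> u (c \<star> v))"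

lemma mbalanced_balanced:
  assumes "mbalanced p q \<Psi>"
  shows "balanced (eval_ker M) p q (\<lambda>u v. frag_of (\<Psi> u v))"
  using assms unfolding balanced_def mbalanced_def by (auto simp: Mg.eval_ker_add)

context
  fixes p q :: int and \<Psi> :: "('v, 'e + 'e, 'f) pelem \<Rightarrow> ('v, 'e + 'e, 'f) pelem \<Rightarrow> 'm"
  assumes \<Psi>: "mbalanced p q \<Psi>" and pq: "p \<ge> 0" "q \<ge> 0"
begin

lemma msum_closed:
  assumes "set ps \<subseteq> koszul_W Q p \<times> koszul_W Q q"
  shows "list_msum M (\<lambda>(u, v). \<Psi> u v) ps \<in> carrier M"
  using assms \<Psi> by (intro Mg.list_msum_closed) (auto simp: mbalanced_def)

lemma msum_eval:
  assumes "set ps \<subseteq> koszul_W Q p \<times> koszul_W Q q"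
  shows "frag_coset (eval_ker M) (frag_of (list_msum M (\<lambda>(u, v). \<Psi> u v) ps)) =
    frag_coset (eval_ker M) (\<Sum>(u, v)\<leftarrow>ps. frag_of (\<Psi> u v))"
proof -
  have "frag_coset (eval_ker M) (frag_of (list_msum M (\<lambda>(u, v). \<Psi> u v) ps)) =
    frag_coset (eval_ker M) (\<Sum>x\<leftarrow>ps. frag_of (case x of (u, v) \<Rightarrow> \<Psi> u v))"
    using assms \<Psi> by (intro Mg.eval_ker_list_msum) (auto simp: mbalanced_def)
  then show ?thesis by (simp add: case_prod_unfold)
qed

lemma msplit_closed: "w \<in> koszul_W Q (p + q) \<Longrightarrow> list_msum M (\<lambda>(u, v). \<Psi> u v) (split Q p q w) \<in> carrier M"
  by (intro msum_closed split_decomposition pq)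

lemma msplit_eq_list:
  assumes "set ps \<subseteq> koszul_W Q p \<times> koszul_W Q q" "(\<Sum>(u, v)\<leftarrow>ps. u \<star> v) = w" "w \<in> koszul_W Q (p + q)"
  shows "list_msum M (\<lambda>(u, v). \<Psi> u v) (split Q p q w) = list_msum M (\<lambda>(u, v). \<Psi> u v) ps"
proof (rule Mg.eval_ker_eqI)
  show "frag_coset (eval_ker M) (frag_of (list_msum M (\<lambda>(u, v). \<Psi> u v) (split Q p q w))) =
    frag_coset (eval_ker M) (frag_of (list_msum M (\<lambda>(u, v). \<Psi> u v) ps))"
    using split_eq_list[OF Mg.add_subgroup_eval_ker mbalanced_balanced[OF \<Psi>] pq assms] assms
    by (simp add: msum_eval split_decomposition pq)
qed (use assms in \<open>auto intro!: msum_closed msplit_closed\<close>)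

lemma msplit_add:
  assumes "w \<in> koszul_W Q (p + q)" "w' \<in> koszul_W Q (p + q)"
  shows "list_msum M (\<lambda>(u, v). \<Psi> u v) (split Q p q (w + w')) =
    list_msum M (\<lambda>(u, v). \<Psi> u v) (split Q p q w) \<oplus>\<^bsub>M\<^esub> list_msum M (\<lambda>(u, v). \<Psi> u v) (split Q p q w')"
proof (rule Mg.eval_ker_eqI)
  have "frag_coset (eval_ker M) (frag_of (list_msum M (\<lambda>(u, v). \<Psi> u v) (split Q p q (w + w')))) =
      frag_coset (eval_ker M) ((\<Sum>(u, v)\<leftarrow>split Q p q w. frag_of (\<Psi> u v)) + (\<Sum>(u, v)\<leftarrow>split Q p q w'. frag_of (\<Psi> u v)))"
    using split_add[OF Mg.add_subgroup_eval_ker mbalanced_balanced[OF \<Psi>] pq assms] assms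
    by (simp add: msum_eval split_decomposition pq koszul_W_closed)
  also have "\<dots> = frag_coset (eval_ker M) (frag_of (list_msum M (\<lambda>(u, v). \<Psi> u v) (split Q p q w)) +
      frag_of (list_msum M (\<lambda>(u, v). \<Psi> u v) (split Q p q w')))"
    using assms by (intro frag_coset_add[OF Mg.add_subgroup_eval_ker] msum_eval[symmetric] split_decomposition pq)
  also have "\<dots> = frag_coset (eval_ker M) (frag_of (list_msum M (\<lambda>(u, v). \<Psi> u v) (split Q p q w) \<oplus>\<^bsub>M\<^esub>
      list_msum M (\<lambda>(u, v). \<Psi> u v) (split Q p q w')))"
    using assms by (intro Mg.eval_ker_add[symmetric] msplit_closed)
  finally show "frag_coset (eval_ker M) (frag_of (list_msum M (\<lambda>(u, v). \<Psi> u v) (split Q p q (w + w')))) = \<dots>" .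
qed (use assms in \<open>auto intro!: msplit_closed koszul_W_closed\<close>)

lemma msplit_bimod:
  assumes w: "w \<in> koszul_W Q (p + q)" and cd: "c \<in> base_k Q" "d \<in> base_k Q"
    and bi: "\<And>u v. u \<in> koszul_W Q p \<Longrightarrow> v \<in> koszul_W Q q \<Longrightarrow>
      \<Psi> (c \<star> u) (v \<star> d) = (cls Q c \<odot>\<^bsub>M\<^esub> \<Psi> u v) \<oslash>\<^bsub>M\<^esub> cls Q d"
  shows "list_msum M (\<lambda>(u, v). \<Psi> u v) (split Q p q (c \<star> w \<star> d)) =
    (cls Q c \<odot>\<^bsub>M\<^esub> list_msum M (\<lambda>(u, v). \<Psi> u v) (split Q p q w)) \<oslash>\<^bsub>M\<^esub> cls Q d"
proof -
  note sp = split_decomposition[OF pq w]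
  have cl: "(case x of (u, v) \<Rightarrow> \<Psi> u v) \<in> carrier M" if "x \<in> set (split Q p q w)" for x
    using \<Psi> sp that by (auto simp: mbalanced_def)
  have "(\<Sum>(u, v)\<leftarrow>ps. c \<star> u \<star> (v \<star> d)) = c \<star> (\<Sum>(u, v)\<leftarrow>ps. u \<star> v) \<star> d" for ps
    by (induction ps) (auto simp: path_mult_add_left path_mult_add_right path_mult_assoc)
  then have "list_msum M (\<lambda>(u, v). \<Psi> u v) (split Q p q (c \<star> w \<star> d)) =
      list_msum M (\<lambda>(u, v). \<Psi> u v) (map (\<lambda>(u, v). (c \<star> u, v \<star> d)) (split Q p q w))"
    using sp w cd koszul_W_closed(4,5)
    by (intro msplit_eq_list) (fastforce simp: comp_def case_prod_unfold)+
  also have "\<dots> = list_msum M (\<lambda>(u, v). \<Psi> (c \<star> u) (v \<star> d)) (split Q p q w)"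
    by (simp add: list_msum_def foldr_map comp_def case_prod_unfold)
  also have "\<dots> = list_msum M (\<lambda>x. (cls Q c \<odot>\<^bsub>M\<^esub> (case x of (u, v) \<Rightarrow> \<Psi> u v)) \<oslash>\<^bsub>M\<^esub> cls Q d) (split Q p q w)"
    using sp bi by (intro list_msum_cong) auto
  also have "\<dots> = (cls Q c \<odot>\<^bsub>M\<^esub> list_msum M (\<lambda>(u, v). \<Psi> u v) (split Q p q w)) \<oslash>\<^bsub>M\<^esub> cls Q d"
  proof -
    have "cls Q c \<odot>\<^bsub>M\<^esub> list_msum M (\<lambda>(u, v). \<Psi> u v) (split Q p q w) =
        list_msum M (\<lambda>x. cls Q c \<odot>\<^bsub>M\<^esub> (case x of (u, v) \<Rightarrow> \<Psi> u v)) (split Q p q w)"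
      by (rule list_msum_act(1)[OF base_keys[OF cd(1)] cl])
    moreover have "list_msum M (\<lambda>x. cls Q c \<odot>\<^bsub>M\<^esub> (case x of (u, v) \<Rightarrow> \<Psi> u v)) (split Q p q w) \<oslash>\<^bsub>M\<^esub> cls Q d =
        list_msum M (\<lambda>x. (cls Q c \<odot>\<^bsub>M\<^esub> (case x of (u, v) \<Rightarrow> \<Psi> u v)) \<oslash>\<^bsub>M\<^esub> cls Q d) (split Q p q w)"
      by (rule list_msum_act(2)[OF base_keys[OF cd(2)] act_simps(1)[OF base_keys[OF cd(1)] cl]])
    ultimately show ?thesis by simp
  qed
  finally show ?thesis .
qed

end

end

end

section \<open>Koszul cochains\<close>

lemma (in abelian_group) sgn_diff_add:
  assumes "a \<in> carrier G" "a' \<in> carrier G" "b \<in> carrier G" "b' \<in> carrier G"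
  shows "(a \<oplus> a') \<ominus> [sgn_pow p] \<cdot> (b \<oplus> b') = (a \<ominus> [sgn_pow p] \<cdot> b) \<oplus> (a' \<ominus> [sgn_pow p] \<cdot> b')"
  using assms by (auto simp: add_pow_sgn a_minus_def minus_add a_ac)

lemma (in abelian_group) sgn_diff_closed:
  "a \<in> carrier G \<Longrightarrow> b \<in> carrier G \<Longrightarrow> a \<ominus> [sgn_pow p] \<cdot> b \<in> carrier G"
  by (auto simp: add_pow_sgn)

lemma ring_of_type_simps:
  fixes x y :: "'f::field"
  shows "carrier (ring_of_type_algebra :: 'f ring) = UNIV"
    and "x \<oplus>\<^bsub>ring_of_type_algebra\<^esub> y = x + y"
    and "x \<otimes>\<^bsub>ring_of_type_algebra\<^esub> y = x * y" "\<one>\<^bsub>ring_of_type_algebra :: 'f ring\<^esub> = 1"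
  by (simp_all add: ring_of_type_algebra_def)

context connected_quiver
begin

lemma koszul_W_1_base:
  "x \<in> koszul_W Q 1 \<Longrightarrow> Poly_Mapping.keys x \<subseteq> paths D"
  for x :: "('v, 'e + 'e, 'f::field) pelem"
  by (rule koszul_W_closed)

context
  fixes M :: "(('v, 'e + 'e, 'f::field) pelem set, 'm) bimodule"
  assumes M: "preproj_bimodule Q M"
begin

interpretation Mg: abelian_group M by (rule abelian_M[OF M])

lemmas actM = act_simps[OF M]

lemma act_sgn_diff:
  fixes x :: "('v, 'e + 'e, 'f) pelem"
  assumes "Poly_Mapping.keys x \<subseteq> paths D" "a \<in> carrier M" "b \<in> carrier M"
  shows "cls Q x \<odot>\<^bsub>M\<^esub> (a \<ominus>\<^bsub>M\<^esub> [sgn_pow p] \<cdot>\<^bsub>M\<^esub> b) = (cls Q x \<odot>\<^bsub>M\<^esub> a) \<ominus>\<^bsub>M\<^esub> [sgn_pow p] \<cdot>\<^bsub>M\<^esub> (cls Q x \<odot>\<^bsub>M\<^esub> b)"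
    and "(a \<ominus>\<^bsub>M\<^esub> [sgn_pow p] \<cdot>\<^bsub>M\<^esub> b) \<oslash>\<^bsub>M\<^esub> cls Q x = (a \<oslash>\<^bsub>M\<^esub> cls Q x) \<ominus>\<^bsub>M\<^esub> [sgn_pow p] \<cdot>\<^bsub>M\<^esub> (b \<oslash>\<^bsub>M\<^esub> cls Q x)"
  using assms by (auto simp: Mg.add_pow_sgn a_minus_def actM act_minus[OF M])

lemma act_sgn:
  fixes x :: "('v, 'e + 'e, 'f) pelem"
  assumes "Poly_Mapping.keys x \<subseteq> paths D" "b \<in> carrier M"
  shows "cls Q x \<odot>\<^bsub>M\<^esub> [sgn_pow p] \<cdot>\<^bsub>M\<^esub> b = [sgn_pow p] \<cdot>\<^bsub>M\<^esub> (cls Q x \<odot>\<^bsub>M\<^esub> b)"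
    and "([sgn_pow p] \<cdot>\<^bsub>M\<^esub> b) \<oslash>\<^bsub>M\<^esub> cls Q x = [sgn_pow p] \<cdot>\<^bsub>M\<^esub> (b \<oslash>\<^bsub>M\<^esub> cls Q x)"
  using assms by (auto simp: Mg.add_pow_sgn actM act_minus[OF M])

lemma cochain_iff:
  "f \<in> carrier (koszul_cochains Q M p) \<longleftrightarrow>
     f \<in> koszul_W Q p \<rightarrow>\<^sub>E carrier M \<and>
     (\<forall>u\<in>koszul_W Q p. \<forall>v\<in>koszul_W Q p. f (u + v) = f u \<oplus>\<^bsub>M\<^esub> f v) \<and>
     (\<forall>c\<in>base_k Q. \<forall>d\<in>base_k Q. \<forall>w\<in>koszul_W Q p. f (c \<star> w \<star> d) = (cls Q c \<odot>\<^bsub>M\<^esub> f w) \<oslash>\<^bsub>M\<^esub> cls Q d)"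
  by (simp add: koszul_cochains_def)

lemma cochain_ops:
  "\<zero>\<^bsub>koszul_cochains Q M p\<^esub> = (\<lambda>w\<in>koszul_W Q p. \<zero>\<^bsub>M\<^esub>)"
  "f \<oplus>\<^bsub>koszul_cochains Q M p\<^esub> g = (\<lambda>w\<in>koszul_W Q p. f w \<oplus>\<^bsub>M\<^esub> g w)"
  "c \<odot>\<^bsub>koszul_cochains Q M p\<^esub> f = (\<lambda>w\<in>koszul_W Q p. scalar Q c \<odot>\<^bsub>M\<^esub> f w)"
  by (simp_all add: koszul_cochains_def)

lemma cochainI:
  assumes "\<And>w. w \<in> koszul_W Q p \<Longrightarrow> F w \<in> carrier M"
    and "\<And>u v. u \<in> koszul_W Q p \<Longrightarrow> v \<in> koszul_W Q p \<Longrightarrow> F (u + v) = F u \<oplus>\<^bsub>M\<^esub> F v"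
    and "\<And>c d w. c \<in> base_k Q \<Longrightarrow> d \<in> base_k Q \<Longrightarrow> w \<in> koszul_W Q p \<Longrightarrow>
      F (c \<star> w \<star> d) = (cls Q c \<odot>\<^bsub>M\<^esub> F w) \<oslash>\<^bsub>M\<^esub> cls Q d"
  shows "(\<lambda>w\<in>koszul_W Q p. F w) \<in> carrier (koszul_cochains Q M p)"
  using assms by (auto simp: cochain_iff koszul_W_closed)

text \<open>The one-sided rules put the unit of k on the other side. Linearity over the field, which
  is not part of the definition of cochains, holds because scalars come from k.\<close>

lemma cochainD:
  assumes "f \<in> carrier (koszul_cochains Q M p)"
  shows "w \<in> koszul_W Q p \<Longrightarrow> f w \<in> carrier M"
    and "u \<in> koszul_W Q p \<Longrightarrow> v \<in> koszul_W Q p \<Longrightarrow> f (u + v) = f u \<oplus>\<^bsub>M\<^esub> f v"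
    and "c \<in> base_k Q \<Longrightarrow> d \<in> base_k Q \<Longrightarrow> w \<in> koszul_W Q p \<Longrightarrow>
      f (c \<star> w \<star> d) = (cls Q c \<odot>\<^bsub>M\<^esub> f w) \<oslash>\<^bsub>M\<^esub> cls Q d"
    and "c \<in> base_k Q \<Longrightarrow> w \<in> koszul_W Q p \<Longrightarrow> f (c \<star> w) = cls Q c \<odot>\<^bsub>M\<^esub> f w"
    and "c \<in> base_k Q \<Longrightarrow> w \<in> koszul_W Q p \<Longrightarrow> f (w \<star> c) = f w \<oslash>\<^bsub>M\<^esub> cls Q c"
    and "w \<in> koszul_W Q p \<Longrightarrow> f (pscale a w) = scalar Q a \<odot>\<^bsub>M\<^esub> f w"
    and "f 0 = \<zero>\<^bsub>M\<^esub>"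
proof -
  note f = assms[unfolded cochain_iff]
  show cl: "w \<in> koszul_W Q p \<Longrightarrow> f w \<in> carrier M" for w
    using f by auto
  show ad: "u \<in> koszul_W Q p \<Longrightarrow> v \<in> koszul_W Q p \<Longrightarrow> f (u + v) = f u \<oplus>\<^bsub>M\<^esub> f v" for u v
    using f by auto
  show bi: "c \<in> base_k Q \<Longrightarrow> d \<in> base_k Q \<Longrightarrow> w \<in> koszul_W Q p \<Longrightarrow>
      f (c \<star> w \<star> d) = (cls Q c \<odot>\<^bsub>M\<^esub> f w) \<oslash>\<^bsub>M\<^esub> cls Q d" for c d w
    using f by auto
  show l: "f (c \<star> w) = cls Q c \<odot>\<^bsub>M\<^esub> f w" if "c \<in> base_k Q" "w \<in> koszul_W Q p" for c w
  proof -
    have "c \<star> w \<star> \<one>\<^bsub>tensor_algebra Q\<^esub> = c \<star> w"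
      using koszul_W_closed(6)[OF koszul_W_closed(4)[OF that]] by (rule dq.path_mult_one)
    with bi[OF that(1) dq.one_deg that(2)] show ?thesis
      using cl[OF that(2)] base_keys[OF that(1)] by (simp add: actM)
  qed
  show "f (w \<star> c) = f w \<oslash>\<^bsub>M\<^esub> cls Q c" if "c \<in> base_k Q" "w \<in> koszul_W Q p" for c w
  proof -
    have "\<one>\<^bsub>tensor_algebra Q\<^esub> \<star> w \<star> c = w \<star> c"
      using koszul_W_closed(6)[OF that(2)] by (simp add: dq.path_mult_one)
    with bi[OF dq.one_deg that] show ?thesis
      using cl[OF that(2)] base_keys[OF that(1)] by (simp add: actM)
  qed
  show "f (pscale a w) = scalar Q a \<odot>\<^bsub>M\<^esub> f w" if w: "w \<in> koszul_W Q p" for w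
    unfolding pscale_eq_mult(1)[OF koszul_W_closed(6)[OF w]] scalar_def by (rule l[OF base_scalar w])
  have 0: "(0 :: ('v, 'e + 'e, 'f) pelem) \<in> koszul_W Q p" by (rule koszul_W_closed)
  from ad[OF 0 0] cl[OF 0] show "f 0 = \<zero>\<^bsub>M\<^esub>"
    by (metis Mg.add.r_cancel_one' add_0_left)
qed

lemma cochain_eqI:
  assumes "f \<in> carrier (koszul_cochains Q M p)" "g \<in> carrier (koszul_cochains Q M p)"
    and "\<And>w. w \<in> koszul_W Q p \<Longrightarrow> f w = g w"
  shows "f = g"
  using assms unfolding cochain_iff by (metis PiE_ext)

lemma cochain_zero: "(\<lambda>w\<in>koszul_W Q p. \<zero>\<^bsub>M\<^esub>) \<in> carrier (koszul_cochains Q M p)"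
  by (rule cochainI) (auto simp: act_zero[OF M] base_keys)

lemma cochain_add:
  assumes "f \<in> carrier (koszul_cochains Q M p)" "g \<in> carrier (koszul_cochains Q M p)"
  shows "(\<lambda>w\<in>koszul_W Q p. f w \<oplus>\<^bsub>M\<^esub> g w) \<in> carrier (koszul_cochains Q M p)"
  using cochainD[OF assms(1)] cochainD[OF assms(2)]
  by (intro cochainI) (auto simp: actM base_keys Mg.a_ac)

lemma cochain_scalar:
  assumes "f \<in> carrier (koszul_cochains Q M p)"
  shows "(\<lambda>w\<in>koszul_W Q p. scalar Q c \<odot>\<^bsub>M\<^esub> f w) \<in> carrier (koszul_cochains Q M p)"
  using cochainD[OF assms]
  by (intro cochainI) (auto simp: actM base_keys scalar_act[OF M] scalar_distrib[OF M] scalar_cls_comm[OF M])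

lemma cochain_minus:
  assumes "f \<in> carrier (koszul_cochains Q M p)"
  shows "(\<lambda>w\<in>koszul_W Q p. \<ominus>\<^bsub>M\<^esub> f w) \<in> carrier (koszul_cochains Q M p)"
  using cochainD[OF assms]
  by (intro cochainI) (auto simp: actM base_keys act_minus[OF M] Mg.minus_add)

lemma module_cochains: "module (ring_of_type_algebra :: 'f ring) (koszul_cochains Q M p)"
proof (rule moduleI)
  show "cring (ring_of_type_algebra :: 'f ring)" by (rule cring_from_type_algebra)
  let ?C = "koszul_cochains Q M p"
  have ext: "f = (\<lambda>w\<in>koszul_W Q p. f w)" if "f \<in> carrier ?C" for f
    using that unfolding cochain_iff by (metis PiE_restrict restrict_apply restrict_ext)
  show "abelian_group ?C"
  proof (rule abelian_groupI)
    show "\<zero>\<^bsub>?C\<^esub> \<in> carrier ?C" unfolding cochain_ops by (rule cochain_zero)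
    fix f g assume f: "f \<in> carrier ?C" and g: "g \<in> carrier ?C"
    note fD = cochainD(1)[OF f] and gD = cochainD(1)[OF g]
    show "f \<oplus>\<^bsub>?C\<^esub> g \<in> carrier ?C" unfolding cochain_ops by (rule cochain_add[OF f g])
    show "f \<oplus>\<^bsub>?C\<^esub> g = g \<oplus>\<^bsub>?C\<^esub> f"
      unfolding cochain_ops using fD gD by (intro restrict_ext Mg.a_comm)
    show "\<zero>\<^bsub>?C\<^esub> \<oplus>\<^bsub>?C\<^esub> f = f"
      unfolding cochain_ops by (subst (2) ext[OF f]) (rule restrict_ext, simp add: fD)
    show "\<exists>g\<in>carrier ?C. g \<oplus>\<^bsub>?C\<^esub> f = \<zero>\<^bsub>?C\<^esub>"
      unfolding cochain_ops by (rule bexI[OF _ cochain_minus[OF f]]) (rule restrict_ext, simp add: fD Mg.l_neg)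
    fix h assume h: "h \<in> carrier ?C"
    show "f \<oplus>\<^bsub>?C\<^esub> g \<oplus>\<^bsub>?C\<^esub> h = f \<oplus>\<^bsub>?C\<^esub> (g \<oplus>\<^bsub>?C\<^esub> h)"
      unfolding cochain_ops by (rule restrict_ext) (simp add: fD gD cochainD(1)[OF h] Mg.a_assoc)
  qed
  fix a b and f g assume f: "f \<in> carrier ?C"
  note fD = cochainD(1)[OF f]
  show "a \<odot>\<^bsub>?C\<^esub> f \<in> carrier ?C" unfolding cochain_ops by (rule cochain_scalar[OF f])
  show "(a \<oplus>\<^bsub>ring_of_type_algebra :: 'f ring\<^esub> b) \<odot>\<^bsub>?C\<^esub> f = a \<odot>\<^bsub>?C\<^esub> f \<oplus>\<^bsub>?C\<^esub> b \<odot>\<^bsub>?C\<^esub> f"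
    unfolding cochain_ops ring_of_type_simps by (rule restrict_ext) (simp add: fD scalar_distrib[OF M])
  show "(a \<otimes>\<^bsub>ring_of_type_algebra :: 'f ring\<^esub> b) \<odot>\<^bsub>?C\<^esub> f = a \<odot>\<^bsub>?C\<^esub> (b \<odot>\<^bsub>?C\<^esub> f)"
    unfolding cochain_ops ring_of_type_simps by (rule restrict_ext) (simp add: fD scalar_distrib[OF M])
  show "\<one>\<^bsub>ring_of_type_algebra :: 'f ring\<^esub> \<odot>\<^bsub>?C\<^esub> f = f"
    unfolding cochain_ops ring_of_type_simps by (subst (2) ext[OF f]) (rule restrict_ext, simp add: fD scalar_distrib[OF M])
  assume g: "g \<in> carrier ?C"
  show "a \<odot>\<^bsub>?C\<^esub> (f \<oplus>\<^bsub>?C\<^esub> g) = a \<odot>\<^bsub>?C\<^esub> f \<oplus>\<^bsub>?C\<^esub> a \<odot>\<^bsub>?C\<^esub> g"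
    unfolding cochain_ops by (rule restrict_ext) (simp add: fD cochainD(1)[OF g] scalar_distrib[OF M])
qed

lemma mbalanced_right:
  assumes f: "f \<in> carrier (koszul_cochains Q M p)"
  shows "mbalanced M p 1 (\<lambda>u x. f u \<oslash>\<^bsub>M\<^esub> cls Q x)"
  unfolding mbalanced_def[OF M] using cochainD[OF f]
  by (simp add: actM koszul_W_1_base base_keys)

lemma mbalanced_left:
  assumes f: "f \<in> carrier (koszul_cochains Q M p)"
  shows "mbalanced M 1 p (\<lambda>x u. cls Q x \<odot>\<^bsub>M\<^esub> f u)"
  unfolding mbalanced_def[OF M] using cochainD[OF f]
  by (simp add: actM koszul_W_1_base base_keys)

lemma cochain_d_neg: "p < 0 \<Longrightarrow> cochain_d Q M p f = (\<lambda>w\<in>koszul_W Q (p + 1). \<zero>\<^bsub>M\<^esub>)"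
  unfolding cochain_d_def by (rule restrict_ext) simp

lemma cochain_d_apply:
  "p \<ge> 0 \<Longrightarrow> w \<in> koszul_W Q (p + 1) \<Longrightarrow> cochain_d Q M p f w =
     list_msum M (\<lambda>(u, x). f u \<oslash>\<^bsub>M\<^esub> cls Q x) (split Q p 1 w) \<ominus>\<^bsub>M\<^esub>
     [sgn_pow p] \<cdot>\<^bsub>M\<^esub> list_msum M (\<lambda>(x, u). cls Q x \<odot>\<^bsub>M\<^esub> f u) (split Q 1 p w)"
  by (simp add: cochain_d_def)

lemma msums_closed:
  assumes f: "f \<in> carrier (koszul_cochains Q M p)" and p: "p \<ge> 0" and w: "w \<in> koszul_W Q (p + 1)"
  shows "list_msum M (\<lambda>(u, x). f u \<oslash>\<^bsub>M\<^esub> cls Q x) (split Q p 1 w) \<in> carrier M"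
    and "list_msum M (\<lambda>(x, u). cls Q x \<odot>\<^bsub>M\<^esub> f u) (split Q 1 p w) \<in> carrier M"
  using msplit_closed[OF M mbalanced_right[OF f], of w] msplit_closed[OF M mbalanced_left[OF f], of w] p w
  by (simp_all add: add.commute)

lemma cochain_d_closed:
  assumes f: "f \<in> carrier (koszul_cochains Q M p)"
  shows "cochain_d Q M p f \<in> carrier (koszul_cochains Q M (p + 1))"
proof (cases "p < 0")
  case True
  then show ?thesis
    by (simp only: cochain_d_neg cochain_zero)
next
  case False
  then have p: "p \<ge> 0" by simp
  let ?L1 = "\<lambda>w. list_msum M (\<lambda>(u, x). f u \<oslash>\<^bsub>M\<^esub> cls Q x) (split Q p 1 w)"
  let ?L2 = "\<lambda>w. list_msum M (\<lambda>(x, u). cls Q x \<odot>\<^bsub>M\<^esub> f u) (split Q 1 p w)"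
  note b1 = mbalanced_right[OF f] and b2 = mbalanced_left[OF f]
  have "(\<lambda>w\<in>koszul_W Q (p + 1). ?L1 w \<ominus>\<^bsub>M\<^esub> [sgn_pow p] \<cdot>\<^bsub>M\<^esub> ?L2 w) \<in> carrier (koszul_cochains Q M (p + 1))"
  proof (rule cochainI)
    fix u v :: "('v, 'e + 'e, 'f) pelem" assume uv: "u \<in> koszul_W Q (p + 1)" "v \<in> koszul_W Q (p + 1)"
    show "?L1 u \<ominus>\<^bsub>M\<^esub> [sgn_pow p] \<cdot>\<^bsub>M\<^esub> ?L2 u \<in> carrier M"
      using msums_closed[OF f p uv(1)] by (rule Mg.sgn_diff_closed)
    have 1: "?L1 (u + v) = ?L1 u \<oplus>\<^bsub>M\<^esub> ?L1 v"
      using uv p by (intro msplit_add[OF M b1]) auto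
    have 2: "?L2 (u + v) = ?L2 u \<oplus>\<^bsub>M\<^esub> ?L2 v"
      using uv p by (intro msplit_add[OF M b2]) (auto simp: add.commute)
    show "?L1 (u + v) \<ominus>\<^bsub>M\<^esub> [sgn_pow p] \<cdot>\<^bsub>M\<^esub> ?L2 (u + v) =
      (?L1 u \<ominus>\<^bsub>M\<^esub> [sgn_pow p] \<cdot>\<^bsub>M\<^esub> ?L2 u) \<oplus>\<^bsub>M\<^esub> (?L1 v \<ominus>\<^bsub>M\<^esub> [sgn_pow p] \<cdot>\<^bsub>M\<^esub> ?L2 v)"
      unfolding 1 2 by (intro Mg.sgn_diff_add msums_closed[OF f p] uv)
  next
    fix c d w :: "('v, 'e + 'e, 'f) pelem"
    assume cd: "c \<in> base_k Q" "d \<in> base_k Q" and w: "w \<in> koszul_W Q (p + 1)"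
    have 1: "?L1 (c \<star> w \<star> d) = (cls Q c \<odot>\<^bsub>M\<^esub> ?L1 w) \<oslash>\<^bsub>M\<^esub> cls Q d"
      using cd w p cochainD[OF f] by (intro msplit_bimod[OF M b1]) (auto simp: actM koszul_W_1_base base_keys)
    have 2: "?L2 (c \<star> w \<star> d) = (cls Q c \<odot>\<^bsub>M\<^esub> ?L2 w) \<oslash>\<^bsub>M\<^esub> cls Q d"
      using cd w p cochainD[OF f] by (intro msplit_bimod[OF M b2]) (auto simp: actM koszul_W_1_base base_keys add.commute)
    show "?L1 (c \<star> w \<star> d) \<ominus>\<^bsub>M\<^esub> [sgn_pow p] \<cdot>\<^bsub>M\<^esub> ?L2 (c \<star> w \<star> d) =
        (cls Q c \<odot>\<^bsub>M\<^esub> (?L1 w \<ominus>\<^bsub>M\<^esub> [sgn_pow p] \<cdot>\<^bsub>M\<^esub> ?L2 w)) \<oslash>\<^bsub>M\<^esub> cls Q d"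
      unfolding 1 2 using msums_closed[OF f p w] base_keys[OF cd(1)] base_keys[OF cd(2)] by (simp add: act_sgn_diff actM(1,2))
  qed
  moreover have "cochain_d Q M p f = (\<lambda>w\<in>koszul_W Q (p + 1). ?L1 w \<ominus>\<^bsub>M\<^esub> [sgn_pow p] \<cdot>\<^bsub>M\<^esub> ?L2 w)"
    unfolding cochain_d_def using p by (intro restrict_ext) simp
  ultimately show ?thesis by simp
qed

lemma cochain_d_add:
  assumes f: "f \<in> carrier (koszul_cochains Q M p)" and g: "g \<in> carrier (koszul_cochains Q M p)"
  shows "cochain_d Q M p (f \<oplus>\<^bsub>koszul_cochains Q M p\<^esub> g) =
    cochain_d Q M p f \<oplus>\<^bsub>koszul_cochains Q M (p + 1)\<^esub> cochain_d Q M p g"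
proof (cases "p < 0")
  case True
  then show ?thesis
    unfolding cochain_d_neg[OF True] cochain_ops by (intro restrict_ext) simp
next
  case False
  then have p: "p \<ge> 0" by simp
  have fg: "f \<oplus>\<^bsub>koszul_cochains Q M p\<^esub> g \<in> carrier (koszul_cochains Q M p)"
    unfolding cochain_ops by (rule cochain_add[OF f g])
  show ?thesis
  proof (rule cochain_eqI[OF cochain_d_closed[OF fg]])
    show "cochain_d Q M p f \<oplus>\<^bsub>koszul_cochains Q M (p + 1)\<^esub> cochain_d Q M p g \<in> carrier (koszul_cochains Q M (p + 1))"
      unfolding cochain_ops by (intro cochain_add cochain_d_closed f g)
    fix w :: "('v, 'e + 'e, 'f) pelem" assume w: "w \<in> koszul_W Q (p + 1)"
    have sp: "set (split Q p 1 w) \<subseteq> koszul_W Q p \<times> koszul_W Q 1" "set (split Q 1 p w) \<subseteq> koszul_W Q 1 \<times> koszul_W Q p"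
      by (rule split_decomposition; use w p in \<open>simp add: add.commute\<close>)+
    let ?R = "\<lambda>f x. case x of (u, x) \<Rightarrow> f u \<oslash>\<^bsub>M\<^esub> cls Q x" and ?L = "\<lambda>f x. case x of (x, u) \<Rightarrow> cls Q x \<odot>\<^bsub>M\<^esub> f u"
    have "list_msum M (?R (f \<oplus>\<^bsub>koszul_cochains Q M p\<^esub> g)) (split Q p 1 w) =
        list_msum M (\<lambda>x. ?R f x \<oplus>\<^bsub>M\<^esub> ?R g x) (split Q p 1 w)"
      using sp(1) cochainD(1)[OF f] cochainD(1)[OF g]
      by (intro list_msum_cong[OF M]) (auto simp: cochain_ops actM koszul_W_1_base)
    also have "\<dots> = list_msum M (?R f) (split Q p 1 w) \<oplus>\<^bsub>M\<^esub> list_msum M (?R g) (split Q p 1 w)"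
      using sp(1) cochainD(1)[OF f] cochainD(1)[OF g]
      by (intro list_msum_add[OF M]) (auto simp: actM koszul_W_1_base)
    finally have 1: "list_msum M (?R (f \<oplus>\<^bsub>koszul_cochains Q M p\<^esub> g)) (split Q p 1 w) =
      list_msum M (?R f) (split Q p 1 w) \<oplus>\<^bsub>M\<^esub> list_msum M (?R g) (split Q p 1 w)" .
    have "list_msum M (?L (f \<oplus>\<^bsub>koszul_cochains Q M p\<^esub> g)) (split Q 1 p w) =
        list_msum M (\<lambda>x. ?L f x \<oplus>\<^bsub>M\<^esub> ?L g x) (split Q 1 p w)"
      using sp(2) cochainD(1)[OF f] cochainD(1)[OF g]
      by (intro list_msum_cong[OF M]) (auto simp: cochain_ops actM koszul_W_1_base)
    also have "\<dots> = list_msum M (?L f) (split Q 1 p w) \<oplus>\<^bsub>M\<^esub> list_msum M (?L g) (split Q 1 p w)"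
      using sp(2) cochainD(1)[OF f] cochainD(1)[OF g]
      by (intro list_msum_add[OF M]) (auto simp: actM koszul_W_1_base)
    finally have 2: "list_msum M (?L (f \<oplus>\<^bsub>koszul_cochains Q M p\<^esub> g)) (split Q 1 p w) =
      list_msum M (?L f) (split Q 1 p w) \<oplus>\<^bsub>M\<^esub> list_msum M (?L g) (split Q 1 p w)" .
    have "cochain_d Q M p (f \<oplus>\<^bsub>koszul_cochains Q M p\<^esub> g) w = cochain_d Q M p f w \<oplus>\<^bsub>M\<^esub> cochain_d Q M p g w"
      unfolding cochain_d_apply[OF p w] 1 2 by (intro Mg.sgn_diff_add msums_closed f g p w)
    then show "cochain_d Q M p (f \<oplus>\<^bsub>koszul_cochains Q M p\<^esub> g) w =
      (cochain_d Q M p f \<oplus>\<^bsub>koszul_cochains Q M (p + 1)\<^esub> cochain_d Q M p g) w"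
      using w by (simp add: cochain_ops(2)[of "p + 1"])
  qed
qed

lemma cochain_d_scalar:
  assumes f: "f \<in> carrier (koszul_cochains Q M p)"
  shows "cochain_d Q M p (c \<odot>\<^bsub>koszul_cochains Q M p\<^esub> f) = c \<odot>\<^bsub>koszul_cochains Q M (p + 1)\<^esub> cochain_d Q M p f"
proof (cases "p < 0")
  case True
  then show ?thesis
    unfolding cochain_d_neg[OF True] cochain_ops by (intro restrict_ext) (simp add: scalar_distrib[OF M Mg.zero_closed])
next
  case False
  then have p: "p \<ge> 0" by simp
  have cf: "c \<odot>\<^bsub>koszul_cochains Q M p\<^esub> f \<in> carrier (koszul_cochains Q M p)"
    unfolding cochain_ops by (rule cochain_scalar[OF f])
  show ?thesis
  proof (rule cochain_eqI[OF cochain_d_closed[OF cf]])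
    show "c \<odot>\<^bsub>koszul_cochains Q M (p + 1)\<^esub> cochain_d Q M p f \<in> carrier (koszul_cochains Q M (p + 1))"
      unfolding cochain_ops by (intro cochain_scalar cochain_d_closed f)
    fix w :: "('v, 'e + 'e, 'f) pelem" assume w: "w \<in> koszul_W Q (p + 1)"
    have sp: "set (split Q p 1 w) \<subseteq> koszul_W Q p \<times> koszul_W Q 1" "set (split Q 1 p w) \<subseteq> koszul_W Q 1 \<times> koszul_W Q p"
      by (rule split_decomposition; use w p in \<open>simp add: add.commute\<close>)+
    let ?R = "\<lambda>f x. case x of (u, x) \<Rightarrow> f u \<oslash>\<^bsub>M\<^esub> cls Q x" and ?L = "\<lambda>f x. case x of (x, u) \<Rightarrow> cls Q x \<odot>\<^bsub>M\<^esub> f u"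
    have "list_msum M (?R (c \<odot>\<^bsub>koszul_cochains Q M p\<^esub> f)) (split Q p 1 w) =
        list_msum M (\<lambda>x. scalar Q c \<odot>\<^bsub>M\<^esub> ?R f x) (split Q p 1 w)"
      using sp(1) cochainD(1)[OF f]
      by (intro list_msum_cong[OF M]) (auto simp: cochain_ops scalar_cls_comm[OF M] koszul_W_1_base)
    also have "\<dots> = scalar Q c \<odot>\<^bsub>M\<^esub> list_msum M (?R f) (split Q p 1 w)"
      unfolding scalar_def using sp(1) cochainD(1)[OF f]
      by (intro list_msum_act(1)[OF M scalar_keys, symmetric]) (auto simp: actM koszul_W_1_base)
    finally have 1: "list_msum M (?R (c \<odot>\<^bsub>koszul_cochains Q M p\<^esub> f)) (split Q p 1 w) =
      scalar Q c \<odot>\<^bsub>M\<^esub> list_msum M (?R f) (split Q p 1 w)" .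
    have "list_msum M (?L (c \<odot>\<^bsub>koszul_cochains Q M p\<^esub> f)) (split Q 1 p w) =
        list_msum M (\<lambda>x. scalar Q c \<odot>\<^bsub>M\<^esub> ?L f x) (split Q 1 p w)"
      using sp(2) cochainD(1)[OF f]
      by (intro list_msum_cong[OF M]) (auto simp: cochain_ops scalar_cls_comm(1)[OF M] koszul_W_1_base)
    also have "\<dots> = scalar Q c \<odot>\<^bsub>M\<^esub> list_msum M (?L f) (split Q 1 p w)"
      unfolding scalar_def using sp(2) cochainD(1)[OF f]
      by (intro list_msum_act(1)[OF M scalar_keys, symmetric]) (auto simp: actM koszul_W_1_base)
    finally have 2: "list_msum M (?L (c \<odot>\<^bsub>koszul_cochains Q M p\<^esub> f)) (split Q 1 p w) =
      scalar Q c \<odot>\<^bsub>M\<^esub> list_msum M (?L f) (split Q 1 p w)" .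
    have "cochain_d Q M p (c \<odot>\<^bsub>koszul_cochains Q M p\<^esub> f) w = scalar Q c \<odot>\<^bsub>M\<^esub> cochain_d Q M p f w"
      unfolding cochain_d_apply[OF p w] 1 2 unfolding scalar_def
      using msums_closed[OF f p w] by (simp add: act_sgn_diff scalar_keys)
    then show "cochain_d Q M p (c \<odot>\<^bsub>koszul_cochains Q M p\<^esub> f) w =
      (c \<odot>\<^bsub>koszul_cochains Q M (p + 1)\<^esub> cochain_d Q M p f) w"
      using w by (simp add: cochain_ops(3)[of "p + 1"])
  qed
qed

text \<open>Computed with the decompositions x = 1 x and x = x 1. A 0-cochain is given by its value
  m at the unit, and its differential is the inner derivation x \<mapsto> m x - x m.\<close>

lemma cochain_d_0:
  assumes f: "f \<in> carrier (koszul_cochains Q M 0)" and x: "x \<in> koszul_W Q 1"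
  shows "cochain_d Q M 0 f x = (f \<one>\<^bsub>tensor_algebra Q\<^esub> \<oslash>\<^bsub>M\<^esub> cls Q x) \<ominus>\<^bsub>M\<^esub> (cls Q x \<odot>\<^bsub>M\<^esub> f \<one>\<^bsub>tensor_algebra Q\<^esub>)"
proof -
  have one: "(\<one>\<^bsub>tensor_algebra Q\<^esub> :: ('v, 'e + 'e, 'f) pelem) \<in> koszul_W Q 0"
    by (simp add: koszul_W_simps dq.one_deg)
  note m = cochainD(1)[OF f one] and xk = koszul_W_1_base[OF x]
  have "list_msum M (\<lambda>(u, x). f u \<oslash>\<^bsub>M\<^esub> cls Q x) (split Q 0 1 x) =
      list_msum M (\<lambda>(u, x). f u \<oslash>\<^bsub>M\<^esub> cls Q x) [(\<one>\<^bsub>tensor_algebra Q\<^esub>, x)]"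
    using one x xk by (intro msplit_eq_list[OF M mbalanced_right[OF f]]) (auto simp: dq.path_mult_one)
  moreover have "list_msum M (\<lambda>(x, u). cls Q x \<odot>\<^bsub>M\<^esub> f u) (split Q 1 0 x) =
      list_msum M (\<lambda>(x, u). cls Q x \<odot>\<^bsub>M\<^esub> f u) [(x, \<one>\<^bsub>tensor_algebra Q\<^esub>)]"
    using one x xk by (intro msplit_eq_list[OF M mbalanced_left[OF f]]) (auto simp: dq.path_mult_one)
  ultimately show ?thesis
    using x m xk by (simp add: cochain_d_apply list_msum_simps[OF M] actM Mg.add_pow_sgn)
qed

text \<open>Only p = 0 has content: for p \<ge> 1 the target lives on W_{p+2} = 0, and in negative
  degrees the first differential vanishes. For p = 0 the inner derivation \<delta> of m satisfies
  \<delta>(u v) = \<delta>(u) v + u \<delta>(v), so the double differential at a relation w equals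
  \<delta>(w), which is 0 as w is 0 in A.\<close>

lemma cochain_d_square:
  assumes f: "f \<in> carrier (koszul_cochains Q M p)"
  shows "cochain_d Q M (p + 1) (cochain_d Q M p f) = \<zero>\<^bsub>koszul_cochains Q M (p + 1 + 1)\<^esub>"
proof (rule cochain_eqI)
  show "cochain_d Q M (p + 1) (cochain_d Q M p f) \<in> carrier (koszul_cochains Q M (p + 1 + 1))"
    by (intro cochain_d_closed f)
  then have zero: "cochain_d Q M (p + 1) (cochain_d Q M p f) 0 = \<zero>\<^bsub>M\<^esub>"
    by (rule cochainD)
  show "\<zero>\<^bsub>koszul_cochains Q M (p + 1 + 1)\<^esub> \<in> carrier (koszul_cochains Q M (p + 1 + 1))"
    unfolding cochain_ops by (rule cochain_zero)
  fix w :: "('v, 'e + 'e, 'f) pelem" assume w: "w \<in> koszul_W Q (p + 1 + 1)"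
  have "cochain_d Q M (p + 1) (cochain_d Q M p f) w = \<zero>\<^bsub>M\<^esub>"
  proof -
    consider "p \<ge> 1" | "p + 1 < 0" | "p = -1" | "p = 0" by linarith
    then show ?thesis
    proof cases
      case 1
      with w have "w = 0" by (simp add: koszul_W_ge_3)
      with zero show ?thesis by simp
    next
      case 2
      with w show ?thesis by (simp add: cochain_d_neg[OF 2])
    next
      case 3
      have d: "cochain_d Q M p f \<in> carrier (koszul_cochains Q M 0)"
        using cochain_d_closed[OF f] 3 by simp
      have one: "(\<one>\<^bsub>tensor_algebra Q\<^esub> :: ('v, 'e + 'e, 'f) pelem) \<in> koszul_W Q 0"
        by (simp add: koszul_W_simps dq.one_deg)
      have "cochain_d Q M p f \<one>\<^bsub>tensor_algebra Q\<^esub> = \<zero>\<^bsub>M\<^esub>"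
        using 3 one by (simp add: cochain_d_neg)
      then show ?thesis
        using cochain_d_0[OF d, of w] w 3 by (simp add: act_zero[OF M] koszul_W_1_base a_minus_def Mg.r_neg)
    next
      case 4
      define m where "m = f \<one>\<^bsub>tensor_algebra Q\<^esub>"
      have m: "m \<in> carrier M"
        unfolding m_def using f 4 by (intro cochainD(1)) (auto simp: koszul_W_simps dq.one_deg)
      define \<delta> where "\<delta> x = (m \<oslash>\<^bsub>M\<^esub> cls Q x) \<ominus>\<^bsub>M\<^esub> (cls Q x \<odot>\<^bsub>M\<^esub> m)" for x
      let ?g = "cochain_d Q M 0 f"
      have g: "?g u = \<delta> u" if "u \<in> koszul_W Q 1" for u
        using cochain_d_0[of f u] f 4 that by (simp add: \<delta>_def m_def)
      have gc: "?g \<in> carrier (koszul_cochains Q M 1)"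
        using cochain_d_closed[OF f] 4 by simp
      let ?ps = "split Q 1 1 w"
      have w2: "w \<in> koszul_W Q (1 + 1)" using w 4 by simp
      have ps: "set ?ps \<subseteq> koszul_W Q 1 \<times> koszul_W Q 1" "(\<Sum>(u, v)\<leftarrow>?ps. u \<star> v) = w"
        by (intro split_decomposition; use w2 in simp)+
      have \<delta>_add: "\<delta> (x + y) = \<delta> x \<oplus>\<^bsub>M\<^esub> \<delta> y" if "Poly_Mapping.keys x \<subseteq> paths D" "Poly_Mapping.keys y \<subseteq> paths D" for x y
        using that m by (simp add: \<delta>_def actM a_minus_def Mg.minus_add Mg.a_ac)
      have \<delta>_mult: "(?g u \<oslash>\<^bsub>M\<^esub> cls Q v) \<oplus>\<^bsub>M\<^esub> (cls Q u \<odot>\<^bsub>M\<^esub> ?g v) = \<delta> (u \<star> v)"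
        if "u \<in> koszul_W Q 1" "v \<in> koszul_W Q 1" for u v
      proof -
        note k = koszul_W_1_base[OF that(1)] koszul_W_1_base[OF that(2)]
        let ?a = "m \<oslash>\<^bsub>M\<^esub> cls Q (u \<star> v)" and ?b = "cls Q u \<odot>\<^bsub>M\<^esub> (m \<oslash>\<^bsub>M\<^esub> cls Q v)" and ?c = "cls Q (u \<star> v) \<odot>\<^bsub>M\<^esub> m"
        have "?g u \<oslash>\<^bsub>M\<^esub> cls Q v = ?a \<ominus>\<^bsub>M\<^esub> ?b" "cls Q u \<odot>\<^bsub>M\<^esub> ?g v = ?b \<ominus>\<^bsub>M\<^esub> ?c"
          using k m by (simp_all add: g that \<delta>_def a_minus_def actM act_minus[OF M])
        moreover have "?a \<in> carrier M" "?b \<in> carrier M" "?c \<in> carrier M"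
          using k m dq.path_mult_closed[OF k] by (simp_all add: actM(1,2))
        ultimately show ?thesis
          by (simp add: \<delta>_def a_minus_def Mg.a_assoc) (metis Mg.a_assoc Mg.a_inv_closed Mg.l_neg Mg.l_zero)
      qed
      \<comment> \<open>Membership of the partial sums in the path algebra is proved along with the
        identity, because \<open>\<delta>_add\<close> requires it.\<close>
      have "list_msum M (\<lambda>(u, x). ?g u \<oslash>\<^bsub>M\<^esub> cls Q x) ps \<oplus>\<^bsub>M\<^esub> list_msum M (\<lambda>(x, u). cls Q x \<odot>\<^bsub>M\<^esub> ?g u) ps =
          \<delta> (\<Sum>(u, v)\<leftarrow>ps. u \<star> v) \<and> Poly_Mapping.keys (\<Sum>(u, v)\<leftarrow>ps. u \<star> v) \<subseteq> paths D"
        if "set ps \<subseteq> koszul_W Q 1 \<times> koszul_W Q 1" for ps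
      proof -
        have "list_msum M (\<lambda>(u, x). ?g u \<oslash>\<^bsub>M\<^esub> cls Q x) ps \<oplus>\<^bsub>M\<^esub> list_msum M (\<lambda>(x, u). cls Q x \<odot>\<^bsub>M\<^esub> ?g u) ps =
            list_msum M (\<lambda>x. (case x of (u, x) \<Rightarrow> ?g u \<oslash>\<^bsub>M\<^esub> cls Q x) \<oplus>\<^bsub>M\<^esub> (case x of (x, u) \<Rightarrow> cls Q x \<odot>\<^bsub>M\<^esub> ?g u)) ps"
          using that cochainD(1)[OF gc]
          by (intro list_msum_add[OF M, symmetric]) (auto simp: actM koszul_W_1_base)
        also have "\<dots> = list_msum M (\<lambda>(u, v). \<delta> (u \<star> v)) ps"
          using that by (intro list_msum_cong[OF M]) (auto simp: \<delta>_mult)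
        finally have *: "list_msum M (\<lambda>(u, x). ?g u \<oslash>\<^bsub>M\<^esub> cls Q x) ps \<oplus>\<^bsub>M\<^esub> list_msum M (\<lambda>(x, u). cls Q x \<odot>\<^bsub>M\<^esub> ?g u) ps =
          list_msum M (\<lambda>(u, v). \<delta> (u \<star> v)) ps" .
        have "list_msum M (\<lambda>(u, v). \<delta> (u \<star> v)) ps = \<delta> (\<Sum>(u, v)\<leftarrow>ps. u \<star> v) \<and> Poly_Mapping.keys (\<Sum>(u, v)\<leftarrow>ps. u \<star> v) \<subseteq> paths D"
          using that
        proof (induction ps)
          case Nil
          have "cls Q (0 :: ('v, 'e + 'e, 'f) pelem) = \<zero>\<^bsub>preproj Q\<^esub>"
            by (rule cls_relation) (simp add: relations_def pelem.span_zero)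
          then show ?case using m by (simp add: list_msum_simps[OF M] \<delta>_def zero_act[OF M] a_minus_def Mg.r_neg)
        next
          case (Cons y ps)
          obtain u v where y: "y = (u, v)" "u \<in> koszul_W Q 1" "v \<in> koszul_W Q 1"
            using Cons.prems by (cases y) auto
          have k: "Poly_Mapping.keys (u \<star> v) \<subseteq> paths D"
            by (intro dq.path_mult_closed koszul_W_1_base y)
          with Cons show ?case
            using keys_add[of "u \<star> v" "\<Sum>(u, v)\<leftarrow>ps. u \<star> v"] by (auto simp: y list_msum_simps[OF M] \<delta>_add)
        qed
        with * show ?thesis by simp
      qed
      from this[OF ps(1)] have "list_msum M (\<lambda>(u, x). ?g u \<oslash>\<^bsub>M\<^esub> cls Q x) ?ps \<oplus>\<^bsub>M\<^esub>
          list_msum M (\<lambda>(x, u). cls Q x \<odot>\<^bsub>M\<^esub> ?g u) ?ps = \<delta> w"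
        by (simp only: ps(2))
      moreover have "cochain_d Q M 1 ?g w = list_msum M (\<lambda>(u, x). ?g u \<oslash>\<^bsub>M\<^esub> cls Q x) ?ps \<oplus>\<^bsub>M\<^esub>
          list_msum M (\<lambda>(x, u). cls Q x \<odot>\<^bsub>M\<^esub> ?g u) ?ps"
        using msums_closed[OF gc _ w2] by (simp add: cochain_d_apply[OF _ w2] Mg.add_pow_sgn a_minus_def)
      moreover have "cls Q w = \<zero>\<^bsub>preproj Q\<^esub>"
        using w 4 by (intro cls_relation) (simp add: koszul_W_2)
      then have "\<delta> w = \<zero>\<^bsub>M\<^esub>"
        using m by (simp add: \<delta>_def zero_act[OF M] a_minus_def Mg.r_neg)
      ultimately show ?thesis using 4 by simp
    qed
  qed
  then show "cochain_d Q M (p + 1) (cochain_d Q M p f) w = \<zero>\<^bsub>koszul_cochains Q M (p + 1 + 1)\<^esub> w"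
    using w by (simp only: cochain_ops(1) restrict_apply')
qed

lemma cochain_complex_cochains: "cochain_complex (koszul_cochains Q M) (cochain_d Q M)"
  unfolding cochain_complex_def linear_maps_def
  using module_cochains cochain_d_closed cochain_d_add cochain_d_scalar cochain_d_square by auto

end

end

section \<open>Koszul chains\<close>

context connected_quiver
begin

text \<open>This is \<open>respects_tensor\<close> for the relations of \<open>null_ke\<close>,
  written out so that the pairs encoding k^e and the updated carrier do not appear in later
  proofs.\<close>

definition respects_chains ::
  "(('v, 'e + 'e, 'f::field) pelem set, 'm) bimodule \<Rightarrow> int \<Rightarrow> ('c \<Rightarrow>\<^sub>0 int) set \<Rightarrow>
   ('m \<times> ('v, 'e + 'e, 'f) pelem \<Rightarrow> 'c \<Rightarrow>\<^sub>0 int) \<Rightarrow> bool" where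
  "respects_chains M p K h \<longleftrightarrow>
     (\<forall>m\<in>carrier M. \<forall>m'\<in>carrier M. \<forall>w\<in>koszul_W Q p.
        frag_coset K (h (m \<oplus>\<^bsub>M\<^esub> m', w)) = frag_coset K (h (m, w) + h (m', w))) \<and>
     (\<forall>m\<in>carrier M. \<forall>w\<in>koszul_W Q p. \<forall>w'\<in>koszul_W Q p.
        frag_coset K (h (m, w + w')) = frag_coset K (h (m, w) + h (m, w'))) \<and>
     (\<forall>m\<in>carrier M. \<forall>c\<in>base_k Q. \<forall>d\<in>base_k Q. \<forall>w\<in>koszul_W Q p.
        frag_coset K (h ((cls Q d \<odot>\<^bsub>M\<^esub> m) \<oslash>\<^bsub>M\<^esub> cls Q c, w)) = frag_coset K (h (m, c \<star> w \<star> d)))"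

lemma respects_chains_tensor:
  "respects_chains M p K h \<longleftrightarrow>
     respects_tensor K M (tensor_algebra Q\<lparr>carrier := koszul_W Q p\<rparr>) (base_k Q \<times> base_k Q)
       (\<lambda>m (c, d). (cls Q d \<odot>\<^bsub>M\<^esub> m) \<oslash>\<^bsub>M\<^esub> cls Q c) (\<lambda>(c, d) w. c \<star> w \<star> d) h"
  unfolding respects_chains_def respects_tensor_def by (simp add: path_algebra_def)

lemma respects_chains_add:
  assumes "add_subgroup K" "respects_chains M p K f" "respects_chains M p K g"
  shows "respects_chains M p K (\<lambda>x. f x + g x)"
  using assms unfolding respects_chains_tensor by (rule respects_tensor_add)

lemma respects_chains_cmul:
  assumes "add_subgroup K" "respects_chains M p K f"
  shows "respects_chains M p K (\<lambda>x. frag_cmul n (f x))"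
  using assms unfolding respects_chains_tensor by (rule respects_tensor_cmul)

lemma path1_base: "u \<in> koszul_W Q p \<Longrightarrow> c \<in> base_k Q \<Longrightarrow> Poly_Mapping.keys (c \<star> u) \<subseteq> paths D"
  "u \<in> koszul_W Q p \<Longrightarrow> c \<in> base_k Q \<Longrightarrow> Poly_Mapping.keys (u \<star> c) \<subseteq> paths D"
  for u c :: "('v, 'e + 'e, 'f::field) pelem"
  by (auto intro: subsetD[OF koszul_W_closed(6)] koszul_W_closed)

context
  fixes M :: "(('v, 'e + 'e, 'f::field) pelem set, 'm) bimodule"
  assumes M: "preproj_bimodule Q M"
begin

interpretation Mg: abelian_group M by (rule abelian_M[OF M])

lemma tensor_closed_chains:
  "tensor_closed M (tensor_algebra Q\<lparr>carrier := koszul_W Q p\<rparr>) (base_k Q \<times> base_k Q)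
     (\<lambda>m (c, d). (cls Q d \<odot>\<^bsub>M\<^esub> m) \<oslash>\<^bsub>M\<^esub> cls Q c) (\<lambda>(c, d) w. c \<star> w \<star> d)"
  unfolding tensor_closed_def by (auto simp: path_algebra_def koszul_W_closed act_simps[OF M] base_keys)

lemma add_subgroup_ke: "add_subgroup (null_ke Q M p)"
  unfolding null_ke_def by (rule add_subgroup_tensor_null[OF tensor_closed_chains])

lemma induced_chains:
  assumes "add_subgroup K" "respects_chains M p K h"
  shows "induced K h (frag_coset (null_ke Q M p) r) = frag_coset K (frag_extend h r)"
  using assms unfolding null_ke_def respects_chains_tensor by (intro induced_coset tensor_closed_chains)

lemma respects_chains_refl: "respects_chains M p (null_ke Q M p) frag_of"
  unfolding null_ke_def respects_chains_tensor by (rule respects_tensor_refl[OF tensor_closed_chains])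

lemma ke_rules:
  shows "m \<in> carrier M \<Longrightarrow> m' \<in> carrier M \<Longrightarrow> w \<in> koszul_W Q p \<Longrightarrow>
      frag_coset (null_ke Q M p) (frag_of (m \<oplus>\<^bsub>M\<^esub> m', w)) = frag_coset (null_ke Q M p) (frag_of (m, w) + frag_of (m', w))"
    and "m \<in> carrier M \<Longrightarrow> w \<in> koszul_W Q p \<Longrightarrow> w' \<in> koszul_W Q p \<Longrightarrow>
      frag_coset (null_ke Q M p) (frag_of (m, w + w')) = frag_coset (null_ke Q M p) (frag_of (m, w) + frag_of (m, w'))"
    and "m \<in> carrier M \<Longrightarrow> c \<in> base_k Q \<Longrightarrow> d \<in> base_k Q \<Longrightarrow> w \<in> koszul_W Q p \<Longrightarrow>
      frag_coset (null_ke Q M p) (frag_of ((cls Q d \<odot>\<^bsub>M\<^esub> m) \<oslash>\<^bsub>M\<^esub> cls Q c, w)) = frag_coset (null_ke Q M p) (frag_of (m, c \<star> w \<star> d))"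
  using respects_chains_refl[of p] unfolding respects_chains_def by blast+

lemma ke_right:
  assumes "m \<in> carrier M" "c \<in> base_k Q" "w \<in> koszul_W Q p"
  shows "frag_coset (null_ke Q M p) (frag_of (m \<oslash>\<^bsub>M\<^esub> cls Q c, w)) = frag_coset (null_ke Q M p) (frag_of (m, c \<star> w))"
  using ke_rules(3)[OF assms(1,2) dq.one_deg assms(3)] assms koszul_W_closed(6)[OF koszul_W_closed(4)[OF assms(2,3)]]
  by (simp add: act_simps[OF M] dq.path_mult_one)

lemma ke_left:
  assumes "m \<in> carrier M" "d \<in> base_k Q" "w \<in> koszul_W Q p"
  shows "frag_coset (null_ke Q M p) (frag_of (cls Q d \<odot>\<^bsub>M\<^esub> m, w)) = frag_coset (null_ke Q M p) (frag_of (m, w \<star> d))"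
  using ke_rules(3)[OF assms(1) dq.one_deg assms(2,3)] assms koszul_W_closed(6)[OF assms(3)]
  by (simp add: act_simps[OF M] base_keys dq.path_mult_one)

lemma ke_scalar:
  assumes "m \<in> carrier M" "w \<in> koszul_W Q p"
  shows "frag_coset (null_ke Q M p) (frag_of (scalar Q c \<odot>\<^bsub>M\<^esub> m, w)) = frag_coset (null_ke Q M p) (frag_of (m, pscale c w))"
  using ke_left[OF assms(1) base_scalar assms(2), of c] pscale_eq_mult(2)[OF koszul_W_closed(6)[OF assms(2)], of c]
  by (simp add: scalar_def)

text \<open>Used to pull a sum or a sign that was formed in M, inside the first tensor factor, out
  to the level of chains.\<close>

lemma ke_eval:
  assumes "w \<in> koszul_W Q p" "frag_coset (eval_ker M) a = frag_coset (eval_ker M) b"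
  shows "frag_coset (null_ke Q M p) (frag_extend (\<lambda>m. frag_of (m, w)) a) = frag_coset (null_ke Q M p) (frag_extend (\<lambda>m. frag_of (m, w)) b)"
  using assms by (intro Mg.eval_ker_map[OF add_subgroup_ke] ke_rules)

lemma ke_zero: "w \<in> koszul_W Q p \<Longrightarrow> frag_coset (null_ke Q M p) (frag_of (\<zero>\<^bsub>M\<^esub>, w)) = frag_coset (null_ke Q M p) 0"
  using ke_eval[OF _ Mg.eval_ker_zero, of w p] by simp

lemma ke_zero_right:
  assumes m: "m \<in> carrier M" shows "frag_coset (null_ke Q M p) (frag_of (m, 0)) = frag_coset (null_ke Q M p) 0"
proof -
  have 0: "(0 :: ('v, 'e + 'e, 'f) pelem) \<in> koszul_W Q p" by (rule koszul_W_closed)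
  have "frag_coset (null_ke Q M p) (frag_of (m, 0)) = frag_coset (null_ke Q M p) (frag_of (scalar Q 0 \<odot>\<^bsub>M\<^esub> m, 0))"
    using ke_scalar[OF m 0, of 0] by simp
  then show ?thesis
    using ke_zero[OF 0] m by (simp add: scalar_distrib[OF M])
qed

lemma ke_sum_right:
  assumes "m \<in> carrier M" "\<And>i. i \<in> I \<Longrightarrow> f i \<in> koszul_W Q p"
  shows "frag_coset (null_ke Q M p) (frag_of (m, \<Sum>i\<in>I. f i)) = frag_coset (null_ke Q M p) (\<Sum>i\<in>I. frag_of (m, f i))"
  using assms(2)
proof (induction I rule: infinite_finite_induct)
  case (insert i I)
  then have "frag_coset (null_ke Q M p) (frag_of (m, f i + (\<Sum>i\<in>I. f i))) = frag_coset (null_ke Q M p) (frag_of (m, f i) + frag_of (m, \<Sum>i\<in>I. f i))"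
    using assms(1) by (intro ke_rules koszul_W_sum) auto
  also have "\<dots> = frag_coset (null_ke Q M p) (frag_of (m, f i) + (\<Sum>i\<in>I. frag_of (m, f i)))"
    using insert by (intro frag_coset_add[OF add_subgroup_ke]) auto
  finally show ?case using insert by simp
qed (auto simp: ke_zero_right[OF assms(1)])

lemma carrier_chains:
  "carrier (koszul_chains Q M p) = {frag_coset (null_ke Q M p) r |r. Poly_Mapping.keys r \<subseteq> carrier M \<times> koszul_W Q p}"
  by (simp add: koszul_chains_def Let_def carrier_frag_quotient)

lemma chains_ops:
  "\<zero>\<^bsub>koszul_chains Q M p\<^esub> = frag_coset (null_ke Q M p) 0"
  "frag_coset (null_ke Q M p) r \<oplus>\<^bsub>koszul_chains Q M p\<^esub> frag_coset (null_ke Q M p) s = frag_coset (null_ke Q M p) (r + s)"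
  by (simp_all add: koszul_chains_def Let_def frag_quotient_ops[OF add_subgroup_ke] del: mult_FactGroup one_FactGroup)

lemma respects_chains_scalar:
  "respects_chains M p (null_ke Q M p) (\<lambda>(m, w). frag_of (scalar Q c \<odot>\<^bsub>M\<^esub> m, w))"
proof -
  have "frag_of (scalar Q c \<odot>\<^bsub>M\<^esub> ((cls Q d \<odot>\<^bsub>M\<^esub> m) \<oslash>\<^bsub>M\<^esub> cls Q b), w) =
      frag_of ((cls Q d \<odot>\<^bsub>M\<^esub> (scalar Q c \<odot>\<^bsub>M\<^esub> m)) \<oslash>\<^bsub>M\<^esub> cls Q b, w)"
    if "m \<in> carrier M" "b \<in> base_k Q" "d \<in> base_k Q" for b d m and w :: "('v, 'e + 'e, 'f) pelem"
    using that by (simp add: scalar_cls_comm(1,2)[OF M] act_simps(1)[OF M] base_keys)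
  then show ?thesis
    unfolding respects_chains_def
    by (simp add: scalar_distrib[OF M] scalar_act[OF M] ke_rules)
qed

lemma chains_smult:
  "c \<odot>\<^bsub>koszul_chains Q M p\<^esub> frag_coset (null_ke Q M p) r =
     frag_coset (null_ke Q M p) (frag_extend (\<lambda>(m, w). frag_of (scalar Q c \<odot>\<^bsub>M\<^esub> m, w)) r)"
  by (simp add: koszul_chains_def Let_def induced_chains[OF add_subgroup_ke respects_chains_scalar])

lemma abelian_group_chains: "abelian_group (koszul_chains Q M p)"
  by (rule abelian_group_frag_quotient[OF add_subgroup_ke carrier_chains chains_ops])

lemma module_chains: "module (ring_of_type_algebra :: 'f ring) (koszul_chains Q M p)"
proof (rule moduleI)
  show "cring (ring_of_type_algebra :: 'f ring)" by (rule cring_from_type_algebra)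
  show "abelian_group (koszul_chains Q M p)" by (rule abelian_group_chains)
  let ?C = "koszul_chains Q M p" and ?K = "null_ke Q M p"
  let ?s = "\<lambda>c (m, w). frag_of (scalar Q c \<odot>\<^bsub>M\<^esub> m, w)"
  fix a b and x assume "x \<in> carrier ?C"
  then obtain r where r: "x = frag_coset ?K r" "Poly_Mapping.keys r \<subseteq> carrier M \<times> koszul_W Q p"
    unfolding carrier_chains by auto
  have kr: "fst z \<in> carrier M \<and> snd z \<in> koszul_W Q p" if "z \<in> Poly_Mapping.keys r" for z
    using r(2) that by auto
  have "Poly_Mapping.keys (frag_extend (?s a) r) \<subseteq> carrier M \<times> koszul_W Q p"
    using kr by (intro order.trans[OF keys_frag_extend] UN_least) (auto simp: keys_frag_of scalar_act[OF M] case_prod_unfold)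
  then show "a \<odot>\<^bsub>?C\<^esub> x \<in> carrier ?C"
    unfolding r(1) chains_smult carrier_chains by blast
  have "frag_coset ?K (frag_extend (?s (a + b)) r) = frag_coset ?K (frag_extend (\<lambda>z. ?s a z + ?s b z) r)"
    using kr by (intro frag_coset_extend[OF add_subgroup_ke])
      (simp add: case_prod_unfold scalar_distrib(2)[OF M] ke_rules scalar_act(1)[OF M])
  then show "(a \<oplus>\<^bsub>ring_of_type_algebra :: 'f ring\<^esub> b) \<odot>\<^bsub>?C\<^esub> x = a \<odot>\<^bsub>?C\<^esub> x \<oplus>\<^bsub>?C\<^esub> b \<odot>\<^bsub>?C\<^esub> x"
    by (simp add: ring_of_type_simps r chains_smult chains_ops frag_extend_fun_add)
  have "frag_extend (?s (a * b)) r = frag_extend (\<lambda>z. frag_extend (?s a) (?s b z)) r"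
    using kr by (intro frag_extend_eq) (auto simp: case_prod_unfold scalar_distrib(3)[OF M])
  then show "(a \<otimes>\<^bsub>ring_of_type_algebra :: 'f ring\<^esub> b) \<odot>\<^bsub>?C\<^esub> x = a \<odot>\<^bsub>?C\<^esub> (b \<odot>\<^bsub>?C\<^esub> x)"
    by (simp add: ring_of_type_simps r chains_smult frag_extend_frag_extend)
  have "frag_extend (?s 1) r = frag_extend frag_of r"
    using kr by (intro frag_extend_eq) (auto simp: case_prod_unfold scalar_distrib(4)[OF M])
  then show "\<one>\<^bsub>ring_of_type_algebra :: 'f ring\<^esub> \<odot>\<^bsub>?C\<^esub> x = x"
    by (simp add: ring_of_type_simps r chains_smult flip: frag_expansion)
  fix y assume "y \<in> carrier ?C"
  then obtain s where "y = frag_coset ?K s"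
    unfolding carrier_chains by auto
  then show "a \<odot>\<^bsub>?C\<^esub> (x \<oplus>\<^bsub>?C\<^esub> y) = a \<odot>\<^bsub>?C\<^esub> x \<oplus>\<^bsub>?C\<^esub> a \<odot>\<^bsub>?C\<^esub> y"
    by (simp add: r chains_smult chains_ops frag_extend_add)
qed

text \<open>The chain differential and both cap products have this shape: m \<otimes> w is sent to a
  sum over a decomposition of w. Their well-definedness reduces to conditions on a single
  term.\<close>

lemma respects_chains_split:
  assumes K: "add_subgroup K" and pq: "p \<ge> 0" "q \<ge> 0" and n: "n = p + q"
    and bal: "\<And>m. m \<in> carrier M \<Longrightarrow> balanced K p q (\<Phi> m)"
    and add: "\<And>m m' u v. m \<in> carrier M \<Longrightarrow> m' \<in> carrier M \<Longrightarrow> u \<in> koszul_W Q p \<Longrightarrow> v \<in> koszul_W Q q \<Longrightarrow>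
      frag_coset K (\<Phi> (m \<oplus>\<^bsub>M\<^esub> m') u v) = frag_coset K (\<Phi> m u v + \<Phi> m' u v)"
    and act: "\<And>m c d u v. m \<in> carrier M \<Longrightarrow> c \<in> base_k Q \<Longrightarrow> d \<in> base_k Q \<Longrightarrow> u \<in> koszul_W Q p \<Longrightarrow> v \<in> koszul_W Q q \<Longrightarrow>
      frag_coset K (\<Phi> ((cls Q d \<odot>\<^bsub>M\<^esub> m) \<oslash>\<^bsub>M\<^esub> cls Q c) u v) = frag_coset K (\<Phi> m (c \<star> u) (v \<star> d))"
  shows "respects_chains M n K (\<lambda>(m, w). \<Sum>(u, v)\<leftarrow>split Q p q w. \<Phi> m u v)"
  unfolding respects_chains_def prod.case
proof (intro conjI ballI)
  fix m m' and w :: "('v, 'e + 'e, 'f) pelem"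
  assume m: "m \<in> carrier M" "m' \<in> carrier M" and w: "w \<in> koszul_W Q n"
  have "frag_coset K (\<Sum>(u, v)\<leftarrow>split Q p q w. \<Phi> (m \<oplus>\<^bsub>M\<^esub> m') u v) =
      frag_coset K (\<Sum>x\<leftarrow>split Q p q w. (case x of (u, v) \<Rightarrow> \<Phi> m u v) + (case x of (u, v) \<Rightarrow> \<Phi> m' u v))"
    using split_decomposition(1)[OF pq, of w] w n m add by (intro frag_coset_sum_list[OF K]) auto
  then show "frag_coset K (\<Sum>(u, v)\<leftarrow>split Q p q w. \<Phi> (m \<oplus>\<^bsub>M\<^esub> m') u v) =
      frag_coset K ((\<Sum>(u, v)\<leftarrow>split Q p q w. \<Phi> m u v) + (\<Sum>(u, v)\<leftarrow>split Q p q w. \<Phi> m' u v))"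
    by (simp add: sum_list_addf)
next
  fix m and w w' :: "('v, 'e + 'e, 'f) pelem"
  assume "m \<in> carrier M" "w \<in> koszul_W Q n" "w' \<in> koszul_W Q n"
  then show "frag_coset K (\<Sum>(u, v)\<leftarrow>split Q p q (w + w'). \<Phi> m u v) =
      frag_coset K ((\<Sum>(u, v)\<leftarrow>split Q p q w. \<Phi> m u v) + (\<Sum>(u, v)\<leftarrow>split Q p q w'. \<Phi> m u v))"
    using n by (intro split_add[OF K bal pq]) auto
next
  fix m and c d w :: "('v, 'e + 'e, 'f) pelem"
  assume m: "m \<in> carrier M" and cd: "c \<in> base_k Q" "d \<in> base_k Q" and w: "w \<in> koszul_W Q n"
  have "frag_coset K (\<Sum>(u, v)\<leftarrow>split Q p q w. \<Phi> ((cls Q d \<odot>\<^bsub>M\<^esub> m) \<oslash>\<^bsub>M\<^esub> cls Q c) u v) =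
      frag_coset K (\<Sum>(u, v)\<leftarrow>split Q p q w. \<Phi> m (c \<star> u) (v \<star> d))"
    using split_decomposition(1)[OF pq, of w] w n m cd act by (intro frag_coset_sum_list[OF K]) auto
  also have "\<dots> = frag_coset K (\<Sum>(u, v)\<leftarrow>split Q p q (c \<star> w \<star> d). \<Phi> m u v)"
    using w n cd by (intro split_bimod[OF K bal[OF m] pq, symmetric]) auto
  finally show "frag_coset K (\<Sum>(u, v)\<leftarrow>split Q p q w. \<Phi> ((cls Q d \<odot>\<^bsub>M\<^esub> m) \<oslash>\<^bsub>M\<^esub> cls Q c) u v) = \<dots>" .
qed

lemma respects_chain_d:
  assumes p: "p \<ge> 1"
  shows "respects_chains M p (null_ke Q M (p - 1))
    (\<lambda>(m, w). (\<Sum>(x, v)\<leftarrow>split Q 1 (p - 1) w. frag_of (m \<oslash>\<^bsub>M\<^esub> cls Q x, v)) +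
       frag_cmul (sgn_pow p) (\<Sum>(u, x)\<leftarrow>split Q (p - 1) 1 w. frag_of (cls Q x \<odot>\<^bsub>M\<^esub> m, u)))"
proof -
  let ?K = "null_ke Q M (p - 1)"
  have 1: "respects_chains M p ?K (\<lambda>(m, w). \<Sum>(x, v)\<leftarrow>split Q 1 (p - 1) w. frag_of (m \<oslash>\<^bsub>M\<^esub> cls Q x, v))"
  proof (rule respects_chains_split[OF add_subgroup_ke])
    fix m assume m: "m \<in> carrier M"
    show "balanced ?K 1 (p - 1) (\<lambda>x v. frag_of (m \<oslash>\<^bsub>M\<^esub> cls Q x, v))"
      unfolding balanced_def using m
      by (intro conjI ballI) (simp_all add: act_simps[OF M] koszul_W_1_base base_keys ke_rules ke_right)
    fix c d x v :: "('v, 'e + 'e, 'f) pelem"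
    assume cd: "c \<in> base_k Q" "d \<in> base_k Q" and xv: "x \<in> koszul_W Q 1" "v \<in> koszul_W Q (p - 1)"
    \<comment> \<open>The factor \<open>c\<close> joins \<open>x\<close>, while \<open>d\<close>
      stays at the left end of the coefficient; from there the relation over k^e carries it to the
      right end of \<open>v\<close>.\<close>
    have "((cls Q d \<odot>\<^bsub>M\<^esub> m) \<oslash>\<^bsub>M\<^esub> cls Q c) \<oslash>\<^bsub>M\<^esub> cls Q x = cls Q d \<odot>\<^bsub>M\<^esub> (m \<oslash>\<^bsub>M\<^esub> cls Q (c \<star> x))"
      using m cd xv by (simp add: act_simps[OF M] koszul_W_1_base base_keys)
    then show "frag_coset ?K (frag_of (((cls Q d \<odot>\<^bsub>M\<^esub> m) \<oslash>\<^bsub>M\<^esub> cls Q c) \<oslash>\<^bsub>M\<^esub> cls Q x, v)) = frag_coset ?K (frag_of (m \<oslash>\<^bsub>M\<^esub> cls Q (c \<star> x), v \<star> d))"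
      using m cd xv path1_base[OF xv(1) cd(1)] by (simp add: ke_left act_simps(2)[OF M])
  qed (use p in \<open>simp_all add: act_simps[OF M] koszul_W_1_base ke_rules\<close>)
  have 2: "respects_chains M p ?K (\<lambda>(m, w). \<Sum>(u, x)\<leftarrow>split Q (p - 1) 1 w. frag_of (cls Q x \<odot>\<^bsub>M\<^esub> m, u))"
  proof (rule respects_chains_split[OF add_subgroup_ke])
    fix m assume m: "m \<in> carrier M"
    show "balanced ?K (p - 1) 1 (\<lambda>u x. frag_of (cls Q x \<odot>\<^bsub>M\<^esub> m, u))"
      unfolding balanced_def using m
      by (intro conjI ballI) (simp_all add: act_simps[OF M] koszul_W_1_base base_keys ke_rules ke_left)
    fix c d u x :: "('v, 'e + 'e, 'f) pelem"
    assume cd: "c \<in> base_k Q" "d \<in> base_k Q" and xu: "u \<in> koszul_W Q (p - 1)" "x \<in> koszul_W Q 1"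
    have "cls Q x \<odot>\<^bsub>M\<^esub> ((cls Q d \<odot>\<^bsub>M\<^esub> m) \<oslash>\<^bsub>M\<^esub> cls Q c) = (cls Q (x \<star> d) \<odot>\<^bsub>M\<^esub> m) \<oslash>\<^bsub>M\<^esub> cls Q c"
      using m cd xu by (simp add: act_simps[OF M] koszul_W_1_base base_keys)
    then show "frag_coset ?K (frag_of (cls Q x \<odot>\<^bsub>M\<^esub> ((cls Q d \<odot>\<^bsub>M\<^esub> m) \<oslash>\<^bsub>M\<^esub> cls Q c), u)) = frag_coset ?K (frag_of (cls Q (x \<star> d) \<odot>\<^bsub>M\<^esub> m, c \<star> u))"
      using m cd xu path1_base[OF xu(2) cd(2)] by (simp add: ke_right act_simps(1)[OF M])
  qed (use p in \<open>simp_all add: act_simps[OF M] koszul_W_1_base ke_rules\<close>)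
  show ?thesis
    using respects_chains_add[OF add_subgroup_ke 1 respects_chains_cmul[OF add_subgroup_ke 2, of "sgn_pow p"]]
    by (simp add: case_prod_unfold)
qed

lemma chain_d_coset:
  assumes p: "p \<ge> 1"
  shows "chain_d Q M p (frag_coset (null_ke Q M p) r) = frag_coset (null_ke Q M (p - 1)) (frag_extend
    (\<lambda>(m, w). (\<Sum>(x, v)\<leftarrow>split Q 1 (p - 1) w. frag_of (m \<oslash>\<^bsub>M\<^esub> cls Q x, v)) +
       frag_cmul (sgn_pow p) (\<Sum>(u, x)\<leftarrow>split Q (p - 1) 1 w. frag_of (cls Q x \<odot>\<^bsub>M\<^esub> m, u))) r)"
  using p unfolding chain_d_def by (simp add: induced_chains[OF add_subgroup_ke respects_chain_d[OF p]])

end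

end

section \<open>Tensor products of bimodules\<close>

context connected_quiver
begin

lemma ring_preproj: "ring (preproj Q :: ('v, 'e + 'e, 'f::field) pelem set ring)"
proof -
  interpret T: ring "tensor_algebra Q :: ('v, 'e + 'e, 'f) pelem ring" by (rule ring_tensor_algebra)
  interpret J: ideal "genideal (tensor_algebra Q) (relations Q) :: ('v, 'e + 'e, 'f) pelem set"
    "tensor_algebra Q :: ('v, 'e + 'e, 'f) pelem ring"
    using relations_closed by (rule T.genideal_ideal)
  show ?thesis unfolding preproj_def by (rule J.quotient_is_ring)
qed

lemma scalar_closed: "scalar Q c \<in> carrier (preproj Q)"
  unfolding scalar_def by (rule cls_simps(1)[OF scalar_keys])

context
  fixes M :: "(('v, 'e + 'e, 'f::field) pelem set, 'm) bimodule"
    and P :: "(('v, 'e + 'e, 'f) pelem set, 'p) bimodule"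
  assumes M: "preproj_bimodule Q M" and P: "preproj_bimodule Q P"
begin

interpretation Mb: bimodule "preproj Q" M by (rule bimodule_M[OF M])
interpretation Pb: bimodule "preproj Q" P by (rule bimodule_M[OF P])

abbreviation (input) "K\<^sub>r \<equiv> null_ring (preproj Q) M P"
abbreviation (input) "MP \<equiv> bimodule_tensor (preproj Q) M P"
abbreviation (input) "pt \<equiv> pure_tensor (preproj Q) M P"

lemma tensor_closed_ring:
  "tensor_closed M P (carrier (preproj Q)) (rsmult M) (module.smult P)"
  unfolding tensor_closed_def by (auto intro: Mb.ract_closed Pb.lact_closed Mb.M.a_closed Pb.M.a_closed)

lemma add_subgroup_ring: "add_subgroup K\<^sub>r"
  unfolding null_ring_def by (rule add_subgroup_tensor_null[OF tensor_closed_ring])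

lemma induced_ring:
  assumes "add_subgroup K" "respects_tensor K M P (carrier (preproj Q)) (rsmult M) (module.smult P) h"
  shows "induced K h (frag_coset K\<^sub>r r) = frag_coset K (frag_extend h r)"
  using assms unfolding null_ring_def by (intro induced_coset tensor_closed_ring)

lemma nr_rules:
  shows "m \<in> carrier M \<Longrightarrow> m' \<in> carrier M \<Longrightarrow> n \<in> carrier P \<Longrightarrow>
      frag_coset K\<^sub>r (frag_of (m \<oplus>\<^bsub>M\<^esub> m', n)) = frag_coset K\<^sub>r (frag_of (m, n) + frag_of (m', n))"
    and "m \<in> carrier M \<Longrightarrow> n \<in> carrier P \<Longrightarrow> n' \<in> carrier P \<Longrightarrow>
      frag_coset K\<^sub>r (frag_of (m, n \<oplus>\<^bsub>P\<^esub> n')) = frag_coset K\<^sub>r (frag_of (m, n) + frag_of (m, n'))"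
    and "m \<in> carrier M \<Longrightarrow> a \<in> carrier (preproj Q) \<Longrightarrow> n \<in> carrier P \<Longrightarrow>
      frag_coset K\<^sub>r (frag_of (m \<oslash>\<^bsub>M\<^esub> a, n)) = frag_coset K\<^sub>r (frag_of (m, a \<odot>\<^bsub>P\<^esub> n))"
  using respects_tensor_refl[OF tensor_closed_ring] unfolding respects_tensor_def null_ring_def by blast+

lemma carrier_tensor: "carrier MP = {frag_coset K\<^sub>r r |r. Poly_Mapping.keys r \<subseteq> carrier M \<times> carrier P}"
  by (simp add: bimodule_tensor_def Let_def carrier_frag_quotient)

lemma tensor_ops:
  "\<zero>\<^bsub>MP\<^esub> = frag_coset K\<^sub>r 0"
  "frag_coset K\<^sub>r r \<oplus>\<^bsub>MP\<^esub> frag_coset K\<^sub>r s = frag_coset K\<^sub>r (r + s)"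
  by (simp_all add: bimodule_tensor_def Let_def frag_quotient_ops[OF add_subgroup_ring] del: mult_FactGroup one_FactGroup)

text \<open>The action passes to the quotient by the balancing relations because the left action of
  A on M commutes with the right one.\<close>

lemma tensor_lact:
  assumes a: "a \<in> carrier (preproj Q)"
  shows "a \<odot>\<^bsub>MP\<^esub> frag_coset K\<^sub>r r = frag_coset K\<^sub>r (frag_extend (\<lambda>(m, n). frag_of (a \<odot>\<^bsub>M\<^esub> m, n)) r)"
proof -
  have "respects_tensor K\<^sub>r M P (carrier (preproj Q)) (rsmult M) (module.smult P) (\<lambda>(m, n). frag_of (a \<odot>\<^bsub>M\<^esub> m, n))"
    unfolding respects_tensor_def prod.case
  proof (intro conjI ballI)
    fix m n and s :: "('v, 'e + 'e, 'f) pelem set"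
    assume "m \<in> carrier M" "s \<in> carrier (preproj Q)" "n \<in> carrier P"
    then show "frag_coset K\<^sub>r (frag_of (a \<odot>\<^bsub>M\<^esub> (m \<oslash>\<^bsub>M\<^esub> s), n)) = frag_coset K\<^sub>r (frag_of (a \<odot>\<^bsub>M\<^esub> m, s \<odot>\<^bsub>P\<^esub> n))"
      using a by (simp add: nr_rules(3) Mb.lact_closed flip: Mb.lact_ract)
  qed (simp_all add: a nr_rules(1,2) Mb.lact_closed Mb.lact_r_distr)
  then show ?thesis
    by (simp add: bimodule_tensor_def Let_def induced_ring[OF add_subgroup_ring])
qed

lemma tensor_ract:
  assumes a: "a \<in> carrier (preproj Q)"
  shows "frag_coset K\<^sub>r r \<oslash>\<^bsub>MP\<^esub> a = frag_coset K\<^sub>r (frag_extend (\<lambda>(m, n). frag_of (m, n \<oslash>\<^bsub>P\<^esub> a)) r)"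
proof -
  have "respects_tensor K\<^sub>r M P (carrier (preproj Q)) (rsmult M) (module.smult P) (\<lambda>(m, n). frag_of (m, n \<oslash>\<^bsub>P\<^esub> a))"
    unfolding respects_tensor_def prod.case
  proof (intro conjI ballI)
    fix m n and s :: "('v, 'e + 'e, 'f) pelem set"
    assume "m \<in> carrier M" "s \<in> carrier (preproj Q)" "n \<in> carrier P"
    then show "frag_coset K\<^sub>r (frag_of (m \<oslash>\<^bsub>M\<^esub> s, n \<oslash>\<^bsub>P\<^esub> a)) = frag_coset K\<^sub>r (frag_of (m, (s \<odot>\<^bsub>P\<^esub> n) \<oslash>\<^bsub>P\<^esub> a))"
      using a by (simp add: nr_rules(3) Pb.ract_closed Pb.lact_ract)
  qed (simp_all add: a nr_rules(1,2) Pb.ract_closed Pb.ract_l_distr)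
  then show ?thesis
    by (simp add: bimodule_tensor_def Let_def induced_ring[OF add_subgroup_ring])
qed

lemma abelian_group_tensor: "abelian_group MP"
  by (rule abelian_group_frag_quotient[OF add_subgroup_ring carrier_tensor tensor_ops])

lemma tensor_cases:
  assumes "x \<in> carrier MP"
  obtains r where "x = frag_coset K\<^sub>r r" "\<And>y. y \<in> Poly_Mapping.keys r \<Longrightarrow> fst y \<in> carrier M \<and> snd y \<in> carrier P"
    "Poly_Mapping.keys r \<subseteq> carrier M \<times> carrier P"
  using assms unfolding carrier_tensor by force

lemma tensor_carrierI:
  assumes "\<And>y. y \<in> Poly_Mapping.keys r \<Longrightarrow> Poly_Mapping.keys (h y) \<subseteq> carrier M \<times> carrier P"
  shows "frag_coset K\<^sub>r (frag_extend h r) \<in> carrier MP"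
proof -
  have "Poly_Mapping.keys (frag_extend h r) \<subseteq> carrier M \<times> carrier P"
    by (rule order.trans[OF keys_frag_extend UN_least]) (rule assms)
  then show ?thesis
    unfolding carrier_tensor by blast
qed

lemma bimodule_tensor_bimodule: "bimodule (preproj Q) MP"
proof (intro bimodule.intro bimodule_axioms.intro ring_preproj abelian_group_tensor)
  note ext = frag_coset_extend[OF add_subgroup_ring]
  fix x y and a b :: "('v, 'e + 'e, 'f) pelem set"
  assume a: "a \<in> carrier (preproj Q)" and x: "x \<in> carrier MP"
  obtain r where r: "x = frag_coset K\<^sub>r r" "\<And>y. y \<in> Poly_Mapping.keys r \<Longrightarrow> fst y \<in> carrier M \<and> snd y \<in> carrier P"
    using x tensor_cases by blast
  show "a \<odot>\<^bsub>MP\<^esub> x \<in> carrier MP"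
    unfolding r(1) tensor_lact[OF a] using r(2) a
    by (intro tensor_carrierI) (simp add: case_prod_unfold keys_frag_of Mb.lact_closed)
  show "x \<oslash>\<^bsub>MP\<^esub> a \<in> carrier MP"
    unfolding r(1) tensor_ract[OF a] using r(2) a
    by (intro tensor_carrierI) (simp add: case_prod_unfold keys_frag_of Pb.ract_closed)
  {
    assume y: "y \<in> carrier MP"
    then obtain s where s: "y = frag_coset K\<^sub>r s" by (rule tensor_cases)
    show "a \<odot>\<^bsub>MP\<^esub> (x \<oplus>\<^bsub>MP\<^esub> y) = a \<odot>\<^bsub>MP\<^esub> x \<oplus>\<^bsub>MP\<^esub> a \<odot>\<^bsub>MP\<^esub> y"
      by (simp add: r(1) s tensor_ops tensor_lact a frag_extend_add)
    show "(x \<oplus>\<^bsub>MP\<^esub> y) \<oslash>\<^bsub>MP\<^esub> a = x \<oslash>\<^bsub>MP\<^esub> a \<oplus>\<^bsub>MP\<^esub> y \<oslash>\<^bsub>MP\<^esub> a"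
      by (simp add: r(1) s tensor_ops tensor_ract a frag_extend_add)
  }
  assume b: "b \<in> carrier (preproj Q)"
  show "(a \<oplus>\<^bsub>preproj Q\<^esub> b) \<odot>\<^bsub>MP\<^esub> x = a \<odot>\<^bsub>MP\<^esub> x \<oplus>\<^bsub>MP\<^esub> b \<odot>\<^bsub>MP\<^esub> x"
    unfolding r(1) tensor_lact[OF a] tensor_lact[OF b] tensor_lact[OF Mb.R.a_closed[OF a b]] tensor_ops frag_extend_fun_add[symmetric]
    using r(2) a b by (intro ext) (simp add: case_prod_unfold Mb.lact_l_distr Mb.lact_closed nr_rules(1))
  show "x \<oslash>\<^bsub>MP\<^esub> (a \<oplus>\<^bsub>preproj Q\<^esub> b) = x \<oslash>\<^bsub>MP\<^esub> a \<oplus>\<^bsub>MP\<^esub> x \<oslash>\<^bsub>MP\<^esub> b"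
    unfolding r(1) tensor_ract[OF a] tensor_ract[OF b] tensor_ract[OF Mb.R.a_closed[OF a b]] tensor_ops frag_extend_fun_add[symmetric]
    using r(2) a b by (intro ext) (simp add: case_prod_unfold Pb.ract_r_distr Pb.ract_closed nr_rules(2))
  show "(a \<otimes>\<^bsub>preproj Q\<^esub> b) \<odot>\<^bsub>MP\<^esub> x = a \<odot>\<^bsub>MP\<^esub> (b \<odot>\<^bsub>MP\<^esub> x)"
    unfolding r(1) tensor_lact[OF a] tensor_lact[OF b] tensor_lact[OF Mb.R.m_closed[OF a b]] frag_extend_frag_extend
    using r(2) a b by (intro ext) (simp add: case_prod_unfold Mb.lact_assoc)
  show "x \<oslash>\<^bsub>MP\<^esub> (a \<otimes>\<^bsub>preproj Q\<^esub> b) = (x \<oslash>\<^bsub>MP\<^esub> a) \<oslash>\<^bsub>MP\<^esub> b"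
    unfolding r(1) tensor_ract[OF a] tensor_ract[OF b] tensor_ract[OF Mb.R.m_closed[OF a b]] frag_extend_frag_extend
    using r(2) a b by (intro ext) (simp add: case_prod_unfold Pb.ract_assoc)
  show "(a \<odot>\<^bsub>MP\<^esub> x) \<oslash>\<^bsub>MP\<^esub> b = a \<odot>\<^bsub>MP\<^esub> (x \<oslash>\<^bsub>MP\<^esub> b)"
    unfolding r(1) tensor_lact[OF a] tensor_ract[OF b] frag_extend_frag_extend
    by (simp add: case_prod_unfold)
next
  fix x assume x: "x \<in> carrier MP"
  obtain r where r: "x = frag_coset K\<^sub>r r" "\<And>y. y \<in> Poly_Mapping.keys r \<Longrightarrow> fst y \<in> carrier M \<and> snd y \<in> carrier P"
    using x tensor_cases by blast
  have "frag_extend (\<lambda>(m, n). frag_of (\<one>\<^bsub>preproj Q\<^esub> \<odot>\<^bsub>M\<^esub> m, n)) r = frag_extend frag_of r"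
    using r(2) by (intro frag_extend_eq) (auto simp: case_prod_unfold Mb.lact_one)
  then show "\<one>\<^bsub>preproj Q\<^esub> \<odot>\<^bsub>MP\<^esub> x = x"
    by (simp add: r(1) tensor_lact flip: frag_expansion)
  have "frag_extend (\<lambda>(m, n). frag_of (m, n \<oslash>\<^bsub>P\<^esub> \<one>\<^bsub>preproj Q\<^esub>)) r = frag_extend frag_of r"
    using r(2) by (intro frag_extend_eq) (auto simp: case_prod_unfold Pb.ract_one)
  then show "x \<oslash>\<^bsub>MP\<^esub> \<one>\<^bsub>preproj Q\<^esub> = x"
    by (simp add: r(1) tensor_ract flip: frag_expansion)
qed

text \<open>Symmetry is used in both factors: for a scalar c, c m \<otimes> n = m c \<otimes> n = m
  \<otimes> c n = m \<otimes> n c.\<close>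

lemma preproj_bimodule_tensor: "preproj_bimodule Q MP"
  unfolding preproj_bimodule_def
proof (intro conjI allI ballI bimodule_tensor_bimodule)
  fix c x assume x: "x \<in> carrier MP"
  obtain r where r: "x = frag_coset K\<^sub>r r" "\<And>y. y \<in> Poly_Mapping.keys r \<Longrightarrow> fst y \<in> carrier M \<and> snd y \<in> carrier P"
    using x tensor_cases by blast
  have "frag_coset K\<^sub>r (frag_of (scalar Q c \<odot>\<^bsub>M\<^esub> m, n)) = frag_coset K\<^sub>r (frag_of (m, n \<oslash>\<^bsub>P\<^esub> scalar Q c))"
    if "m \<in> carrier M" "n \<in> carrier P" for m n
    using nr_rules(3)[OF that(1) scalar_closed that(2), of c] that by (simp add: scalar_act(2)[OF M] scalar_act(2)[OF P])
  with r(2) show "scalar Q c \<odot>\<^bsub>MP\<^esub> x = x \<oslash>\<^bsub>MP\<^esub> scalar Q c"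
    unfolding r(1) tensor_lact[OF scalar_closed] tensor_ract[OF scalar_closed]
    by (intro frag_coset_extend[OF add_subgroup_ring]) (simp add: case_prod_unfold)
qed

lemma pt_rules:
  fixes x :: "('v, 'e + 'e, 'f) pelem"
  assumes m: "m \<in> carrier M" and n: "n \<in> carrier P"
  shows "pt m n \<in> carrier MP"
    and "m' \<in> carrier M \<Longrightarrow> pt (m \<oplus>\<^bsub>M\<^esub> m') n = pt m n \<oplus>\<^bsub>MP\<^esub> pt m' n"
    and "n' \<in> carrier P \<Longrightarrow> pt m (n \<oplus>\<^bsub>P\<^esub> n') = pt m n \<oplus>\<^bsub>MP\<^esub> pt m n'"
    and "Poly_Mapping.keys x \<subseteq> paths D \<Longrightarrow> pt (m \<oslash>\<^bsub>M\<^esub> cls Q x) n = pt m (cls Q x \<odot>\<^bsub>P\<^esub> n)"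
    and "Poly_Mapping.keys x \<subseteq> paths D \<Longrightarrow> cls Q x \<odot>\<^bsub>MP\<^esub> pt m n = pt (cls Q x \<odot>\<^bsub>M\<^esub> m) n"
    and "Poly_Mapping.keys x \<subseteq> paths D \<Longrightarrow> pt m n \<oslash>\<^bsub>MP\<^esub> cls Q x = pt m (n \<oslash>\<^bsub>P\<^esub> cls Q x)"
    and "scalar Q c \<odot>\<^bsub>MP\<^esub> pt m n = pt (scalar Q c \<odot>\<^bsub>M\<^esub> m) n"
proof -
  show "pt m n \<in> carrier MP"
    unfolding pure_tensor_def carrier_tensor using m n by (auto intro!: exI[of _ "frag_of (m, n)"] simp: keys_frag_of)
qed (use m n in \<open>simp_all add: pure_tensor_def nr_rules tensor_ops tensor_lact tensor_ract cls_simps(1) scalar_closed\<close>)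

end

section \<open>The identification of \<open>A \<otimes>\<^sub>A M\<close> with \<open>M\<close>\<close>

lemma regular_simps [simp]:
  "carrier (regular_bimodule R) = carrier R" "\<zero>\<^bsub>regular_bimodule R\<^esub> = \<zero>\<^bsub>R\<^esub>"
  "x \<oplus>\<^bsub>regular_bimodule R\<^esub> y = x \<oplus>\<^bsub>R\<^esub> y"
  "x \<odot>\<^bsub>regular_bimodule R\<^esub> y = x \<otimes>\<^bsub>R\<^esub> y" "x \<oslash>\<^bsub>regular_bimodule R\<^esub> y = x \<otimes>\<^bsub>R\<^esub> y"
  by (simp_all add: regular_bimodule_def)

lemma preproj_bimodule_regular:
  "preproj_bimodule Q (regular_bimodule (preproj Q :: ('v, 'e + 'e, 'f::field) pelem set ring))"
proof -
  interpret R: ring "preproj Q :: ('v, 'e + 'e, 'f) pelem set ring" by (rule ring_preproj)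
  let ?A = "regular_bimodule (preproj Q :: ('v, 'e + 'e, 'f) pelem set ring)"
  have "abelian_group ?A"
  proof (rule abelian_groupI)
    fix x assume "x \<in> carrier ?A"
    then show "\<exists>y\<in>carrier ?A. y \<oplus>\<^bsub>?A\<^esub> x = \<zero>\<^bsub>?A\<^esub>"
      by (auto intro!: bexI[of _ "\<ominus>\<^bsub>preproj Q\<^esub> x"] simp: R.l_neg)
  qed (auto simp: R.a_ac)
  then have "bimodule (preproj Q) ?A"
    by (intro bimodule.intro bimodule_axioms.intro ring_preproj) (auto simp: R.l_distr R.r_distr R.m_assoc)
  moreover have "scalar Q c \<otimes>\<^bsub>preproj Q\<^esub> x = x \<otimes>\<^bsub>preproj Q\<^esub> scalar Q c" if "x \<in> carrier (preproj Q)"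
    for c and x :: "('v, 'e + 'e, 'f) pelem set"
    using cls_surj[OF that] scalar_comm by metis
  ultimately show ?thesis
    by (simp add: preproj_bimodule_def)
qed

context
  fixes M :: "(('v, 'e + 'e, 'f::field) pelem set, 'm) bimodule"
  assumes M: "preproj_bimodule Q M"
begin

interpretation Mg: abelian_group M by (rule abelian_M[OF M])
interpretation Mb: bimodule "preproj Q" M by (rule bimodule_M[OF M])

abbreviation (input) "A\<^sub>r \<equiv> regular_bimodule (preproj Q :: ('v, 'e + 'e, 'f) pelem set ring)"
abbreviation (input) "AM \<equiv> bimodule_tensor (preproj Q) A\<^sub>r M"

text \<open>\<open>left_unitor\<close> takes the element of the image of a coset under evaluation,
  so this image has to be a singleton. It is, because the action map of A on M is biadditive and
  balanced and its extension kills all relations.\<close>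

lemma left_unitor_coset:
  assumes r: "Poly_Mapping.keys r \<subseteq> carrier (preproj Q) \<times> carrier M"
  shows "left_unitor M (frag_coset (null_ring (preproj Q) A\<^sub>r M) r) = frag_eval M (\<lambda>y. fst y \<odot>\<^bsub>M\<^esub> snd y) r"
proof -
  let ?K = "null_ring (preproj Q) A\<^sub>r M" and ?g = "\<lambda>y. fst y \<odot>\<^bsub>M\<^esub> snd y"
  note tc = tensor_closed_ring[OF preproj_bimodule_regular M]
  have g: "?g y \<in> carrier M" if "y \<in> Poly_Mapping.keys s" "Poly_Mapping.keys s \<subseteq> carrier (preproj Q) \<times> carrier M" for y s
    using that Mb.lact_closed by auto
  have res: "respects_tensor (eval_ker M) A\<^sub>r M (carrier (preproj Q)) (rsmult A\<^sub>r) (module.smult M) (\<lambda>y. frag_of (?g y))"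
    unfolding respects_tensor_def
    by (simp add: Mb.lact_l_distr Mb.lact_r_distr Mb.lact_assoc Mb.lact_closed Mg.eval_ker_add)
  \<comment> \<open>The supports are recorded too: evaluation in M is additive only for formal sums
    whose terms have values in the carrier.\<close>
  have K: "frag_extend (\<lambda>y. frag_of (?g y)) k \<in> eval_ker M \<and> Poly_Mapping.keys k \<subseteq> carrier (preproj Q) \<times> carrier M"
    if "k \<in> ?K" for k
  proof
    show "frag_extend (\<lambda>y. frag_of (?g y)) k \<in> eval_ker M"
      using that res unfolding null_ring_def by (intro respects_tensor_null[OF tc Mg.add_subgroup_eval_ker])
    interpret F: group "free_Abelian_group (carrier A\<^sub>r \<times> carrier M)" by simp
    have "?K \<subseteq> carrier (free_Abelian_group (carrier A\<^sub>r \<times> carrier M))"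
      unfolding null_ring_def tensor_null_def using relators_keys[OF tc]
      by (intro F.generate_incl) (auto simp del: regular_simps)
    with that have "k \<in> carrier (free_Abelian_group (carrier A\<^sub>r \<times> carrier M))" by blast
    then show "Poly_Mapping.keys k \<subseteq> carrier (preproj Q) \<times> carrier M" by simp
  qed
  have "frag_eval M ?g (k + r) = frag_eval M ?g r" if "k \<in> ?K" for k
  proof (rule Mg.eval_ker_eqI)
    have kr: "Poly_Mapping.keys (k + r) \<subseteq> carrier (preproj Q) \<times> carrier M"
      using K[OF that] r keys_add[of k r] by blast
    show "frag_eval M ?g (k + r) \<in> carrier M" "frag_eval M ?g r \<in> carrier M"
      using g[OF _ kr] g[OF _ r] by (auto intro: Mg.frag_eval_closed)
    have "frag_coset (eval_ker M) (frag_of (frag_eval M ?g (k + r))) = frag_coset (eval_ker M) (frag_extend (\<lambda>y. frag_of (?g y)) (k + r))"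
      using g[OF _ kr] by (intro Mg.eval_ker_frag_of_eval) auto
    also have "\<dots> = frag_coset (eval_ker M) (frag_extend (\<lambda>y. frag_of (?g y)) r)"
      using K[OF that] by (simp add: frag_coset_eq_iff[OF Mg.add_subgroup_eval_ker] frag_extend_add)
    also have "\<dots> = frag_coset (eval_ker M) (frag_of (frag_eval M ?g r))"
      using g[OF _ r] by (intro Mg.eval_ker_frag_of_eval[symmetric]) auto
    finally show "frag_coset (eval_ker M) (frag_of (frag_eval M ?g (k + r))) = \<dots>" .
  qed
  moreover have "0 \<in> ?K"
    by (rule add_subgroupD[OF add_subgroup_ring[OF preproj_bimodule_regular M]])
  ultimately have "frag_eval M ?g ` frag_coset ?K r = {frag_eval M ?g r}"
    by (auto simp: frag_coset_eq image_image)
  then show ?thesis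
    by (simp add: left_unitor_def frag_eval_def)
qed

lemma left_unitor_pt:
  "a \<in> carrier (preproj Q) \<Longrightarrow> m \<in> carrier M \<Longrightarrow> left_unitor M (pure_tensor (preproj Q) A\<^sub>r M a m) = a \<odot>\<^bsub>M\<^esub> m"
  unfolding pure_tensor_def by (subst left_unitor_coset) (auto simp: keys_frag_of Mb.lact_closed)

lemma left_unitor_closed:
  assumes "x \<in> carrier AM" shows "left_unitor M x \<in> carrier M"
proof -
  obtain r where r: "x = frag_coset (null_ring (preproj Q) A\<^sub>r M) r" "Poly_Mapping.keys r \<subseteq> carrier A\<^sub>r \<times> carrier M"
    using assms by (rule tensor_cases[OF preproj_bimodule_regular M])
  then show ?thesis
    using Mb.lact_closed by (auto simp: left_unitor_coset intro!: Mg.frag_eval_closed)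
qed

lemma left_unitor_add:
  assumes "x \<in> carrier AM" "y \<in> carrier AM"
  shows "left_unitor M (x \<oplus>\<^bsub>AM\<^esub> y) = left_unitor M x \<oplus>\<^bsub>M\<^esub> left_unitor M y"
proof -
  obtain r where r: "x = frag_coset (null_ring (preproj Q) A\<^sub>r M) r" "Poly_Mapping.keys r \<subseteq> carrier A\<^sub>r \<times> carrier M"
    using assms(1) by (rule tensor_cases[OF preproj_bimodule_regular M])
  obtain s where s: "y = frag_coset (null_ring (preproj Q) A\<^sub>r M) s" "Poly_Mapping.keys s \<subseteq> carrier A\<^sub>r \<times> carrier M"
    using assms(2) by (rule tensor_cases[OF preproj_bimodule_regular M])
  have "Poly_Mapping.keys (r + s) \<subseteq> carrier (preproj Q) \<times> carrier M"
    using r s keys_add[of r s] by auto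
  then show ?thesis
    unfolding r(1) s(1) tensor_ops[OF preproj_bimodule_regular M] using r(2) s(2) Mb.lact_closed
    by (subst (1 2 3) left_unitor_coset) (auto intro!: Mg.frag_eval_add)
qed

lemma left_unitor_act:
  assumes x: "x \<in> carrier AM" and a: "a \<in> carrier (preproj Q)"
  shows "left_unitor M (a \<odot>\<^bsub>AM\<^esub> x) = a \<odot>\<^bsub>M\<^esub> left_unitor M x" (is ?l)
    and "left_unitor M (x \<oslash>\<^bsub>AM\<^esub> a) = left_unitor M x \<oslash>\<^bsub>M\<^esub> a" (is ?r)
proof -
  let ?K = "null_ring (preproj Q) A\<^sub>r M" and ?g = "\<lambda>y. fst y \<odot>\<^bsub>M\<^esub> snd y"
  interpret AMb: bimodule "preproj Q" AM by (rule bimodule_tensor_bimodule[OF preproj_bimodule_regular M])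
  obtain r where r: "x = frag_coset ?K r" "Poly_Mapping.keys r \<subseteq> carrier A\<^sub>r \<times> carrier M"
    using x by (rule tensor_cases[OF preproj_bimodule_regular M])
  have gM: "?g y \<in> carrier M" if "y \<in> Poly_Mapping.keys r" for y
    using that r(2) Mb.lact_closed by auto
  \<comment> \<open>Treats both actions at once: \<open>h\<close> is the action on pairs,
    \<open>F\<close> the corresponding additive map on M, and the hypothesis says that they match on
    generators.\<close>
  have lu: "left_unitor M (frag_coset ?K (frag_extend (\<lambda>y. frag_of (h y)) r)) = F (left_unitor M x)"
    if h: "\<And>y. y \<in> Poly_Mapping.keys r \<Longrightarrow> h y \<in> carrier (preproj Q) \<times> carrier M \<and> ?g (h y) = F (?g y)"
      and F: "\<And>m. m \<in> carrier M \<Longrightarrow> F m \<in> carrier M"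
      and F_add: "\<And>m m'. m \<in> carrier M \<Longrightarrow> m' \<in> carrier M \<Longrightarrow> F (m \<oplus>\<^bsub>M\<^esub> m') = F m \<oplus>\<^bsub>M\<^esub> F m'" for h F
  proof -
    let ?s = "frag_extend (\<lambda>y. frag_of (h y)) r"
    have s: "Poly_Mapping.keys ?s \<subseteq> carrier (preproj Q) \<times> carrier M"
      using h by (intro order.trans[OF keys_frag_extend] UN_least) (auto simp: keys_frag_of)
    have gs: "?g y \<in> carrier M" if "y \<in> Poly_Mapping.keys ?s" for y
      using that s Mb.lact_closed by auto
    have xr: "left_unitor M x = frag_eval M ?g r"
      using r by (simp add: left_unitor_coset)
    have "frag_eval M ?g ?s = F (frag_eval M ?g r)"
    proof (rule Mg.eval_ker_eqI)
      show "frag_eval M ?g ?s \<in> carrier M" "F (frag_eval M ?g r) \<in> carrier M"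
        using gs gM by (auto intro!: Mg.frag_eval_closed F)
      have "frag_coset (eval_ker M) (frag_of (frag_eval M ?g ?s)) = frag_coset (eval_ker M) (frag_extend (\<lambda>y. frag_of (?g y)) ?s)"
        using gs by (rule Mg.eval_ker_frag_of_eval)
      also have "frag_extend (\<lambda>y. frag_of (?g y)) ?s = frag_extend (\<lambda>y. frag_of (F (?g y))) r"
        unfolding frag_extend_frag_extend using h by (intro frag_extend_eq) auto
      also have "\<dots> = frag_extend (\<lambda>m. frag_of (F m)) (frag_extend (\<lambda>y. frag_of (?g y)) r)"
        by (simp add: frag_extend_frag_extend)
      also have "frag_coset (eval_ker M) \<dots> = frag_coset (eval_ker M) (frag_extend (\<lambda>m. frag_of (F m)) (frag_of (frag_eval M ?g r)))"
        using gM by (intro Mg.eval_ker_map[OF Mg.add_subgroup_eval_ker] Mg.eval_ker_frag_of_eval[symmetric])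
          (simp_all add: F F_add Mg.eval_ker_add)
      finally show "frag_coset (eval_ker M) (frag_of (frag_eval M ?g ?s)) = frag_coset (eval_ker M) (frag_of (F (frag_eval M ?g r)))"
        by simp
    qed
    then show ?thesis
      using s by (simp add: xr left_unitor_coset)
  qed
  have rk: "fst y \<in> carrier (preproj Q) \<and> snd y \<in> carrier M" if "y \<in> Poly_Mapping.keys r" for y
    using that r(2) by auto
  have "left_unitor M (frag_coset ?K (frag_extend (\<lambda>y. frag_of (a \<otimes>\<^bsub>preproj Q\<^esub> fst y, snd y)) r)) = a \<odot>\<^bsub>M\<^esub> left_unitor M x"
    by (rule lu) (simp_all add: rk a Mb.lact_assoc Mb.lact_closed Mb.lact_r_distr)
  then show ?l
    unfolding r(1) tensor_lact[OF preproj_bimodule_regular M a] by (simp add: case_prod_unfold)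
  have "left_unitor M (frag_coset ?K (frag_extend (\<lambda>y. frag_of (fst y, snd y \<oslash>\<^bsub>M\<^esub> a)) r)) = left_unitor M x \<oslash>\<^bsub>M\<^esub> a"
    by (rule lu) (simp_all add: rk a Mb.lact_ract Mb.ract_closed Mb.ract_l_distr)
  then show ?r
    unfolding r(1) tensor_ract[OF preproj_bimodule_regular M a] by (simp add: case_prod_unfold)
qed

end

end

section \<open>The fundamental chain as a Casimir element\<close>

context connected_quiver
begin

lemma one_W: "\<one>\<^bsub>tensor_algebra Q\<^esub> \<in> koszul_W Q 0"
  by (simp add: koszul_W_simps dq.one_deg)

lemma trivial_path_W: "i \<in> verts Q \<Longrightarrow> trivial_path i \<in> koszul_W Q 0"
  by (simp add: koszul_W_simps dq.trivial_path_deg)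

lemma trivial_path_base: "i \<in> verts Q \<Longrightarrow> trivial_path i \<in> base_k Q"
  by (simp add: dq.trivial_path_deg)

lemma sigma_W: "i \<in> verts Q \<Longrightarrow> sigma Q i \<in> koszul_W Q 2"
  by (auto simp: koszul_W_2 relations_def intro: pelem.span_base)

lemma finite_idx: "finite (idx p)"
  by (simp add: idx_def double_quiver_arrows)

lemma idx_facts:
  assumes "b \<in> idx p"
  shows "(bas p b :: ('v, 'e + 'e, 'f::field) pelem) \<in> koszul_W Q p"
    and "(dua p b :: ('v, 'e + 'e, 'f) pelem) \<in> koszul_W Q (2 - p)"
    and "hh b \<in> verts Q" "tt b \<in> verts Q"
    and "trivial_path (hh b) \<star> bas p b = (bas p b :: ('v, 'e + 'e, 'f) pelem)"
    and "bas p b \<star> trivial_path (tt b) = (bas p b :: ('v, 'e + 'e, 'f) pelem)"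
    and "trivial_path (tt b) \<star> dua p b = (dua p b :: ('v, 'e + 'e, 'f) pelem)"
    and "dua p b \<star> trivial_path (hh b) = (dua p b :: ('v, 'e + 'e, 'f) pelem)"
proof -
  interpret A: path_basis D "koszul_W Q p :: ('v, 'e + 'e, 'f) pelem set" "nat p" "idx p" "bas p" hh tt
     "case_sum (\<lambda>i. if p = 2 then eps (arrow_to i) else 1) (\<lambda>_. 1)"
     "case_sum (\<lambda>i. if p = 2 then [arrow_to i, star (arrow_to i)] else []) (\<lambda>a. [a])"
    by (rule bas_basis)
  interpret B: path_basis D "koszul_W Q (2 - p) :: ('v, 'e + 'e, 'f) pelem set" "nat (2 - p)" "idx p" "dua p" tt hh
     "case_sum (\<lambda>i. if p = 0 then eps (arrow_to i) else 1) eps"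
     "case_sum (\<lambda>i. if p = 0 then [arrow_to i, star (arrow_to i)] else []) (\<lambda>a. [star a])"
    by (rule dua_basis)
  show "(bas p b :: ('v, 'e + 'e, 'f) pelem) \<in> koszul_W Q p" "trivial_path (hh b) \<star> bas p b = (bas p b :: ('v, 'e + 'e, 'f) pelem)"
    "bas p b \<star> trivial_path (tt b) = (bas p b :: ('v, 'e + 'e, 'f) pelem)"
    using assms by (rule A.b_in A.b_head A.b_tail)+
  show "(dua p b :: ('v, 'e + 'e, 'f) pelem) \<in> koszul_W Q (2 - p)" "trivial_path (tt b) \<star> dua p b = (dua p b :: ('v, 'e + 'e, 'f) pelem)"
    "dua p b \<star> trivial_path (hh b) = (dua p b :: ('v, 'e + 'e, 'f) pelem)"
    using assms by (rule B.b_in B.b_head B.b_tail)+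
  show "hh b \<in> verts Q" "tt b \<in> verts Q"
    using A.h_in[OF assms] A.t_in[OF assms] by simp_all
qed

lemma casimir:
  assumes p: "p \<ge> 0" "p \<le> 2" and i: "i \<in> verts Q"
  shows "(\<Sum>b\<in>{b \<in> idx p. hh b = i}. bas p b \<star> dua p b) = (sigma Q i :: ('v, 'e + 'e, 'f::field) pelem)"
proof -
  consider "p = 0" | "p = 1" | "p = 2" using p by linarith
  then show ?thesis
  proof cases
    case 1
    have "{b \<in> idx p. hh b = i} = {Inl i}" using i 1 by (auto simp: idx_def hh_def)
    then show ?thesis by (simp add: 1 bas_def dua_def sigma_head)
  next
    case 2
    have "{b \<in> idx p. hh b = i} = Inr ` {a \<in> arcs D. head D a = i}" using 2 by (auto simp: idx_def hh_def)
    then show ?thesis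
      by (simp add: 2 bas_def dua_def sigma_def sum.reindex path_mult_pscale_right)
  next
    case 3
    have "{b \<in> idx p. hh b = i} = {Inl i}" using i 3 by (auto simp: idx_def hh_def)
    then show ?thesis by (simp add: 3 bas_def dua_def sigma_tail)
  qed
qed

lemma sum_by_head:
  "(\<Sum>i\<in>verts Q. \<Sum>b\<in>{b \<in> idx p. hh b = i}. f b) = (\<Sum>b\<in>idx p. f b)"
  using idx_facts(3) by (intro sum.group finite_idx) auto

lemma sum_idx_vertex:
  "p = 0 \<or> p = 2 \<Longrightarrow> (\<Sum>b\<in>idx p. f b) = (\<Sum>i\<in>verts Q. f (Inl i))"
  by (auto simp: idx_def sum.reindex)

lemma one_trivial_path:
  assumes "i \<in> verts Q"
  shows "\<one>\<^bsub>tensor_algebra Q\<^esub> \<star> trivial_path i = (trivial_path i :: ('v, 'e + 'e, 'f::field) pelem)"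
  by (rule dq.path_mult_one(1)[OF koszul_W_closed(6)[OF trivial_path_W[OF assms]]])

lemma dua_W:
  "b \<in> idx p \<Longrightarrow> p + q = 2 \<Longrightarrow> (dua p b :: ('v, 'e + 'e, 'f::field) pelem) \<in> koszul_W Q q"
  using idx_facts(2)[of b p] by (metis add_diff_cancel_left')

lemma split_unit_left:
  assumes K: "add_subgroup K" and S: "balanced K p q S" and p: "p = 0" "q \<ge> 0" and w: "w \<in> koszul_W Q q"
  shows "frag_coset K (\<Sum>(u, v)\<leftarrow>split Q p q w. S u v) = frag_coset K (S \<one>\<^bsub>tensor_algebra Q\<^esub> w)"
proof -
  have "frag_coset K (\<Sum>(u, v)\<leftarrow>split Q p q w. S u v) = frag_coset K (\<Sum>(u, v)\<leftarrow>[(\<one>\<^bsub>tensor_algebra Q\<^esub>, w)]. S u v)"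
    using p w one_W by (intro split_eq_list[OF K S]) (simp_all add: dq.path_mult_one koszul_W_closed(6))
  then show ?thesis by simp
qed

lemma split_unit_right:
  assumes K: "add_subgroup K" and S: "balanced K p q S" and p: "p \<ge> 0" "q = 0" and w: "w \<in> koszul_W Q p"
  shows "frag_coset K (\<Sum>(u, v)\<leftarrow>split Q p q w. S u v) = frag_coset K (S w \<one>\<^bsub>tensor_algebra Q\<^esub>)"
proof -
  have "frag_coset K (\<Sum>(u, v)\<leftarrow>split Q p q w. S u v) = frag_coset K (\<Sum>(u, v)\<leftarrow>[(w, \<one>\<^bsub>tensor_algebra Q\<^esub>)]. S u v)"
    using p w one_W by (intro split_eq_list[OF K S]) (simp_all add: dq.path_mult_one koszul_W_closed(6))
  then show ?thesis by simp
qed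

lemma split_sigma:
  assumes K: "add_subgroup K" and S: "balanced K p q S" and p: "p \<ge> 0" "q \<ge> 0" "p + q = 2" and i: "i \<in> verts Q"
  shows "frag_coset K (\<Sum>(u, v)\<leftarrow>split Q p q (sigma Q i). S u v) =
    frag_coset K (\<Sum>b\<in>{b \<in> idx p. hh b = i}. S (bas p b) (dua p b))"
proof (rule split_eq_sum[OF K S p(1,2)])
  show "sigma Q i \<in> koszul_W Q (p + q)"
    unfolding p(3) by (rule sigma_W[OF i])
  show "bas p b \<in> koszul_W Q p \<and> dua p b \<in> koszul_W Q q" if "b \<in> {b \<in> idx p. hh b = i}" for b
    using that idx_facts(1)[of b p] dua_W[of b p q] p by blast
  show "(\<Sum>b\<in>{b \<in> idx p. hh b = i}. bas p b \<star> dua p b) = sigma Q i"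
    using p i by (intro casimir) simp_all
qed (simp add: finite_idx)

text \<open>For p = 0 and p = 2 both sides sum over the same pairs of an idempotent and a sigma_i.
  For p = 1, renaming a as a* exchanges the two factors and changes the sign of eps(a).\<close>

lemma casimir_symmetry:
  fixes S :: "('v, 'e + 'e, 'f::field) pelem \<Rightarrow> ('v, 'e + 'e, 'f) pelem \<Rightarrow> 'c \<Rightarrow>\<^sub>0 int"
  assumes K: "add_subgroup K" and S: "balanced K p q S" and p: "p \<ge> 0" "q \<ge> 0" "p + q = 2"
  shows "frag_coset K (\<Sum>b\<in>idx p. S (bas p b) (dua p b)) =
    frag_coset K (frag_cmul (sgn_pow p) (\<Sum>b\<in>idx q. S (dua q b) (bas q b)))"
proof -
  consider "p = 0" "q = 2" | "p = 1" "q = 1" | "p = 2" "q = 0" using p by linarith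
  then show ?thesis
  proof cases
    case 1
    then show ?thesis by (simp add: sum_idx_vertex bas_def dua_def sgn_pow_def)
  next
    case 3
    then show ?thesis by (simp add: sum_idx_vertex bas_def dua_def sgn_pow_def)
  next
    case 2
    have W: "arrow D a \<in> koszul_W Q 1" if "a \<in> arcs D" for a
      using dq.arrow_deg[OF that] by (simp add: koszul_W_simps)
    have "frag_coset K (S (arrow D a) (pscale (eps a) (arrow D (star a)))) =
        frag_coset K (- S (pscale (eps (star a)) (arrow D a)) (arrow D (star a)))" if a: "a \<in> arcs D" for a
    proof -
      have a': "star a \<in> arcs D" using a by simp
      have "frag_coset K (S (pscale (eps (star a)) (arrow D a) + pscale (eps a) (arrow D a)) (arrow D (star a))) =
          frag_coset K (S (pscale (eps (star a)) (arrow D a)) (arrow D (star a)) + S (pscale (eps a) (arrow D a)) (arrow D (star a)))"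
        unfolding 2 by (intro balancedD(1)[OF K S[unfolded 2]] koszul_W_closed(3) W a a')
      moreover have "pscale (eps (star a)) (arrow D a) + pscale (eps a) (arrow D a) = (0 :: ('v, 'e + 'e, 'f) pelem)"
        by (simp flip: pelem.scale_left_distrib)
      moreover have "frag_coset K (S 0 (arrow D (star a))) = frag_coset K 0"
        using W[OF a'] 2 by (intro balanced_0_left[OF K S]) auto
      ultimately have "frag_coset K (S (pscale (eps (star a)) (arrow D a)) (arrow D (star a)) + S (pscale (eps a) (arrow D a)) (arrow D (star a))) = frag_coset K 0"
        by simp
      then have "frag_coset K (S (pscale (eps a) (arrow D a)) (arrow D (star a))) = frag_coset K (- S (pscale (eps (star a)) (arrow D a)) (arrow D (star a)))"
        by (simp add: frag_coset_eq_iff[OF K] add.commute)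
      moreover have "frag_coset K (S (arrow D a) (pscale (eps a) (arrow D (star a)))) = frag_coset K (S (pscale (eps a) (arrow D a)) (arrow D (star a)))"
        using W[OF a] W[OF a'] 2 by (intro balanced_pscale[OF K S]) auto
      ultimately show ?thesis by simp
    qed
    then have "frag_coset K (\<Sum>a\<in>arcs D. S (arrow D a) (pscale (eps a) (arrow D (star a)))) =
        frag_coset K (\<Sum>a\<in>arcs D. - S (pscale (eps (star a)) (arrow D (star (star a)))) (arrow D (star a)))"
      by (intro frag_coset_sum[OF K]) simp
    also have "(\<Sum>a\<in>arcs D. - S (pscale (eps (star a)) (arrow D (star (star a)))) (arrow D (star a))) =
        (\<Sum>a\<in>arcs D. - S (pscale (eps a) (arrow D (star a))) (arrow D a))"
      by (rule sum.reindex_bij_betw[OF bij_star])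
    finally show ?thesis
      using 2 by (simp add: idx_def sum.reindex bas_def dua_def sgn_pow_def sum_negf)
  qed
qed

text \<open>The third condition closes the cycle: a factor from k may also pass between the last and
  the first argument, as it does around a tensor product over k^e.\<close>

definition trilinear where
  "trilinear K p q r T \<longleftrightarrow>
     (\<forall>w\<in>koszul_W Q r. balanced K p q (\<lambda>u v. T u v w)) \<and>
     (\<forall>u\<in>koszul_W Q p. balanced K q r (\<lambda>v w. T u v w)) \<and>
     (\<forall>v\<in>koszul_W Q q. balanced K r p (\<lambda>w u. T u v w))"

text \<open>
  Both identities say that the three ways of splitting the sum of the \<open>\<sigma>\<^sub>i\<close> into three factors agree
  up to a cyclic permutation, which introduces a sign. One of the three degrees is \<open>0\<close>, so that
  only the decompositions \<open>w = 1 w\<close>, \<open>w = w 1\<close> and the Casimir decomposition of \<open>\<sigma>\<^sub>i\<close> are needed.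
\<close>

context
  fixes K :: "('c \<Rightarrow>\<^sub>0 int) set" and p q r :: int
    and T :: "('v, 'e + 'e, 'f::field) pelem \<Rightarrow> ('v, 'e + 'e, 'f) pelem \<Rightarrow> ('v, 'e + 'e, 'f) pelem \<Rightarrow> 'c \<Rightarrow>\<^sub>0 int"
  assumes K: "add_subgroup K" and T: "trilinear K p q r T"
    and pqr: "p \<ge> 0" "q \<ge> 0" "r \<ge> 0" "p + q + r = 2"
begin

lemma trilinearD:
  "w \<in> koszul_W Q r \<Longrightarrow> balanced K p q (\<lambda>u v. T u v w)"
  "u \<in> koszul_W Q p \<Longrightarrow> balanced K q r (\<lambda>v w. T u v w)"
  "v \<in> koszul_W Q q \<Longrightarrow> balanced K r p (\<lambda>w u. T u v w)"
  using T unfolding trilinear_def by blast+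

lemma trilinear_first:
  "frag_coset K (\<Sum>b\<in>idx (p + q). \<Sum>(u, v)\<leftarrow>split Q p q (bas (p + q) b). T u v (dua (p + q) b)) =
   frag_coset K (\<Sum>b\<in>idx p. \<Sum>(u, v)\<leftarrow>split Q q r (dua p b). T (bas p b) u v)"
   (is "frag_coset K ?L = frag_coset K ?R")
proof -
  note bal = trilinearD and bD = balancedD[OF K] and fs = frag_coset_sum[OF K]
  consider "p = 0" | "q = 0" | "r = 0" using pqr by linarith
  then show ?thesis
  proof cases
    case 1
    have qr: "q + r = 2" using 1 pqr by simp
    have tw: "i \<in> verts Q \<Longrightarrow> trivial_path i \<in> koszul_W Q p" for i using 1 trivial_path_W by simp
    have "frag_coset K ?L = frag_coset K (\<Sum>b\<in>idx q. T \<one>\<^bsub>tensor_algebra Q\<^esub> (bas q b) (dua q b))"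
      unfolding 1 add_0 using 1 pqr idx_facts(1) dua_W[OF _ qr]
      by (intro fs split_unit_left[OF K bal(1)[unfolded 1]]) simp_all
    \<comment> \<open>Since b = e b for the idempotent e at \<open>hh b\<close>, balancing replaces
      the unit by e. After that the sum can be grouped by vertices and recognized as splitting the
      sigma_i.\<close>
    also have "\<dots> = frag_coset K (\<Sum>b\<in>idx q. T (trivial_path (hh b)) (bas q b) (dua q b))"
    proof (intro fs)
      fix b assume b: "b \<in> idx q"
      have "frag_coset K (T (\<one>\<^bsub>tensor_algebra Q\<^esub> \<star> trivial_path (hh b)) (bas q b) (dua q b)) =
          frag_coset K (T \<one>\<^bsub>tensor_algebra Q\<^esub> (trivial_path (hh b) \<star> bas q b) (dua q b))"
        using 1 one_W by (intro bD(3)[OF bal(1)] trivial_path_base idx_facts[OF b] dua_W[OF b qr]) simp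
      then show "frag_coset K (T \<one>\<^bsub>tensor_algebra Q\<^esub> (bas q b) (dua q b)) = frag_coset K (T (trivial_path (hh b)) (bas q b) (dua q b))"
        by (simp only: one_trivial_path idx_facts[OF b])
    qed
    also have "(\<Sum>b\<in>idx q. T (trivial_path (hh b)) (bas q b) (dua q b)) =
        (\<Sum>i\<in>verts Q. \<Sum>b\<in>{b \<in> idx q. hh b = i}. T (trivial_path i) (bas q b) (dua q b))"
      by (subst sum_by_head[symmetric]) (rule sum.cong[OF refl], rule sum.cong[OF refl], simp)
    also have "frag_coset K \<dots> = frag_coset K (\<Sum>i\<in>verts Q. \<Sum>(u, v)\<leftarrow>split Q q r (sigma Q i). T (trivial_path i) u v)"
      using pqr qr tw by (intro fs split_sigma[OF K bal(2), symmetric]) simp_all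
    also have "(\<Sum>i\<in>verts Q. \<Sum>(u, v)\<leftarrow>split Q q r (sigma Q i). T (trivial_path i) u v) = ?R"
      using 1 by (simp add: sum_idx_vertex bas_def dua_def)
    finally show ?thesis .
  next
    case 2
    have pr: "p + r = 2" using 2 pqr by simp
    \<comment> \<open>With the middle degree 0, both decompositions put the unit in the middle
      argument.\<close>
    have "frag_coset K (\<Sum>(u, v)\<leftarrow>split Q p q (bas p b). T u v (dua p b)) =
        frag_coset K (\<Sum>(u, v)\<leftarrow>split Q q r (dua p b). T (bas p b) u v)" if b: "b \<in> idx p" for b
      by (rule trans[OF split_unit_right[OF K bal(1)] split_unit_left[OF K bal(2), symmetric]])
        (use 2 pqr idx_facts(1)[OF b] dua_W[OF b pr] in simp_all)
    then show ?thesis unfolding 2 add_0_right by (intro fs) (simp add: 2)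
  next
    case 3
    have pq: "p + q = 2" using 3 pqr by simp
    have "?L = (\<Sum>i\<in>verts Q. \<Sum>(u, v)\<leftarrow>split Q p q (sigma Q i). T u v (trivial_path i))"
      by (simp add: pq sum_idx_vertex bas_def dua_def)
    also have "frag_coset K \<dots> = frag_coset K (\<Sum>i\<in>verts Q. \<Sum>b\<in>{b \<in> idx p. hh b = i}. T (bas p b) (dua p b) (trivial_path i))"
      using 3 pqr pq trivial_path_W by (intro fs split_sigma[OF K bal(1)]) simp_all
    also have "(\<Sum>i\<in>verts Q. \<Sum>b\<in>{b \<in> idx p. hh b = i}. T (bas p b) (dua p b) (trivial_path i)) =
        (\<Sum>b\<in>idx p. T (bas p b) (dua p b) (trivial_path (hh b)))"
      by (subst sum_by_head[symmetric]) (rule sum.cong[OF refl], rule sum.cong[OF refl], simp)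
    also have "frag_coset K \<dots> = frag_coset K ?R"
    proof (intro fs)
      fix b assume b: "b \<in> idx p"
      \<comment> \<open>Here the cyclic condition is used: the idempotent travels from the last
        argument to the first, where it is absorbed by the basis element.\<close>
      have "frag_coset K (T (bas p b) (dua p b) (\<one>\<^bsub>tensor_algebra Q\<^esub> \<star> trivial_path (hh b))) =
          frag_coset K (T (trivial_path (hh b) \<star> bas p b) (dua p b) \<one>\<^bsub>tensor_algebra Q\<^esub>)"
        using 3 one_W by (intro bD(3)[OF bal(3)] trivial_path_base idx_facts[OF b] dua_W[OF b pq]) simp
      then have "frag_coset K (T (bas p b) (dua p b) (trivial_path (hh b))) = frag_coset K (T (bas p b) (dua p b) \<one>\<^bsub>tensor_algebra Q\<^esub>)"
        by (simp only: one_trivial_path idx_facts[OF b])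
      also have "\<dots> = frag_coset K (\<Sum>(u, v)\<leftarrow>split Q q r (dua p b). T (bas p b) u v)"
        using 3 pqr idx_facts(1)[OF b] dua_W[OF b pq] by (intro split_unit_right[OF K bal(2), symmetric]) simp_all
      finally show "frag_coset K (T (bas p b) (dua p b) (trivial_path (hh b))) = \<dots>" .
    qed
    finally show ?thesis .
  qed
qed

lemma trilinear_second:
  "frag_coset K (\<Sum>b\<in>idx p. \<Sum>(u, v)\<leftarrow>split Q q r (dua p b). T (bas p b) u v) =
   frag_coset K (frag_cmul (sgn_pow p) (\<Sum>b\<in>idx q. \<Sum>(u, v)\<leftarrow>split Q r p (dua q b). T v (bas q b) u))"
   (is "frag_coset K ?L = frag_coset K (frag_cmul _ ?R)")
proof -
  note bal = trilinearD and bD = balancedD[OF K] and fs = frag_coset_sum[OF K]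
  consider "p = 0" | "q = 0" | "r = 0" using pqr by linarith
  then show ?thesis
  proof cases
    case 1
    have qr: "q + r = 2" using 1 pqr by simp
    \<comment> \<open>By the first identity the left side becomes a sum over the basis of W_q with
      the unit in the first argument. Splitting off the unit on the right side leads to the same
      sum.\<close>
    have "frag_coset K ?L = frag_coset K (\<Sum>b\<in>idx (p + q). \<Sum>(u, v)\<leftarrow>split Q p q (bas (p + q) b). T u v (dua (p + q) b))"
      by (rule trilinear_first[symmetric])
    also have "\<dots> = frag_coset K (\<Sum>b\<in>idx q. T \<one>\<^bsub>tensor_algebra Q\<^esub> (bas q b) (dua q b))"
      unfolding 1 add_0 using 1 pqr idx_facts(1) dua_W[OF _ qr]
      by (intro fs split_unit_left[OF K bal(1)[unfolded 1]]) simp_all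
    also have "\<dots> = frag_coset K ?R"
      using 1 pqr idx_facts(1) dua_W[OF _ qr] by (intro fs split_unit_right[OF K bal(3), symmetric]) simp_all
    finally show ?thesis using 1 by (simp add: sgn_pow_def)
  next
    case 2
    then have pr: "p + r = 2" "r + p = 2" using pqr by simp_all
    have ow: "\<one>\<^bsub>tensor_algebra Q\<^esub> \<in> koszul_W Q q" using 2 one_W by simp
    have tw: "i \<in> verts Q \<Longrightarrow> trivial_path i \<in> koszul_W Q q" for i using 2 trivial_path_W by simp
    have "?R = (\<Sum>i\<in>verts Q. \<Sum>(u, v)\<leftarrow>split Q r p (sigma Q i). T v (trivial_path i) u)"
      using 2 by (simp add: sum_idx_vertex bas_def dua_def)
    also have "frag_coset K \<dots> = frag_coset K (\<Sum>i\<in>verts Q. \<Sum>b\<in>{b \<in> idx r. hh b = i}. T (dua r b) (trivial_path i) (bas r b))"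
      using pqr pr tw by (intro fs split_sigma[OF K bal(3)]) simp_all
    also have "(\<Sum>i\<in>verts Q. \<Sum>b\<in>{b \<in> idx r. hh b = i}. T (dua r b) (trivial_path i) (bas r b)) =
        (\<Sum>b\<in>idx r. T (dua r b) (trivial_path (hh b)) (bas r b))"
      by (subst sum_by_head[symmetric]) (rule sum.cong[OF refl], rule sum.cong[OF refl], simp)
    also have "frag_coset K \<dots> = frag_coset K (\<Sum>b\<in>idx r. T (dua r b) \<one>\<^bsub>tensor_algebra Q\<^esub> (bas r b))"
    proof (intro fs)
      fix b assume b: "b \<in> idx r"
      have "frag_coset K (T (dua r b) (\<one>\<^bsub>tensor_algebra Q\<^esub> \<star> trivial_path (hh b)) (bas r b)) =
          frag_coset K (T (dua r b) \<one>\<^bsub>tensor_algebra Q\<^esub> (trivial_path (hh b) \<star> bas r b))"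
        using 2 one_W by (intro bD(3)[OF bal(2)] trivial_path_base idx_facts[OF b] dua_W[OF b pr(2)]) simp
      then show "frag_coset K (T (dua r b) (trivial_path (hh b)) (bas r b)) = frag_coset K (T (dua r b) \<one>\<^bsub>tensor_algebra Q\<^esub> (bas r b))"
        by (simp only: one_trivial_path idx_facts[OF b])
    qed
    also have "\<dots> = frag_coset K (frag_cmul (sgn_pow r) (\<Sum>b\<in>idx p. T (bas p b) \<one>\<^bsub>tensor_algebra Q\<^esub> (dua p b)))"
      using pqr pr ow by (intro casimir_symmetry[OF K bal(3)]) simp_all
    finally have R: "frag_coset K ?R = frag_coset K (frag_cmul (sgn_pow r) (\<Sum>b\<in>idx p. T (bas p b) \<one>\<^bsub>tensor_algebra Q\<^esub> (dua p b)))" .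
    have "frag_coset K ?L = frag_coset K (\<Sum>b\<in>idx p. T (bas p b) \<one>\<^bsub>tensor_algebra Q\<^esub> (dua p b))"
      using 2 pqr idx_facts(1) dua_W[OF _ pr(1)] by (intro fs split_unit_left[OF K bal(2)]) simp_all
    \<comment> \<open>The Casimir symmetry was applied in degree \<open>r\<close>, so its sign is
      that of \<open>r\<close>. As p + r = 2, it equals the sign of \<open>p\<close> and cancels
      against it.\<close>
    moreover have "even p \<longleftrightarrow> even r"
      using pr by presburger
    then have "frag_cmul (sgn_pow p) (frag_cmul (sgn_pow r) x) = x" for x :: "'c \<Rightarrow>\<^sub>0 int"
      by (simp add: sgn_pow_def)
    ultimately show ?thesis
      using frag_coset_cmul[OF K R, of "sgn_pow p"] by simp
  next
    case 3
    then have pq: "p + q = 2" "q + p = 2" using pqr by simp_all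
    have "frag_coset K ?L = frag_coset K (\<Sum>b\<in>idx p. T (bas p b) (dua p b) \<one>\<^bsub>tensor_algebra Q\<^esub>)"
      using 3 pqr idx_facts(1) dua_W[OF _ pq(1)] by (intro fs split_unit_right[OF K bal(2)]) simp_all
    also have "\<dots> = frag_coset K (frag_cmul (sgn_pow p) (\<Sum>b\<in>idx q. T (dua q b) (bas q b) \<one>\<^bsub>tensor_algebra Q\<^esub>))"
      using 3 pqr pq one_W by (intro casimir_symmetry[OF K bal(1)]) simp_all
    also have "\<dots> = frag_coset K (frag_cmul (sgn_pow p) ?R)"
      using 3 pqr idx_facts(1) dua_W[OF _ pq(2)]
      by (intro frag_coset_cmul[OF K] fs split_unit_left[OF K bal(3), symmetric]) simp_all
    finally show ?thesis .
  qed
qed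

end

end

section \<open>Cap products and the duality map\<close>

context connected_quiver
begin

context
  fixes M :: "(('v, 'e + 'e, 'f::field) pelem set, 'm) bimodule"
    and P :: "(('v, 'e + 'e, 'f) pelem set, 'p) bimodule"
  assumes M: "preproj_bimodule Q M" and P: "preproj_bimodule Q P"
begin

abbreviation (input) "MoP \<equiv> bimodule_tensor (preproj Q) M P"
abbreviation (input) "tp \<equiv> pure_tensor (preproj Q) M P"

lemmas MPb = preproj_bimodule_tensor[OF M P]

lemma balanced_pure_tensor:
  assumes f: "f \<in> carrier (koszul_cochains Q P p)" and m: "m \<in> carrier M"
  shows "balanced (null_ke Q MoP r) p r (\<lambda>u v. frag_of (tp m (f u), v))"
  unfolding balanced_def
proof (intro conjI ballI)
  fix u c v :: "('v, 'e + 'e, 'f) pelem"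
  assume u: "u \<in> koszul_W Q p" and c: "c \<in> base_k Q" and v: "v \<in> koszul_W Q r"
  have "tp m (f (u \<star> c)) = tp m (f u) \<oslash>\<^bsub>MoP\<^esub> cls Q c"
    using m u c by (simp only: cochainD(1,5)[OF P f] pt_rules(6)[OF M P] base_keys)
  then show "frag_coset (null_ke Q MoP r) (frag_of (tp m (f (u \<star> c)), v)) = frag_coset (null_ke Q MoP r) (frag_of (tp m (f u), c \<star> v))"
    using m u c v by (simp only: ke_right[OF MPb] pt_rules(1)[OF M P] cochainD(1)[OF P f])
qed (use m in \<open>simp_all add: pt_rules[OF M P] cochainD(1,2)[OF P f] ke_rules[OF MPb]\<close>)

lemma respects_cap_right:
  assumes f: "f \<in> carrier (koszul_cochains Q P p)" and pq: "0 \<le> p" "p \<le> q"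
  shows "respects_chains M q (null_ke Q MoP (q - p)) (\<lambda>(m, w). frag_cmul (sgn_pow (p * q))
           (\<Sum>(u, v)\<leftarrow>split Q p (q - p) w. frag_of (tp m (f u), v)))"
proof -
  let ?K = "null_ke Q MoP (q - p)"
  note simps = pt_rules[OF M P] cochainD[OF P f] act_simps[OF M] act_simps[OF P] base_keys ke_rules[OF MPb]
  have "respects_chains M q ?K (\<lambda>(m, w). \<Sum>(u, v)\<leftarrow>split Q p (q - p) w. frag_of (tp m (f u), v))"
  proof (rule respects_chains_split[OF M add_subgroup_ke[OF MPb]])
    fix m assume m: "m \<in> carrier M"
    show "balanced ?K p (q - p) (\<lambda>u v. frag_of (tp m (f u), v))"
      by (rule balanced_pure_tensor[OF f m])
    fix c d u v :: "('v, 'e + 'e, 'f) pelem"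
    assume cd: "c \<in> base_k Q" "d \<in> base_k Q" and uv: "u \<in> koszul_W Q p" "v \<in> koszul_W Q (q - p)"
    have "tp ((cls Q d \<odot>\<^bsub>M\<^esub> m) \<oslash>\<^bsub>M\<^esub> cls Q c) (f u) = cls Q d \<odot>\<^bsub>MoP\<^esub> tp m (f (c \<star> u))"
      using m cd uv by (simp only: pt_rules(1,4,5)[OF M P] act_simps(1)[OF M] act_simps(1)[OF P] cochainD(1,4)[OF P f] koszul_W_closed(4) base_keys)
    then show "frag_coset ?K (frag_of (tp ((cls Q d \<odot>\<^bsub>M\<^esub> m) \<oslash>\<^bsub>M\<^esub> cls Q c) (f u), v)) = frag_coset ?K (frag_of (tp m (f (c \<star> u)), v \<star> d))"
      using m cd uv by (simp add: ke_left[OF MPb] pt_rules(1)[OF M P] cochainD(1)[OF P f] koszul_W_closed(4) del: cochainD)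
  qed (use pq in \<open>simp_all add: simps\<close>)
  from respects_chains_cmul[OF add_subgroup_ke[OF MPb] this, of "sgn_pow (p * q)"] show ?thesis
    by (simp add: case_prod_unfold)
qed

lemma cap_right_coset:
  assumes f: "f \<in> carrier (koszul_cochains Q P p)" and pq: "0 \<le> p" "p \<le> q"
  shows "cap_right Q M P q p (frag_coset (null_ke Q M q) r) f =
    frag_coset (null_ke Q MoP (q - p)) (frag_extend (\<lambda>(m, w). frag_cmul (sgn_pow (p * q))
      (\<Sum>(u, v)\<leftarrow>split Q p (q - p) w. frag_of (tp m (f u), v))) r)"
  using pq unfolding cap_right_def Let_def
  by (simp add: induced_chains[OF M add_subgroup_ke[OF MPb] respects_cap_right[OF f pq]])

lemma cap_right_trivial:
  "p < 0 \<or> q < p \<Longrightarrow> cap_right Q M P q p z f = frag_coset (null_ke Q MoP (q - p)) 0"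
  unfolding cap_right_def Let_def by (auto simp: chains_ops[OF MPb])

lemma respects_cap_left:
  assumes f: "f \<in> carrier (koszul_cochains Q M p)" and pq: "0 \<le> p" "p \<le> q"
  shows "respects_chains P q (null_ke Q MoP (q - p)) (\<lambda>(m, w). frag_cmul (sgn_pow ((q - p) * p))
           (\<Sum>(u, v)\<leftarrow>split Q (q - p) p w. frag_of (tp (f v) m, u)))"
proof -
  let ?K = "null_ke Q MoP (q - p)"
  note simps = pt_rules[OF M P] cochainD[OF M f] act_simps[OF M] act_simps[OF P] base_keys ke_rules[OF MPb]
  have "respects_chains P q ?K (\<lambda>(m, w). \<Sum>(u, v)\<leftarrow>split Q (q - p) p w. frag_of (tp (f v) m, u))"
  proof (rule respects_chains_split[OF P add_subgroup_ke[OF MPb]])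
    fix m assume m: "m \<in> carrier P"
    show "balanced ?K (q - p) p (\<lambda>u v. frag_of (tp (f v) m, u))"
      unfolding balanced_def
    proof (intro conjI ballI)
      fix u c v :: "('v, 'e + 'e, 'f) pelem" assume "u \<in> koszul_W Q (q - p)" "c \<in> base_k Q" "v \<in> koszul_W Q p"
      with m show "frag_coset ?K (frag_of (tp (f v) m, u \<star> c)) = frag_coset ?K (frag_of (tp (f (c \<star> v)) m, u))"
        by (simp add: cochainD(1,4)[OF M f] base_keys ke_left[OF MPb] pt_rules(1)[OF M P] flip: pt_rules(5)[OF M P])
    qed (use m in \<open>simp_all add: simps\<close>)
    fix c d u v :: "('v, 'e + 'e, 'f) pelem"
    assume cd: "c \<in> base_k Q" "d \<in> base_k Q" and uv: "u \<in> koszul_W Q (q - p)" "v \<in> koszul_W Q p"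
    have "tp (f v) ((cls Q d \<odot>\<^bsub>P\<^esub> m) \<oslash>\<^bsub>P\<^esub> cls Q c) = tp (f v) (cls Q d \<odot>\<^bsub>P\<^esub> m) \<oslash>\<^bsub>MoP\<^esub> cls Q c"
      using m cd uv by (simp add: simps)
    also have "tp (f v) (cls Q d \<odot>\<^bsub>P\<^esub> m) = tp (f (v \<star> d)) m"
      using m cd uv by (simp add: cochainD(1,5)[OF M f] base_keys pt_rules(4)[OF M P])
    finally show "frag_coset ?K (frag_of (tp (f v) ((cls Q d \<odot>\<^bsub>P\<^esub> m) \<oslash>\<^bsub>P\<^esub> cls Q c), u)) = frag_coset ?K (frag_of (tp (f (v \<star> d)) m, c \<star> u))"
      using m cd uv by (simp add: ke_right[OF MPb] pt_rules(1)[OF M P] cochainD(1)[OF M f] koszul_W_closed(5))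
  qed (use pq in \<open>simp_all add: simps\<close>)
  from respects_chains_cmul[OF add_subgroup_ke[OF MPb] this, of "sgn_pow ((q - p) * p)"] show ?thesis
    by (simp add: case_prod_unfold)
qed

lemma cap_left_coset:
  assumes f: "f \<in> carrier (koszul_cochains Q M p)" and pq: "0 \<le> p" "p \<le> q"
  shows "cap_left Q M P p q f (frag_coset (null_ke Q P q) r) =
    frag_coset (null_ke Q MoP (q - p)) (frag_extend (\<lambda>(m, w). frag_cmul (sgn_pow ((q - p) * p))
      (\<Sum>(u, v)\<leftarrow>split Q (q - p) p w. frag_of (tp (f v) m, u))) r)"
  using pq unfolding cap_left_def Let_def
  by (simp add: induced_chains[OF P add_subgroup_ke[OF MPb] respects_cap_left[OF f pq]])

lemma cap_left_trivial:
  "p < 0 \<or> q < p \<Longrightarrow> cap_left Q M P p q f z = frag_coset (null_ke Q MoP (q - p)) 0"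
  unfolding cap_left_def Let_def by (auto simp: chains_ops[OF MPb])

end

context
  fixes M :: "(('v, 'e + 'e, 'f::field) pelem set, 'm) bimodule"
  assumes M: "preproj_bimodule Q M"
begin

abbreviation (input) "Areg \<equiv> regular_bimodule (preproj Q :: ('v, 'e + 'e, 'f) pelem set ring)"
abbreviation (input) "AoM \<equiv> bimodule_tensor (preproj Q) Areg M"

lemma respects_unitor:
  "respects_chains AoM p (null_ke Q M p) (\<lambda>(t, w). frag_of (left_unitor M t, w))"
  unfolding respects_chains_def prod.case
proof (intro conjI ballI)
  fix t and w c d :: "('v, 'e + 'e, 'f) pelem" assume t: "t \<in> carrier AoM" and w: "w \<in> koszul_W Q p" and cd: "c \<in> base_k Q" "d \<in> base_k Q"
  have "left_unitor M ((cls Q d \<odot>\<^bsub>AoM\<^esub> t) \<oslash>\<^bsub>AoM\<^esub> cls Q c) = (cls Q d \<odot>\<^bsub>M\<^esub> left_unitor M t) \<oslash>\<^bsub>M\<^esub> cls Q c"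
    using t cd by (simp only: left_unitor_act[OF M] cls_simps(1) base_keys act_simps(1)[OF preproj_bimodule_tensor[OF preproj_bimodule_regular M]])
  then show "frag_coset (null_ke Q M p) (frag_of (left_unitor M ((cls Q d \<odot>\<^bsub>AoM\<^esub> t) \<oslash>\<^bsub>AoM\<^esub> cls Q c), w)) =
      frag_coset (null_ke Q M p) (frag_of (left_unitor M t, c \<star> w \<star> d))"
    using t w cd by (simp only: ke_rules[OF M] left_unitor_closed[OF M])
qed (simp_all add: left_unitor_add[OF M] left_unitor_closed[OF M] ke_rules[OF M])

text \<open>The working description of theta. The idempotent that \<open>omega0\<close> contributes
  at the vertex \<open>hh b\<close> is absorbed, as e f(b) = f(e b) = f(b), and the sign of the cap
  product is (-1)^(2p) = 1. Outside degrees 0, 1, 2 the index set is empty.\<close>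

lemma theta_coset:
  assumes f: "f \<in> carrier (koszul_cochains Q M p)"
  shows "theta Q M p f = frag_coset (null_ke Q M (2 - p)) (\<Sum>b\<in>idx p. frag_of (f (bas p b), dua p b))"
proof -
  note Ab = preproj_bimodule_regular and AMb = preproj_bimodule_tensor[OF preproj_bimodule_regular M]
  let ?K = "null_ke Q AoM (2 - p)"
  let ?pt = "pure_tensor (preproj Q) Areg M"
  have cl: "cls Q (trivial_path i) \<in> carrier (preproj Q)" if "i \<in> verts Q" for i
    by (intro cls_simps(1) koszul_W_closed(6)[OF trivial_path_W[OF that]])
  have ind: "induced (null_ke Q M (2 - p)) (\<lambda>(t, w). frag_of (left_unitor M t, w)) (frag_coset ?K r) =
      frag_coset (null_ke Q M (2 - p)) (frag_extend (\<lambda>(t, w). frag_of (left_unitor M t, w)) r)" for r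
    by (rule induced_chains[OF AMb add_subgroup_ke[OF M] respects_unitor])
  show ?thesis
  proof (cases "0 \<le> p \<and> p \<le> 2")
    case False
    then have "idx p = {}" by (auto simp: idx_def)
    moreover have "cap_right Q Areg M 2 p (omega0 Q) f = frag_coset ?K 0"
      using False by (intro cap_right_trivial[OF Ab M]) auto
    ultimately show ?thesis
      unfolding theta_def by (simp add: ind)
  next
    case p: True
    have bal: "balanced ?K p (2 - p) (\<lambda>u v. frag_of (?pt (cls Q (trivial_path i)) (f u), v))" if i: "i \<in> verts Q" for i
      using cl[OF i] by (intro balanced_pure_tensor[OF Ab M f]) simp
    have "cap_right Q Areg M 2 p (omega0 Q) f = frag_coset ?K (\<Sum>i\<in>verts Q.
        \<Sum>(u, v)\<leftarrow>split Q p (2 - p) (sigma Q i). frag_of (?pt (cls Q (trivial_path i)) (f u), v))"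
      unfolding omega0_def using p
      by (simp add: cap_right_coset[OF Ab M f] frag_extend_sum sgn_pow_def comp_def)
    also have "\<dots> = frag_coset ?K (\<Sum>i\<in>verts Q. \<Sum>b\<in>{b \<in> idx p. hh b = i}. frag_of (?pt (cls Q (trivial_path i)) (f (bas p b)), dua p b))"
      using p by (intro frag_coset_sum[OF add_subgroup_ke[OF AMb]] split_sigma[OF add_subgroup_ke[OF AMb] bal]) auto
    also have "(\<Sum>i\<in>verts Q. \<Sum>b\<in>{b \<in> idx p. hh b = i}. frag_of (?pt (cls Q (trivial_path i)) (f (bas p b)), dua p b)) =
        (\<Sum>b\<in>idx p. frag_of (?pt (cls Q (trivial_path (hh b))) (f (bas p b)), dua p b))"
      by (subst sum_by_head[symmetric]) (rule sum.cong[OF refl], rule sum.cong[OF refl], simp)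
    finally have "theta Q M p f = frag_coset (null_ke Q M (2 - p))
        (\<Sum>b\<in>idx p. frag_of (left_unitor M (?pt (cls Q (trivial_path (hh b))) (f (bas p b))), dua p b))"
      unfolding theta_def by (simp add: ind frag_extend_sum finite_idx comp_def)
    also have "(\<Sum>b\<in>idx p. frag_of (left_unitor M (?pt (cls Q (trivial_path (hh b))) (f (bas p b))), dua p b)) =
        (\<Sum>b\<in>idx p. frag_of (f (bas p b), dua p b))"
    proof (rule sum.cong[OF refl])
      fix b :: "'v + ('e + 'e)" assume b: "b \<in> idx p"
      have "left_unitor M (?pt (cls Q (trivial_path (hh b))) (f (bas p b))) = cls Q (trivial_path (hh b)) \<odot>\<^bsub>M\<^esub> f (bas p b)"
        by (intro left_unitor_pt[OF M] cl cochainD(1)[OF M f] idx_facts[OF b])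
      also have "\<dots> = f (trivial_path (hh b) \<star> bas p b)"
        by (intro cochainD(4)[OF M f, symmetric] trivial_path_base idx_facts[OF b])
      finally show "frag_of (left_unitor M (?pt (cls Q (trivial_path (hh b))) (f (bas p b))), dua p b) = frag_of (f (bas p b), dua p b)"
        by (simp add: idx_facts[OF b])
    qed
    finally show ?thesis .
  qed
qed

end

end

section \<open>The duality map is bijective\<close>

lemma frag_extend_fun_sum: "finite I \<Longrightarrow> (\<Sum>i\<in>I. frag_extend (f i) r) = frag_extend (\<lambda>y. \<Sum>i\<in>I. f i y) r"
  by (induction I rule: finite_induct) (simp_all add: frag_extend_fun_add frag_extend_eq_0)

lemma (in abelian_group) list_msum_single:
  assumes "distinct js" "i \<in> set js" "x \<in> carrier G" "\<And>j. j \<in> set js \<Longrightarrow> F j = (if j = i then x else \<zero>)"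
  shows "list_msum G F js = x"
proof -
  have z: "list_msum G F ks = \<zero>" if "\<And>j. j \<in> set ks \<Longrightarrow> F j = \<zero>" for ks
    using that by (induction ks) (simp_all add: list_msum_def)
  show ?thesis
    using assms
  proof (induction js)
    case (Cons j js)
    show ?case
    proof (cases "j = i")
      case True
      with Cons.prems have "list_msum G F js = \<zero>" by (intro z) auto
      with Cons.prems True show ?thesis by (simp add: list_msum_def)
    next
      case False
      with Cons.prems have "list_msum G F js = x" by (intro Cons.IH) auto
      with Cons.prems False show ?thesis by (simp add: list_msum_def)
    qed
  qed simp
qed

context connected_quiver
begin

context
  fixes M :: "(('v, 'e + 'e, 'f::field) pelem set, 'm) bimodule"
  assumes M: "preproj_bimodule Q M"
begin

interpretation Mg: abelian_group M by (rule abelian_M[OF M])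

lemma right_pscale:
  fixes x :: "('v, 'e + 'e, 'f) pelem"
  assumes "Poly_Mapping.keys x \<subseteq> paths D" "m \<in> carrier M"
  shows "m \<oslash>\<^bsub>M\<^esub> cls Q (pscale c x) = scalar Q c \<odot>\<^bsub>M\<^esub> (m \<oslash>\<^bsub>M\<^esub> cls Q x)"
proof -
  have "m \<oslash>\<^bsub>M\<^esub> cls Q (pscale c x) = m \<oslash>\<^bsub>M\<^esub> cls Q (pscale c \<one>\<^bsub>tensor_algebra Q\<^esub> \<star> x)"
    using pscale_eq_mult(1)[OF assms(1)] by simp
  also have "\<dots> = (m \<oslash>\<^bsub>M\<^esub> scalar Q c) \<oslash>\<^bsub>M\<^esub> cls Q x"
    unfolding scalar_def by (intro act_simps(8)[OF M] assms scalar_keys)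
  finally show ?thesis
    using assms by (simp add: scalar_act[OF M] scalar_cls_comm[OF M])
qed

lemma cochain_eq_on_basis:
  assumes f: "f \<in> carrier (koszul_cochains Q M p)" and g: "g \<in> carrier (koszul_cochains Q M p)"
    and eq: "\<And>b. b \<in> idx p \<Longrightarrow> f (bas p b) = g (bas p b)"
  shows "f = g"
proof (rule cochain_eqI[OF M f g])
  interpret A: path_basis D "koszul_W Q p :: ('v, 'e + 'e, 'f) pelem set" "nat p" "idx p" "bas p" hh tt
     "case_sum (\<lambda>i. if p = 2 then eps (arrow_to i) else 1) (\<lambda>_. 1)"
     "case_sum (\<lambda>i. if p = 2 then [arrow_to i, star (arrow_to i)] else []) (\<lambda>a. [a])"
    by (rule bas_basis)
  fix w :: "('v, 'e + 'e, 'f) pelem" assume w: "w \<in> koszul_W Q p"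
  have sum: "f (\<Sum>j\<in>J. x j) = g (\<Sum>j\<in>J. x j) \<and> (\<Sum>j\<in>J. x j) \<in> koszul_W Q p"
    if "finite J" "\<And>j. j \<in> J \<Longrightarrow> x j \<in> koszul_W Q p \<and> f (x j) = g (x j)" for J :: "('v + ('e + 'e)) set" and x
    using that
    by (induction J rule: finite_induct)
      (simp_all add: cochainD(7)[OF M f] cochainD(7)[OF M g] cochainD(2)[OF M f] cochainD(2)[OF M g] koszul_W_closed(1,2))
  have "pscale (A.co i w) (bas p i) \<in> koszul_W Q p \<and> f (pscale (A.co i w) (bas p i)) = g (pscale (A.co i w) (bas p i))"
    if i: "i \<in> idx p" for i
  proof -
    have b: "(bas p i :: ('v, 'e + 'e, 'f) pelem) \<in> koszul_W Q p" by (rule idx_facts(1)[OF i])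
    then show ?thesis
      by (simp add: koszul_W_closed(3) cochainD(6)[OF M f b] cochainD(6)[OF M g b] eq[OF i])
  qed
  then have "f (\<Sum>i\<in>idx p. pscale (A.co i w) (bas p i)) = g (\<Sum>i\<in>idx p. pscale (A.co i w) (bas p i))"
    by (intro conjunct1[OF sum] finite_idx)
  then show "f w = g w"
    using A.co_expand[OF w] by simp
qed

lemma theta_closed:
  assumes f: "f \<in> carrier (koszul_cochains Q M p)"
  shows "theta Q M p f \<in> carrier (koszul_chains Q M (2 - p))"
proof -
  have "Poly_Mapping.keys (\<Sum>b\<in>idx p. frag_of (f (bas p b), dua p b)) \<subseteq> carrier M \<times> koszul_W Q (2 - p)"
    using idx_facts(1,2)[of _ p] cochainD(1)[OF M f]
    by (intro subset_trans[OF keys_sum]) (auto simp: keys_frag_of)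
  then show ?thesis
    unfolding theta_coset[OF M f] carrier_chains[OF M] by blast
qed

lemma theta_add:
  assumes f: "f \<in> carrier (koszul_cochains Q M p)" and g: "g \<in> carrier (koszul_cochains Q M p)"
  shows "theta Q M p (f \<oplus>\<^bsub>koszul_cochains Q M p\<^esub> g) = theta Q M p f \<oplus>\<^bsub>koszul_chains Q M (2 - p)\<^esub> theta Q M p g"
proof -
  have fg: "f \<oplus>\<^bsub>koszul_cochains Q M p\<^esub> g \<in> carrier (koszul_cochains Q M p)"
    using cochain_add[OF M f g] by (simp add: cochain_ops[OF M])
  show ?thesis
    unfolding theta_coset[OF M f] theta_coset[OF M g] theta_coset[OF M fg] chains_ops[OF M] sum.distrib[symmetric]
    by (intro frag_coset_sum[OF add_subgroup_ke[OF M]])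
      (simp add: cochain_ops[OF M] idx_facts ke_rules[OF M] cochainD(1)[OF M f] cochainD(1)[OF M g])
qed

lemma theta_scalar:
  assumes f: "f \<in> carrier (koszul_cochains Q M p)"
  shows "theta Q M p (c \<odot>\<^bsub>koszul_cochains Q M p\<^esub> f) = c \<odot>\<^bsub>koszul_chains Q M (2 - p)\<^esub> theta Q M p f"
proof -
  have cf: "c \<odot>\<^bsub>koszul_cochains Q M p\<^esub> f \<in> carrier (koszul_cochains Q M p)"
    using cochain_scalar[OF M f] by (simp add: cochain_ops[OF M])
  show ?thesis
    unfolding theta_coset[OF M f] theta_coset[OF M cf] chains_smult[OF M] frag_extend_sum[OF finite_idx] comp_def
    by (simp add: cochain_ops[OF M] idx_facts cong: sum.cong)
qed

text \<open>The value f(b_i) is recovered from the chain by a map to M that picks the coordinate of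
  the second factor at \<open>dua p i\<close>. By duality it kills all terms but the one with index
  \<open>i\<close>.\<close>

lemma theta_inj:
  assumes f: "f \<in> carrier (koszul_cochains Q M p)" and g: "g \<in> carrier (koszul_cochains Q M p)"
    and eq: "theta Q M p f = theta Q M p g"
  shows "f = g"
proof (rule cochain_eq_on_basis[OF f g])
  interpret B: path_basis D "koszul_W Q (2 - p) :: ('v, 'e + 'e, 'f) pelem set" "nat (2 - p)" "idx p" "dua p" tt hh
     "case_sum (\<lambda>i. if p = 0 then eps (arrow_to i) else 1) eps"
     "case_sum (\<lambda>i. if p = 0 then [arrow_to i, star (arrow_to i)] else []) (\<lambda>a. [star a])"
    by (rule dua_basis)
  fix i :: "'v + ('e + 'e)" assume i: "i \<in> idx p"
  \<comment> \<open>The idempotents on both sides of m are forced by k^e: acting by c and d on w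
    multiplies its coordinate by their values at \<open>tt i\<close> and \<open>hh i\<close>, and
    the same must happen when they act on m. On f(b_i) the idempotents have no effect.\<close>
  define \<gamma> where "\<gamma> = (\<lambda>(m, w :: ('v, 'e + 'e, 'f) pelem).
    scalar Q (B.co i w) \<odot>\<^bsub>M\<^esub> ((cls Q (trivial_path (hh i)) \<odot>\<^bsub>M\<^esub> m) \<oslash>\<^bsub>M\<^esub> cls Q (trivial_path (tt i))))"
  have k: "Poly_Mapping.keys (trivial_path (hh i) :: ('v, 'e + 'e, 'f) pelem) \<subseteq> paths D"
    "Poly_Mapping.keys (trivial_path (tt i) :: ('v, 'e + 'e, 'f) pelem) \<subseteq> paths D"
    by (intro base_keys trivial_path_base idx_facts[OF i])+
  have cl: "\<gamma> (m, w) \<in> carrier M" if "m \<in> carrier M" for m w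
    unfolding \<gamma>_def using that by (simp add: scalar_act[OF M] act_simps[OF M] k)
  have "respects_chains M (2 - p) (eval_ker M) (\<lambda>y. frag_of (\<gamma> y))"
    unfolding respects_chains_def
  proof (intro conjI ballI)
    fix m m' and w :: "('v, 'e + 'e, 'f) pelem"
    assume m: "m \<in> carrier M" "m' \<in> carrier M"
    have "\<gamma> (m \<oplus>\<^bsub>M\<^esub> m', w) = \<gamma> (m, w) \<oplus>\<^bsub>M\<^esub> \<gamma> (m', w)"
      unfolding \<gamma>_def using m by (simp add: scalar_distrib[OF M] act_simps[OF M] k)
    then show "frag_coset (eval_ker M) (frag_of (\<gamma> (m \<oplus>\<^bsub>M\<^esub> m', w))) = frag_coset (eval_ker M) (frag_of (\<gamma> (m, w)) + frag_of (\<gamma> (m', w)))"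
      using m by (simp add: Mg.eval_ker_add cl)
  next
    fix m and w w' :: "('v, 'e + 'e, 'f) pelem"
    assume m: "m \<in> carrier M"
    have "\<gamma> (m, w + w') = \<gamma> (m, w) \<oplus>\<^bsub>M\<^esub> \<gamma> (m, w')"
      unfolding \<gamma>_def using m by (simp add: B.co_add scalar_distrib[OF M] act_simps[OF M] k)
    then show "frag_coset (eval_ker M) (frag_of (\<gamma> (m, w + w'))) = frag_coset (eval_ker M) (frag_of (\<gamma> (m, w)) + frag_of (\<gamma> (m, w')))"
      using m by (simp add: Mg.eval_ker_add cl)
  next
    fix m and c d w :: "('v, 'e + 'e, 'f) pelem"
    assume m: "m \<in> carrier M" and cd: "c \<in> base_k Q" "d \<in> base_k Q" and w: "w \<in> koszul_W Q (2 - p)"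
    let ?h = "trivial_path (hh i) :: ('v, 'e + 'e, 'f) pelem" and ?t = "trivial_path (tt i) :: ('v, 'e + 'e, 'f) pelem"
    let ?c = "Poly_Mapping.lookup c (tt i, [], tt i)" and ?d = "Poly_Mapping.lookup d (hh i, [], hh i)"
    have "(cls Q ?h \<odot>\<^bsub>M\<^esub> ((cls Q d \<odot>\<^bsub>M\<^esub> m) \<oslash>\<^bsub>M\<^esub> cls Q c)) \<oslash>\<^bsub>M\<^esub> cls Q ?t =
        (cls Q (?h \<star> d) \<odot>\<^bsub>M\<^esub> m) \<oslash>\<^bsub>M\<^esub> cls Q (c \<star> ?t)"
      using m cd k by (simp add: act_simps[OF M] base_keys)
    also have "\<dots> = scalar Q (?c * ?d) \<odot>\<^bsub>M\<^esub> ((cls Q ?h \<odot>\<^bsub>M\<^esub> m) \<oslash>\<^bsub>M\<^esub> cls Q ?t)"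
      using m cd k idx_facts(3,4)[OF i]
      by (simp add: dq.base_mult_trivial right_pscale act_simps(1,2)[OF M] scalar_act[OF M]
          scalar_cls_comm(2)[OF M, symmetric] scalar_distrib(3)[OF M] flip: scalar_cls_comm(3)[OF M])
    finally have "\<gamma> ((cls Q d \<odot>\<^bsub>M\<^esub> m) \<oslash>\<^bsub>M\<^esub> cls Q c, w) = \<gamma> (m, c \<star> w \<star> d)"
      using m cd k w i
      by (simp add: \<gamma>_def B.co_lmult B.co_rmult B.W_lmult act_simps(1,2)[OF M] mult_ac flip: scalar_distrib(3)[OF M])
    then show "frag_coset (eval_ker M) (frag_of (\<gamma> ((cls Q d \<odot>\<^bsub>M\<^esub> m) \<oslash>\<^bsub>M\<^esub> cls Q c, w))) = frag_coset (eval_ker M) (frag_of (\<gamma> (m, c \<star> w \<star> d)))"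
      by simp
  qed
  note ind = induced_chains[OF M Mg.add_subgroup_eval_ker this]
  have val: "induced (eval_ker M) (\<lambda>y. frag_of (\<gamma> y)) (theta Q M p f) = frag_coset (eval_ker M) (frag_of (f (bas p i)))"
    if f: "f \<in> carrier (koszul_cochains Q M p)" for f
  proof -
    have "frag_coset (eval_ker M) (\<Sum>b\<in>idx p. frag_of (\<gamma> (f (bas p b), dua p b))) =
        frag_coset (eval_ker M) (\<Sum>b\<in>idx p. if b = i then frag_of (f (bas p i)) else 0)"
    proof (rule frag_coset_sum[OF Mg.add_subgroup_eval_ker])
      fix b :: "'v + ('e + 'e)" assume b: "b \<in> idx p"
      have m: "f (bas p b) \<in> carrier M" by (intro cochainD(1)[OF M f] idx_facts[OF b])
      show "frag_coset (eval_ker M) (frag_of (\<gamma> (f (bas p b), dua p b))) = frag_coset (eval_ker M) (if b = i then frag_of (f (bas p i)) else 0)"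
      proof (cases "b = i")
        case True
        have "(cls Q (trivial_path (hh i)) \<odot>\<^bsub>M\<^esub> f (bas p i)) \<oslash>\<^bsub>M\<^esub> cls Q (trivial_path (tt i)) =
            f (trivial_path (hh i) \<star> bas p i \<star> trivial_path (tt i))"
          by (intro cochainD(3)[OF M f, symmetric] trivial_path_base idx_facts[OF i])
        also have "\<dots> = f (bas p i)" by (simp add: idx_facts[OF i])
        finally have "\<gamma> (f (bas p i), dua p i) = f (bas p i)"
          using m True by (simp add: \<gamma>_def B.co_b[OF i i] scalar_distrib[OF M])
        then show ?thesis using True by simp
      next
        case False
        then have "\<gamma> (f (bas p b), dua p b) = \<zero>\<^bsub>M\<^esub>"
          using m k by (simp add: \<gamma>_def B.co_b[OF i b] scalar_distrib[OF M] act_simps[OF M])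
        then show ?thesis using False by (simp add: Mg.eval_ker_zero)
      qed
    qed
    also have "(\<Sum>b\<in>idx p. if b = i then frag_of (f (bas p i)) else 0) = frag_of (f (bas p i))"
      using i finite_idx by simp
    finally show ?thesis
      unfolding theta_coset[OF M f] ind by (simp add: frag_extend_sum finite_idx comp_def)
  qed
  show "f (bas p i) = g (bas p i)"
    using val[OF f] val[OF g] eq idx_facts(1)[OF i]
    by (intro Mg.eval_ker_eqI cochainD(1)[OF M f] cochainD(1)[OF M g]) simp_all
qed

text \<open>Expanding the second factors of the given chain in the basis \<open>dua p\<close>
  collects one coefficient in M per index. The cochain with these coefficients as values on
  \<open>bas p\<close> is a preimage.\<close>

lemma theta_surj:
  assumes z: "z \<in> carrier (koszul_chains Q M (2 - p))"
  shows "\<exists>f\<in>carrier (koszul_cochains Q M p). theta Q M p f = z"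
proof -
  interpret A: path_basis D "koszul_W Q p :: ('v, 'e + 'e, 'f) pelem set" "nat p" "idx p" "bas p" hh tt
     "case_sum (\<lambda>i. if p = 2 then eps (arrow_to i) else 1) (\<lambda>_. 1)"
     "case_sum (\<lambda>i. if p = 2 then [arrow_to i, star (arrow_to i)] else []) (\<lambda>a. [a])"
    by (rule bas_basis)
  interpret B: path_basis D "koszul_W Q (2 - p) :: ('v, 'e + 'e, 'f) pelem set" "nat (2 - p)" "idx p" "dua p" tt hh
     "case_sum (\<lambda>i. if p = 0 then eps (arrow_to i) else 1) eps"
     "case_sum (\<lambda>i. if p = 0 then [arrow_to i, star (arrow_to i)] else []) (\<lambda>a. [star a])"
    by (rule dua_basis)
  obtain r where r: "Poly_Mapping.keys r \<subseteq> carrier M \<times> koszul_W Q (2 - p)" and zr: "z = frag_coset (null_ke Q M (2 - p)) r"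
    using z unfolding carrier_chains[OF M] by blast
  obtain js where js: "set js = idx p" "distinct js"
    using finite_distinct_list[OF finite_idx[of p]] by blast
  let ?K = "null_ke Q M (2 - p)"
  define \<gamma> where "\<gamma> i y = scalar Q (B.co i (snd y)) \<odot>\<^bsub>M\<^esub> fst y" for i and y :: "'m \<times> ('v, 'e + 'e, 'f) pelem"
  define n where "n i = frag_eval M (\<gamma> i) r" for i
  \<comment> \<open>Cut down to the corner belonging to \<open>i\<close>, so that the cochain built
    from these values is linear over k on both sides. In the chain group the idempotents move to
    \<open>dua p i\<close>, which absorbs them, so m_i and n_i give the same chain.\<close>
  define m where "m i = (cls Q (trivial_path (hh i)) \<odot>\<^bsub>M\<^esub> n i) \<oslash>\<^bsub>M\<^esub> cls Q (trivial_path (tt i))" for i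
  define f where "f = (\<lambda>w\<in>koszul_W Q p. list_msum M (\<lambda>i. scalar Q (A.co i w) \<odot>\<^bsub>M\<^esub> m i) js)"
  have gc: "\<gamma> i y \<in> carrier M" if "y \<in> Poly_Mapping.keys r" for i y
    using r that unfolding \<gamma>_def by (intro scalar_act[OF M]) auto
  have nc: "n i \<in> carrier M" for i
    unfolding n_def by (intro Mg.frag_eval_closed gc)
  have k: "Poly_Mapping.keys (trivial_path (hh i) :: ('v, 'e + 'e, 'f) pelem) \<subseteq> paths D"
    "Poly_Mapping.keys (trivial_path (tt i) :: ('v, 'e + 'e, 'f) pelem) \<subseteq> paths D" if "i \<in> idx p" for i
    by (intro base_keys trivial_path_base idx_facts[OF that])+
  have mc: "m i \<in> carrier M" if "i \<in> idx p" for i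
    unfolding m_def using nc by (simp add: act_simps[OF M] k[OF that])
  have mact: "(cls Q c \<odot>\<^bsub>M\<^esub> m i) \<oslash>\<^bsub>M\<^esub> cls Q d =
      scalar Q (Poly_Mapping.lookup c (hh i, [], hh i) * Poly_Mapping.lookup d (tt i, [], tt i)) \<odot>\<^bsub>M\<^esub> m i"
    if i: "i \<in> idx p" and cd: "c \<in> base_k Q" "d \<in> base_k Q" for i c d
  proof -
    let ?h = "trivial_path (hh i) :: ('v, 'e + 'e, 'f) pelem" and ?t = "trivial_path (tt i) :: ('v, 'e + 'e, 'f) pelem"
    have "(cls Q c \<odot>\<^bsub>M\<^esub> m i) \<oslash>\<^bsub>M\<^esub> cls Q d = (cls Q (c \<star> ?h) \<odot>\<^bsub>M\<^esub> n i) \<oslash>\<^bsub>M\<^esub> cls Q (?t \<star> d)"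
      unfolding m_def using nc cd k[OF i] by (simp add: act_simps[OF M] base_keys)
    then show ?thesis
      unfolding m_def using nc cd k[OF i] idx_facts(3,4)[OF i]
      by (simp add: dq.base_mult_trivial right_pscale act_simps(1,2)[OF M] scalar_act[OF M]
          scalar_cls_comm(2)[OF M, symmetric] scalar_distrib(3)[OF M] mult.commute[of "Poly_Mapping.lookup c _"] flip: scalar_cls_comm(3)[OF M])
  qed
  have fc: "f \<in> carrier (koszul_cochains Q M p)"
    unfolding f_def
  proof (rule cochainI[OF M])
    fix u v w c d :: "('v, 'e + 'e, 'f) pelem"
    show "list_msum M (\<lambda>i. scalar Q (A.co i w) \<odot>\<^bsub>M\<^esub> m i) js \<in> carrier M"
      using js mc by (intro Mg.list_msum_closed) (simp add: scalar_act[OF M])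
    have "list_msum M (\<lambda>i. scalar Q (A.co i (u + v)) \<odot>\<^bsub>M\<^esub> m i) js =
        list_msum M (\<lambda>i. (scalar Q (A.co i u) \<odot>\<^bsub>M\<^esub> m i) \<oplus>\<^bsub>M\<^esub> (scalar Q (A.co i v) \<odot>\<^bsub>M\<^esub> m i)) js"
      using js mc by (intro list_msum_cong[OF M]) (simp add: A.co_add scalar_distrib[OF M])
    also have "\<dots> = list_msum M (\<lambda>i. scalar Q (A.co i u) \<odot>\<^bsub>M\<^esub> m i) js \<oplus>\<^bsub>M\<^esub> list_msum M (\<lambda>i. scalar Q (A.co i v) \<odot>\<^bsub>M\<^esub> m i) js"
      using js mc by (intro list_msum_add[OF M]) (simp add: scalar_act[OF M])
    finally show "list_msum M (\<lambda>i. scalar Q (A.co i (u + v)) \<odot>\<^bsub>M\<^esub> m i) js = \<dots>" .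
    assume cd: "c \<in> base_k Q" "d \<in> base_k Q" and w: "w \<in> koszul_W Q p"
    have "cls Q c \<odot>\<^bsub>M\<^esub> list_msum M (\<lambda>i. scalar Q (A.co i w) \<odot>\<^bsub>M\<^esub> m i) js =
        list_msum M (\<lambda>i. cls Q c \<odot>\<^bsub>M\<^esub> (scalar Q (A.co i w) \<odot>\<^bsub>M\<^esub> m i)) js"
      using js mc by (intro list_msum_act(1)[OF M base_keys[OF cd(1)]]) (simp add: scalar_act[OF M])
    also have "\<dots> \<oslash>\<^bsub>M\<^esub> cls Q d = list_msum M (\<lambda>i. (cls Q c \<odot>\<^bsub>M\<^esub> (scalar Q (A.co i w) \<odot>\<^bsub>M\<^esub> m i)) \<oslash>\<^bsub>M\<^esub> cls Q d) js"
      using js mc by (intro list_msum_act(2)[OF M base_keys[OF cd(2)]]) (simp add: scalar_act[OF M] act_simps(1)[OF M] base_keys[OF cd(1)])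
    also have "\<dots> = list_msum M (\<lambda>i. scalar Q (A.co i (c \<star> w \<star> d)) \<odot>\<^bsub>M\<^esub> m i) js"
    proof (rule list_msum_cong[OF M])
      fix i assume "i \<in> set js"
      then have i: "i \<in> idx p" using js by simp
      have "(cls Q c \<odot>\<^bsub>M\<^esub> (scalar Q (A.co i w) \<odot>\<^bsub>M\<^esub> m i)) \<oslash>\<^bsub>M\<^esub> cls Q d =
          scalar Q (A.co i w) \<odot>\<^bsub>M\<^esub> ((cls Q c \<odot>\<^bsub>M\<^esub> m i) \<oslash>\<^bsub>M\<^esub> cls Q d)"
        using mc[OF i] cd by (simp only: scalar_cls_comm[OF M] base_keys act_simps(1)[OF M])
      also have "\<dots> = scalar Q (A.co i (c \<star> w \<star> d)) \<odot>\<^bsub>M\<^esub> m i"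
        using mc[OF i] cd w i by (simp add: mact A.co_lmult A.co_rmult A.W_lmult mult_ac flip: scalar_distrib(3)[OF M])
      finally show "(cls Q c \<odot>\<^bsub>M\<^esub> (scalar Q (A.co i w) \<odot>\<^bsub>M\<^esub> m i)) \<oslash>\<^bsub>M\<^esub> cls Q d = scalar Q (A.co i (c \<star> w \<star> d)) \<odot>\<^bsub>M\<^esub> m i" .
    qed
    finally show "list_msum M (\<lambda>i. scalar Q (A.co i (c \<star> w \<star> d)) \<odot>\<^bsub>M\<^esub> m i) js =
        (cls Q c \<odot>\<^bsub>M\<^esub> list_msum M (\<lambda>i. scalar Q (A.co i w) \<odot>\<^bsub>M\<^esub> m i) js) \<oslash>\<^bsub>M\<^esub> cls Q d" by (rule sym)
  qed
  have fb: "f (bas p i) = m i" if i: "i \<in> idx p" for i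
  proof -
    have "list_msum M (\<lambda>j. scalar Q (A.co j (bas p i)) \<odot>\<^bsub>M\<^esub> m j) js = m i"
      by (rule Mg.list_msum_single[of _ i]) (use i js mc in \<open>auto simp: A.co_b scalar_distrib[OF M]\<close>)
    then show ?thesis by (simp add: f_def idx_facts(1)[OF i])
  qed
  have "theta Q M p f = frag_coset ?K (\<Sum>i\<in>idx p. frag_extend (\<lambda>y. frag_of (\<gamma> i y, dua p i)) r)"
    unfolding theta_coset[OF M fc]
  proof (rule frag_coset_sum[OF add_subgroup_ke[OF M]])
    fix i :: "'v + ('e + 'e)" assume i: "i \<in> idx p"
    have "frag_coset ?K (frag_of (m i, dua p i)) = frag_coset ?K (frag_of (n i, trivial_path (tt i) \<star> dua p i \<star> trivial_path (hh i)))"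
      unfolding m_def by (intro ke_rules(3)[OF M] nc trivial_path_base idx_facts[OF i])
    also have "\<dots> = frag_coset ?K (frag_extend (\<lambda>x. frag_of (x, dua p i)) (frag_of (n i)))"
      by (simp add: idx_facts[OF i])
    also have "\<dots> = frag_coset ?K (frag_extend (\<lambda>x. frag_of (x, dua p i)) (frag_extend (\<lambda>y. frag_of (\<gamma> i y)) r))"
      unfolding n_def by (intro ke_eval[OF M] idx_facts[OF i] Mg.eval_ker_frag_of_eval gc)
    finally show "frag_coset ?K (frag_of (f (bas p i), dua p i)) = frag_coset ?K (frag_extend (\<lambda>y. frag_of (\<gamma> i y, dua p i)) r)"
      by (simp add: fb[OF i] frag_extend_frag_extend)
  qed
  also have "(\<Sum>i\<in>idx p. frag_extend (\<lambda>y. frag_of (\<gamma> i y, dua p i)) r) = frag_extend (\<lambda>y. \<Sum>i\<in>idx p. frag_of (\<gamma> i y, dua p i)) r"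
    by (rule frag_extend_fun_sum[OF finite_idx])
  also have "frag_coset ?K \<dots> = frag_coset ?K (frag_extend frag_of r)"
  proof (rule frag_coset_extend[OF add_subgroup_ke[OF M]])
    fix y assume "y \<in> Poly_Mapping.keys r"
    then obtain x w where y: "y = (x, w)" and x: "x \<in> carrier M" and w: "w \<in> koszul_W Q (2 - p)" using r by auto
    have "frag_coset ?K (\<Sum>i\<in>idx p. frag_of (\<gamma> i y, dua p i)) = frag_coset ?K (\<Sum>i\<in>idx p. frag_of (x, pscale (B.co i w) (dua p i)))"
      unfolding \<gamma>_def y fst_conv snd_conv
      by (intro frag_coset_sum[OF add_subgroup_ke[OF M]] ke_scalar[OF M] x idx_facts)
    also have "\<dots> = frag_coset ?K (frag_of (x, \<Sum>i\<in>idx p. pscale (B.co i w) (dua p i)))"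
      by (intro ke_sum_right[OF M, symmetric] x koszul_W_closed(3) idx_facts)
    finally show "frag_coset ?K (\<Sum>i\<in>idx p. frag_of (\<gamma> i y, dua p i)) = frag_coset ?K (frag_of y)"
      using B.co_expand[OF w] y by simp
  qed
  finally have "theta Q M p f = z"
    by (simp add: zr flip: frag_expansion)
  with fc show ?thesis by blast
qed

lemma theta_bij: "bij_betw (theta Q M p) (carrier (koszul_cochains Q M p)) (carrier (koszul_chains Q M (2 - p)))"
  unfolding bij_betw_def
proof
  show "inj_on (theta Q M p) (carrier (koszul_cochains Q M p))"
    by (rule inj_onI) (rule theta_inj)
  show "theta Q M p ` carrier (koszul_cochains Q M p) = carrier (koszul_chains Q M (2 - p))"
    using theta_closed theta_surj by blast
qed

lemma theta_linear: "theta Q M p \<in> linear_maps (koszul_cochains Q M p) (koszul_chains Q M (2 - p))"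
  unfolding linear_maps_def by (simp add: theta_closed theta_add theta_scalar)

end

end

section \<open>Compatibility with differentials and products\<close>

text \<open>Every element of D is the image of one of C. Linearity of \<open>e\<close> and the
  vanishing of its square are therefore inherited from \<open>d\<close>, and only the intertwining
  formula has to be verified for \<open>e\<close>.\<close>

lemma complex_isomorphism_transport:
  assumes C: "cochain_complex C d"
    and D: "\<And>n. module (ring_of_type_algebra :: 'f::field ring) (D n)"
    and h: "\<And>n. h n \<in> linear_maps (C n) (D n)" "\<And>n. bij_betw (h n) (carrier (C n)) (carrier (D n))"
    and he: "\<And>n x. x \<in> carrier (C n) \<Longrightarrow> h (n + 1) (d n x) = e n (h n x)"
  shows "complex_isomorphism C d D e h"
proof -
  have mC: "module (ring_of_type_algebra :: 'f ring) (C n)" for n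
    using C by (simp add: cochain_complex_def)
  have d: "d n x \<in> carrier (C (n + 1))" "y \<in> carrier (C n) \<Longrightarrow> d n (x \<oplus>\<^bsub>C n\<^esub> y) = d n x \<oplus>\<^bsub>C (n + 1)\<^esub> d n y"
    "d n (c \<odot>\<^bsub>C n\<^esub> x) = c \<odot>\<^bsub>C (n + 1)\<^esub> d n x" "d (n + 1) (d n x) = \<zero>\<^bsub>C (n + 1 + 1)\<^esub>"
    if "x \<in> carrier (C n)" for n x y c
    using C that by (auto simp: cochain_complex_def linear_maps_def)
  have hl: "h n x \<in> carrier (D n)" "y \<in> carrier (C n) \<Longrightarrow> h n (x \<oplus>\<^bsub>C n\<^esub> y) = h n x \<oplus>\<^bsub>D n\<^esub> h n y"
    "h n (c \<odot>\<^bsub>C n\<^esub> x) = c \<odot>\<^bsub>D n\<^esub> h n x"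
    if "x \<in> carrier (C n)" for n x y c
    using h(1)[of n] that by (auto simp: linear_maps_def)
  have h0: "h n \<zero>\<^bsub>C n\<^esub> = \<zero>\<^bsub>D n\<^esub>" for n
  proof -
    interpret Cn: module "ring_of_type_algebra :: 'f ring" "C n" by (rule mC)
    interpret Dn: module "ring_of_type_algebra :: 'f ring" "D n" by (rule D)
    show ?thesis
      using hl(1)[where n = n and x = "\<zero>\<^bsub>C n\<^esub>"] hl(2)[where n = n and x = "\<zero>\<^bsub>C n\<^esub>" and y = "\<zero>\<^bsub>C n\<^esub>"]
      by (metis Cn.zero_closed Cn.l_zero Dn.add.r_cancel_one)
  qed
  have surj: "\<exists>a\<in>carrier (C n). x = h n a" if "x \<in> carrier (D n)" for n x
    using h(2)[of n] that by (auto simp: bij_betw_def)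
  have "e n \<in> linear_maps (D n) (D (n + 1))" for n
    unfolding linear_maps_def
  proof (intro CollectI conjI ballI allI funcsetI)
    interpret Cn: module "ring_of_type_algebra :: 'f ring" "C n" by (rule mC)
    fix x assume "x \<in> carrier (D n)"
    then obtain a where a: "a \<in> carrier (C n)" "x = h n a" using surj by blast
    show "e n x \<in> carrier (D (n + 1))"
      using a by (simp add: hl d flip: he)
    show "e n (c \<odot>\<^bsub>D n\<^esub> x) = c \<odot>\<^bsub>D (n + 1)\<^esub> e n x" for c
    proof -
      have "c \<odot>\<^bsub>C n\<^esub> a \<in> carrier (C n)"
        using a by (simp add: Cn.smult_closed ring_of_type_simps)
      then show ?thesis
        using a by (simp add: d hl flip: hl(3) he)
    qed
    fix y assume "y \<in> carrier (D n)"
    then obtain b where b: "b \<in> carrier (C n)" "y = h n b" using surj by blast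
    have "e n (x \<oplus>\<^bsub>D n\<^esub> y) = h (n + 1) (d n (a \<oplus>\<^bsub>C n\<^esub> b))"
      using a b by (simp add: he hl)
    then show "e n (x \<oplus>\<^bsub>D n\<^esub> y) = e n x \<oplus>\<^bsub>D (n + 1)\<^esub> e n y"
      using a b by (simp add: d hl he)
  qed
  moreover have "e (n + 1) (e n x) = \<zero>\<^bsub>D (n + 1 + 1)\<^esub>" if x: "x \<in> carrier (D n)" for n x
  proof -
    obtain a where a: "a \<in> carrier (C n)" "x = h n a" using surj[OF x] by blast
    have "e (n + 1) (e n x) = h (n + 1 + 1) (d (n + 1) (d n a))"
      using a he[of a n] he[of "d n a" "n + 1"] d(1) by simp
    then show ?thesis using a by (simp only: d h0)
  qed
  ultimately show ?thesis
    unfolding complex_isomorphism_def cochain_complex_def[of D] using C D h he by blast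
qed

context connected_quiver
begin

section \<open>Compatibility with the differentials\<close>

context
  fixes M :: "(('v, 'e + 'e, 'f::field) pelem set, 'm) bimodule"
  assumes M: "preproj_bimodule Q M"
begin

interpretation Mg: abelian_group M by (rule abelian_M[OF M])

text \<open>Both differentials and all three products produce chains of the form \<Psi> u v
  \<otimes> w. The linearity of \<Psi> at its outer ends, combined with the relations over k^e,
  supplies the second and third balancing conditions.\<close>

lemma trilinear_chains:
  assumes \<Psi>: "mbalanced M p q \<Psi>"
    and left: "\<And>c u v. c \<in> base_k Q \<Longrightarrow> u \<in> koszul_W Q p \<Longrightarrow> v \<in> koszul_W Q q \<Longrightarrow> \<Psi> (c \<star> u) v = cls Q c \<odot>\<^bsub>M\<^esub> \<Psi> u v"
    and right: "\<And>c u v. c \<in> base_k Q \<Longrightarrow> u \<in> koszul_W Q p \<Longrightarrow> v \<in> koszul_W Q q \<Longrightarrow> \<Psi> u (v \<star> c) = \<Psi> u v \<oslash>\<^bsub>M\<^esub> cls Q c"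
  shows "trilinear (null_ke Q M r) p q r (\<lambda>u v w. frag_of (\<Psi> u v, w))"
  using \<Psi> unfolding trilinear_def balanced_def mbalanced_def[OF M]
  by (simp add: ke_rules(1,2)[OF M] ke_right[OF M] ke_left[OF M] left right)

lemma trilinear_right:
  assumes f: "f \<in> carrier (koszul_cochains Q M p)"
  shows "trilinear (null_ke Q M r) p 1 r (\<lambda>u x w. frag_of (f u \<oslash>\<^bsub>M\<^esub> cls Q x, w))"
  by (rule trilinear_chains[OF mbalanced_right[OF M f]])
    (simp_all add: act_simps[OF M] cochainD(1,4)[OF M f] koszul_W_1_base base_keys)

lemma trilinear_left:
  assumes f: "f \<in> carrier (koszul_cochains Q M p)"
  shows "trilinear (null_ke Q M r) 1 p r (\<lambda>x u w. frag_of (cls Q x \<odot>\<^bsub>M\<^esub> f u, w))"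
  by (rule trilinear_chains[OF mbalanced_left[OF M f]])
    (simp_all add: act_simps[OF M] cochainD(1,5)[OF M f] koszul_W_1_base base_keys)

lemma ke_list_msum:
  assumes \<Psi>: "mbalanced M p q \<Psi>" and pq: "p \<ge> 0" "q \<ge> 0" and w: "w \<in> koszul_W Q (p + q)" and v: "v \<in> koszul_W Q r"
  shows "frag_coset (null_ke Q M r) (frag_of (list_msum M (\<lambda>(a, b). \<Psi> a b) (split Q p q w), v)) =
    frag_coset (null_ke Q M r) (\<Sum>(a, b)\<leftarrow>split Q p q w. frag_of (\<Psi> a b, v))"
  using ke_eval[OF M v msum_eval[OF M \<Psi> pq split_decomposition(1)[OF pq w]]]
  by (simp add: frag_extend_sum_list case_prod_unfold)

lemma ke_cochain_d:
  assumes f: "f \<in> carrier (koszul_cochains Q M p)" and p: "p \<ge> 0" and w: "w \<in> koszul_W Q (p + 1)" and v: "v \<in> koszul_W Q r"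
  shows "frag_coset (null_ke Q M r) (frag_of (cochain_d Q M p f w, v)) =
    frag_coset (null_ke Q M r) ((\<Sum>(u, x)\<leftarrow>split Q p 1 w. frag_of (f u \<oslash>\<^bsub>M\<^esub> cls Q x, v)) -
      frag_cmul (sgn_pow p) (\<Sum>(x, u)\<leftarrow>split Q 1 p w. frag_of (cls Q x \<odot>\<^bsub>M\<^esub> f u, v)))"
proof -
  let ?a = "list_msum M (\<lambda>(u, x). f u \<oslash>\<^bsub>M\<^esub> cls Q x) (split Q p 1 w)"
    and ?b = "list_msum M (\<lambda>(x, u). cls Q x \<odot>\<^bsub>M\<^esub> f u) (split Q 1 p w)"
  have w': "w \<in> koszul_W Q (1 + p)" using w by (simp add: add.commute)
  note cl = msums_closed[OF M f p w]
  have "frag_coset (eval_ker M) (frag_of (?a \<ominus>\<^bsub>M\<^esub> [sgn_pow p] \<cdot>\<^bsub>M\<^esub> ?b)) = frag_coset (eval_ker M) (frag_of ?a - frag_cmul (sgn_pow p) (frag_of ?b))"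
    using cl by (simp add: Mg.eval_ker_diff frag_coset_diff[OF Mg.add_subgroup_eval_ker refl Mg.eval_ker_sgn_pow])
  from ke_eval[OF M v this]
  have "frag_coset (null_ke Q M r) (frag_of (cochain_d Q M p f w, v)) =
      frag_coset (null_ke Q M r) (frag_of (?a, v) - frag_cmul (sgn_pow p) (frag_of (?b, v)))"
    by (simp add: cochain_d_apply[OF M p w] frag_extend_diff frag_extend_cmul)
  also have "\<dots> = frag_coset (null_ke Q M r) ((\<Sum>(u, x)\<leftarrow>split Q p 1 w. frag_of (f u \<oslash>\<^bsub>M\<^esub> cls Q x, v)) -
      frag_cmul (sgn_pow p) (\<Sum>(x, u)\<leftarrow>split Q 1 p w. frag_of (cls Q x \<odot>\<^bsub>M\<^esub> f u, v)))"
    using p by (intro frag_coset_diff frag_coset_cmul add_subgroup_ke[OF M]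
        ke_list_msum[OF mbalanced_right[OF M f]] ke_list_msum[OF mbalanced_left[OF M f]] v w w') simp_all
  finally show ?thesis .
qed

lemma theta_trivial:
  assumes "f \<in> carrier (koszul_cochains Q M p)" "p < 0 \<or> p > 2"
  shows "theta Q M p f = frag_coset (null_ke Q M (2 - p)) 0"
proof -
  have "idx p = {}" using assms(2) by (auto simp: idx_def)
  then show ?thesis by (simp add: theta_coset[OF M assms(1)])
qed

lemma theta_zero:
  "theta Q M p (\<lambda>w\<in>koszul_W Q p. \<zero>\<^bsub>M\<^esub>) = frag_coset (null_ke Q M (2 - p)) 0"
proof -
  have "frag_coset (null_ke Q M (2 - p)) (\<Sum>b\<in>idx p. frag_of ((\<lambda>w\<in>koszul_W Q p. \<zero>\<^bsub>M\<^esub>) (bas p b), dua p b)) =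
      frag_coset (null_ke Q M (2 - p)) (\<Sum>b\<in>idx p. 0)"
    by (intro frag_coset_sum[OF add_subgroup_ke[OF M]]) (simp add: idx_facts ke_zero[OF M])
  then show ?thesis
    by (simp add: theta_coset[OF M cochain_zero[OF M]])
qed

text \<open>The two terms of b_K belong to the trilinear maps f(u) x \<otimes> w, in degrees p, 1, 1
  - p, and x f(u) \<otimes> w, in degrees 1, p, 1 - p. The first identity turns the former into the
  first term of b^K; for the latter both identities are applied in succession.\<close>

lemma theta_cochain_d:
  assumes f: "f \<in> carrier (koszul_cochains Q M p)"
  shows "theta Q M (p + 1) (cochain_d Q M p f) = chain_d Q M (2 - p) (theta Q M p f)"
proof -
  have e: "2 - (p + 1) = 1 - p" "2 - p - 1 = 1 - p" by simp_all
  note df = cochain_d_closed[OF M f]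
  consider "p < 0" | "p \<ge> 2" | "p \<ge> 0" "p \<le> 1" by linarith
  then show ?thesis
  proof cases
    case 1
    have "chain_d Q M (2 - p) (theta Q M p f) = frag_coset (null_ke Q M (1 - p)) 0"
      using 1 by (simp add: theta_trivial[OF f] chain_d_coset[OF M] e)
    \<comment> \<open>For p = -1 the degree p + 1 = 0 has a nonempty basis; the left side vanishes
      there because the differential is the zero cochain.\<close>
    then show ?thesis
      using 1 theta_zero[of "p + 1"] by (simp add: cochain_d_neg[OF M] e)
  next
    case 2
    then show ?thesis
      using theta_trivial[OF df] by (simp add: chain_d_def chains_ops[OF M] e)
  next
    case 3
    let ?r = "1 - p" and ?K = "null_ke Q M (1 - p)"
    note K = add_subgroup_ke[OF M, of "1 - p"]
    let ?X = "\<lambda>b. \<Sum>(x, v)\<leftarrow>split Q 1 ?r (dua p b). frag_of (f (bas p b) \<oslash>\<^bsub>M\<^esub> cls Q x, v)"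
    let ?Y = "\<lambda>b. \<Sum>(u, x)\<leftarrow>split Q ?r 1 (dua p b). frag_of (cls Q x \<odot>\<^bsub>M\<^esub> f (bas p b), u)"
    have "theta Q M (p + 1) (cochain_d Q M p f) = frag_coset ?K (\<Sum>b\<in>idx (p + 1).
        (\<Sum>(u, x)\<leftarrow>split Q p 1 (bas (p + 1) b). frag_of (f u \<oslash>\<^bsub>M\<^esub> cls Q x, dua (p + 1) b)) -
        frag_cmul (sgn_pow p) (\<Sum>(x, u)\<leftarrow>split Q 1 p (bas (p + 1) b). frag_of (cls Q x \<odot>\<^bsub>M\<^esub> f u, dua (p + 1) b)))"
      unfolding theta_coset[OF M df] e using 3
      by (intro frag_coset_sum[OF K] ke_cochain_d[OF f] idx_facts(1) dua_W) simp_all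
    also have "\<dots> = frag_coset ?K (
        (\<Sum>b\<in>idx (p + 1). \<Sum>(u, x)\<leftarrow>split Q p 1 (bas (p + 1) b). frag_of (f u \<oslash>\<^bsub>M\<^esub> cls Q x, dua (p + 1) b)) -
        frag_cmul (sgn_pow p) (\<Sum>b\<in>idx (1 + p). \<Sum>(x, u)\<leftarrow>split Q 1 p (bas (1 + p) b). frag_of (cls Q x \<odot>\<^bsub>M\<^esub> f u, dua (1 + p) b)))"
      by (simp add: sum_subtractf frag_cmul_sum add.commute)
    also have "\<dots> = frag_coset ?K ((\<Sum>b\<in>idx p. ?X b) - frag_cmul (sgn_pow p) (frag_cmul (sgn_pow 1) (\<Sum>b\<in>idx p. ?Y b)))"
    proof (intro frag_coset_diff[OF K] frag_coset_cmul[OF K])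
      show "frag_coset ?K (\<Sum>b\<in>idx (p + 1). \<Sum>(u, x)\<leftarrow>split Q p 1 (bas (p + 1) b). frag_of (f u \<oslash>\<^bsub>M\<^esub> cls Q x, dua (p + 1) b)) =
          frag_coset ?K (\<Sum>b\<in>idx p. ?X b)"
        using 3 by (intro trilinear_first[OF K trilinear_right[OF f]]) simp_all
      show "frag_coset ?K (\<Sum>b\<in>idx (1 + p). \<Sum>(x, u)\<leftarrow>split Q 1 p (bas (1 + p) b). frag_of (cls Q x \<odot>\<^bsub>M\<^esub> f u, dua (1 + p) b)) =
          frag_coset ?K (frag_cmul (sgn_pow 1) (\<Sum>b\<in>idx p. ?Y b))"
        using 3 by (intro trans[OF trilinear_first[OF K trilinear_left[OF f]] trilinear_second[OF K trilinear_left[OF f]]]) simp_all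
    qed
    \<comment> \<open>The minus sign and (-1)^p of b_K, times the -1 from exchanging a factor of
      degree 1, give (-1)^p = (-1)^(2-p), the sign in b^K.\<close>
    also have "(\<Sum>b\<in>idx p. ?X b) - frag_cmul (sgn_pow p) (frag_cmul (sgn_pow 1) (\<Sum>b\<in>idx p. ?Y b)) =
        (\<Sum>b\<in>idx p. ?X b + frag_cmul (sgn_pow (2 - p)) (?Y b))"
      by (auto simp: sum.distrib frag_cmul_sum sgn_pow_def sum_negf)
    also have "frag_coset ?K \<dots> = chain_d Q M (2 - p) (theta Q M p f)"
      using 3 by (simp add: theta_coset[OF M f] chain_d_coset[OF M] e frag_extend_sum finite_idx comp_def)
    finally show ?thesis .
  qed
qed

lemma theta_complex_isomorphism:
  "complex_isomorphism (koszul_cochains Q M) (cochain_d Q M)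
     (\<lambda>p. koszul_chains Q M (2 - p)) (\<lambda>p. chain_d Q M (2 - p)) (theta Q M)"
proof (rule complex_isomorphism_transport)
  show "cochain_complex (koszul_cochains Q M) (cochain_d Q M)" by (rule cochain_complex_cochains[OF M])
  show "module (ring_of_type_algebra :: 'f ring) (koszul_chains Q M (2 - n))" for n by (rule module_chains[OF M])
  show "theta Q M n \<in> linear_maps (koszul_cochains Q M n) (koszul_chains Q M (2 - n))" for n by (rule theta_linear[OF M])
  show "bij_betw (theta Q M n) (carrier (koszul_cochains Q M n)) (carrier (koszul_chains Q M (2 - n)))" for n
    by (rule theta_bij[OF M])
qed (rule theta_cochain_d)

end

section \<open>Compatibility with the cup and cap products\<close>

context
  fixes M :: "(('v, 'e + 'e, 'f::field) pelem set, 'm) bimodule"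
    and N :: "(('v, 'e + 'e, 'f) pelem set, 'n) bimodule"
    and p q :: int and f g
  assumes M: "preproj_bimodule Q M" and N: "preproj_bimodule Q N"
    and f: "f \<in> carrier (koszul_cochains Q M p)" and g: "g \<in> carrier (koszul_cochains Q N q)"
begin

abbreviation (input) "MoN \<equiv> bimodule_tensor (preproj Q) M N"
abbreviation (input) "tpr \<equiv> pure_tensor (preproj Q) M N"

lemmas MNb = preproj_bimodule_tensor[OF M N]

interpretation MNg: abelian_group "bimodule_tensor (preproj Q) M N" by (rule abelian_M[OF MNb])

lemma mbalanced_tensor: "mbalanced MoN p q (\<lambda>u v. tpr (f u) (g v))"
  unfolding mbalanced_def[OF MNb]
  by (simp add: pt_rules[OF M N] cochainD(1,2,5)[OF M f] cochainD(1,2,4)[OF N g] base_keys)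

lemma tensor_left:
  "c \<in> base_k Q \<Longrightarrow> u \<in> koszul_W Q p \<Longrightarrow> v \<in> koszul_W Q q \<Longrightarrow> tpr (f (c \<star> u)) (g v) = cls Q c \<odot>\<^bsub>MoN\<^esub> tpr (f u) (g v)"
  by (simp only: pt_rules(5)[OF M N] cochainD(1,4)[OF M f] cochainD(1)[OF N g] base_keys)

lemma tensor_right:
  "c \<in> base_k Q \<Longrightarrow> u \<in> koszul_W Q p \<Longrightarrow> v \<in> koszul_W Q q \<Longrightarrow> tpr (f u) (g (v \<star> c)) = tpr (f u) (g v) \<oslash>\<^bsub>MoN\<^esub> cls Q c"
  by (simp only: pt_rules(6)[OF M N] cochainD(1)[OF M f] cochainD(1,5)[OF N g] base_keys)

lemma cup_apply:
  assumes "p \<ge> 0" "q \<ge> 0" "w \<in> koszul_W Q (p + q)"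
  shows "cup Q M N p q f g w = [sgn_pow (p * q)] \<cdot>\<^bsub>MoN\<^esub> list_msum MoN (\<lambda>(u, v). tpr (f u) (g v)) (split Q p q w)"
  using assms by (simp add: cup_def Let_def)

lemma cup_trivial: "p < 0 \<or> q < 0 \<Longrightarrow> cup Q M N p q f g = (\<lambda>w\<in>koszul_W Q (p + q). \<zero>\<^bsub>MoN\<^esub>)"
  unfolding cup_def Let_def by (rule restrict_ext) simp

lemma cup_closed: "cup Q M N p q f g \<in> carrier (koszul_cochains Q MoN (p + q))"
proof (cases "p < 0 \<or> q < 0")
  case True
  then show ?thesis by (simp only: cup_trivial cochain_zero[OF MNb])
next
  case False
  then have pq: "p \<ge> 0" "q \<ge> 0" by simp_all
  let ?S = "\<lambda>w. list_msum MoN (\<lambda>(u, v). tpr (f u) (g v)) (split Q p q w)"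
  note cl = msplit_closed[OF MNb mbalanced_tensor pq]
  have "(\<lambda>w\<in>koszul_W Q (p + q). [sgn_pow (p * q)] \<cdot>\<^bsub>MoN\<^esub> ?S w) \<in> carrier (koszul_cochains Q MoN (p + q))"
  proof (rule cochainI[OF MNb])
    fix w :: "('v, 'e + 'e, 'f) pelem" assume w: "w \<in> koszul_W Q (p + q)"
    show "[sgn_pow (p * q)] \<cdot>\<^bsub>MoN\<^esub> ?S w \<in> carrier MoN"
      by (intro MNg.add.int_pow_closed cl w)
    show "[sgn_pow (p * q)] \<cdot>\<^bsub>MoN\<^esub> ?S (w + w') = [sgn_pow (p * q)] \<cdot>\<^bsub>MoN\<^esub> ?S w \<oplus>\<^bsub>MoN\<^esub> [sgn_pow (p * q)] \<cdot>\<^bsub>MoN\<^esub> ?S w'"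
      if w': "w' \<in> koszul_W Q (p + q)" for w'
      unfolding msplit_add[OF MNb mbalanced_tensor pq w w'] using cl[OF w] cl[OF w'] by (simp add: MNg.add.int_pow_distrib)
    show "[sgn_pow (p * q)] \<cdot>\<^bsub>MoN\<^esub> ?S (c \<star> w \<star> d) = (cls Q c \<odot>\<^bsub>MoN\<^esub> [sgn_pow (p * q)] \<cdot>\<^bsub>MoN\<^esub> ?S w) \<oslash>\<^bsub>MoN\<^esub> cls Q d"
      if cd: "c \<in> base_k Q" "d \<in> base_k Q" for c d
    proof -
      have "tpr (f (c \<star> u)) (g (v \<star> d)) = (cls Q c \<odot>\<^bsub>MoN\<^esub> tpr (f u) (g v)) \<oslash>\<^bsub>MoN\<^esub> cls Q d"
        if "u \<in> koszul_W Q p" "v \<in> koszul_W Q q" for u v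
        using that cd by (simp only: tensor_left tensor_right koszul_W_closed(4))
      then have "?S (c \<star> w \<star> d) = (cls Q c \<odot>\<^bsub>MoN\<^esub> ?S w) \<oslash>\<^bsub>MoN\<^esub> cls Q d"
        by (intro msplit_bimod[OF MNb mbalanced_tensor pq w cd])
      then show ?thesis
        using cl[OF w] cd by (simp only: act_sgn[OF MNb] act_simps(1)[OF MNb] base_keys)
    qed
  qed
  then show ?thesis
    using pq by (simp add: cup_def Let_def)
qed

text \<open>All three chains come from the trilinear map f(u) \<otimes> g(v) \<otimes> w: the first
  cuts W_{p+q}, the second cuts the factor dual to a basis of W_p, the third the factor dual to a
  basis of W_q. The two trilinear identities connect them in this order.\<close>

lemma theta_cup:
  shows "theta Q MoN (p + q) (cup Q M N p q f g) = cap_right Q M N (2 - p) q (theta Q M p f) g"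
    and "cap_right Q M N (2 - p) q (theta Q M p f) g = cap_left Q M N p (2 - q) f (theta Q N q g)"
proof -
  let ?r = "2 - (p + q)"
  have e: "2 - p - q = ?r" "2 - q - p = ?r" by simp_all
  let ?K = "null_ke Q MoN ?r"
  note K = add_subgroup_ke[OF MNb, of ?r]
  have "theta Q MoN (p + q) (cup Q M N p q f g) = cap_right Q M N (2 - p) q (theta Q M p f) g \<and>
      cap_right Q M N (2 - p) q (theta Q M p f) g = cap_left Q M N p (2 - q) f (theta Q N q g)"
  proof (cases "p \<ge> 0 \<and> q \<ge> 0 \<and> p + q \<le> 2")
    \<comment> \<open>Out of range all three chains are zero, either by the explicit default of the
      operation or because theta itself vanishes there.\<close>
    case False
    have "theta Q MoN (p + q) (cup Q M N p q f g) = frag_coset ?K 0"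
    proof (cases "p < 0 \<or> q < 0")
      case True
      then show ?thesis using theta_zero[OF MNb, of "p + q"] by (simp only: cup_trivial)
    next
      case False': False
      with False show ?thesis by (intro theta_trivial[OF MNb cup_closed]) auto
    qed
    moreover have "cap_right Q M N (2 - p) q (theta Q M p f) g = frag_coset ?K 0"
    proof (cases "q < 0 \<or> 2 - p < q")
      case True
      then show ?thesis unfolding e(1)[symmetric] by (rule cap_right_trivial[OF M N])
    next
      case False': False
      with False have p: "p < 0" by auto
      then show ?thesis
        using False' by (simp add: theta_trivial[OF M f] cap_right_coset[OF M N g] e)
    qed
    moreover have "cap_left Q M N p (2 - q) f (theta Q N q g) = frag_coset ?K 0"
    proof (cases "p < 0 \<or> 2 - q < p")
      case True
      then show ?thesis unfolding e(2)[symmetric] by (rule cap_left_trivial[OF M N])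
    next
      case False': False
      with False have q: "q < 0" by auto
      then show ?thesis
        using False' by (simp add: theta_trivial[OF N g] cap_left_coset[OF M N f] e)
    qed
    ultimately show ?thesis by simp
  next
    case True
    then have pq: "p \<ge> 0" "q \<ge> 0" "?r \<ge> 0" "p + q + ?r = 2" by simp_all
    note T = trilinear_chains[OF MNb mbalanced_tensor tensor_left tensor_right]
    let ?S = "\<lambda>w. list_msum MoN (\<lambda>(u, v). tpr (f u) (g v)) (split Q p q w)"
    let ?B = "\<Sum>b\<in>idx p. \<Sum>(u, v)\<leftarrow>split Q q ?r (dua p b). frag_of (tpr (f (bas p b)) (g u), v)"
    have "theta Q MoN (p + q) (cup Q M N p q f g) = frag_coset ?K (\<Sum>b\<in>idx (p + q).
        frag_cmul (sgn_pow (p * q)) (\<Sum>(u, v)\<leftarrow>split Q p q (bas (p + q) b). frag_of (tpr (f u) (g v), dua (p + q) b)))"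
      unfolding theta_coset[OF MNb cup_closed]
    proof (rule frag_coset_sum[OF K])
      fix b :: "'v + ('e + 'e)" assume b: "b \<in> idx (p + q)"
      let ?w = "bas (p + q) b :: ('v, 'e + 'e, 'f) pelem" and ?d = "dua (p + q) b :: ('v, 'e + 'e, 'f) pelem"
      note w = idx_facts(1)[OF b] and d = idx_facts(2)[OF b]
      have "frag_coset ?K (frag_extend (\<lambda>m. frag_of (m, ?d)) (frag_of ([sgn_pow (p * q)] \<cdot>\<^bsub>MoN\<^esub> ?S ?w))) =
          frag_coset ?K (frag_extend (\<lambda>m. frag_of (m, ?d)) (frag_cmul (sgn_pow (p * q)) (frag_of (?S ?w))))"
        by (intro ke_eval[OF MNb] d MNg.eval_ker_sgn_pow msplit_closed[OF MNb mbalanced_tensor pq(1,2)] w)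
      also have "\<dots> = frag_coset ?K (frag_cmul (sgn_pow (p * q)) (frag_of (?S ?w, ?d)))"
        by (simp add: frag_extend_cmul)
      also have "\<dots> = frag_coset ?K (frag_cmul (sgn_pow (p * q)) (\<Sum>(u, v)\<leftarrow>split Q p q ?w. frag_of (tpr (f u) (g v), ?d)))"
        by (intro frag_coset_cmul[OF K] ke_list_msum[OF MNb mbalanced_tensor pq(1,2)] w d)
      finally show "frag_coset ?K (frag_of (cup Q M N p q f g ?w, ?d)) = \<dots>"
        by (simp add: cup_apply[OF pq(1,2) w])
    qed
    also have "\<dots> = frag_coset ?K (frag_cmul (sgn_pow (p * q)) (\<Sum>b\<in>idx (p + q). \<Sum>(u, v)\<leftarrow>split Q p q (bas (p + q) b). frag_of (tpr (f u) (g v), dua (p + q) b)))"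
      by (simp add: frag_cmul_sum)
    also have "\<dots> = frag_coset ?K (frag_cmul (sgn_pow (p * q)) ?B)"
      by (intro frag_coset_cmul[OF K] trilinear_first[OF K T pq])
    finally have 1: "theta Q MoN (p + q) (cup Q M N p q f g) = frag_coset ?K (frag_cmul (sgn_pow (p * q)) ?B)" .
    \<comment> \<open>With r = 2 - p - q, the exponent r p has the parity of p q + p. The surplus
      (-1)^p of the left cap product is the sign appearing in
      \<open>trilinear_second\<close>.\<close>
    have s: "sgn_pow (q * (2 - p)) = sgn_pow (p * q)" "sgn_pow (?r * p) = sgn_pow (p * q) * sgn_pow p"
      by (auto simp: sgn_pow_def)
    have 2: "cap_right Q M N (2 - p) q (theta Q M p f) g = frag_coset ?K (frag_cmul (sgn_pow (p * q)) ?B)"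
      using pq by (simp add: theta_coset[OF M f] cap_right_coset[OF M N g] e s frag_extend_sum finite_idx comp_def frag_cmul_sum)
    have "frag_coset ?K ?B = frag_coset ?K (frag_cmul (sgn_pow p) (\<Sum>b\<in>idx q. \<Sum>(u, v)\<leftarrow>split Q ?r p (dua q b). frag_of (tpr (f v) (g (bas q b)), u)))"
      by (rule trilinear_second[OF K T pq])
    from frag_coset_cmul[OF K this, of "sgn_pow (p * q)"]
    have "frag_coset ?K (frag_cmul (sgn_pow (p * q)) ?B) = cap_left Q M N p (2 - q) f (theta Q N q g)"
      using pq by (simp add: theta_coset[OF N g] cap_left_coset[OF M N f] e s frag_extend_sum finite_idx comp_def frag_cmul_sum)
    with 1 2 show ?thesis by simp
  qed
  then show "theta Q MoN (p + q) (cup Q M N p q f g) = cap_right Q M N (2 - p) q (theta Q M p f) g"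
    "cap_right Q M N (2 - p) q (theta Q M p f) g = cap_left Q M N p (2 - q) f (theta Q N q g)"
    by blast+
qed

end

end

theorem proposition1p2:
  fixes Q :: "('v, 'e) pre_digraph"
    and M :: "(('v, 'e + 'e, 'f::field) pelem set, 'm) bimodule"
    and N :: "(('v, 'e + 'e, 'f) pelem set, 'n) bimodule"
  assumes "fin_digraph Q" and "connected Q"
    and "\<not> underlying_A1 Q" and "\<not> underlying_A2 Q"
    and "preproj_bimodule Q M"
  shows "complex_isomorphism (koszul_cochains Q M) (cochain_d Q M)
           (\<lambda>p. koszul_chains Q M (2 - p)) (\<lambda>p. chain_d Q M (2 - p)) (theta Q M) \<and>
         (preproj_bimodule Q N \<longrightarrow>
           (\<forall>p q. \<forall>f\<in>carrier (koszul_cochains Q M p). \<forall>g\<in>carrier (koszul_cochains Q N q).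
              theta Q (bimodule_tensor (preproj Q) M N) (p + q) (cup Q M N p q f g) =
                cap_right Q M N (2 - p) q (theta Q M p f) g \<and>
              cap_right Q M N (2 - p) q (theta Q M p f) g =
                cap_left Q M N p (2 - q) f (theta Q N q g)))"
proof -
  interpret fin_digraph Q by (rule assms)
  interpret connected_quiver Q by unfold_locales (rule assms)+
  show ?thesis
    using theta_complex_isomorphism[OF assms(5)] theta_cup[OF assms(5)] by blast
qed

end
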